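(* Assume $\sum_{j\ge0} 2^j\eta_j<\infty$ and $\theta<1$. (a) If $\theta<0$, then with probability one $h_R(x)=\overline{h}$ for all $x\in\mathbb{T}$; hence, almost surely, for all $h\in[0,\infty]$, $d_R(h)=1$ if $h=\overline{h}$ and $d_R(h)=-\infty$ otherwise. (b) If $\theta\ge0$, then with probability one, for all $h\in[0,\infty]$: $d_R(h)\in\{-\infty,\theta\}$ if $h=\underline{h}$; $d_R(h)=1$ if $h=\overline{h}$; $d_R(h)=-\infty$ otherwise. Moreover, if there is an integer $j_*\ge0$ with $\nu_{1,j}(\{(0,0)\})=0$ for all $j\ge j_*$, then $$\mathbb{P}(d_R(\underline{h})=-\infty)=\Phi_{j_*}(0)\prod_{j=j_*}^\infty(1-\eta_j)^{2^j}.$$ If there is no such $j_*$, then $\mathbb{P}(d_R(\underline{h})=-\infty)>0$, and it equals $1$ if and only if $\varsigma_{\underline{j}}=\infty$, or $\liminf_{j\to\infty}\prod_{\ell=\underline{j}}^j\gamma_\ell=0$, or ($\Phi_{\underline{j}}(0)=1$ and $\eta_j=0$ for all $j\ge\underline{j}$).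
   Context: Let $\mathbb{T}=\mathbb{R}/\mathbb{Z}$ with canonical surjection $\phi:\mathbb{R}\to\mathbb{T}$ and quotient distance $d$. Let $\mathcal{U}=\{\varnothing\}\cup\bigcup_{j\ge1}\{0,1\}^j$ be the set of finite words over $\{0,1\}$ (a binary tree rooted at the empty word $\varnothing$); for $u=u_1\dots u_j$ write $|u|=j$ ($|\varnothing|=0$), and let $u\mathcal{U}$ (resp. $u\mathcal{U}^*$) denote the words $uw$ with $w\in\mathcal{U}$ (resp. $w\in\mathcal{U}\setminus\{\varnothing\}$). Put $\dot x_u=\sum_{j=1}^{|u|}u_j2^{-j}$, $x_u=\phi(\dot x_u)$, $\lambda_u=\phi(\dot x_u+[0,2^{-|u|}))$. Let $\psi$ be a wavelet in the Schwartz class (i.e. $\{2^{j/2}\psi(2^j\cdot-k)\}_{j,k\in\mathbb{Z}}$ is an orthonormal basis of $L^2(\mathbb{R})$), and let $\Psi_{\lambda_u}$ be the function on $\mathbb{T}$ corresponding to the $1$-periodic function $x\mapsto\sum_{m\in\mathbb{Z}}\psi(2^{|u|}(x-m)-2^{|u|}\dot x_u)$. For each integer $j\ge0$, $\nu_{0,j},\nu_{1,j}$ are probability measures on $\{0,1\}^2$, and $X=(X_u)_{u\in\mathcal{U}}$ is a $\{0,1\}$-valued process satisfying the Markov condition: for all $u\in\mathcal{U}$ and $A\subseteq\{0,1\}^2$, $\mathbb{P}((X_{u0},X_{u1})\in A\mid\mathcal{G}_u)=\nu_{X_u,|u|}(A)$, where $\mathcal{G}_u=\sigma(X_v:v\in\mathcal{U}\setminus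 u\mathcal{U}^* )$. Fix $0<\underline{h}<\overline{h}\le\infty$ and set $R=\sum_{u\in\mathcal{U}}\big(2^{-\underline{h}|u|}\mathbf 1_{\{X_u=1\}}+2^{-\overline{h}|u|}\mathbf 1_{\{X_u=0\}}\big)\Psi_{\lambda_u}$ (with $2^{-\infty\cdot0}=1$, $2^{-\infty\cdot j}=0$ for $j\ge1$). Hölder exponent: for $f:\mathbb{R}\to\mathbb{R}$ and $x\in\mathbb{R}$, $h_f(x)$ is the supremum of $h>0$ for which there exist $c,\delta>0$ and a polynomial $P$ with $|f(x')-P(x'-x)|\le c|x'-x|^h$ for all $|x'-x|\le\delta$; for $x\in\mathbb{T}$, $h_R(x)=h_{R\circ\phi}(\dot x)$ for any $\dot x$ with $\phi(\dot x)=x$. For $h\in[0,\infty]$, $E_h=\{x\in\mathbb{T}:h_R(x)=h\}$ and $d_R(h)=\dim E_h$ (Hausdorff dimension, with $\dim\emptyset=-\infty$). Parameters: $\gamma_j=2\nu_{1,j}(\{(1,1)\})+\nu_{1,j}(\{(1,0),(0,1)\})$; $\eta_j=1-\nu_{0,j}(\{(0,0)\})$; $\underline{j}=\inf\{j_0\ge0:\gamma_j>0\ \forall j\ge j_0\}$ ($\inf\emptyset=\infty$); $\theta=\liminf_{j\to\infty}\frac{\log\gamma_{\underline{j}}+\dots+\log\gamma_j}{j\log2}$ if $\underline{j}<\infty$ and $\theta=-\infty$ otherwise; for $j\ge\underline j$, $\varsigma_j=2\sum_{n=j}^\infty\frac{\nu_{1,n}(\{(1,1)\})}{\gamma_n\prod_{\ell=j}^n\gamma_\ell}$;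 $S_j=\{u\in\mathcal{U}:|u|=j,\ X_u=1\}$ and $\Phi_j(z)=\mathbb{E}[z^{\#S_j}]$ (with $0^0=1$). *)

theory Defs
  imports "HOL-Probability.Probability" "HOL-Computational_Algebra.Polynomial"
begin

text \<open>Words of the binary tree are bool lists (True = 1, False = 0); u0 = u @ [False],
  u1 = u @ [True]. The torus T = R/Z is represented by the fundamental domain [0,1)
  equipped with the quotient distance.\<close>

definition tdist :: "real \<Rightarrow> real \<Rightarrow> real" where
  "tdist x y = (INF k::int. \<bar>x - y - real_of_int k\<bar>)"

definition tdiam :: "real set \<Rightarrow> real" where
  "tdiam A = (if A = {} then 0 else Sup {tdist x y | x y. x \<in> A \<and> y \<in> A})"

definition hausdorff_torus :: "real \<Rightarrow> real set \<Rightarrow> ennreal" where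
  "hausdorff_torus s A =
     (SUP \<delta>\<in>{0<..}. INF C\<in>{C :: nat \<Rightarrow> real set. A \<subseteq> (\<Union>n. C n) \<and>
                                (\<forall>n. C n \<subseteq> {0..<1} \<and> tdiam (C n) \<le> \<delta>)}.
         (\<Sum>n. ennreal (tdiam (C n) powr s)))"

definition hdim :: "real set \<Rightarrow> ereal" where
  "hdim A = (if A = {} then -\<infinity> else Inf (ereal ` {s. s > 0 \<and> hausdorff_torus s A = 0}))"

definition holder_exp :: "(real \<Rightarrow> real) \<Rightarrow> real \<Rightarrow> ereal" where
  "holder_exp f x = Sup (insert 0 (ereal ` {h. h > 0 \<and>
      (\<exists>c \<delta> (P :: real poly). c > 0 \<and> \<delta> > 0 \<and>
          (\<forall>x'. \<bar>x' - x\<bar> \<le> \<delta> \<longrightarrow> \<bar>f x' - poly P (x' - x)\<bar> \<le> c * \<bar>x' - x\<bar> powr h))}))"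

definition schwartz :: "(real \<Rightarrow> real) \<Rightarrow> bool" where
  "schwartz f \<longleftrightarrow> (\<forall>n x. (deriv ^^ n) f differentiable (at x)) \<and>
     (\<forall>m n. \<exists>C. \<forall>x. \<bar>x\<bar> ^ m * \<bar>(deriv ^^ n) f x\<bar> \<le> C)"

definition wav :: "(real \<Rightarrow> real) \<Rightarrow> int \<Rightarrow> int \<Rightarrow> real \<Rightarrow> real" where
  "wav psi j k x = 2 powr (real_of_int j / 2) * psi (2 powr (real_of_int j) * x - real_of_int k)"

definition wavelet_onb :: "(real \<Rightarrow> real) \<Rightarrow> bool" where
  "wavelet_onb psi \<longleftrightarrow>
     (\<forall>j k j' k'. integrable lborel (\<lambda>x. wav psi j k x * wav psi j' k' x) \<and>
        (LINT x|lborel. wav psi j k x * wav psi j' k' x) = (if (j, k) = (j', k') then 1 else 0)) \<and>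
     (\<forall>f \<in> borel_measurable lborel. integrable lborel (\<lambda>x. (f x)\<^sup>2) \<longrightarrow>
        (\<forall>j k. (LINT x|lborel. f x * wav psi j k x) = 0) \<longrightarrow> (AE x in lborel. f x = 0))"

definition xdot :: "bool list \<Rightarrow> real" where
  "xdot u = (\<Sum>i<length u. (if u ! i then 1 else 0) / 2 ^ Suc i)"

definition Psi :: "(real \<Rightarrow> real) \<Rightarrow> bool list \<Rightarrow> real \<Rightarrow> real" where
  "Psi psi u x = (\<Sum>\<^sub>\<infinity>m::int. psi (2 ^ length u * (x - real_of_int m) - 2 ^ length u * xdot u))"

text \<open>Coefficient 2^(-h|u|), with conventions 2^(-inf*0) = 1, 2^(-inf*j) = 0 for j >= 1.\<close>
definition wcoef :: "real \<Rightarrow> ereal \<Rightarrow> bool \<Rightarrow> nat \<Rightarrow> real" where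
  "wcoef hl hu b n = (if b then 2 powr (- hl * real n)
      else if hu = \<infinity> then (if n = 0 then 1 else 0) else 2 powr (- real_of_ereal hu * real n))"

text \<open>The random series R (as the 1-periodic function R o phi on R).\<close>
definition Rser :: "(real \<Rightarrow> real) \<Rightarrow> real \<Rightarrow> ereal \<Rightarrow> (bool list \<Rightarrow> 'a \<Rightarrow> bool) \<Rightarrow> 'a \<Rightarrow> real \<Rightarrow> real" where
  "Rser psi hl hu X \<omega> x = (\<Sum>\<^sub>\<infinity>u::bool list. wcoef hl hu (X u \<omega>) (length u) * Psi psi u x)"

definition Eset :: "(real \<Rightarrow> real) \<Rightarrow> real \<Rightarrow> ereal \<Rightarrow> (bool list \<Rightarrow> 'a \<Rightarrow> bool) \<Rightarrow> 'a \<Rightarrow> ereal \<Rightarrow> real set" where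
  "Eset psi hl hu X \<omega> h = {x \<in> {0..<1}. holder_exp (Rser psi hl hu X \<omega>) x = h}"

definition dR :: "(real \<Rightarrow> real) \<Rightarrow> real \<Rightarrow> ereal \<Rightarrow> (bool list \<Rightarrow> 'a \<Rightarrow> bool) \<Rightarrow> 'a \<Rightarrow> ereal \<Rightarrow> ereal" where
  "dR psi hl hu X \<omega> h = hdim (Eset psi hl hu X \<omega> h)"

definition Gsig :: "'a measure \<Rightarrow> (bool list \<Rightarrow> 'a \<Rightarrow> bool) \<Rightarrow> bool list \<Rightarrow> 'a measure" where
  "Gsig M X u = sigma (space M)
     {X v -` {b} \<inter> space M | v b. \<not> (\<exists>w. w \<noteq> [] \<and> v = u @ w)}"

definition markov_tree :: "'a measure \<Rightarrow> (bool list \<Rightarrow> 'a \<Rightarrow> bool) \<Rightarrow> (bool \<Rightarrow> nat \<Rightarrow> (bool \<times> bool) pmf) \<Rightarrow> bool" where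
  "markov_tree M X nu \<longleftrightarrow> (\<forall>u (A :: (bool \<times> bool) set). AE \<omega> in M.
      real_cond_exp M (Gsig M X u) (\<lambda>\<omega>. indicator A (X (u @ [False]) \<omega>, X (u @ [True]) \<omega>)) \<omega>
        = measure_pmf.prob (nu (X u \<omega>) (length u)) A)"

definition gam :: "(bool \<Rightarrow> nat \<Rightarrow> (bool \<times> bool) pmf) \<Rightarrow> nat \<Rightarrow> real" where
  "gam nu j = 2 * measure_pmf.prob (nu True j) {(True, True)}
              + measure_pmf.prob (nu True j) {(True, False), (False, True)}"

definition eta :: "(bool \<Rightarrow> nat \<Rightarrow> (bool \<times> bool) pmf) \<Rightarrow> nat \<Rightarrow> real" where
  "eta nu j = 1 - measure_pmf.prob (nu False j) {(False, False)}"

definition jlow :: "(bool \<Rightarrow> nat \<Rightarrow> (bool \<times> bool) pmf) \<Rightarrow> enat" where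
  "jlow nu = (if \<exists>j0. \<forall>j\<ge>j0. gam nu j > 0 then enat (LEAST j0. \<forall>j\<ge>j0. gam nu j > 0) else \<infinity>)"

definition theta :: "(bool \<Rightarrow> nat \<Rightarrow> (bool \<times> bool) pmf) \<Rightarrow> ereal" where
  "theta nu = (case jlow nu of
      enat j0 \<Rightarrow> liminf (\<lambda>j. ereal ((\<Sum>l=j0..j. ln (gam nu l)) / (real j * ln 2)))
    | \<infinity> \<Rightarrow> -\<infinity>)"

definition varsigma :: "(bool \<Rightarrow> nat \<Rightarrow> (bool \<times> bool) pmf) \<Rightarrow> nat \<Rightarrow> ennreal" where
  "varsigma nu j = 2 * (\<Sum>n. ennreal (if j \<le> n then
       measure_pmf.prob (nu True n) {(True, True)} / (gam nu n * (\<Prod>l=j..n. gam nu l)) else 0))"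

definition Phi :: "'a measure \<Rightarrow> (bool list \<Rightarrow> 'a \<Rightarrow> bool) \<Rightarrow> nat \<Rightarrow> real \<Rightarrow> real" where
  "Phi M X j z = (\<integral>\<omega>. z ^ card {u. length u = j \<and> X u \<omega>} \<partial>M)"

text \<open>"P(event described by Q) = p": Q coincides a.s. with a measurable event of probability p.\<close>
definition ae_event_prob :: "'a measure \<Rightarrow> ('a \<Rightarrow> bool) \<Rightarrow> real \<Rightarrow> bool" where
  "ae_event_prob M Q p \<longleftrightarrow> (\<exists>A\<in>sets M. (AE \<omega> in M. (\<omega> \<in> A) = Q \<omega>) \<and> measure M A = p)"

end

theory Submission imports Defs begin

text \<open>Almost surely only finitely many ones have a parent labelled zero. From the level where
  this holds on, the random series has exponent \<open>hu\<close> at the points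
  that stay away from the deep dyadic points carrying a one, by smoothness and decay of the wavelet;
  at every other point the exponent is \<open>hl\<close>, because the coefficients of the series are recovered by
  integrating against the wavelet, whose moments all vanish. The set of exponent \<open>hl\<close> is thus the
  limit set of the tree of ones, a branching process in varying environment. Covering
  by the intervals of one generation bounds its dimension above, a second moment (energy) estimate
  with a conditional zero-one law bounds it below, and it is empty exactly when there are only
  finitely many ones.\<close>

section \<open>Schwartz functions and lattice sums\<close>

text \<open>The level at which births stop is random and not a stopping time, so nothing is
  conditioned on it. Instead, for each fixed \<open>j\<close>, \<open>branch j\<close> keeps the
  words whose prefixes of length at least \<open>j\<close> all carry ones. Generation
  \<open>j\<close> is unrestricted, and beyond it this is a branching process with offspring laws
  \<open>nu True\<close>. Almost sure statements are proved for all large \<open>j\<close> at once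
  and transferred to the ones where no birth occurs from \<open>j\<close> on.

  The offspring laws vary with the level, so the population divided by its mean need not have a
  positive limit on survival. A second moment bound yields only a fixed fraction of the survival
  probability. It suffices because this fraction is an absolute constant, the same under
  conditioning on any event of finitely many generations, and such events approximate all relevant
  ones in measure.

  Since \<open>theta\<close> is a lower limit, small means occur only along a subsequence, which is
  enough for coverings, whereas lower bounds hold at every level, as the energy sum
  requires.\<close>

lemma schwartz_deriv:
  assumes "schwartz f"
  shows "((deriv ^^ n) f has_real_derivative (deriv ^^ Suc n) f x) (at x)"
proof -
  have "(deriv ^^ n) f differentiable (at x)"
    using assms by (simp add: schwartz_def)
  then show ?thesis
    by (simp add: DERIV_deriv_iff_real_differentiable)
qed

lemma schwartz_continuous:
  assumes "schwartz f"
  shows "continuous_on UNIV ((deriv ^^ n) f)"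
  by (meson DERIV_isCont assms continuous_at_imp_continuous_on schwartz_deriv)

lemma schwartz_decay:
  assumes "schwartz f"
  obtains C where "C > 0" "\<And>x. \<bar>(deriv ^^ n) f x\<bar> \<le> C / (1 + \<bar>x\<bar>) ^ m"
proof -
  obtain C1 where C1: "\<And>x. \<bar>x\<bar> ^ 0 * \<bar>(deriv ^^ n) f x\<bar> \<le> C1"
    using assms unfolding schwartz_def by blast
  obtain C2 where C2: "\<And>x. \<bar>x\<bar> ^ m * \<bar>(deriv ^^ n) f x\<bar> \<le> C2"
    using assms unfolding schwartz_def by blast
  let ?C = "2 ^ m * (C1 + C2) + 1"
  have C1': "0 \<le> C1" using order_trans[OF _ C1[of 0]] by simp
  have C2': "0 \<le> C2" using order_trans[OF _ C2[of 0]] by simp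
  have "\<bar>(deriv ^^ n) f x\<bar> \<le> ?C / (1 + \<bar>x\<bar>) ^ m" for x
  proof -
    have "(1 + \<bar>x\<bar>) ^ m \<le> (2 * max 1 \<bar>x\<bar>) ^ m"
      by (intro power_mono) auto
    also have "\<dots> = 2 ^ m * (max 1 \<bar>x\<bar>) ^ m" by (simp add: power_mult_distrib)
    also have "\<dots> \<le> 2 ^ m * (1 + \<bar>x\<bar> ^ m)"
      by (auto simp: max_def)
    finally have "(1 + \<bar>x\<bar>) ^ m * \<bar>(deriv ^^ n) f x\<bar> \<le> 2 ^ m * (1 + \<bar>x\<bar> ^ m) * \<bar>(deriv ^^ n) f x\<bar>"
      by (rule mult_right_mono) simp
    also have "\<dots> = 2 ^ m * (\<bar>x\<bar> ^ 0 * \<bar>(deriv ^^ n) f x\<bar> + \<bar>x\<bar> ^ m * \<bar>(deriv ^^ n) f x\<bar>)"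
      by (simp add: algebra_simps)
    also have "\<dots> \<le> 2 ^ m * (C1 + C2)"
      using C1[of x] C2[of x] by (intro mult_left_mono add_mono) auto
    finally show ?thesis by (simp add: pos_le_divide_eq mult.commute)
  qed
  moreover have "?C > 0" using C1' C2' by (smt (verit) mult_nonneg_nonneg zero_le_power)
  ultimately show ?thesis using that by blast
qed

text \<open>On either side of \<open>y\<close> the distances to the integers have distinct integer
  parts, so each side is dominated by the sum of the inverse squares, uniformly in \<open>y\<close>.
  Bounds for arbitrary finite subsets later give summability and the estimate at the same
  time.\<close>

lemma inverse_square_lattice_sum:
  obtains L :: real where "L > 0"
    "\<And>(y::real) F. finite F \<Longrightarrow> (\<Sum>k\<in>F. 1 / (1 + \<bar>y - real_of_int k\<bar>) ^ 2) \<le> L"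
proof -
  define s where "s = (\<Sum>n. 1 / real (Suc n) ^ 2)"
  have sm: "summable (\<lambda>n. 1 / real (Suc n) ^ 2)"
    using summable_Suc_iff[of "\<lambda>n. 1 / real n ^ 2"] inverse_power_summable[of 2, where 'a=real]
    by (simp add: divide_inverse)
  have nat: "(\<Sum>n\<in>G. 1 / real (Suc n) ^ 2) \<le> s" if "finite G" for G
    unfolding s_def by (rule sum_le_suminf[OF sm that]) simp
  have half: "(\<Sum>k\<in>F. 1 / (1 + \<bar>y - real_of_int k\<bar>) ^ 2) \<le> s"
    if F: "finite F" "inj_on (\<lambda>k. nat \<lfloor>\<bar>y - real_of_int k\<bar>\<rfloor>) F" for y :: real and F
  proof -
    have "(\<Sum>k\<in>F. 1 / (1 + \<bar>y - real_of_int k\<bar>) ^ 2) 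
        \<le> (\<Sum>k\<in>F. 1 / real (Suc (nat \<lfloor>\<bar>y - real_of_int k\<bar>\<rfloor>)) ^ 2)"
      by (intro sum_mono divide_left_mono power_mono mult_pos_pos zero_less_power) (auto simp: add_pos_nonneg)
    also have "\<dots> = (\<Sum>n\<in>(\<lambda>k. nat \<lfloor>\<bar>y - real_of_int k\<bar>\<rfloor>) ` F. 1 / real (Suc n) ^ 2)"
      by (subst sum.reindex[OF F(2)]) simp
    also have "\<dots> \<le> s" using F(1) by (intro nat) auto
    finally show ?thesis .
  qed
  have "(\<Sum>k\<in>F. 1 / (1 + \<bar>y - real_of_int k\<bar>) ^ 2) \<le> 2 * s + 1" if F: "finite F" for y :: real and F
  proof -
    let ?P = "{k\<in>F. real_of_int k \<le> y}" and ?N = "{k\<in>F. \<not> real_of_int k \<le> y}"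
    have inj1: "inj_on (\<lambda>k. nat \<lfloor>\<bar>y - real_of_int k\<bar>\<rfloor>) ?P"
      by (rule inj_onI) (auto simp: le_floor_iff[symmetric])
    have inj2: "inj_on (\<lambda>k. nat \<lfloor>\<bar>y - real_of_int k\<bar>\<rfloor>) ?N"
    proof (rule inj_onI)
      fix a b assume a: "a \<in> ?N" and b: "b \<in> ?N" and eq: "nat \<lfloor>\<bar>y - real_of_int a\<bar>\<rfloor> = nat \<lfloor>\<bar>y - real_of_int b\<bar>\<rfloor>"
      have "\<bar>y - real_of_int a\<bar> = - y + real_of_int a" "\<bar>y - real_of_int b\<bar> = - y + real_of_int b" 
        using a b by auto
      moreover have "\<lfloor>- y + real_of_int a\<rfloor> = \<lfloor>- y\<rfloor> + a" "\<lfloor>- y + real_of_int b\<rfloor> = \<lfloor>- y\<rfloor> + b"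
        by linarith+
      moreover have "0 \<le> \<lfloor>- y + real_of_int a\<rfloor>" "0 \<le> \<lfloor>- y + real_of_int b\<rfloor>"
        using a b by auto
      ultimately show "a = b" using eq by (metis add_left_cancel eq_nat_nat_iff)
    qed
    have "F = ?P \<union> ?N" "?P \<inter> ?N = {}" by auto
    then have "(\<Sum>k\<in>F. 1 / (1 + \<bar>y - real_of_int k\<bar>) ^ 2) =
      (\<Sum>k\<in>?P. 1 / (1 + \<bar>y - real_of_int k\<bar>) ^ 2) + (\<Sum>k\<in>?N. 1 / (1 + \<bar>y - real_of_int k\<bar>) ^ 2)"
      using F by (metis (no_types, lifting) finite_Un sum.union_disjoint)
    also have "\<dots> \<le> s + s"
      using F by (intro add_mono half inj1 inj2) auto
    finally show ?thesis by simp
  qed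
  moreover have "2 * s + 1 > 0" using nat[of "{}"] by simp
  ultimately show ?thesis using that by blast
qed

text \<open>Two regimes. For \<open>|s| \<le> 1\<close> the Lagrange remainder of order
  \<open>N + 1\<close> is used, with \<open>|s|^(N+1) \<le> |s|^h\<close>. For
  \<open>|s| \<ge> 1\<close> every term is estimated alone, with \<open>|s|^i \<le> |s|^h\<close>
  for \<open>i \<le> N\<close>. The weights at both \<open>y\<close> and \<open>y + s\<close> keep
  the error summable over lattice translates.\<close>

lemma schwartz_taylor_remainder:
  assumes "schwartz f" and h: "real N \<le> h" "h \<le> real N + 1"
  shows "\<exists>C>0. \<forall>y s. \<bar>f (y + s) - (\<Sum>i\<le>N. (deriv ^^ i) f y / fact i * s ^ i)\<bar>
      \<le> C * \<bar>s\<bar> powr h * (1 / (1 + \<bar>y + s\<bar>) ^ M + 1 / (1 + \<bar>y\<bar>) ^ M)"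
proof -
  let ?D = "\<lambda>n. (deriv ^^ n) f"
  let ?w = "\<lambda>y::real. 1 / (1 + \<bar>y\<bar>) ^ M"
  have "\<exists>C>0. \<forall>x. \<bar>?D n x\<bar> \<le> C / (1 + \<bar>x\<bar>) ^ M" for n
    by (rule schwartz_decay[OF assms(1), of n M]) blast
  then obtain C where C: "\<And>n. C n > 0" "\<And>n x. \<bar>?D n x\<bar> \<le> C n / (1 + \<bar>x\<bar>) ^ M"
    by metis
  define B where "B = 2 ^ M * C (Suc N) + C 0 + (\<Sum>i\<le>N. C i)"
  have Bpos: "B > 0" unfolding B_def
    by (intro add_pos_nonneg add_pos_pos mult_pos_pos sum_nonneg C less_imp_le) auto
  have wpos: "?w y > 0" for y by (intro divide_pos_pos zero_less_power) auto
  have "\<bar>f (y + s) - (\<Sum>i\<le>N. ?D i y / fact i * s ^ i)\<bar> \<le> B * \<bar>s\<bar> powr h * (?w (y + s) + ?w y)" for y s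
  proof (cases "s = 0")
    case True
    have "(\<Sum>i\<le>N. ?D i y / fact i * 0 ^ i) = f y"
      by (subst sum.remove[of _ 0]) (auto intro!: sum.neutral)
    then show ?thesis using True by simp
  next
    case s0: False
    show ?thesis
    proof (cases "\<bar>s\<bar> \<le> 1")
      case True
      obtain t where t: "if y + s < y then y + s < t \<and> t < y else y < t \<and> t < y + s"
        "f (y + s) = (\<Sum>m<Suc N. ?D m y / fact m * (y + s - y) ^ m) + ?D (Suc N) t / fact (Suc N) * (y + s - y) ^ Suc N"
        using Taylor[of "Suc N" ?D f "min y (y+s)" "max y (y+s)" y "y + s"] schwartz_deriv[OF assms(1)] s0
        by (auto simp del: funpow.simps) 
      have eq: "f (y + s) - (\<Sum>i\<le>N. ?D i y / fact i * s ^ i) = ?D (Suc N) t / fact (Suc N) * s ^ Suc N"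
        using t(2) by (simp add: lessThan_Suc_atMost del: funpow.simps)
      \<comment> \<open>The intermediate point \<open>t\<close> is within distance one of
        \<open>y\<close>, so the weights at \<open>t\<close> and at \<open>y\<close> are
        comparable.\<close>
      have "(1 + \<bar>y\<bar>) ^ M \<le> (2 * (1 + \<bar>t\<bar>)) ^ M"
        using t(1) True by (intro power_mono) (auto split: if_splits)
      then have "(1 + \<bar>y\<bar>) ^ M \<le> 2 ^ M * (1 + \<bar>t\<bar>) ^ M"
        by (simp only: power_mult_distrib)
      then have w: "?w t \<le> 2 ^ M * ?w y"
        by (simp add: pos_divide_le_eq pos_le_divide_eq add_pos_nonneg)
      have "\<bar>?D (Suc N) t / fact (Suc N) * s ^ Suc N\<bar> = (\<bar>?D (Suc N) t\<bar> / fact (Suc N)) * \<bar>s\<bar> ^ Suc N"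
        by (simp add: abs_mult power_abs del: funpow.simps)
      also have "\<dots> \<le> (C (Suc N) * ?w t) * \<bar>s\<bar> powr h"
      proof (intro mult_mono)
        have "\<bar>?D (Suc N) t\<bar> / fact (Suc N) \<le> \<bar>?D (Suc N) t\<bar> / 1"
          by (intro divide_left_mono fact_ge_1) auto
        also have "\<dots> \<le> C (Suc N) * ?w t" using C(2)[of "Suc N" t] by (simp del: funpow.simps)
        finally show "\<bar>?D (Suc N) t\<bar> / fact (Suc N) \<le> C (Suc N) * ?w t" .
        have "\<bar>s\<bar> ^ Suc N = \<bar>s\<bar> powr (real (Suc N))" using s0 by (subst powr_realpow) auto
        also have "\<dots> \<le> \<bar>s\<bar> powr h" using s0 True h by (intro powr_mono') auto
        finally show "\<bar>s\<bar> ^ Suc N \<le> \<bar>s\<bar> powr h" .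
        show "0 \<le> C (Suc N) * ?w t" using C(1)[of "Suc N"] wpos[of t] by simp
      qed simp
      also have "\<dots> \<le> (C (Suc N) * (2 ^ M * ?w y)) * \<bar>s\<bar> powr h"
        using C(1)[of "Suc N"] w by (intro mult_right_mono mult_left_mono) auto
      also have "\<dots> = (2 ^ M * C (Suc N)) * \<bar>s\<bar> powr h * ?w y" by simp
      also have "\<dots> \<le> B * \<bar>s\<bar> powr h * (?w (y + s) + ?w y)"
      proof (intro mult_mono)
        show "2 ^ M * C (Suc N) \<le> B" unfolding B_def using C(1) 
          by (smt (verit) sum_nonneg)
      qed (use Bpos wpos in \<open>auto intro: less_imp_le\<close>)
      finally show ?thesis using eq by simp
    next
      case False
      have s1: "\<bar>s\<bar> \<ge> 1" using False by simp
      have sp: "\<bar>s\<bar> ^ i \<le> \<bar>s\<bar> powr h" if "i \<le> N" for i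
      proof -
        have "\<bar>s\<bar> ^ i = \<bar>s\<bar> powr (real i)" using s0 by (subst powr_realpow) auto
        also have "\<dots> \<le> \<bar>s\<bar> powr h" using s1 that h by (intro powr_mono) auto
        finally show ?thesis .
      qed
      have "\<bar>f (y + s)\<bar> \<le> C 0 * ?w (y + s)" using C(2)[of 0 "y + s"] by simp
      also have "\<dots> \<le> C 0 * ?w (y + s) * \<bar>s\<bar> powr h"
        using sp[of 0] C(1)[of 0] wpos[of "y+s"] mult_left_mono[of 1 "\<bar>s\<bar> powr h" "C 0 * ?w (y + s)"] by simp
      finally have 1: "\<bar>f (y + s)\<bar> \<le> C 0 * ?w (y + s) * \<bar>s\<bar> powr h" .
      have "\<bar>\<Sum>i\<le>N. ?D i y / fact i * s ^ i\<bar> \<le> (\<Sum>i\<le>N. \<bar>?D i y / fact i * s ^ i\<bar>)" by (rule sum_abs)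
      also have "\<dots> \<le> (\<Sum>i\<le>N. C i * ?w y * \<bar>s\<bar> powr h)"
      proof (rule sum_mono)
        fix i assume i: "i \<in> {..N}"
        have "\<bar>?D i y / fact i * s ^ i\<bar> = \<bar>?D i y\<bar> / fact i * \<bar>s\<bar> ^ i" by (simp add: abs_mult power_abs)
        also have "\<dots> \<le> (C i * ?w y) * \<bar>s\<bar> powr h"
        proof (intro mult_mono sp)
          have "\<bar>?D i y\<bar> / fact i \<le> \<bar>?D i y\<bar> / 1"
            by (intro divide_left_mono fact_ge_1) auto
          also have "\<dots> \<le> C i * ?w y" using C(2)[of i y] by simp
          finally show "\<bar>?D i y\<bar> / fact i \<le> C i * ?w y" .
          show "0 \<le> C i * ?w y" using C(1)[of i] wpos[of y] by simp
        qed (use i in auto)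
        finally show "\<bar>?D i y / fact i * s ^ i\<bar> \<le> C i * ?w y * \<bar>s\<bar> powr h" .
      qed
      finally have 2: "\<bar>\<Sum>i\<le>N. ?D i y / fact i * s ^ i\<bar> \<le> (\<Sum>i\<le>N. C i) * \<bar>s\<bar> powr h * ?w y"
        by (simp add: sum_distrib_right sum_divide_distrib mult_ac)
      have "C 0 * ?w (y + s) * \<bar>s\<bar> powr h \<le> B * \<bar>s\<bar> powr h * ?w (y + s)"
      proof -
        have "C 0 \<le> B" unfolding B_def using C(1) by (smt (verit) sum_nonneg mult_nonneg_nonneg zero_le_power)
        then have "C 0 * (\<bar>s\<bar> powr h * ?w (y + s)) \<le> B * (\<bar>s\<bar> powr h * ?w (y + s))"
          using wpos[of "y+s"] by (intro mult_right_mono) auto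
        then show ?thesis by (simp add: mult_ac)
      qed
      moreover have "(\<Sum>i\<le>N. C i) * \<bar>s\<bar> powr h * ?w y \<le> B * \<bar>s\<bar> powr h * ?w y"
      proof -
        have "(\<Sum>i\<le>N. C i) \<le> B" unfolding B_def using C(1)[of 0] C(1)[of "Suc N"] by (smt (verit) mult_nonneg_nonneg zero_le_power)
        then have "(\<Sum>i\<le>N. C i) * (\<bar>s\<bar> powr h * ?w y) \<le> B * (\<bar>s\<bar> powr h * ?w y)"
          using wpos[of "y"] by (intro mult_right_mono) auto
        then show ?thesis by (simp add: mult_ac)
      qed
      ultimately show ?thesis using 1 2 by (simp only: distrib_left) linarith
    qed
  qed
  then show ?thesis using Bpos by (intro exI[of _ B]) simp
qed

section \<open>Dyadic points\<close>

lemma xdot_Nil [simp]: "xdot [] = 0"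
  by (simp add: xdot_def)

lemma xdot_snoc: "xdot (u @ [b]) = xdot u + (if b then 1 else 0) / 2 ^ Suc (length u)"
proof -
  have "(\<Sum>i<length u. (if (u @ [b]) ! i then 1 else 0) / 2 ^ Suc i) 
      = (\<Sum>i<length u. (if u ! i then 1 else 0) / (2::real) ^ Suc i)"
    by (intro sum.cong) (auto simp: nth_append)
  then show ?thesis by (simp add: xdot_def)
qed

lemma xdot_Ints: "2 ^ length u * xdot u \<in> \<int>"
proof (induction u rule: rev_induct)
  case (snoc b u)
  have "2 ^ length (u @ [b]) * xdot (u @ [b]) = 2 * (2 ^ length u * xdot u) + (if b then 1 else 0)"
    by (simp add: xdot_snoc algebra_simps)
  with snoc show ?case by auto
qed simp

lemma xdot_append_bounds:
  "xdot u \<le> xdot (u @ w)" "xdot (u @ w) < xdot u + 1 / 2 ^ length u"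
proof -
  \<comment> \<open>The strict upper bound alone is not inductive. The gap
    \<open>1 / 2 ^ length (u @ w)\<close> to the right end is, since appending a letter halves
    it.\<close>
  have "xdot u \<le> xdot (u @ w) \<and> xdot (u @ w) \<le> xdot u + 1 / 2 ^ length u - 1 / 2 ^ length (u @ w)"
  proof (induction w rule: rev_induct)
    case (snoc b w)
    define e :: real where "e = 1 / 2 ^ length (u @ w)"
    have e: "e > 0" "1 / 2 ^ length (u @ w @ [b]) = e / 2" by (simp_all add: e_def)
    have "xdot (u @ w @ [b]) = xdot (u @ w) + (if b then e / 2 else 0)"
      using xdot_snoc[of "u @ w" b] by (simp add: e_def)
    with snoc e show ?case
      by (auto simp only: append_assoc e_def[symmetric] split: if_splits)
  qed simp
  moreover have "(0::real) < 1 / 2 ^ length (u @ w)" by simp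
  ultimately show "xdot u \<le> xdot (u @ w)" "xdot (u @ w) < xdot u + 1 / 2 ^ length u"
    by linarith+
qed

lemma xdot_range: "0 \<le> xdot u" "xdot u < 1"
  using xdot_append_bounds[of "[]" u] by simp_all

text \<open>Both points lie in \<open>[0, 1)\<close>, so an integral difference vanishes. Once
  scaled to an integer, the parity is the last letter, and induction from the right recovers the
  rest.\<close>

lemma xdot_inj:
  assumes "length u = length v" "xdot u - xdot v \<in> \<int>"
  shows "u = v"
proof -
  have eq: "xdot u = xdot v"
  proof -
    obtain n :: int where n: "xdot u - xdot v = of_int n" using assms(2) by (auto elim: Ints_cases)
    have "\<bar>real_of_int n\<bar> < 1" using xdot_range[of u] xdot_range[of v] n by linarith
    then have "n = 0" by linarith
    then show ?thesis using n by simp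
  qed
  from assms(1) this show ?thesis
  proof (induction u v rule: rev_induct2)
    case (4 a u b v)
    then have len: "length u = length v" by simp
    have eq: "xdot u + (if a then 1 else 0) / 2 ^ Suc (length u) = xdot v + (if b then 1 else 0) / 2 ^ Suc (length u)"
      using 4(3) len by (simp only: xdot_snoc)
    then have "2 ^ Suc (length u) * (xdot u + (if a then 1 else 0) / 2 ^ Suc (length u)) 
        = 2 ^ Suc (length u) * (xdot v + (if b then 1 else 0) / 2 ^ Suc (length u))" by simp
    then have e2: "2 * (2 ^ length u * xdot u) + (if a then 1 else 0) = 2 * (2 ^ length v * xdot v) + (if b then 1 else 0)"
      using len by (simp add: algebra_simps)
    obtain i j :: int where ij: "2 ^ length u * xdot u = of_int i" "2 ^ length v * xdot v = of_int j"
      using xdot_Ints[of u] xdot_Ints[of v] by (auto elim!: Ints_cases)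
    have "real_of_int (2 * i + (if a then 1 else 0)) = real_of_int (2 * j + (if b then 1 else 0))"
      using e2 unfolding ij by (cases a; cases b; simp)
    then have "2 * i + (if a then 1 else 0) = 2 * j + (if b then 1 else 0)"
      by (simp only: of_int_eq_iff)
    then have "a = b" by (cases a; cases b; simp) presburger+
    with eq have "xdot u = xdot v" by simp
    with 4(1) len \<open>a = b\<close> show ?case by simp
  qed auto
qed

text \<open>The pair \<open>(u, m)\<close> stands for the translate by \<open>m\<close> of the dyadic interval of \<open>u\<close>, whose
  position at scale \<open>2^|u|\<close> is the integer \<open>wpos (u, m)\<close>.\<close>
definition wpos :: "bool list \<times> int \<Rightarrow> int" where
  "wpos p = \<lfloor>2 ^ length (fst p) * xdot (fst p)\<rfloor> + 2 ^ length (fst p) * snd p"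

lemma wpos_real: "real_of_int (wpos (u, m)) = 2 ^ length u * (xdot u + m)"
  using xdot_Ints[of u] by (auto simp: wpos_def algebra_simps elim!: Ints_cases)

lemma wpos_inj:
  assumes "length u = length v" "wpos (u, m) = wpos (v, n)"
  shows "(u, m) = (v, n)"
proof -
  have "2 ^ length u * (xdot u + m) = 2 ^ length u * (xdot v + n)"
    using assms wpos_real[of u m] wpos_real[of v n] by simp
  then have e: "xdot u + m = xdot v + n" by simp
  then have "xdot u - xdot v = of_int (n - m)" by simp
  then have "u = v" using assms(1) by (metis Ints_of_int xdot_inj)
  with e show ?thesis by simp
qed

text \<open>Within one length the positions \<open>wpos p\<close> are distinct integers, so each
  level is a lattice sum. The centre \<open>y\<close> depends on the level because it will be
  \<open>2^n x\<close>.\<close>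

lemma lattice_sum_levels:
  "\<exists>L>0. \<forall>(y::nat \<Rightarrow> real) a F. (\<forall>n. a n \<ge> (0::real)) \<longrightarrow> summable a \<longrightarrow> finite F \<longrightarrow>
       (\<Sum>p\<in>F. a (length (fst p)) * (1 / (1 + \<bar>y (length (fst p)) - real_of_int (wpos p)\<bar>) ^ 2)) \<le> L * suminf a"
proof -
  obtain L :: real where L: "L > 0"
    "\<And>(y::real) F. finite F \<Longrightarrow> (\<Sum>k\<in>F. 1 / (1 + \<bar>y - real_of_int k\<bar>) ^ 2) \<le> L"
    using inverse_square_lattice_sum by blast
  have "(\<Sum>p\<in>F. a (length (fst p)) * (1 / (1 + \<bar>y (length (fst p)) - real_of_int (wpos p)\<bar>) ^ 2)) \<le> L * suminf a"
    if a: "\<And>n. a n \<ge> 0" "summable a" and F: "finite F" for y :: "nat \<Rightarrow> real" and a F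
  proof -
    let ?g = "\<lambda>p. a (length (fst p)) * (1 / (1 + \<bar>y (length (fst p)) - real_of_int (wpos p)\<bar>) ^ 2)"
    let ?N = "(\<lambda>p. length (fst p)) ` F"
    have "sum ?g F = (\<Sum>n\<in>?N. sum ?g {p\<in>F. length (fst p) = n})"
      by (rule sum.image_gen[OF F])
    also have "\<dots> \<le> (\<Sum>n\<in>?N. a n * L)"
    proof (rule sum_mono)
      fix n
      let ?G = "{p\<in>F. length (fst p) = n}"
      have inj: "inj_on wpos ?G"
        by (rule inj_onI) (auto dest: wpos_inj[rotated])
      have "sum ?g ?G = a n * (\<Sum>p\<in>?G. 1 / (1 + \<bar>y n - real_of_int (wpos p)\<bar>) ^ 2)"
        by (simp add: sum_distrib_left)
      also have "(\<Sum>p\<in>?G. 1 / (1 + \<bar>y n - real_of_int (wpos p)\<bar>) ^ 2) = (\<Sum>k\<in>wpos ` ?G. 1 / (1 + \<bar>y n - real_of_int k\<bar>) ^ 2)"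
        by (subst sum.reindex[OF inj]) simp
      also have "a n * \<dots> \<le> a n * L"
        using F a by (intro mult_left_mono L) auto
      finally show "sum ?g ?G \<le> a n * L" .
    qed
    also have "\<dots> = L * (\<Sum>n\<in>?N. a n)" by (simp add: sum_distrib_left mult.commute)
    also have "\<dots> \<le> L * suminf a"
      using L(1) F a by (intro mult_left_mono sum_le_suminf) auto
    finally show ?thesis .
  qed
  then show ?thesis using L(1) by (intro exI[of _ L]) simp
qed

section \<open>Absolutely summable families and integration term by term\<close>

lemma abs_summable_onI_finite_sums:
  fixes f :: "'i \<Rightarrow> real"
  assumes "\<And>F. finite F \<Longrightarrow> (\<Sum>p\<in>F. \<bar>f p\<bar>) \<le> B"
  shows "(\<lambda>p. \<bar>f p\<bar>) summable_on UNIV" "\<bar>infsum f UNIV\<bar> \<le> B"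
proof -
  show s: "(\<lambda>p. \<bar>f p\<bar>) summable_on UNIV"
    by (rule nonneg_bdd_above_summable_on) (use assms in \<open>auto intro!: bdd_aboveI[of _ B]\<close>)
  have "\<bar>infsum f UNIV\<bar> \<le> infsum (\<lambda>p. \<bar>f p\<bar>) UNIV"
    using norm_infsum_bound[of f UNIV] s by simp
  also have "\<dots> \<le> B"
    using s assms by (intro infsum_le_finite_sums) auto
  finally show "\<bar>infsum f UNIV\<bar> \<le> B" .
qed

lemma integral_infsum:
  fixes f :: "'i::countable \<Rightarrow> real \<Rightarrow> real"
  assumes int: "\<And>p. integrable M (f p)"
    and abs: "\<And>x. (\<lambda>p. \<bar>f p x\<bar>) summable_on UNIV"
    and B: "\<And>F. finite F \<Longrightarrow> (\<Sum>p\<in>F. \<integral>x. \<bar>f p x\<bar> \<partial>M) \<le> B"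
    and inf: "infinite (UNIV :: 'i set)"
  shows "(\<integral>x. (\<Sum>\<^sub>\<infinity>p. f p x) \<partial>M) = (\<Sum>\<^sub>\<infinity>p. \<integral>x. f p x \<partial>M)"
    and "integrable M (\<lambda>x. \<Sum>\<^sub>\<infinity>p. f p x)"
proof -
  obtain e :: "nat \<Rightarrow> 'i" where e: "bij e"
    using inf by (metis bij_betw_from_nat_into uncountable_def countableI_type)
  \<comment> \<open>Absolute summability makes the order irrelevant, so an enumeration turns
    unordered sums into series, for which integration term by term is known.\<close>
  have reind: "infsum g UNIV = suminf (\<lambda>n. g (e n))" "summable (\<lambda>n. norm (g (e n)))"
    if "(\<lambda>p. \<bar>g p\<bar>) summable_on UNIV" for g :: "'i \<Rightarrow> real"
  proof -
    have s: "(\<lambda>n. norm (g (e n))) summable_on UNIV"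
      using that summable_on_reindex_bij_betw[OF e, of "\<lambda>x. norm (g x)"] by simp
    then show "summable (\<lambda>n. norm (g (e n)))" by (rule summable_on_imp_summable)
    have "infsum g UNIV = infsum (\<lambda>n. g (e n)) UNIV"
      by (simp add: infsum_reindex_bij_betw[OF e])
    moreover have "((\<lambda>n. g (e n)) has_sum infsum (\<lambda>n. g (e n)) UNIV) UNIV"
      using abs_summable_summable[OF s] by simp
    ultimately show "infsum g UNIV = suminf (\<lambda>n. g (e n))"
      using has_sum_imp_sums sums_unique by metis
  qed
  have s1: "summable (\<lambda>n. norm (f (e n) x))" for x using reind(2)[OF abs] .
  have "(\<lambda>p. \<bar>\<integral>x. \<bar>f p x\<bar> \<partial>M\<bar>) summable_on UNIV"
    by (rule abs_summable_onI_finite_sums) (use B in auto)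
  from reind(2)[OF this] have s2: "summable (\<lambda>n. \<integral>x. norm (f (e n) x) \<partial>M)" by simp
  have eq: "(\<lambda>x. \<Sum>\<^sub>\<infinity>p. f p x) = (\<lambda>x. \<Sum>n. f (e n) x)"
    using reind(1)[OF abs] by auto
  show "integrable M (\<lambda>x. \<Sum>\<^sub>\<infinity>p. f p x)"
    unfolding eq by (rule integrable_suminf) (use int s1 s2 in auto)
  have "(\<integral>x. (\<Sum>n. f (e n) x) \<partial>M) = (\<Sum>n. \<integral>x. f (e n) x \<partial>M)"
    by (rule integral_suminf) (use int s1 s2 in auto)
  moreover have "(\<lambda>p. \<bar>\<integral>x. f p x \<partial>M\<bar>) summable_on UNIV"
  proof (rule abs_summable_onI_finite_sums)
    fix F :: "'i set" assume "finite F"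
    have "(\<Sum>p\<in>F. \<bar>\<integral>x. f p x \<partial>M\<bar>) \<le> (\<Sum>p\<in>F. \<integral>x. \<bar>f p x\<bar> \<partial>M)"
      by (intro sum_mono integral_abs_bound)
    also have "\<dots> \<le> B" by (rule B) fact
    finally show "(\<Sum>p\<in>F. \<bar>\<integral>x. f p x \<partial>M\<bar>) \<le> B" .
  qed
  ultimately show "(\<integral>x. (\<Sum>\<^sub>\<infinity>p. f p x) \<partial>M) = (\<Sum>\<^sub>\<infinity>p. \<integral>x. f p x \<partial>M)"
    using reind(1)[of "\<lambda>p. \<integral>x. f p x \<partial>M"] by (simp only: eq)
qed

section \<open>Wavelet series and lower bounds for the exponent\<close>

text \<open>The periodisation in \<open>Psi\<close> is unfolded: every pair contributes one rescaled
  wavelet on the whole line, so that orthonormality in \<open>L^2\<close> of the line applies term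
  by term.\<close>

definition wterm :: "(real \<Rightarrow> real) \<Rightarrow> real \<Rightarrow> bool list \<times> int \<Rightarrow> real" where
  "wterm psi x p = psi (2 ^ length (fst p) * x - wpos p)"

definition wseries :: "(real \<Rightarrow> real) \<Rightarrow> (bool list \<Rightarrow> real) \<Rightarrow> real \<Rightarrow> real" where
  "wseries psi c x = (\<Sum>\<^sub>\<infinity>p. c (fst p) * wterm psi x p)"

lemma summable_two_powr:
  assumes "(h::real) > 0"
  shows "summable (\<lambda>n. 2 powr (- h * real n))"
proof -
  have "(\<lambda>n. 2 powr (- h * real n)) = (\<lambda>n. (2 powr (- h)) ^ n)"
    by (simp add: powr_realpow[symmetric] powr_powr)
  moreover have "2 powr (- h) < 1" using assms by (simp add: powr_less_one)
  ultimately show ?thesis by (simp add: summable_geometric)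
qed

text \<open>A single constant serves all points and all coefficient families with the same geometric
  bound. It gives absolute convergence of the series and its boundedness.\<close>

lemma wterm_weighted_bound:
  assumes "schwartz psi" "h > 0"
  shows "\<exists>B>0. \<forall>c F x. finite F \<longrightarrow> (\<forall>u. \<bar>c u\<bar> \<le> 2 powr (- h * real (length u))) \<longrightarrow>
       (\<Sum>p\<in>F. \<bar>c (fst p) * wterm psi x p\<bar>) \<le> B"
proof -
  obtain C where C: "C > 0" "\<And>x. \<bar>psi x\<bar> \<le> C / (1 + \<bar>x\<bar>) ^ 2"
    using schwartz_decay[OF assms(1), of 0 2] by auto
  obtain L where L: "L > 0" "\<forall>(y::nat \<Rightarrow> real) a F. (\<forall>n. a n \<ge> (0::real)) \<longrightarrow> summable a \<longrightarrow> finite F \<longrightarrow>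
       (\<Sum>p\<in>F. a (length (fst p)) * (1 / (1 + \<bar>y (length (fst p)) - real_of_int (wpos p)\<bar>) ^ 2)) \<le> L * suminf a"
    using lattice_sum_levels by (elim exE conjE) (rule that)
  define a where "a n = C * 2 powr (- h * real n)" for n
  have a: "a n \<ge> 0" "summable a" for n
    using C(1) summable_mult[OF summable_two_powr[OF assms(2)], of C] by (simp_all add: a_def[abs_def])
  have main: "(\<Sum>p\<in>F. \<bar>c (fst p) * wterm psi x p\<bar>) \<le> L * suminf a"
    if F: "finite F" and c: "\<And>u. \<bar>c u\<bar> \<le> 2 powr (- h * real (length u))" for c F x
  proof -
    have "(\<Sum>p\<in>F. \<bar>c (fst p) * wterm psi x p\<bar>) 
       \<le> (\<Sum>p\<in>F. a (length (fst p)) * (1 / (1 + \<bar>2 ^ length (fst p) * x - real_of_int (wpos p)\<bar>) ^ 2))"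
    proof (rule sum_mono)
      fix p
      have "\<bar>c (fst p) * wterm psi x p\<bar> \<le> 2 powr (- h * real (length (fst p))) * (C / (1 + \<bar>2 ^ length (fst p) * x - real_of_int (wpos p)\<bar>) ^ 2)"
        unfolding abs_mult wterm_def by (intro mult_mono c C) auto
      then show "\<bar>c (fst p) * wterm psi x p\<bar> \<le> a (length (fst p)) * (1 / (1 + \<bar>2 ^ length (fst p) * x - real_of_int (wpos p)\<bar>) ^ 2)"
        by (simp add: a_def mult_ac)
    qed
    also have "\<dots> \<le> L * suminf a"
      using L(2)[rule_format, OF a F, of "\<lambda>n. 2 ^ n * x"] by simp
    finally show ?thesis .
  qed
  have pos: "0 \<le> L * suminf a"
    using L(1) suminf_nonneg[OF a(2,1)] by simp
  show ?thesis
  proof (intro exI[of _ "L * suminf a + 1"] conjI allI impI)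
    show "L * suminf a + 1 > 0" using pos by linarith
    fix c :: "bool list \<Rightarrow> real" and F :: "(bool list \<times> int) set" and x
    assume "finite F" "\<forall>u. \<bar>c u\<bar> \<le> 2 powr (- h * real (length u))"
    then have "(\<Sum>p\<in>F. \<bar>c (fst p) * wterm psi x p\<bar>) \<le> L * suminf a"
      by (intro main) auto
    then show "(\<Sum>p\<in>F. \<bar>c (fst p) * wterm psi x p\<bar>) \<le> L * suminf a + 1" by linarith
  qed
qed

lemma Rser_eq_wseries:
  assumes "schwartz psi" "hl > 0" and c: "\<And>u. \<bar>wcoef hl hu (X u w) (length u)\<bar> \<le> 2 powr (- hl * real (length u))"
  shows "Rser psi hl hu X w x = wseries psi (\<lambda>u. wcoef hl hu (X u w) (length u)) x"
proof -
  let ?c = "\<lambda>u. wcoef hl hu (X u w) (length u)"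
  obtain B where "B > 0" and B: "\<forall>c F x. finite F \<longrightarrow> (\<forall>u. \<bar>c u\<bar> \<le> 2 powr (- hl * real (length u))) \<longrightarrow>
       (\<Sum>p\<in>F. \<bar>c (fst p) * wterm psi x p\<bar>) \<le> B"
    using wterm_weighted_bound[OF assms(1,2)] by (elim exE conjE) (rule that)
  have "(\<lambda>p. \<bar>?c (fst p) * wterm psi x p\<bar>) summable_on UNIV"
    by (rule abs_summable_onI_finite_sums, rule B[rule_format, OF _ c])
  then have "(\<lambda>p. ?c (fst p) * wterm psi x p) summable_on (UNIV \<times> UNIV)"
    using abs_summable_summable[of "\<lambda>p. ?c (fst p) * wterm psi x p" UNIV] by simp
  from infsum_Sigma_banach[OF this]
  have "wseries psi ?c x = (\<Sum>\<^sub>\<infinity>u. \<Sum>\<^sub>\<infinity>m. ?c u * wterm psi x (u, m))"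
    by (simp add: wseries_def)
  also have "\<dots> = (\<Sum>\<^sub>\<infinity>u. ?c u * (\<Sum>\<^sub>\<infinity>m. wterm psi x (u, m)))"
    by (simp add: infsum_cmult_right')
  also have "(\<lambda>u. \<Sum>\<^sub>\<infinity>m. wterm psi x (u, m)) = (\<lambda>u. Psi psi u x)"
    unfolding Psi_def wterm_def wpos_real by (simp add: algebra_simps)
  finally show ?thesis unfolding Rser_def ..
qed

lemma powr_le_holder_exp:
  assumes "h > 0" "c > 0" "d > 0"
    "\<And>t. \<bar>t\<bar> \<le> d \<Longrightarrow> \<bar>f (x + t) - poly P t\<bar> \<le> c * \<bar>t\<bar> powr h"
  shows "ereal h \<le> holder_exp f x"
  unfolding holder_exp_def
proof (rule Sup_upper, rule insertI2, rule imageI, rule CollectI, intro conjI exI allI impI)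
  fix x' assume "\<bar>x' - x\<bar> \<le> d"
  from assms(4)[OF this] show "\<bar>f x' - poly P (x' - x)\<bar> \<le> c * \<bar>x' - x\<bar> powr h" by simp
qed (use assms in auto)

lemma has_sum_finite_sum:
  fixes f :: "'i \<Rightarrow> 'p \<Rightarrow> real"
  assumes "finite I" "\<And>i. i \<in> I \<Longrightarrow> f i summable_on A"
  shows "((\<lambda>p. \<Sum>i\<in>I. f i p) has_sum (\<Sum>i\<in>I. infsum (f i) A)) A"
  using assms by (induction I) (auto intro!: has_sum_add has_sum_infsum has_sum_0)

lemma has_sum_diff_real:
  fixes f g :: "'p \<Rightarrow> real"
  assumes "(f has_sum a) A" "(g has_sum b) A"
  shows "((\<lambda>p. f p - g p) has_sum (a - b)) A"
  using has_sum_add[OF assms(1) has_sum_uminusI[OF assms(2)]] by simp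

text \<open>The approximating polynomial is the sum of the Taylor polynomials of all terms at
  \<open>x\<close>, of degree the integer part of \<open>h'\<close>. Losing \<open>h - h'\<close>
  makes the sum over levels geometric. The growth of order \<open>M\<close> allowed by
  \<open>loc\<close> is paid for by extra decay of the wavelet; \<open>loc\<close> is required
  around \<open>x\<close> because the Taylor remainder has a weight at \<open>x + t\<close> as
  well.\<close>

lemma wseries_holder_ge_aux:
  fixes x d A h h' :: real
  assumes sch: "schwartz psi" and h0: "h0 > 0"
    and c: "\<And>u. \<bar>c u\<bar> \<le> 2 powr (- h0 * real (length u))"
    and hh: "0 < h'" "h' < h" and A: "A > 0" and d: "d > 0"
    and loc: "\<And>u m (t::real). \<bar>t\<bar> \<le> d \<Longrightarrow>
       \<bar>c u\<bar> \<le> A * 2 powr (- h * real (length u)) * (1 + \<bar>2 ^ length u * (x + t) - wpos (u, m)\<bar>) ^ M"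
  shows "ereal h' \<le> holder_exp (wseries psi c) x"
proof -
  define N where "N = nat \<lfloor>h'\<rfloor>"
  have N: "real N \<le> h'" "h' \<le> real N + 1" 
  proof -
    have "real N = of_int \<lfloor>h'\<rfloor>" using hh(1) by (simp add: N_def)
    then show "real N \<le> h'" "h' \<le> real N + 1" by linarith+
  qed
  obtain C where C: "C > 0" "\<forall>y s. \<bar>psi (y + s) - (\<Sum>i\<le>N. (deriv ^^ i) psi y / fact i * s ^ i)\<bar>
      \<le> C * \<bar>s\<bar> powr h' * (1 / (1 + \<bar>y + s\<bar>) ^ (M + 2) + 1 / (1 + \<bar>y\<bar>) ^ (M + 2))"
    using schwartz_taylor_remainder[OF sch N, of "M + 2"] by (elim exE conjE) (rule that)
  obtain L where L: "L > 0" "\<forall>(y::nat \<Rightarrow> real) a F. (\<forall>n. a n \<ge> (0::real)) \<longrightarrow> summable a \<longrightarrow> finite F \<longrightarrow>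
       (\<Sum>p\<in>F. a (length (fst p)) * (1 / (1 + \<bar>y (length (fst p)) - real_of_int (wpos p)\<bar>) ^ 2)) \<le> L * suminf a"
    using lattice_sum_levels by (elim exE conjE) (rule that)
  define y where "y p = 2 ^ length (fst p) * x - wpos p" for p
  define T where "T p i = c (fst p) * ((deriv ^^ i) psi (y p) / fact i * (2 ^ length (fst p)) ^ i)" for p i
  obtain B0 where "B0 > 0" and B0: "\<forall>c F x. finite F \<longrightarrow> (\<forall>u. \<bar>c u\<bar> \<le> 2 powr (- h0 * real (length u))) \<longrightarrow>
       (\<Sum>p\<in>F. \<bar>c (fst p) * wterm psi x p\<bar>) \<le> B0"
    using wterm_weighted_bound[OF sch h0] by (elim exE conjE) (rule that)
  \<comment> \<open>Of the \<open>M + 2\<close> powers of decay, \<open>M\<close> cancel the growth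
    permitted by \<open>loc\<close>; the remaining two are summable over the lattice.\<close>
  have lift: "v * (1 / (1 + \<bar>z\<bar>) ^ (M + 2)) \<le> A * 2 powr (- h * real (length (fst p))) * (1 / (1 + \<bar>z\<bar>) ^ 2)"
    if z: "z = 2 ^ length (fst p) * (x + t) - wpos p" and t: "\<bar>t\<bar> \<le> d" and v: "v = \<bar>c (fst p)\<bar>" for z t v :: real and p
  proof -
    have "v * (1 / (1 + \<bar>z\<bar>) ^ (M + 2)) \<le> (A * 2 powr (- h * real (length (fst p))) * (1 + \<bar>z\<bar>) ^ M) * (1 / (1 + \<bar>z\<bar>) ^ (M + 2))"
      using loc[OF t, of "fst p" "snd p"] z v by (intro mult_right_mono) auto
    also have "\<dots> = A * 2 powr (- h * real (length (fst p))) * (1 / (1 + \<bar>z\<bar>) ^ 2)"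
      using abs_ge_zero[of z] by (simp add: power_add power2_eq_square add_nonneg_eq_0_iff)
    finally show ?thesis .
  qed
  define b where "b n = A * 2 powr (- (h - h') * real n)" for n
  have b: "b n \<ge> 0" "summable b" for n
  proof -
    show "summable b" unfolding b_def[abs_def] using hh by (intro summable_mult summable_two_powr) simp
  qed (use A in \<open>simp add: b_def\<close>)
  have scale: "2 powr (- h * real n) * (2 ^ n) powr h' = 2 powr (- (h - h') * real n)" for n
    by (simp add: powr_realpow[symmetric] powr_powr powr_add[symmetric] algebra_simps)
  \<comment> \<open>At level \<open>n\<close>, differentiating \<open>i\<close> times costs
    \<open>2^(n i)\<close>, which is at most \<open>2^(n h')\<close> because
    \<open>i \<le> N \<le> h'\<close>.\<close>
  have Tsum: "(\<lambda>p. T p i) summable_on UNIV" if i: "i \<le> N" for i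
  proof -
    obtain K where K: "K > 0" "\<And>y. \<bar>(deriv ^^ i) psi y\<bar> \<le> K / (1 + \<bar>y\<bar>) ^ (M + 2)"
      using schwartz_decay[OF sch, of i "M + 2"] by blast
    have "(\<lambda>p. \<bar>T p i\<bar>) summable_on UNIV"
    proof (rule abs_summable_onI_finite_sums)
      fix F :: "(bool list \<times> int) set" assume F: "finite F"
      have "(\<Sum>p\<in>F. \<bar>T p i\<bar>) \<le> (\<Sum>p\<in>F. K * (b (length (fst p)) * (1 / (1 + \<bar>2 ^ length (fst p) * x - real_of_int (wpos p)\<bar>) ^ 2)))"
      proof (rule sum_mono)
        fix p :: "bool list \<times> int"
        let ?n = "length (fst p)"
        have "\<bar>T p i\<bar> = \<bar>c (fst p)\<bar> * (\<bar>(deriv ^^ i) psi (y p)\<bar> / fact i * (2 ^ ?n) ^ i)"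
          by (simp add: T_def abs_mult)
        also have "\<dots> \<le> \<bar>c (fst p)\<bar> * (\<bar>(deriv ^^ i) psi (y p)\<bar> / 1 * (2 ^ ?n) powr h')"
        proof (intro mult_left_mono mult_mono divide_left_mono fact_ge_1)
          have "(2 ^ ?n) ^ i = (2 ^ ?n :: real) powr real i" by (simp add: powr_realpow)
          also have "\<dots> \<le> (2 ^ ?n) powr h'" using i N by (intro powr_mono) auto
          finally show "(2 ^ ?n) ^ i \<le> (2 ^ ?n) powr h'" .
        qed auto
        also have "\<dots> \<le> \<bar>c (fst p)\<bar> * (K / (1 + \<bar>y p\<bar>) ^ (M + 2) * (2 ^ ?n) powr h')"
          using K(2)[of "y p"] by (intro mult_left_mono mult_right_mono) auto
        also have "\<dots> = K * (2 ^ ?n) powr h' * (\<bar>c (fst p)\<bar> * (1 / (1 + \<bar>y p\<bar>) ^ (M + 2)))" by simp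
        also have "\<dots> \<le> K * (2 ^ ?n) powr h' * (A * 2 powr (- h * real ?n) * (1 / (1 + \<bar>y p\<bar>) ^ 2))"
          using K(1) d by (intro mult_left_mono lift[of _ _ 0]) (auto simp: y_def)
        also have "\<dots> = K * (A * (2 powr (- h * real ?n) * (2 ^ ?n) powr h')) * (1 / (1 + \<bar>y p\<bar>) ^ 2)"
          by simp
        also have "\<dots> = K * b ?n * (1 / (1 + \<bar>y p\<bar>) ^ 2)"
          unfolding scale b_def ..
        finally show "\<bar>T p i\<bar> \<le> K * (b ?n * (1 / (1 + \<bar>2 ^ ?n * x - real_of_int (wpos p)\<bar>) ^ 2))"
          by (simp add: y_def)
      qed
      also have "\<dots> = K * (\<Sum>p\<in>F. b (length (fst p)) * (1 / (1 + \<bar>2 ^ length (fst p) * x - real_of_int (wpos p)\<bar>) ^ 2))"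
        by (simp add: sum_distrib_left)
      also have "\<dots> \<le> K * (L * suminf b)"
        using K(1) by (intro mult_left_mono L(2)[rule_format, OF b F]) auto
      finally show "(\<Sum>p\<in>F. \<bar>T p i\<bar>) \<le> K * (L * suminf b)" .
    qed
    then show ?thesis using abs_summable_summable[of "\<lambda>p. T p i" UNIV] by simp
  qed
  define P where "P = Poly (map (\<lambda>i. \<Sum>\<^sub>\<infinity>p. T p i) [0..<Suc N])"
  have coeffP: "coeff P i = (if i \<le> N then \<Sum>\<^sub>\<infinity>p. T p i else 0)" for i
    by (simp add: P_def nth_default_def del: upt_Suc)
  have polyP: "poly P t = (\<Sum>\<^sub>\<infinity>p. \<Sum>i\<le>N. T p i * t ^ i)" for t
  proof -
    have "poly P t = (\<Sum>i\<le>N. coeff P i * t ^ i)"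
      unfolding poly_altdef
      by (rule sum.mono_neutral_left) (auto simp: coeffP coeff_eq_0 intro!: degree_le le_degree)
    also have "\<dots> = (\<Sum>i\<le>N. \<Sum>\<^sub>\<infinity>p. T p i * t ^ i)"
      by (simp add: coeffP infsum_cmult_left')
    also have "\<dots> = (\<Sum>\<^sub>\<infinity>p. \<Sum>i\<le>N. T p i * t ^ i)"
      by (rule infsumI[OF has_sum_finite_sum, symmetric]) (auto intro!: summable_on_cmult_left Tsum)
    finally show ?thesis .
  qed
  have "\<bar>wseries psi c (x + t) - poly P t\<bar> \<le> (2 * C * (L * suminf b) + 1) * \<bar>t\<bar> powr h'" if t: "\<bar>t\<bar> \<le> d" for t
  proof -
    have s1: "(\<lambda>p. c (fst p) * wterm psi (x + t) p) summable_on UNIV"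
    proof -
      have "(\<lambda>p. \<bar>c (fst p) * wterm psi (x + t) p\<bar>) summable_on UNIV"
        by (rule abs_summable_onI_finite_sums, rule B0[rule_format, OF _ c])
      then show ?thesis using abs_summable_summable[of "\<lambda>p. c (fst p) * wterm psi (x + t) p" UNIV] by simp
    qed
    have s2: "(\<lambda>p. \<Sum>i\<le>N. T p i * t ^ i) summable_on UNIV"
      by (rule has_sum_imp_summable, rule has_sum_finite_sum) (auto intro!: summable_on_cmult_left Tsum)
    let ?r = "\<lambda>p. c (fst p) * wterm psi (x + t) p - (\<Sum>i\<le>N. T p i * t ^ i)"
    have "wseries psi c (x + t) - poly P t = infsum ?r UNIV"
      unfolding wseries_def polyP by (rule infsumI[OF has_sum_diff_real[OF has_sum_infsum[OF s1] has_sum_infsum[OF s2]], symmetric])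
    also have "\<bar>\<dots>\<bar> \<le> 2 * C * (L * suminf b) * \<bar>t\<bar> powr h'"
    proof (rule abs_summable_onI_finite_sums(2))
      fix F :: "(bool list \<times> int) set" assume F: "finite F"
      let ?w = "\<lambda>t p. b (length (fst p)) * (1 / (1 + \<bar>2 ^ length (fst p) * (x + t) - real_of_int (wpos p)\<bar>) ^ 2)"
      have "(\<Sum>p\<in>F. \<bar>?r p\<bar>) \<le> (\<Sum>p\<in>F. C * \<bar>t\<bar> powr h' * (?w t p + ?w 0 p))"
      proof (rule sum_mono)
        fix p :: "bool list \<times> int"
        let ?n = "length (fst p)"
        let ?s = "2 ^ ?n * t"
        let ?y' = "2 ^ ?n * (x + t) - real_of_int (wpos p)"
        have y': "?y' = y p + ?s" by (simp add: y_def algebra_simps)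
        have "(\<Sum>i\<le>N. T p i * t ^ i) = c (fst p) * (\<Sum>i\<le>N. (deriv ^^ i) psi (y p) / fact i * ?s ^ i)"
          by (simp add: T_def sum_distrib_left power_mult_distrib mult_ac)
        then have "?r p = c (fst p) * (psi (y p + ?s) - (\<Sum>i\<le>N. (deriv ^^ i) psi (y p) / fact i * ?s ^ i))"
          unfolding wterm_def y' by (simp add: right_diff_distrib)
        then have "\<bar>?r p\<bar> \<le> \<bar>c (fst p)\<bar> * (C * \<bar>?s\<bar> powr h' * (1 / (1 + \<bar>y p + ?s\<bar>) ^ (M + 2) + 1 / (1 + \<bar>y p\<bar>) ^ (M + 2)))"
          using C(2)[rule_format, of "y p" ?s] by (simp only: abs_mult) (intro mult_left_mono, auto)
        also have "\<dots> = C * \<bar>?s\<bar> powr h' * (\<bar>c (fst p)\<bar> * (1 / (1 + \<bar>y p + ?s\<bar>) ^ (M + 2)) + \<bar>c (fst p)\<bar> * (1 / (1 + \<bar>y p\<bar>) ^ (M + 2)))"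
          by (simp only: distrib_left mult_ac)
        also have "\<dots> \<le> C * \<bar>?s\<bar> powr h' * (A * 2 powr (- h * real ?n) * (1 / (1 + \<bar>y p + ?s\<bar>) ^ 2) + A * 2 powr (- h * real ?n) * (1 / (1 + \<bar>y p\<bar>) ^ 2))"
          using C(1) by (intro mult_left_mono add_mono lift[of _ _ t] lift[of _ _ 0]) (use t d in \<open>auto simp: y_def algebra_simps\<close>)
        also have "\<bar>?s\<bar> powr h' = (2 ^ ?n) powr h' * \<bar>t\<bar> powr h'"
          by (simp add: abs_mult powr_mult)
        also have "C * ((2 ^ ?n) powr h' * \<bar>t\<bar> powr h') * (A * 2 powr (- h * real ?n) * (1 / (1 + \<bar>y p + ?s\<bar>) ^ 2) + A * 2 powr (- h * real ?n) * (1 / (1 + \<bar>y p\<bar>) ^ 2))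
          = C * \<bar>t\<bar> powr h' * ((A * (2 powr (- h * real ?n) * (2 ^ ?n) powr h')) * (1 / (1 + \<bar>y p + ?s\<bar>) ^ 2) + (A * (2 powr (- h * real ?n) * (2 ^ ?n) powr h')) * (1 / (1 + \<bar>y p\<bar>) ^ 2))"
          by (simp add: algebra_simps)
        also have "\<dots> = C * \<bar>t\<bar> powr h' * (?w t p + ?w 0 p)"
          unfolding scale b_def[symmetric] y'[symmetric] by (simp add: y_def)
        finally show "\<bar>?r p\<bar> \<le> C * \<bar>t\<bar> powr h' * (?w t p + ?w 0 p)" .
      qed
      also have "\<dots> = C * \<bar>t\<bar> powr h' * (sum (?w t) F + sum (?w 0) F)"
        by (simp only: sum_distrib_left[symmetric] sum.distrib)
      also have "\<dots> \<le> C * \<bar>t\<bar> powr h' * (L * suminf b + L * suminf b)"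
        using C(1) by (intro mult_left_mono add_mono L(2)[rule_format, OF b F]) auto
      finally show "(\<Sum>p\<in>F. \<bar>?r p\<bar>) \<le> 2 * C * (L * suminf b) * \<bar>t\<bar> powr h'"
        by (simp add: algebra_simps)
    qed
    also have "\<dots> \<le> (2 * C * (L * suminf b) + 1) * \<bar>t\<bar> powr h'"
      by (intro mult_right_mono) auto
    finally show ?thesis .
  qed
  moreover have "2 * C * (L * suminf b) + 1 > 0"
    using C(1) L(1) suminf_nonneg[OF b(2,1)] by (intro add_nonneg_pos) auto
  ultimately show ?thesis
    using hh(1) d by (intro powr_le_holder_exp[where P = P and d = d and c = "2 * C * (L * suminf b) + 1"]) auto
qed

section \<open>Vanishing moments and upper bounds for the exponent\<close>

text \<open>Decay of order \<open>D + 2\<close> against growth of order \<open>D\<close> leaves an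
  integrable inverse square. The base \<open>2 + |x|\<close> is the one that arises for dyadic
  positions within two units of a point.\<close>

lemma integrable_poly_growth_schwartz:
  assumes "schwartz f" and g: "g \<in> borel_measurable lborel" "\<And>x. \<bar>g x\<bar> \<le> K * (2 + \<bar>x\<bar>) ^ D"
  shows "integrable lborel (\<lambda>x. g x * f x)"
proof -
  obtain C where C: "C > 0" "\<And>x. \<bar>f x\<bar> \<le> C / (1 + \<bar>x\<bar>) ^ (D + 2)"
    using schwartz_decay[OF assms(1), of 0 "D + 2"] by auto
  have K: "0 \<le> K" using order_trans[OF abs_ge_zero g(2)[of 0]] by (auto simp: zero_le_mult_iff power_le_zero_eq)
  have "continuous_on UNIV f" using schwartz_continuous[OF assms(1), of 0] by simp
  then have [measurable]: "f \<in> borel_measurable borel" by (rule borel_measurable_continuous_onI)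
  have [measurable]: "g \<in> borel_measurable borel" using g(1) by simp
  have i: "integrable lborel (\<lambda>x::real. K * 2 ^ D * C * inverse (1 + x ^ 2))"
    using integrable_inverse_1_plus_square unfolding set_integrable_def by simp
  show ?thesis
  proof (rule Bochner_Integration.integrable_bound[OF i])
    show "AE x in lborel. norm (g x * f x) \<le> norm (K * 2 ^ D * C * inverse (1 + x ^ 2))"
    proof (rule AE_I2)
      fix x :: real
      have "\<bar>g x * f x\<bar> \<le> (K * (2 + \<bar>x\<bar>) ^ D) * (C / (1 + \<bar>x\<bar>) ^ (D + 2))"
        unfolding abs_mult using K by (intro mult_mono g C) auto
      also have "\<dots> \<le> (K * (2 * (1 + \<bar>x\<bar>)) ^ D) * (C / (1 + \<bar>x\<bar>) ^ (D + 2))"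
        using K C(1) by (intro mult_right_mono mult_left_mono power_mono) auto
      also have "\<dots> = K * 2 ^ D * C * (1 / (1 + \<bar>x\<bar>) ^ 2)"
        unfolding power_mult_distrib power_add using abs_ge_zero[of x] by (simp add: power2_eq_square add_nonneg_eq_0_iff)
      also have "\<dots> \<le> K * 2 ^ D * C * inverse (1 + x ^ 2)"
      proof (rule mult_left_mono)
        have "1 + x ^ 2 \<le> (1 + \<bar>x\<bar>) ^ 2" by (simp add: power2_sum)
        then show "1 / (1 + \<bar>x\<bar>) ^ 2 \<le> inverse (1 + x ^ 2)"
          by (simp add: inverse_eq_divide) (intro divide_left_mono mult_pos_pos, auto simp: add_pos_nonneg)
      qed (use K C(1) in auto)
      finally show "norm (g x * f x) \<le> norm (K * 2 ^ D * C * inverse (1 + x ^ 2))"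
        using K C(1) by (simp add: abs_mult add_pos_nonneg)
    qed
  qed simp
qed

lemma integrable_abs_power_schwartz:
  assumes "schwartz f" "a \<ge> 0" "a \<le> 2"
  shows "integrable lborel (\<lambda>x. (a + \<bar>x\<bar>) ^ D * \<bar>f x\<bar>)"
proof -
  have "integrable lborel (\<lambda>x. (a + \<bar>x\<bar>) ^ D * f x)"
    by (rule integrable_poly_growth_schwartz[OF assms(1), of _ 1 D])
       (use assms in \<open>auto simp: power_abs intro!: power_mono\<close>)
  from integrable_abs[OF this] show ?thesis
    using assms by (simp add: abs_mult power_abs add_nonneg_nonneg)
qed

lemma poly_growth:
  fixes Q :: "real poly"
  assumes "degree Q \<le> D"
  obtains K where "K > 0" "\<And>x. \<bar>poly Q x\<bar> \<le> K * (1 + \<bar>x\<bar>) ^ D"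
proof -
  have "\<bar>poly Q x\<bar> \<le> ((\<Sum>i\<le>degree Q. \<bar>coeff Q i\<bar>) + 1) * (1 + \<bar>x\<bar>) ^ D" for x
  proof -
    have "\<bar>poly Q x\<bar> \<le> (\<Sum>i\<le>degree Q. \<bar>coeff Q i\<bar> * \<bar>x\<bar> ^ i)"
      unfolding poly_altdef by (rule order_trans[OF sum_abs]) (simp add: abs_mult power_abs)
    also have "\<dots> \<le> (\<Sum>i\<le>degree Q. \<bar>coeff Q i\<bar> * (1 + \<bar>x\<bar>) ^ D)"
    proof (intro sum_mono mult_left_mono)
      fix i assume "i \<in> {..degree Q}"
      have "\<bar>x\<bar> ^ i \<le> (1 + \<bar>x\<bar>) ^ i" by (intro power_mono) auto
      also have "\<dots> \<le> (1 + \<bar>x\<bar>) ^ D" using \<open>i \<in> _\<close> assms by (intro power_increasing) auto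
      finally show "\<bar>x\<bar> ^ i \<le> (1 + \<bar>x\<bar>) ^ D" .
    qed auto
    also have "\<dots> = (\<Sum>i\<le>degree Q. \<bar>coeff Q i\<bar>) * (1 + \<bar>x\<bar>) ^ D" by (simp add: sum_distrib_right)
    also have "\<dots> \<le> ((\<Sum>i\<le>degree Q. \<bar>coeff Q i\<bar>) + 1) * (1 + \<bar>x\<bar>) ^ D" by (intro mult_right_mono) auto
    finally show ?thesis .
  qed
  moreover have "(\<Sum>i\<le>degree Q. \<bar>coeff Q i\<bar>) + 1 > 0" by (intro add_nonneg_pos sum_nonneg) auto
  ultimately show ?thesis using that by blast
qed

lemma integrable_poly_schwartz:
  assumes "schwartz f"
  shows "integrable lborel (\<lambda>x. poly Q x * f x)"
proof -
  obtain K where K: "K > 0" "\<And>x. \<bar>poly Q x\<bar> \<le> K * (1 + \<bar>x\<bar>) ^ degree Q"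
    using poly_growth[of Q "degree Q"] by blast
  show ?thesis
  proof (rule integrable_poly_growth_schwartz[OF assms, of _ K "degree Q"])
    show "poly Q \<in> borel_measurable lborel"
      using continuous_on_poly[OF continuous_on_id, of UNIV Q] by (simp add: borel_measurable_continuous_onI)
    fix x :: real
    have "K * (1 + \<bar>x\<bar>) ^ degree Q \<le> K * (2 + \<bar>x\<bar>) ^ degree Q"
      using K(1) by (intro mult_left_mono power_mono) auto
    with K(2)[of x] show "\<bar>poly Q x\<bar> \<le> K * (2 + \<bar>x\<bar>) ^ degree Q" by linarith
  qed
qed

text \<open>The substitution that turns the wavelet of scale \<open>J\<close> and position
  \<open>K\<close> into \<open>psi\<close> itself. This form serves both the moments and the
  recovery of coefficients.\<close>

lemma wavelet_orthonormal_rescaled: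
  assumes "wavelet_onb psi"
  shows "(\<integral>y. psi (2 ^ j * ((y + of_int K) / 2 ^ J) - of_int k) * psi y \<partial>lborel) = (if j = J \<and> k = K then 1 else 0)"
proof -
  let ?I = "\<integral>y. psi (2 ^ j * ((y + of_int K) / 2 ^ J) - of_int k) * psi y \<partial>lborel"
  have pw: "2 powr real_of_int (int n) = (2::real) ^ n" for n by (simp add: powr_realpow)
  have "(\<integral>x. wav psi (int j) k x * wav psi (int J) K x \<partial>lborel) 
      = (2 powr (real j / 2) * 2 powr (real J / 2)) * (\<integral>x. psi (2 ^ j * x - of_int k) * psi (2 ^ J * x - of_int K) \<partial>lborel)"
    unfolding wav_def pw by (subst integral_mult_right_zero[symmetric]) (simp add: mult_ac)
  also have "(\<integral>x. psi (2 ^ j * x - of_int k) * psi (2 ^ J * x - of_int K) \<partial>lborel) = ?I / 2 ^ J"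
    by (subst lborel_integral_real_affine[where t = "of_int K / 2 ^ J" and c = "1 / 2 ^ J"])
       (simp_all add: add_divide_distrib algebra_simps)
  finally have 1: "(if (int j, k) = (int J, K) then 1 else 0) = 2 powr (real j / 2) * 2 powr (real J / 2) * (?I / 2 ^ J)"
    using assms unfolding wavelet_onb_def by metis
  show ?thesis
  proof (cases "j = J")
    case True
    have "2 powr (real J / 2) * 2 powr (real J / 2) = (2::real) ^ J"
      by (simp add: powr_add[symmetric] powr_realpow)
    with 1 True show ?thesis by (auto split: if_splits)
  next
    case False
    with 1 show ?thesis by simp
  qed
qed

text \<open>Otherwise the derivative vanishes on the dense set of dyadic points, hence everywhere.
  Descending in the order, each lower derivative is then constant, and being of rapid decay it is
  zero, down to \<open>f\<close> itself.\<close>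

lemma schwartz_deriv_dyadic_nonzero:
  assumes "schwartz f" "f x0 \<noteq> 0"
  obtains p :: int and q :: nat where "(deriv ^^ l) f (of_int p / 2 ^ q) \<noteq> 0"
proof (rule ccontr)
  assume "\<not> thesis"
  then have Z: "(deriv ^^ l) f (of_int p / 2 ^ q) = 0" for p q using that by blast
  have zero: "(deriv ^^ l) f x = 0" for x
  proof -
    have "(\<lambda>q. of_int \<lfloor>2 ^ q * x\<rfloor> / 2 ^ q) \<longlonglongrightarrow> x"
    proof (rule tendsto_sandwich)
      show "\<forall>\<^sub>F q in sequentially. x - 1 / 2 ^ q \<le> of_int \<lfloor>2 ^ q * x\<rfloor> / 2 ^ q"
      proof (intro always_eventually allI)
        fix q :: nat
        have "2 ^ q * x - 1 \<le> of_int \<lfloor>2 ^ q * x\<rfloor>" by linarith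
        then have "(2 ^ q * x - 1) / 2 ^ q \<le> of_int \<lfloor>2 ^ q * x\<rfloor> / 2 ^ q" by (intro divide_right_mono) auto
        then show "x - 1 / 2 ^ q \<le> of_int \<lfloor>2 ^ q * x\<rfloor> / 2 ^ q" by (simp add: diff_divide_distrib)
      qed
      show "\<forall>\<^sub>F q in sequentially. of_int \<lfloor>2 ^ q * x\<rfloor> / 2 ^ q \<le> x"
      proof (intro always_eventually allI)
        fix q :: nat
        have "of_int \<lfloor>2 ^ q * x\<rfloor> \<le> 2 ^ q * x" by linarith
        then show "of_int \<lfloor>2 ^ q * x\<rfloor> / 2 ^ q \<le> x" by (simp add: field_simps)
      qed
      have "(\<lambda>q. x - (1 / 2) ^ q) \<longlonglongrightarrow> x - 0" by (intro tendsto_intros) simp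
      then show "(\<lambda>q. x - 1 / 2 ^ q) \<longlonglongrightarrow> x" by (simp add: power_divide)
    qed simp
    moreover have "isCont ((deriv ^^ l) f) x" using schwartz_deriv[OF assms(1)] DERIV_isCont by blast
    ultimately have "(\<lambda>q. (deriv ^^ l) f (of_int \<lfloor>2 ^ q * x\<rfloor> / 2 ^ q)) \<longlonglongrightarrow> (deriv ^^ l) f x"
      by (rule isCont_tendsto_compose[rotated])
    then show ?thesis using Z by (simp add: LIMSEQ_const_iff)
  qed
  have "\<forall>x. (deriv ^^ i) f x = 0" if "i \<le> l" for i
    using that
  proof (induction i rule: inc_induct)
    case (step i)
    have "((deriv ^^ i) f has_real_derivative 0) (at x)" for x
      using schwartz_deriv[OF assms(1), of i x] step by simp
    then have const: "(deriv ^^ i) f x = (deriv ^^ i) f 0" for x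
      by (intro DERIV_isconst_all) auto
    obtain C where C: "C > 0" "\<And>x. \<bar>(deriv ^^ i) f x\<bar> \<le> C / (1 + \<bar>x\<bar>) ^ 1"
      using schwartz_decay[OF assms(1)] by blast
    have "(deriv ^^ i) f 0 = 0"
    proof (rule ccontr)
      assume nz: "(deriv ^^ i) f 0 \<noteq> 0"
      let ?v = "\<bar>(deriv ^^ i) f 0\<bar>"
      have "?v \<le> C / (1 + \<bar>C / ?v\<bar>)" using C(2)[of "C / ?v"] unfolding const[of "C / ?v"] by simp
      then have "?v * (1 + C / ?v) \<le> C" using C(1) nz by (simp add: pos_le_divide_eq add_pos_nonneg)
      then show False using nz by (simp add: distrib_left)
    qed
    then show ?case using const by simp
  qed (use zero in auto)
  from this[of 0] assms(2) show False by simp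
qed

lemma wavelet_nonzero:
  assumes "wavelet_onb psi"
  obtains x where "psi x \<noteq> 0"
proof (rule ccontr)
  assume "\<not> thesis"
  then have "psi = (\<lambda>x. 0)" using that by auto
  then show False using wavelet_orthonormal_rescaled[OF assms, of 0 0 0 0] by simp
qed

text \<open>Test the orthogonality of \<open>\<psi>\<close> and \<open>\<psi>(2^J \<cdot> - 2^J a)\<close> for large \<open>J\<close>, where \<open>a\<close> is a dyadic
  point at which the \<open>l\<close>-th derivative does not vanish: if the moments below \<open>l\<close> vanish, the
  Taylor expansion of \<open>\<psi>\<close> at \<open>a\<close> leaves only the \<open>l\<close>-th moment at order \<open>2^(-Jl)\<close>.\<close>
lemma wavelet_vanishing_moments:
  assumes "schwartz psi" "wavelet_onb psi"
  shows "(\<integral>y. y ^ l * psi y \<partial>lborel) = 0"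
proof (induction l rule: less_induct)
  case (less l)
  define m where "m i = (\<integral>y. y ^ i * psi y \<partial>lborel)" for i
  have mi: "integrable lborel (\<lambda>y. y ^ i * psi y)" for i
    using integrable_poly_schwartz[OF assms(1), of "monom 1 i"] by (simp add: poly_monom)
  obtain x0 where x0: "psi x0 \<noteq> 0" using wavelet_nonzero[OF assms(2)] .
  obtain p q where pq: "(deriv ^^ l) psi (of_int p / 2 ^ q) \<noteq> 0"
    using schwartz_deriv_dyadic_nonzero[OF assms(1) x0] .
  define a where "a = of_int p / (2::real) ^ q"
  let ?D = "\<lambda>i. (deriv ^^ i) psi a / fact i"
  obtain C where C: "C > 0" "\<forall>y s. \<bar>psi (y + s) - (\<Sum>i\<le>l. (deriv ^^ i) psi y / fact i * s ^ i)\<bar>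
      \<le> C * \<bar>s\<bar> powr real (l + 1) * (1 / (1 + \<bar>y + s\<bar>) ^ 0 + 1 / (1 + \<bar>y\<bar>) ^ 0)"
    using schwartz_taylor_remainder[OF assms(1), of l "real (l + 1)" 0] by (auto simp del: of_nat_Suc)
  define Q where "Q = (\<integral>y. \<bar>y\<bar> ^ (l + 1) * \<bar>psi y\<bar> \<partial>lborel)"
  have bound: "\<bar>?D l * m l\<bar> \<le> 2 * C * Q / 2 ^ J" if J: "J \<ge> q" "J \<ge> 1" for J
  proof -
    \<comment> \<open>For \<open>J \<ge> q\<close> the dyadic point \<open>a\<close> is a position
      of scale \<open>J\<close>, so the wavelet of that scale centred at \<open>a\<close> is
      orthogonal to \<open>psi\<close>, which has scale \<open>0 < J\<close>.\<close>
    define K where "K = p * 2 ^ (J - q)"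
    have K: "of_int K = 2 ^ J * a"
    proof -
      have "(2::real) ^ J = 2 ^ (J - q) * 2 ^ q" using J(1) by (simp add: power_add[symmetric])
      then show ?thesis by (simp add: K_def a_def)
    qed
    have o: "(\<integral>y. psi (a + y / 2 ^ J) * psi y \<partial>lborel) = 0"
      using wavelet_orthonormal_rescaled[OF assms(2), of 0 K J 0] J(2) unfolding K
      by (simp add: add_divide_distrib add.commute)
    have i1: "integrable lborel (\<lambda>y. psi (a + y / 2 ^ J) * psi y)"
    proof -
      obtain C0 where C0: "C0 > 0" "\<And>x. \<bar>psi x\<bar> \<le> C0 / (1 + \<bar>x\<bar>) ^ 0"
        using schwartz_decay[OF assms(1), of 0 0] by auto
      have c: "continuous_on UNIV psi" using schwartz_continuous[OF assms(1), of 0] by simp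
      show ?thesis
      proof (rule integrable_poly_growth_schwartz[OF assms(1), of _ C0 0])
        have "continuous_on UNIV (\<lambda>y. psi (a + y / 2 ^ J))"
          by (rule continuous_on_compose2[OF c]) (auto intro!: continuous_intros)
        then show "(\<lambda>y. psi (a + y / 2 ^ J)) \<in> borel_measurable lborel"
          by (simp add: borel_measurable_continuous_onI)
      qed (use C0 in simp)
    qed
    let ?T = "\<lambda>y. (\<Sum>i\<le>l. ?D i * (y / 2 ^ J) ^ i) * psi y"
    have Teq: "?T y = (\<Sum>i\<le>l. (?D i / (2 ^ J) ^ i) * (y ^ i * psi y))" for y
      by (simp only: sum_distrib_right) (simp add: power_divide mult_ac)
    have i2: "integrable lborel ?T" unfolding Teq by (intro Bochner_Integration.integrable_sum integrable_mult_right mi)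
    have "(\<integral>y. ?T y \<partial>lborel) = (\<Sum>i\<le>l. (?D i / (2 ^ J) ^ i) * m i)"
      unfolding Teq m_def by (subst Bochner_Integration.integral_sum) (auto intro!: integrable_mult_right mi)
    \<comment> \<open>All moments of lower order vanish by the induction hypothesis.\<close>
    also have "\<dots> = ?D l / (2 ^ J) ^ l * m l"
      by (subst sum.remove[of _ l]) (auto intro!: sum.neutral simp: m_def less.IH)
    finally have "?D l / (2 ^ J) ^ l * m l = (\<integral>y. ?T y - psi (a + y / 2 ^ J) * psi y \<partial>lborel)"
      using o i1 i2 by simp
    then have "\<bar>?D l / (2 ^ J) ^ l * m l\<bar> \<le> (\<integral>y. \<bar>?T y - psi (a + y / 2 ^ J) * psi y\<bar> \<partial>lborel)"
      by (simp add: integral_abs_bound)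
    also have "\<dots> \<le> (\<integral>y. (2 * C / (2 ^ J) ^ (l + 1)) * (\<bar>y\<bar> ^ (l + 1) * \<bar>psi y\<bar>) \<partial>lborel)"
    proof (rule integral_mono)
      show "integrable lborel (\<lambda>y. \<bar>?T y - psi (a + y / 2 ^ J) * psi y\<bar>)" using i1 i2 by simp
      show "integrable lborel (\<lambda>y. (2 * C / (2 ^ J) ^ (l + 1)) * (\<bar>y\<bar> ^ (l + 1) * \<bar>psi y\<bar>))"
        using integrable_abs_power_schwartz[OF assms(1), of 0 "l + 1"] by simp
      fix y
      have "\<bar>?T y - psi (a + y / 2 ^ J) * psi y\<bar> = \<bar>psi (a + y / 2 ^ J) - (\<Sum>i\<le>l. ?D i * (y / 2 ^ J) ^ i)\<bar> * \<bar>psi y\<bar>"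
        by (simp only: left_diff_distrib[symmetric] abs_mult abs_minus_commute)
      also have "\<dots> \<le> (C * \<bar>y / 2 ^ J\<bar> powr real (l + 1) * 2) * \<bar>psi y\<bar>"
        using C(2)[rule_format, of a "y / 2 ^ J"] by (intro mult_right_mono) auto
      also have "\<bar>y / 2 ^ J\<bar> powr real (l + 1) = \<bar>y / 2 ^ J\<bar> ^ (l + 1)"
        
        proof (cases "y = 0")
          case False
          then show ?thesis by (intro powr_realpow) simp
        qed simp
      also have "(C * \<bar>y / 2 ^ J\<bar> ^ (l + 1) * 2) * \<bar>psi y\<bar> = (2 * C / (2 ^ J) ^ (l + 1)) * (\<bar>y\<bar> ^ (l + 1) * \<bar>psi y\<bar>)"
        by (simp add: abs_divide power_divide)
      finally show "\<bar>?T y - psi (a + y / 2 ^ J) * psi y\<bar> \<le> (2 * C / (2 ^ J) ^ (l + 1)) * (\<bar>y\<bar> ^ (l + 1) * \<bar>psi y\<bar>)" .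
    qed
    also have "\<dots> = 2 * C / (2 ^ J) ^ (l + 1) * Q" by (simp add: Q_def)
    finally have "\<bar>?D l * m l\<bar> / (2 ^ J) ^ l \<le> 2 * C / (2 ^ J) ^ (l + 1) * Q"
      by (simp add: abs_mult abs_divide)
    then have "\<bar>?D l * m l\<bar> / (2 ^ J) ^ l * (2 ^ J) ^ l \<le> 2 * C / (2 ^ J) ^ (l + 1) * Q * (2 ^ J) ^ l"
      by (intro mult_right_mono) auto
    then show ?thesis by simp
  qed
  have "\<bar>?D l * m l\<bar> \<le> 0"
  proof (rule tendsto_lowerbound)
    have "(\<lambda>J. 2 * C * Q * (1 / 2) ^ J) \<longlonglongrightarrow> 2 * C * Q * 0" by (intro tendsto_intros) simp
    then show "(\<lambda>J. 2 * C * Q / 2 ^ J) \<longlonglongrightarrow> 0" by (simp add: power_divide)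
    show "\<forall>\<^sub>F J in sequentially. \<bar>?D l * m l\<bar> \<le> 2 * C * Q / 2 ^ J"
      using bound by (intro eventually_sequentiallyI[of "max q 1"]) auto
  qed simp
  then have "?D l * m l = 0" by (simp only: abs_le_zero_iff)
  then show ?case using pq by (simp add: a_def m_def)
qed

lemma wavelet_poly_orthogonal:
  assumes "schwartz psi" "wavelet_onb psi"
  shows "(\<integral>y. poly Q y * psi y \<partial>lborel) = 0"
proof -
  have i: "integrable lborel (\<lambda>y. y ^ i * psi y)" for i
    using integrable_poly_schwartz[OF assms(1), of "monom 1 i"] by (simp add: poly_monom)
  have "(\<lambda>y. poly Q y * psi y) = (\<lambda>y. \<Sum>i\<le>degree Q. coeff Q i * (y ^ i * psi y))"
    by (simp add: poly_altdef sum_distrib_right mult.assoc)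
  then show ?thesis
    by (simp add: Bochner_Integration.integral_sum integrable_mult_right i wavelet_vanishing_moments[OF assms])
qed

text \<open>All finite sums of absolute values are at most \<open>B |psi|\<close>, so sum and
  integral may be exchanged. Length and position determine a pair, so orthonormality leaves only the
  term \<open>p = q\<close>.\<close>

lemma wseries_coefficient:
  assumes sch: "schwartz psi" and onb: "wavelet_onb psi" and h0: "h0 > 0"
    and c: "\<And>u. \<bar>c u\<bar> \<le> 2 powr (- h0 * real (length u))"
  shows "integrable lborel (\<lambda>y. wseries psi c ((y + wpos q) / 2 ^ length (fst q)) * psi y)"
    and "(\<integral>y. wseries psi c ((y + wpos q) / 2 ^ length (fst q)) * psi y \<partial>lborel) = c (fst q)"
proof -
  obtain B where B0: "B > 0" and B: "\<forall>c F x. finite F \<longrightarrow> (\<forall>u. \<bar>c u\<bar> \<le> 2 powr (- h0 * real (length u))) \<longrightarrow>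
       (\<Sum>p\<in>F. \<bar>c (fst p) * wterm psi x p\<bar>) \<le> B"
    using wterm_weighted_bound[OF sch h0] by (elim exE conjE) (rule that)
  let ?x = "\<lambda>y::real. (y + wpos q) / 2 ^ length (fst q)"
  define f where "f p y = (c (fst p) * wterm psi (?x y) p) * psi y" for p y
  have cont: "continuous_on UNIV psi" using schwartz_continuous[OF sch, of 0] by simp
  have wb: "\<bar>c (fst p) * wterm psi (?x y) p\<bar> \<le> B" for p y
    using B[rule_format, of "{p}" c "?x y"] c by simp
  have meas: "(\<lambda>y. c (fst p) * wterm psi (?x y) p) \<in> borel_measurable lborel" for p
  proof -
    have "continuous_on UNIV (\<lambda>y. psi (2 ^ length (fst p) * ?x y - wpos p))"
      by (rule continuous_on_compose2[OF cont]) (auto intro!: continuous_intros)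
    then have "continuous_on UNIV (\<lambda>y. c (fst p) * wterm psi (?x y) p)"
      unfolding wterm_def by (intro continuous_intros)
    then show ?thesis by (simp add: borel_measurable_continuous_onI)
  qed
  have int: "integrable lborel (f p)" for p
    unfolding f_def by (rule integrable_poly_growth_schwartz[OF sch meas, of _ B 0]) (use wb in simp)
  have ip: "integrable lborel (\<lambda>y. \<bar>psi y\<bar>)"
    using integrable_abs_power_schwartz[OF sch, of 0 0] by simp
  have sumf: "(\<Sum>p\<in>F. \<bar>f p y\<bar>) \<le> B * \<bar>psi y\<bar>" if "finite F" for F y
  proof -
    have "(\<Sum>p\<in>F. \<bar>f p y\<bar>) = (\<Sum>p\<in>F. \<bar>c (fst p) * wterm psi (?x y) p\<bar>) * \<bar>psi y\<bar>"
      by (simp add: f_def abs_mult sum_distrib_right)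
    also have "\<dots> \<le> B * \<bar>psi y\<bar>" using B that c by (intro mult_right_mono) auto
    finally show ?thesis .
  qed
  have abs: "(\<lambda>p. \<bar>f p y\<bar>) summable_on UNIV" for y
    by (rule abs_summable_onI_finite_sums, rule sumf)
  have Bs: "(\<Sum>p\<in>F. \<integral>y. \<bar>f p y\<bar> \<partial>lborel) \<le> B * (\<integral>y. \<bar>psi y\<bar> \<partial>lborel)" if F: "finite F" for F
  proof -
    have "(\<Sum>p\<in>F. \<integral>y. \<bar>f p y\<bar> \<partial>lborel) = (\<integral>y. (\<Sum>p\<in>F. \<bar>f p y\<bar>) \<partial>lborel)"
      using int by (subst Bochner_Integration.integral_sum) auto
    also have "\<dots> \<le> (\<integral>y. B * \<bar>psi y\<bar> \<partial>lborel)"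
      using int ip sumf[OF F] by (intro integral_mono) auto
    finally show ?thesis by simp
  qed
  have inf: "infinite (UNIV :: (bool list \<times> int) set)"
    by (simp add: finite_prod)
  have eq: "(\<lambda>y. wseries psi c (?x y) * psi y) = (\<lambda>y. \<Sum>\<^sub>\<infinity>p. f p y)"
    unfolding wseries_def f_def by (simp add: infsum_cmult_left')
  note II = integral_infsum[of lborel f, OF int abs Bs inf]
  show "integrable lborel (\<lambda>y. wseries psi c (?x y) * psi y)"
    unfolding eq by (rule II(2))
  have fint: "(\<integral>y. f p y \<partial>lborel) = (if p = q then c (fst q) else 0)" for p
  proof -
    have "(\<integral>y. f p y \<partial>lborel) = c (fst p) * (\<integral>y. psi (2 ^ length (fst p) * ?x y - wpos p) * psi y \<partial>lborel)"
      unfolding f_def wterm_def by (simp add: mult.assoc)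
    also have "\<dots> = (if p = q then c (fst q) else 0)"
      unfolding wavelet_orthonormal_rescaled[OF onb] using wpos_inj[of "fst p" "fst q" "snd p" "snd q"] by auto
    finally show ?thesis .
  qed
  show "(\<integral>y. wseries psi c (?x y) * psi y \<partial>lborel) = c (fst q)"
  proof -
    have "(\<integral>y. wseries psi c (?x y) * psi y \<partial>lborel) = (\<Sum>\<^sub>\<infinity>p. \<integral>y. f p y \<partial>lborel)"
      unfolding eq by (rule II(1))
    also have "\<dots> = c (fst q)"
      unfolding fint by (rule infsumI, rule has_sum_finite_neutralI[of "{q}"]) auto
    finally show ?thesis .
  qed
qed

text \<open>A larger exponent would give some \<open>h1 > h\<close> with a polynomial
  \<open>P\<close>. As the wavelet annihilates polynomials, a coefficient is the integral of series
  minus \<open>P\<close> against the wavelet, hence of order \<open>2^(-h1 |u|)\<close> for every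
  word with a position within two units of \<open>x\<close> at its scale. Long words from
  \<open>freq\<close> contradict this.\<close>

lemma wseries_holder_le:
  fixes x h :: real
  assumes sch: "schwartz psi" and onb: "wavelet_onb psi" and h0: "h0 > 0" and h: "h \<ge> 0"
    and c: "\<And>u. \<bar>c u\<bar> \<le> 2 powr (- h0 * real (length u))"
    and freq: "\<And>n. \<exists>u m. length u \<ge> n \<and> \<bar>2 ^ length u * x - wpos (u, m)\<bar> \<le> 2 \<and> 2 powr (- h * real (length u)) \<le> \<bar>c u\<bar>"
  shows "holder_exp (wseries psi c) x \<le> ereal h"
  unfolding holder_exp_def
proof (rule Sup_least, elim insertE)
  fix e assume "e \<in> ereal ` {h. h > 0 \<and> (\<exists>c' d (P::real poly). c' > 0 \<and> d > 0 \<and>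
          (\<forall>x'. \<bar>x' - x\<bar> \<le> d \<longrightarrow> \<bar>wseries psi c x' - poly P (x' - x)\<bar> \<le> c' * \<bar>x' - x\<bar> powr h))}"
  then obtain h1 c' d and P :: "real poly" where e: "e = ereal h1" "h1 > 0" "c' > 0" "d > 0"
    "\<And>x'. \<bar>x' - x\<bar> \<le> d \<Longrightarrow> \<bar>wseries psi c x' - poly P (x' - x)\<bar> \<le> c' * \<bar>x' - x\<bar> powr h1"
    by blast
  show "e \<le> ereal h"
  proof (rule ccontr)
    assume "\<not> e \<le> ereal h"
    then have hh: "h < h1" using e by simp
    obtain B where B0: "B > 0" and B: "\<forall>c F x. finite F \<longrightarrow> (\<forall>u. \<bar>c u\<bar> \<le> 2 powr (- h0 * real (length u))) \<longrightarrow>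
         (\<Sum>p\<in>F. \<bar>c (fst p) * wterm psi x p\<bar>) \<le> B"
      using wterm_weighted_bound[OF sch h0] by (elim exE conjE) (rule that)
    have fB: "\<bar>wseries psi c z\<bar> \<le> B" for z
      unfolding wseries_def by (rule abs_summable_onI_finite_sums(2)) (use B c in auto)
    define D where "D = max (nat \<lceil>h1\<rceil>) (degree P)"
    have D1: "h1 \<le> real D" unfolding D_def using real_nat_ceiling_ge[of h1] by simp
    obtain Cp where Cp: "Cp > 0" "\<And>x. \<bar>poly P x\<bar> \<le> Cp * (1 + \<bar>x\<bar>) ^ D"
      using poly_growth[of P D] by (auto simp: D_def)
    define Kc where "Kc = c' + (B + Cp) * (1 / d + 1) ^ D"
    have Kc: "c' \<le> Kc" "(B + Cp) * (1 / d + 1) ^ D \<le> Kc" "Kc > 0"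
      unfolding Kc_def using e B0 Cp by (auto intro!: add_pos_nonneg)
    \<comment> \<open>Extends the local estimate to all \<open>t\<close>. For \<open>|t| > d\<close>
      one has \<open>1 + |t| \<le> (1/d + 1) |t|\<close>, so boundedness of the series and growth of
      \<open>P\<close> give a multiple of \<open>|t|^D\<close>, and \<open>D \<ge> h1\<close> turns
      this into the required decay in \<open>J\<close>.\<close>
    have global: "\<bar>wseries psi c (x + t) - poly P t\<bar> \<le> Kc * ((2 + \<bar>y\<bar>) ^ D * 2 powr (- h1 * real J))"
      if t: "\<bar>t\<bar> \<le> (2 + \<bar>y\<bar>) / 2 ^ J" for t y J
    proof (cases "\<bar>t\<bar> \<le> d")
      case True
      have "\<bar>wseries psi c (x + t) - poly P t\<bar> \<le> c' * \<bar>t\<bar> powr h1"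
        using e(5)[of "x + t"] True by simp
      also have "\<dots> \<le> c' * ((2 + \<bar>y\<bar>) / 2 ^ J) powr h1"
        using t e by (intro mult_left_mono powr_mono2) auto
      also have "((2 + \<bar>y\<bar>) / 2 ^ J) powr h1 = (2 + \<bar>y\<bar>) powr h1 * 2 powr (- h1 * real J)"
      proof -
        have "((2 + \<bar>y\<bar>) / 2 ^ J) powr h1 = (2 + \<bar>y\<bar>) powr h1 / (2 ^ J) powr h1"
          by (rule powr_divide)
        also have "(2 ^ J :: real) powr h1 = 2 powr (h1 * real J)"
          by (simp add: powr_realpow[symmetric] powr_powr mult.commute)
        finally show ?thesis by (simp add: powr_minus divide_inverse)
      qed
      also have "\<dots> \<le> (2 + \<bar>y\<bar>) ^ D * 2 powr (- h1 * real J)"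
      proof (rule mult_right_mono)
        have "(2 + \<bar>y\<bar>) powr h1 \<le> (2 + \<bar>y\<bar>) powr real D" using D1 by (intro powr_mono) auto
        then show "(2 + \<bar>y\<bar>) powr h1 \<le> (2 + \<bar>y\<bar>) ^ D" by (simp add: powr_realpow add_pos_nonneg)
      qed simp
      also have "c' * \<dots> \<le> Kc * \<dots>" using Kc by (intro mult_right_mono) auto
      finally show ?thesis using e(3) by (simp add: mult_left_mono)
    next
      case False
      have "\<bar>wseries psi c (x + t) - poly P t\<bar> \<le> B + Cp * (1 + \<bar>t\<bar>) ^ D"
        using fB[of "x + t"] Cp(2)[of t] by linarith
      also have "\<dots> \<le> B * (1 + \<bar>t\<bar>) ^ D + Cp * (1 + \<bar>t\<bar>) ^ D"
        using B0 one_le_power[of "1 + \<bar>t\<bar>" D] by simp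
      also have "\<dots> = (B + Cp) * (1 + \<bar>t\<bar>) ^ D" by (simp add: distrib_right)
      also have "\<dots> \<le> (B + Cp) * ((1 / d + 1) * ((2 + \<bar>y\<bar>) / 2 ^ J)) ^ D"
      proof (intro mult_left_mono power_mono)
        have "1 \<le> 1 / d * \<bar>t\<bar>" using False e(4) by (simp add: field_simps)
        then have "1 + \<bar>t\<bar> \<le> (1 / d + 1) * \<bar>t\<bar>" by (simp add: distrib_right)
        also have "\<dots> \<le> (1 / d + 1) * ((2 + \<bar>y\<bar>) / 2 ^ J)" using t e by (intro mult_left_mono) auto
        finally show "1 + \<bar>t\<bar> \<le> (1 / d + 1) * ((2 + \<bar>y\<bar>) / 2 ^ J)" .
      qed (use B0 Cp in auto)
      also have "\<dots> = (B + Cp) * (1 / d + 1) ^ D * ((2 + \<bar>y\<bar>) ^ D * (1 / 2 ^ J) ^ D)"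
        by (simp add: power_mult_distrib power_divide)
      also have "\<dots> \<le> (B + Cp) * (1 / d + 1) ^ D * ((2 + \<bar>y\<bar>) ^ D * 2 powr (- h1 * real J))"
      proof (intro mult_left_mono)
        have "2 powr real (D * J) = (2::real) ^ (D * J)" by (rule powr_realpow) simp
        then have "(1 / 2 ^ J) ^ D = 2 powr (- (real D * real J))"
          by (simp add: power_mult[symmetric] powr_minus divide_inverse power_inverse mult.commute)
        also have "\<dots> \<le> 2 powr (- (h1 * real J))"
          using D1 by (intro powr_mono) (auto intro: mult_right_mono)
        finally show "(1 / 2 ^ J) ^ D \<le> 2 powr (- h1 * real J)" by simp
      qed (use B0 Cp e in auto)
      also have "\<dots> \<le> Kc * ((2 + \<bar>y\<bar>) ^ D * 2 powr (- h1 * real J))"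
        using Kc by (intro mult_right_mono) auto
      finally show ?thesis .
    qed
    define Q where "Q = (\<integral>y. (2 + \<bar>y\<bar>) ^ D * \<bar>psi y\<bar> \<partial>lborel)"
    have Q: "integrable lborel (\<lambda>y. (2 + \<bar>y\<bar>) ^ D * \<bar>psi y\<bar>)"
      by (rule integrable_abs_power_schwartz[OF sch]) auto
    have coef: "\<bar>c u\<bar> \<le> Kc * Q * 2 powr (- h1 * real (length u))"
      if um: "\<bar>2 ^ length u * x - wpos (u, m)\<bar> \<le> 2" for u m
    proof -
      let ?J = "length u" and ?K = "wpos (u, m)"
      let ?t = "\<lambda>y::real. (y + ?K) / 2 ^ ?J - x"
      have tb: "\<bar>?t y\<bar> \<le> (2 + \<bar>y\<bar>) / 2 ^ ?J" for y
      proof -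
        have "?t y = (y - (2 ^ ?J * x - ?K)) / 2 ^ ?J" by (simp add: field_simps)
        then have "\<bar>?t y\<bar> = \<bar>y - (2 ^ ?J * x - ?K)\<bar> / 2 ^ ?J" by (simp only: abs_divide) simp
        also have "\<dots> \<le> (2 + \<bar>y\<bar>) / 2 ^ ?J" using um by (intro divide_right_mono) auto
        finally show ?thesis .
      qed
      have i1: "integrable lborel (\<lambda>y. wseries psi c ((y + ?K) / 2 ^ ?J) * psi y)"
        and c1: "(\<integral>y. wseries psi c ((y + ?K) / 2 ^ ?J) * psi y \<partial>lborel) = c u"
        using wseries_coefficient[OF sch onb h0 c, of "(u, m)"] by simp_all
      \<comment> \<open>In the variable of integration \<open>P\<close> is again a polynomial, hence
        orthogonal to the wavelet.\<close>
      let ?Q = "pcompose P [: ?K / 2 ^ ?J - x, 1 / 2 ^ ?J :]"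
      have pQ: "poly ?Q y = poly P (?t y)" for y
        by (simp add: poly_pcompose add_divide_distrib algebra_simps)
      have i2: "integrable lborel (\<lambda>y. poly P (?t y) * psi y)"
        and c2: "(\<integral>y. poly P (?t y) * psi y \<partial>lborel) = 0"
        using integrable_poly_schwartz[OF sch, of ?Q] wavelet_poly_orthogonal[OF sch onb, of ?Q]
        unfolding pQ by simp_all
      have i3: "integrable lborel (\<lambda>y. (wseries psi c ((y + ?K) / 2 ^ ?J) - poly P (?t y)) * psi y)"
        unfolding left_diff_distrib using i1 i2 by (rule Bochner_Integration.integrable_diff)
      have "c u = (\<integral>y. (wseries psi c ((y + ?K) / 2 ^ ?J) - poly P (?t y)) * psi y \<partial>lborel)"
        unfolding left_diff_distrib using i1 i2 c1 c2 by simp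
      then have "\<bar>c u\<bar> \<le> (\<integral>y. \<bar>(wseries psi c ((y + ?K) / 2 ^ ?J) - poly P (?t y)) * psi y\<bar> \<partial>lborel)"
        by (simp only: integral_abs_bound)
      also have "\<dots> \<le> (\<integral>y. (Kc * 2 powr (- h1 * real ?J)) * ((2 + \<bar>y\<bar>) ^ D * \<bar>psi y\<bar>) \<partial>lborel)"
      proof (rule integral_mono)
        show "integrable lborel (\<lambda>y. \<bar>(wseries psi c ((y + ?K) / 2 ^ ?J) - poly P (?t y)) * psi y\<bar>)"
          using i3 by (rule integrable_abs)
        show "integrable lborel (\<lambda>y. (Kc * 2 powr (- h1 * real ?J)) * ((2 + \<bar>y\<bar>) ^ D * \<bar>psi y\<bar>))"
          using Q by simp
        fix y :: real
        have "\<bar>wseries psi c ((y + ?K) / 2 ^ ?J) - poly P (?t y)\<bar> \<le> Kc * ((2 + \<bar>y\<bar>) ^ D * 2 powr (- h1 * real ?J))"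
          using global[OF tb[of y]] by simp
        then have "\<bar>wseries psi c ((y + ?K) / 2 ^ ?J) - poly P (?t y)\<bar> * \<bar>psi y\<bar> \<le> Kc * ((2 + \<bar>y\<bar>) ^ D * 2 powr (- h1 * real ?J)) * \<bar>psi y\<bar>"
          by (rule mult_right_mono) simp
        then show "\<bar>(wseries psi c ((y + ?K) / 2 ^ ?J) - poly P (?t y)) * psi y\<bar> \<le> (Kc * 2 powr (- h1 * real ?J)) * ((2 + \<bar>y\<bar>) ^ D * \<bar>psi y\<bar>)"
          by (simp add: abs_mult mult_ac)
      qed
      also have "\<dots> = Kc * Q * 2 powr (- h1 * real ?J)" by (simp add: Q_def)
      finally show ?thesis .
    qed
    have Q0: "Q \<ge> 0" unfolding Q_def by (rule integral_nonneg_AE) auto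
    \<comment> \<open>For words of length at least this \<open>n\<close>, the lower bound from
      \<open>freq\<close> exceeds the upper bound from \<open>coef\<close>.\<close>
    obtain n :: nat where n: "(log 2 (Kc * Q + 1)) / (h1 - h) < real n"
      using reals_Archimedean2 by blast
    from freq[of n] obtain u m where u: "length u \<ge> n" "\<bar>2 ^ length u * x - wpos (u, m)\<bar> \<le> 2" "2 powr (- h * real (length u)) \<le> \<bar>c u\<bar>"
      by blast
    have "2 powr (- h * real (length u)) \<le> Kc * Q * 2 powr (- h1 * real (length u))"
      using u(3) coef[OF u(2)] by linarith
    then have "2 powr (- h * real (length u)) * 2 powr (h1 * real (length u)) \<le> Kc * Q * 2 powr (- h1 * real (length u)) * 2 powr (h1 * real (length u))"
      by (rule mult_right_mono) simp
    then have le: "2 powr ((h1 - h) * real (length u)) \<le> Kc * Q"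
      by (simp add: powr_add[symmetric] algebra_simps)
    have "log 2 (Kc * Q + 1) < (h1 - h) * real n"
      using n hh by (simp add: field_simps)
    also have "\<dots> \<le> (h1 - h) * real (length u)" using u(1) hh by (intro mult_left_mono) auto
    finally have "Kc * Q + 1 < 2 powr ((h1 - h) * real (length u))"
      using Kc(3) Q0 by (subst (asm) log_less_iff) (auto intro: add_nonneg_pos)
    with le show False by simp
  qed
qed (use h in simp)

section \<open>Isolated and limit points of a set of words\<close>

text \<open>\<open>S\<close> is the set of words carrying the large coefficient. A point is \<open>isolated_from S\<close> if the
  dyadic points of all but finitely many generations of \<open>S\<close> keep a positive torus distance from it.\<close>
definition isolated_from :: "(bool list \<Rightarrow> bool) \<Rightarrow> real \<Rightarrow> bool" where
  "isolated_from S x \<longleftrightarrow> (\<exists>d>0. \<exists>n. \<forall>u m. S u \<longrightarrow> n \<le> length u \<longrightarrow> d \<le> \<bar>x - xdot u - of_int m\<bar>)"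

definition limit_set :: "(bool list \<Rightarrow> bool) \<Rightarrow> real set" where
  "limit_set S = {x \<in> {0..<1}. \<not> isolated_from S x}"

text \<open>The set of ones has this property once births have ceased. A deep one near a point then
  forces ones near it at every earlier level from \<open>j\<close> on.\<close>

definition closed_from :: "nat \<Rightarrow> (bool list \<Rightarrow> bool) \<Rightarrow> bool" where
  "closed_from j S \<longleftrightarrow> (\<forall>u i. S u \<longrightarrow> j \<le> i \<longrightarrow> i \<le> length u \<longrightarrow> S (take i u))"

section \<open>Exponents at isolated points and at limit points\<close>

lemma abs_wcoef_le:
  assumes "0 < hl" "ereal hl < hu"
  shows "\<bar>wcoef hl hu b n\<bar> \<le> 2 powr (- hl * real n)"
proof (cases hu)
  case (real r)
  then have "2 powr (- (r * real n)) \<le> 2 powr (- (hl * real n))"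
    using assms by (intro powr_mono) (auto intro: mult_right_mono)
  with real show ?thesis by (simp add: wcoef_def)
qed (use assms in \<open>auto simp: wcoef_def\<close>)

lemma holder_exp_nonneg: "0 \<le> holder_exp f x"
  unfolding holder_exp_def by (rule Sup_upper) simp

text \<open>The supremum in the exponent absorbs the loss: let \<open>h'\<close> increase to
  \<open>h\<close>.\<close>

lemma wseries_holder_ge:
  fixes x d A h :: real
  assumes sch: "schwartz psi" and h0: "h0 > 0"
    and c: "\<And>u. \<bar>c u\<bar> \<le> 2 powr (- h0 * real (length u))"
    and A: "A > 0" and d: "d > 0"
    and loc: "\<And>u m (t::real). \<bar>t\<bar> \<le> d \<Longrightarrow>
       \<bar>c u\<bar> \<le> A * 2 powr (- h * real (length u)) * (1 + \<bar>2 ^ length u * (x + t) - wpos (u, m)\<bar>) ^ M"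
  shows "ereal h \<le> holder_exp (wseries psi c) x"
proof (rule dense_le)
  fix e assume e: "e < ereal h"
  show "e \<le> holder_exp (wseries psi c) x"
  proof (cases "e \<le> 0")
    case False
    then obtain h' where "e = ereal h'" "0 < h'" "h' < h" using e by (cases e) auto
    then show ?thesis using wseries_holder_ge_aux[OF sch h0 c _ _ A d loc] by simp
  qed (use holder_exp_nonneg order_trans in blast)
qed

text \<open>Read the integer in binary: its parity is the last letter and its half is handled by
  induction. Hence at every level some word has a position next to a given real number.\<close>

lemma wpos_surj: "\<exists>u m. length u = n \<and> wpos (u, m) = k"
proof (induction n arbitrary: k)
  case 0
  show ?case by (intro exI[of _ "[]"] exI[of _ k]) (simp add: wpos_def)
next
  case (Suc n)
  obtain u m where um: "length u = n" "wpos (u, m) = k div 2" using Suc by blast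
  let ?b = "odd k"
  have "real_of_int (wpos (u @ [?b], m)) = 2 * real_of_int (wpos (u, m)) + (if ?b then 1 else 0)"
    unfolding wpos_real by (simp add: xdot_snoc algebra_simps)
  also have "\<dots> = real_of_int (2 * (k div 2) + (if ?b then 1 else 0))" using um by simp
  finally have "wpos (u @ [?b], m) = 2 * (k div 2) + (if ?b then 1 else 0)" by (simp only: of_int_eq_iff)
  also have "\<dots> = k" by (simp add: odd_two_times_div_two_succ)
  finally show ?case using um(1) by (intro exI[of _ "u @ [?b]"] exI[of _ m]) simp
qed

lemma wpos_distance:
  fixes x :: real
  shows "2 ^ length u * x - wpos (u, m) = 2 ^ length u * (x - xdot u - of_int m)"
  unfolding wpos_real by (simp add: algebra_simps)

text \<open>Non-isolation gives a one of length at least \<open>n\<close> at distance below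
  \<open>2^(-n)\<close>. Its prefix of length \<open>n\<close> is a one by closure, and passing to
  it moves the dyadic point by less than another \<open>2^(-n)\<close>; hence the factor
  two.\<close>

lemma not_isolated_near:
  assumes "closed_from j S" "\<not> isolated_from S x" "j \<le> n"
  shows "\<exists>v m. S v \<and> length v = n \<and> \<bar>x - xdot v - of_int m\<bar> \<le> 2 / 2 ^ n"
proof -
  have "\<not> (\<forall>u m. S u \<longrightarrow> n \<le> length u \<longrightarrow> 1 / 2 ^ n \<le> \<bar>x - xdot u - of_int m\<bar>)"
    using assms(2) unfolding isolated_from_def by (meson zero_less_divide_1_iff zero_less_numeral zero_less_power)
  then obtain u m where u: "S u" "n \<le> length u" "\<bar>x - xdot u - of_int m\<bar> < 1 / 2 ^ n" unfolding not_all not_imp not_le by blast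
  let ?v = "take n u"
  have "xdot ?v \<le> xdot u" "xdot u < xdot ?v + 1 / 2 ^ n"
    using xdot_append_bounds[of ?v "drop n u"] u(2) by simp_all
  then have "\<bar>x - xdot ?v - of_int m\<bar> \<le> 2 / 2 ^ n" using u(3) by (smt (verit) add_divide_distrib)
  moreover have "S ?v" using assms(1,3) u unfolding closed_from_def by blast
  ultimately show ?thesis using u(2) by (intro exI[of _ ?v] exI[of _ m]) simp
qed

context
  fixes psi :: "real \<Rightarrow> real" and hl :: real and hu :: ereal and S :: "bool list \<Rightarrow> bool"
    and c :: "bool list \<Rightarrow> real"
  assumes sch: "schwartz psi" and onb: "wavelet_onb psi" and hl: "0 < hl" and hu: "ereal hl < hu"
  defines "c \<equiv> \<lambda>u. wcoef hl hu (S u) (length u)"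
begin

lemma c_bound: "\<bar>c u\<bar> \<le> 2 powr (- hl * real (length u))"
  unfolding c_def by (rule abs_wcoef_le[OF hl hu])

lemma holder_ge_hl: "ereal hl \<le> holder_exp (wseries psi c) x"
proof (rule wseries_holder_ge[OF sch hl c_bound, of 1 1 hl x 0])
qed (use c_bound in auto)

text \<open>Near an isolated point the long words with large coefficients sit at distance of order
  \<open>2^|u|\<close> in their own scale. The polynomial factor of order \<open>M \<ge> h\<close>
  that is allowed in the hypothesis then outweighs \<open>2^(-h |u|)\<close>.\<close>

lemma isolated_holder_ge:
  assumes "isolated_from S x" "0 < h" "ereal h \<le> hu"
  shows "ereal h \<le> holder_exp (wseries psi c) x"
proof -
  obtain d n where d: "d > 0" "\<And>u m. S u \<Longrightarrow> n \<le> length u \<Longrightarrow> d \<le> \<bar>x - xdot u - of_int m\<bar>"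
    using assms(1) unfolding isolated_from_def by blast
  define M where "M = nat \<lceil>h\<rceil>"
  have M: "h \<le> real M" unfolding M_def by (rule real_nat_ceiling_ge)
  \<comment> \<open>The three summands take care, in this order, of the long words in
    \<open>S\<close>, of the words in \<open>S\<close> shorter than \<open>n\<close>, and of the
    words outside \<open>S\<close>.\<close>
  define A where "A = (2 / d) ^ M + 2 powr (h * real n) + 1"
  have A: "A > 0" "(2 / d) ^ M \<le> A" "2 powr (h * real n) \<le> A" "1 \<le> A"
    unfolding A_def using d(1) by (auto intro!: add_nonneg_pos)
  show ?thesis
  proof (rule wseries_holder_ge[OF sch hl c_bound A(1), of "d / 2" h x M])
    fix u m and t :: real assume t: "\<bar>t\<bar> \<le> d / 2"
    let ?w = "1 + \<bar>2 ^ length u * (x + t) - wpos (u, m)\<bar>"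
    have c1: "\<bar>c u\<bar> \<le> 1"
      using c_bound[of u] hl powr_mono[of "- hl * real (length u)" 0 2] by simp
    have w1: "1 \<le> ?w ^ M" by (rule one_le_power) simp
    have le: "A * 2 powr (- h * real (length u)) \<le> A * 2 powr (- h * real (length u)) * ?w ^ M"
      using w1 A(1) mult_left_mono[OF w1, of "A * 2 powr (- h * real (length u))"] by simp
    show "\<bar>c u\<bar> \<le> A * 2 powr (- h * real (length u)) * ?w ^ M"
    proof (cases "S u")
      case True
      show ?thesis
      proof (cases "n \<le> length u")
        case far: True
        have "d \<le> \<bar>x - xdot u - of_int m\<bar>" using d(2)[OF True far] .
        then have "d / 2 \<le> \<bar>x + t - xdot u - of_int m\<bar>" using t by linarith
        then have "2 ^ length u * (d / 2) \<le> \<bar>2 ^ length u * (x + t) - wpos (u, m)\<bar>"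
          unfolding wpos_distance abs_mult by simp
        then have "(2 ^ length u * (d / 2)) ^ M \<le> ?w ^ M"
          using d(1) by (intro power_mono) auto
        then have "A * 2 powr (- h * real (length u)) * (2 ^ length u * (d / 2)) ^ M \<le> A * 2 powr (- h * real (length u)) * ?w ^ M"
          using A(1) by (intro mult_left_mono) auto
        moreover have "1 \<le> A * 2 powr (- h * real (length u)) * (2 ^ length u * (d / 2)) ^ M"
        proof -
          have "1 = (2 / d) ^ M * (d / 2) ^ M" using d(1) by (simp add: power_mult_distrib[symmetric])
          also have "\<dots> \<le> A * (d / 2) ^ M" using A d(1) by (intro mult_right_mono) auto
          also have "\<dots> \<le> A * (d / 2) ^ M * (2 powr (- h * real (length u)) * (2 ^ length u) ^ M)"
          proof -
            have "2 powr (h * real (length u)) \<le> 2 powr (real M * real (length u))"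
              using M by (intro powr_mono mult_right_mono) auto
            also have "\<dots> = (2 ^ length u) ^ M"
              by (simp add: powr_realpow[symmetric] powr_powr mult.commute)
            finally have "2 powr (- h * real (length u)) * 2 powr (h * real (length u)) \<le> 2 powr (- h * real (length u)) * (2 ^ length u) ^ M"
              by (rule mult_left_mono) simp
            then have "1 \<le> 2 powr (- h * real (length u)) * (2 ^ length u) ^ M"
              by (simp add: powr_add[symmetric])
            then show ?thesis using mult_left_mono[of 1 _ "A * (d / 2) ^ M"] A(1) d(1) by simp
          qed
          finally show ?thesis by (simp only: power_mult_distrib mult_ac)
        qed
        ultimately show ?thesis using c1 by linarith
      next
        case False
        have "1 = 2 powr (h * real n) * 2 powr (- h * real n)" by (simp add: powr_add[symmetric])
        also have "\<dots> \<le> A * 2 powr (- h * real (length u))"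
        proof (rule mult_mono[OF A(3)])
          have "h * real (length u) \<le> h * real n" using False assms(2) by (intro mult_left_mono) auto
          then show "2 powr (- h * real n) \<le> 2 powr (- h * real (length u))" by simp
        qed (use A in auto)
        finally show ?thesis using c1 le by linarith
      qed
    next
      case False
      have "\<bar>c u\<bar> \<le> 2 powr (- h * real (length u))"
      proof (cases hu)
        case (real r)
        then have "h \<le> r" using assms(3) by simp
        then have "2 powr (- (r * real (length u))) \<le> 2 powr (- (h * real (length u)))"
          by (intro powr_mono) (auto intro: mult_right_mono)
        with False real show ?thesis by (simp add: c_def wcoef_def)
      qed (use False hu in \<open>auto simp: c_def wcoef_def\<close>)
      also have "\<dots> \<le> A * 2 powr (- h * real (length u))" using A(4) by simp
      finally show ?thesis using le by linarith
    qed
  qed (use d in simp)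
qed

text \<open>For finite \<open>hu\<close> every coefficient, large or small, is at least
  \<open>2^(-hu |u|)\<close>, so the word whose position is next to the point gives the required
  lower bound at every level.\<close>

lemma holder_le_hu: "holder_exp (wseries psi c) x \<le> hu"
proof (cases hu)
  case (real r)
  have hr: "hl < r" using hu real by simp
  have "holder_exp (wseries psi c) x \<le> ereal r"
  proof (rule wseries_holder_le[OF sch onb hl _ c_bound])
    fix n
    obtain u m where u: "length u = n" "wpos (u, m) = \<lfloor>2 ^ n * x\<rfloor>" using wpos_surj by blast
    have "\<bar>2 ^ length u * x - wpos (u, m)\<bar> \<le> 2" unfolding u by linarith
    moreover have "2 powr (- r * real (length u)) \<le> \<bar>c u\<bar>"
    proof -
      have "r * real (length u) \<ge> hl * real (length u)" using hr by (intro mult_right_mono) auto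
      then show ?thesis using real by (simp add: c_def wcoef_def)
    qed
    ultimately show "\<exists>u m. n \<le> length u \<and> \<bar>2 ^ length u * x - wpos (u, m)\<bar> \<le> 2 \<and> 2 powr (- r * real (length u)) \<le> \<bar>c u\<bar>"
      using u by blast
  qed (use hl hr in auto)
  then show ?thesis using real by simp
qed (use hu in auto)

lemma holder_isolated:
  assumes "isolated_from S x"
  shows "holder_exp (wseries psi c) x = hu"
proof (rule antisym[OF holder_le_hu])
  show "hu \<le> holder_exp (wseries psi c) x"
  proof (rule dense_le)
    fix e assume e: "e < hu"
    show "e \<le> holder_exp (wseries psi c) x"
    proof (cases "e \<le> 0")
      case False
      then obtain h where "e = ereal h" "0 < h" using e by (cases e) auto
      then show ?thesis using isolated_holder_ge[OF assms, of h] e by auto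
    qed (use holder_exp_nonneg order_trans in blast)
  qed
qed

lemma holder_not_isolated:
  assumes "closed_from j S" "\<not> isolated_from S x"
  shows "holder_exp (wseries psi c) x = ereal hl"
proof (rule antisym[OF _ holder_ge_hl])
  show "holder_exp (wseries psi c) x \<le> ereal hl"
  proof (rule wseries_holder_le[OF sch onb hl _ c_bound])
    fix n
    obtain v m where v: "S v" "length v = max j n" "\<bar>x - xdot v - of_int m\<bar> \<le> 2 / 2 ^ max j n"
      using not_isolated_near[OF assms max.cobounded1] by blast
    have "\<bar>2 ^ length v * x - wpos (v, m)\<bar> \<le> 2"
      unfolding wpos_distance abs_mult using v(2,3) by (simp add: field_simps)
    moreover have "2 powr (- hl * real (length v)) \<le> \<bar>c v\<bar>" using v(1) by (simp add: c_def wcoef_def)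
    ultimately show "\<exists>u m. n \<le> length u \<and> \<bar>2 ^ length u * x - wpos (u, m)\<bar> \<le> 2 \<and> 2 powr (- hl * real (length u)) \<le> \<bar>c u\<bar>"
      using v(2) by (intro exI[of _ v] exI[of _ m]) auto
  qed (use hl in auto)
qed

end

section \<open>Existence of limit points\<close>

lemma finite_bounded_words: "finite {u :: bool list. length u \<le> n}"
  using finite_lists_length_le[of "UNIV :: bool set" n] by simp

lemma isolated_from_finite:
  assumes "finite {u. S u}"
  shows "isolated_from S x"
proof -
  obtain n where "\<And>u. S u \<Longrightarrow> length u \<le> n"
    using finite_nat_set_iff_bounded_le[of "length ` {u. S u}"] assms by auto
  then have "\<not> Suc n \<le> length u" if "S u" for u using that by fastforce
  then show ?thesis unfolding isolated_from_def by (intro exI[of _ 1] conjI exI[of _ "Suc n"]) auto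
qed

text \<open>Bolzano-Weierstrass for the dyadic points of ever longer words. The fractional part
  returns a limit equal to 1 to the fundamental domain.\<close>

lemma limit_set_nonempty:
  assumes "infinite {u. S u}"
  obtains x where "x \<in> limit_set S"
proof -
  have "\<exists>u. S u \<and> k \<le> length u" for k
  proof (rule ccontr)
    assume "\<nexists>u. S u \<and> k \<le> length u"
    then have "{u. S u} \<subseteq> {u. length u \<le> k}" by force
    then show False using assms finite_bounded_words finite_subset by blast
  qed
  then obtain u where u: "\<And>k. S (u k)" "\<And>k. k \<le> length (u k)" by metis
  have "seq_compact {0..1::real}" using compact_Icc compact_imp_seq_compact by blast
  moreover have "\<forall>k. xdot (u k) \<in> {0..1}" using xdot_range less_imp_le by auto
  ultimately obtain l r where l: "l \<in> {0..1}" "strict_mono r" "((\<lambda>k. xdot (u k)) \<circ> r) \<longlonglongrightarrow> l"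
    by (rule seq_compactE)
  have "\<not> isolated_from S (frac l)"
    unfolding isolated_from_def
  proof (intro notI, elim exE conjE)
    fix d :: real and n assume d: "d > 0" "\<forall>u m. S u \<longrightarrow> n \<le> length u \<longrightarrow> d \<le> \<bar>frac l - xdot u - of_int m\<bar>"
    obtain k0 where k0: "\<And>k. k \<ge> k0 \<Longrightarrow> \<bar>xdot (u (r k)) - l\<bar> < d"
      using LIMSEQ_D[OF l(3) d(1)] by auto
    let ?k = "max k0 n"
    have "n \<le> length (u (r ?k))" using u(2)[of "r ?k"] seq_suble[OF l(2), of ?k] by linarith
    then have "d \<le> \<bar>frac l - xdot (u (r ?k)) - of_int (- \<lfloor>l\<rfloor>)\<bar>" using d(2) u(1) by blast
    then show False using k0[of ?k] by (simp add: frac_def)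
  qed
  then have "frac l \<in> limit_set S" by (simp add: limit_set_def frac_lt_1)
  then show ?thesis using that by blast
qed

section \<open>Hausdorff measure on the circle\<close>

lemma tdist_eq_round: "tdist x y = \<bar>x - y - of_int (round (x - y))\<bar>"
  unfolding tdist_def
proof (rule antisym)
  have "bdd_below (range (\<lambda>k::int. \<bar>x - y - real_of_int k\<bar>))" by (rule bdd_belowI[of _ 0]) auto
  then show "(INF k::int. \<bar>x - y - real_of_int k\<bar>) \<le> \<bar>x - y - of_int (round (x - y))\<bar>"
    by (rule cINF_lower) simp
  show "\<bar>x - y - of_int (round (x - y))\<bar> \<le> (INF k::int. \<bar>x - y - real_of_int k\<bar>)"
    by (rule cINF_greatest) (auto intro: round_diff_minimal)
qed

lemma tdist_le: "tdist x y \<le> \<bar>x - y - of_int k\<bar>"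
  unfolding tdist_eq_round by (rule round_diff_minimal)

lemma tdist_nonneg: "0 \<le> tdist x y"
  unfolding tdist_eq_round by simp

lemma tdist_le_1: "tdist x y \<le> 1"
  using tdist_le[of x y "\<lfloor>x - y\<rfloor>"] by linarith

lemma tdist_le_tdiam:
  assumes "x \<in> A" "y \<in> A"
  shows "tdist x y \<le> tdiam A"
proof -
  have "bdd_above {tdist x y |x y. x \<in> A \<and> y \<in> A}" using tdist_le_1 by (intro bdd_aboveI[of _ 1]) auto
  then have "tdist x y \<le> Sup {tdist x y |x y. x \<in> A \<and> y \<in> A}" using assms by (intro cSup_upper) auto
  then show ?thesis using assms by (auto simp: tdiam_def)
qed

lemma tdiam_empty [simp]: "tdiam {} = 0"
  by (simp add: tdiam_def)

lemma tdiam_leI: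
  assumes "0 \<le> d" "\<And>x y. x \<in> A \<Longrightarrow> y \<in> A \<Longrightarrow> tdist x y \<le> d"
  shows "tdiam A \<le> d"
proof (cases "A = {}")
  case False
  then obtain a where "a \<in> A" by blast
  then have "Sup {tdist x y |x y. x \<in> A \<and> y \<in> A} \<le> d" using assms by (intro cSup_least) blast+
  then show ?thesis by (simp add: tdiam_def False)
qed (use assms in \<open>simp add: tdiam_def\<close>)

lemma tdiam_nonneg: "0 \<le> tdiam A"
proof (cases "A = {}")
  case False
  then obtain x where "x \<in> A" by blast
  then show ?thesis using tdist_le_tdiam[of x A x] tdist_nonneg[of x x] by linarith
qed (simp add: tdiam_def)

lemma tdiam_le_1: "tdiam A \<le> 1"
  by (rule tdiam_leI) (auto intro: tdist_le_1)

definition torus_covers :: "real \<Rightarrow> real set \<Rightarrow> (nat \<Rightarrow> real set) set" where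
  "torus_covers d A = {C. A \<subseteq> (\<Union>n. C n) \<and> (\<forall>n. C n \<subseteq> {0..<1} \<and> tdiam (C n) \<le> d)}"

lemma hausdorff_torus_alt:
  "hausdorff_torus s A = (SUP d\<in>{0<..}. INF C\<in>torus_covers d A. \<Sum>n. ennreal (tdiam (C n) powr s))"
  unfolding hausdorff_torus_def torus_covers_def ..

lemma hausdorff_torus_mono:
  assumes "A \<subseteq> B"
  shows "hausdorff_torus s A \<le> hausdorff_torus s B"
  unfolding hausdorff_torus_alt
proof (rule SUP_mono', rule INF_superset_mono)
  fix d show "torus_covers d B \<subseteq> torus_covers d A" using assms unfolding torus_covers_def by blast
qed simp

lemma hausdorff_torus_eq_0I:
  assumes "\<And>d e. d > 0 \<Longrightarrow> e > 0 \<Longrightarrow> \<exists>C\<in>torus_covers d A. (\<Sum>n. ennreal (tdiam (C n) powr s)) \<le> ennreal e"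
  shows "hausdorff_torus s A = 0"
proof -
  have "(INF C\<in>torus_covers d A. \<Sum>n. ennreal (tdiam (C n) powr s)) \<le> 0" if d: "d > 0" for d
  proof (rule ennreal_le_epsilon)
    fix e :: real assume "e > 0"
    then obtain C where "C \<in> torus_covers d A" "(\<Sum>n. ennreal (tdiam (C n) powr s)) \<le> ennreal e"
      using assms d by blast
    then show "(INF C\<in>torus_covers d A. \<Sum>n. ennreal (tdiam (C n) powr s)) \<le> 0 + ennreal e"
      by (auto intro: INF_lower2)
  qed
  then have "hausdorff_torus s A \<le> 0"
    unfolding hausdorff_torus_alt by (intro SUP_least) auto
  then show ?thesis by simp
qed

lemma hausdorff_torus_eq_0D:
  assumes "hausdorff_torus s A = 0" "d > 0" "e > 0"
  obtains C where "C \<in> torus_covers d A" "(\<Sum>n. ennreal (tdiam (C n) powr s)) < ennreal e"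
proof -
  have "(INF C\<in>torus_covers d A. \<Sum>n. ennreal (tdiam (C n) powr s)) \<le> hausdorff_torus s A"
    unfolding hausdorff_torus_alt using assms by (intro SUP_upper) auto
  then have "(INF C\<in>torus_covers d A. \<Sum>n. ennreal (tdiam (C n) powr s)) < ennreal e"
    using assms by simp
  then show ?thesis unfolding INF_less_iff using that by blast
qed

lemma hdim_le:
  assumes "s > 0" "hausdorff_torus s A = 0"
  shows "hdim A \<le> ereal s"
  using assms by (auto simp: hdim_def intro!: Inf_lower)

lemma hdim_ge:
  assumes "A \<noteq> {}" "\<And>s. s > 0 \<Longrightarrow> hausdorff_torus s A = 0 \<Longrightarrow> t \<le> ereal s"
  shows "t \<le> hdim A"
  using assms by (auto simp: hdim_def intro!: Inf_greatest)

lemma hdim_empty_iff: "hdim A = -\<infinity> \<longleftrightarrow> A = {}"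
proof
  assume "hdim A = -\<infinity>"
  moreover have "A \<noteq> {} \<Longrightarrow> 0 \<le> hdim A" by (rule hdim_ge) auto
  ultimately show "A = {}" by auto
qed (simp add: hdim_def)

abbreviation generation :: "(bool list \<Rightarrow> bool) \<Rightarrow> nat \<Rightarrow> bool list set" where
  "generation S n \<equiv> {u. length u = n \<and> S u}"

lemma finite_generation: "finite (generation S n)"
  by (rule finite_subset[OF _ finite_bounded_words[of n]]) auto

text \<open>The arcs of radius \<open>2 / 2^k\<close> about the words of generation \<open>k\<close>
  cover the limit set for every \<open>k \<ge> j\<close>. Small sums are therefore needed for
  arbitrarily large \<open>k\<close> only, which is what a lower limit provides.\<close>

lemma hausdorff_limit_set_eq_0:
  assumes cl: "closed_from j S" and s: "s > 0"
    and lim: "\<And>e n. e > 0 \<Longrightarrow> \<exists>k\<ge>n. real (card (generation S k)) * 2 powr (- s * real k) \<le> e"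
  shows "hausdorff_torus s (limit_set S) = 0"
proof (rule hausdorff_torus_eq_0I)
  fix d e :: real assume d: "d > 0" and e: "e > 0"
  obtain n0 where n0: "(1/2 :: real) ^ n0 < d / 4" using real_arch_pow_inv[of "d / 4" "1/2"] d by auto
  \<comment> \<open>\<open>k \<ge> n0\<close> makes the diameters smaller than \<open>d\<close>, and
    \<open>4 powr s\<close> is the price of diameters \<open>4 / 2^k\<close> instead of
    \<open>1 / 2^k\<close>.\<close>
  obtain k where k: "k \<ge> max j n0" "real (card (generation S k)) * 2 powr (- s * real k) \<le> e / 4 powr s"
    using lim[of "e / 4 powr s" "max j n0"] e by auto
  have jk: "j \<le> k" using k(1) by simp
  let ?G = "generation S k"
  let ?piece = "\<lambda>v. {x \<in> {0..<1}. \<exists>m. \<bar>x - xdot v - of_int m\<bar> \<le> 2 / 2 ^ k}"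
  have diam: "tdiam (?piece v) \<le> 4 / 2 ^ k" for v
  proof (rule tdiam_leI)
    fix x y assume "x \<in> ?piece v" "y \<in> ?piece v"
    then obtain m m' where "\<bar>x - xdot v - of_int m\<bar> \<le> 2 / 2 ^ k" "\<bar>y - xdot v - of_int m'\<bar> \<le> 2 / 2 ^ k" by auto
    then have "\<bar>x - y - of_int (m - m')\<bar> \<le> 2 / 2 ^ k + 2 / 2 ^ k" unfolding of_int_diff by arith
    also have "\<dots> = 4 / 2 ^ k" by simp
    finally show "tdist x y \<le> 4 / 2 ^ k" by (rule order_trans[OF tdist_le])
  qed simp
  obtain f where f: "bij_betw f {..<card ?G} ?G"
    using ex_bij_betw_nat_finite[OF finite_generation, of k S] by (auto simp: atLeast0LessThan)
  define C where "C n = (if n < card ?G then ?piece (f n) else {})" for n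
  show "\<exists>C\<in>torus_covers d (limit_set S). (\<Sum>n. ennreal (tdiam (C n) powr s)) \<le> ennreal e"
  proof (rule bexI[of _ C])
    have dk: "4 / 2 ^ k \<le> d"
    proof -
      have "(1/2::real) ^ k \<le> (1/2) ^ n0" using k(1) by (intro power_decreasing) auto
      with n0 have "(1/2::real) ^ k \<le> d / 4" by linarith
      then show ?thesis by (simp add: power_divide)
    qed
    show "C \<in> torus_covers d (limit_set S)"
      unfolding torus_covers_def
    proof (intro CollectI conjI allI subsetI)
      fix x assume x: "x \<in> limit_set S"
      then have "\<not> isolated_from S x" by (simp add: limit_set_def)
      then obtain v m where v: "S v" "length v = k" "\<bar>x - xdot v - of_int m\<bar> \<le> 2 / 2 ^ k"
        using not_isolated_near[OF cl _ jk] by blast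
      have "f ` {..<card ?G} = ?G" using f by (simp add: bij_betw_def)
      moreover have "v \<in> ?G" using v by simp
      ultimately have "v \<in> f ` {..<card ?G}" by (simp only:)
      then obtain n where n: "n < card ?G" "f n = v" by (elim imageE) simp
      have "x \<in> C n" using n v(3) x by (auto simp: C_def limit_set_def)
      then show "x \<in> (\<Union>n. C n)" by blast
    next
      fix n show "tdiam (C n) \<le> d" using order_trans[OF diam[of "f n"] dk] d by (simp add: C_def)
    qed (auto simp: C_def split: if_splits)
    have "(\<Sum>n. ennreal (tdiam (C n) powr s)) = (\<Sum>n<card ?G. ennreal (tdiam (C n) powr s))"
      by (rule suminf_finite) (auto simp: C_def)
    also have "\<dots> \<le> (\<Sum>n<card ?G. ennreal ((4 / 2 ^ k) powr s))"
      using diam tdiam_nonneg s by (intro sum_mono ennreal_leI powr_mono2) (auto simp: C_def)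
    also have "\<dots> = ennreal (real (card ?G) * (4 / 2 ^ k) powr s)"
      by (simp add: ennreal_mult' ennreal_of_nat_eq_real_of_nat)
    also have "\<dots> \<le> ennreal e"
    proof (rule ennreal_leI)
      have "(4 / 2 ^ k) powr s = 4 powr s * 2 powr (- s * real k)"
      proof -
        have "(4 / 2 ^ k) powr s = 4 powr s / (2 ^ k) powr s" by (rule powr_divide)
        also have "(2 ^ k :: real) powr s = 2 powr (s * real k)"
          by (simp add: powr_realpow[symmetric] powr_powr mult.commute)
        finally show ?thesis by (simp add: powr_minus divide_inverse)
      qed
      then show "real (card ?G) * (4 / 2 ^ k) powr s \<le> e" using k(2) by (simp add: field_simps)
    qed
    finally show "(\<Sum>n. ennreal (tdiam (C n) powr s)) \<le> ennreal e" .
  qed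
qed

lemma limit_set_all: "limit_set (\<lambda>u. True) = {0..<1}"
proof -
  have "\<not> isolated_from (\<lambda>u. True) x" for x
    unfolding isolated_from_def
  proof (intro notI, elim exE conjE)
    fix d :: real and n assume d: "d > 0" "\<forall>u m. True \<longrightarrow> n \<le> length u \<longrightarrow> d \<le> \<bar>x - xdot u - of_int m\<bar>"
    obtain n0 where n0: "(1/2 :: real) ^ n0 < d" using real_arch_pow_inv[of d "1/2"] d by auto
    let ?N = "max n n0"
    obtain u m where u: "length u = ?N" "wpos (u, m) = \<lfloor>2 ^ ?N * x\<rfloor>" using wpos_surj by blast
    have "d \<le> \<bar>x - xdot u - of_int m\<bar>" using d(2) u(1) by auto
    moreover have "\<bar>2 ^ length u * x - wpos (u, m)\<bar> = 2 ^ length u * \<bar>x - xdot u - of_int m\<bar>"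
      unfolding wpos_distance abs_mult by simp
    ultimately have "2 ^ ?N * d \<le> \<bar>2 ^ length u * x - wpos (u, m)\<bar>"
      unfolding u(1) by simp
    also have "\<dots> \<le> 1" unfolding u by linarith
    finally have "d \<le> (1/2) ^ ?N" by (simp add: power_divide field_simps)
    moreover have "(1/2::real) ^ ?N \<le> (1/2) ^ n0" by (intro power_decreasing) auto
    ultimately show False using n0 by linarith
  qed
  then show ?thesis by (auto simp: limit_set_def)
qed

lemma card_generation_all: "card (generation (\<lambda>u. True) n) = 2 ^ n"
  using card_lists_length_eq[of "UNIV :: bool set" n] by simp

text \<open>The whole circle is the limit set of the full tree, which has \<open>2^k\<close> words
  of length \<open>k\<close>; the covering lemma then applies with any exponent above one.\<close>

lemma hdim_le_1:
  assumes "A \<subseteq> {0..<1}"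
  shows "hdim A \<le> 1"
proof (rule dense_ge)
  fix z :: ereal assume z: "1 < z"
  show "hdim A \<le> z"
  proof (cases z)
  case (real r)
  define e where "e = r - 1"
  have e: "e > 0" "r = 1 + e" using z real by (simp_all add: e_def)
  have "hausdorff_torus (1 + e) (limit_set (\<lambda>u. True)) = 0"
  proof (rule hausdorff_limit_set_eq_0[of 0])
    fix d :: real and n :: nat assume d: "d > 0"
    have "(\<lambda>k. (2 powr (- e)) ^ k) \<longlonglongrightarrow> 0" using e by (intro LIMSEQ_realpow_zero) (auto simp: powr_less_one)
    then obtain n1 where n1: "\<And>k. k \<ge> n1 \<Longrightarrow> norm ((2 powr (- e)) ^ k - 0) < d"
      using LIMSEQ_D d by blast
    have "real (card (generation (\<lambda>u. True) k)) * 2 powr (- (1 + e) * real k) = (2 powr (- e)) ^ k" for k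
    proof -
      have "real (card (generation (\<lambda>u. True) k)) = 2 powr real k"
        unfolding card_generation_all by (simp add: powr_realpow)
      then show ?thesis by (simp add: powr_add[symmetric] powr_realpow[symmetric] powr_powr algebra_simps)
    qed
    then show "\<exists>k\<ge>n. real (card (generation (\<lambda>u. True) k)) * 2 powr (- (1 + e) * real k) \<le> d"
      using n1[of "max n n1"] by (intro exI[of _ "max n n1"]) auto
  qed (use e in \<open>auto simp: closed_from_def\<close>)
  then have "hausdorff_torus (1 + e) A = 0"
    using hausdorff_torus_mono[OF assms, of "1 + e"] by (simp add: limit_set_all)
  then have "hdim A \<le> ereal (1 + e)" using e by (intro hdim_le) auto
  then show ?thesis using real e by simp
  qed (use z in auto)
qed

text \<open>Comparison with Lebesgue measure. A set of torus diameter \<open>d\<close> lies in three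
  intervals of length \<open>2 d\<close>, about one of its points and the translates of that point
  by \<open>-1\<close> and \<open>1\<close>; this is the origin of the 6. Also
  \<open>d \<le> d powr s\<close>, since \<open>d\<close> and \<open>s\<close> are at most
  one.\<close>

lemma hausdorff_interval_nonzero:
  assumes ab: "a < b" "{a..<b} \<subseteq> A" and s: "0 < s" "s \<le> 1"
  shows "hausdorff_torus s A \<noteq> 0"
proof
  assume "hausdorff_torus s A = 0"
  then obtain C where C: "C \<in> torus_covers 1 A" "(\<Sum>n. ennreal (tdiam (C n) powr s)) < ennreal ((b - a) / 6)"
    by (rule hausdorff_torus_eq_0D[of s A 1 "(b - a) / 6"]) (use ab in simp_all)
  have cov: "A \<subseteq> (\<Union>n. C n)" "\<And>n. C n \<subseteq> {0..<1}" using C(1) by (auto simp: torus_covers_def)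
  define y where "y n = (SOME y. y \<in> C n)" for n
  define D where "D n = (if C n = {} then {} else (\<Union>k\<in>{-1,0,1::int}. {y n + k - tdiam (C n)..y n + k + tdiam (C n)}))" for n
  have CD: "C n \<subseteq> D n" for n
  proof
    fix x assume x: "x \<in> C n"
    then have y: "y n \<in> C n" unfolding y_def by (rule someI)
    let ?k = "round (x - y n)"
    have "\<bar>x - y n - of_int ?k\<bar> \<le> tdiam (C n)"
      using tdist_le_tdiam[OF x y] unfolding tdist_eq_round .
    moreover have "?k \<in> {-1, 0, 1}"
    proof -
      have "x \<in> {0..<1}" "y n \<in> {0..<1}" using cov(2) x y by blast+
      then have "\<bar>x - y n\<bar> < 1" by (auto simp: abs_less_iff)
      moreover have "\<bar>x - y n - of_int ?k\<bar> \<le> 1/2" by (metis abs_minus_commute of_int_round_abs_le)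
      moreover have "\<bar>real_of_int ?k\<bar> \<le> \<bar>x - y n\<bar> + \<bar>x - y n - of_int ?k\<bar>" by linarith
      ultimately have "real_of_int \<bar>?k\<bar> < 2" unfolding of_int_abs by linarith
      then have "\<bar>?k\<bar> < 2" by linarith
      then show ?thesis by auto
    qed
    ultimately show "x \<in> D n" using x unfolding D_def by (auto simp: abs_le_iff)
  qed
  have meas: "emeasure lborel (D n) \<le> 6 * ennreal (tdiam (C n) powr s)" for n
  proof (cases "C n = {}")
    case False
    have "emeasure lborel (D n) \<le> (\<Sum>k\<in>{-1,0,1::int}. emeasure lborel {y n + k - tdiam (C n)..y n + k + tdiam (C n)})"
    proof -
      have D: "D n = (\<Union>k\<in>{-1,0,1::int}. {y n + k - tdiam (C n)..y n + k + tdiam (C n)})"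
        unfolding D_def using False by (simp only: if_False)
      show ?thesis unfolding D by (rule emeasure_subadditive_finite) auto
    qed
    also have "\<dots> = ennreal (6 * tdiam (C n))"
    proof -
      have "(\<Sum>k\<in>{-1,0,1::int}. emeasure lborel {y n + k - tdiam (C n)..y n + k + tdiam (C n)}) = (\<Sum>k\<in>{-1,0,1::int}. ennreal (2 * tdiam (C n)))"
        using tdiam_nonneg[of "C n"] by (intro sum.cong) auto
      also have "\<dots> = ennreal (\<Sum>k\<in>{-1,0,1::int}. 2 * tdiam (C n))"
        using tdiam_nonneg[of "C n"] by (intro sum_ennreal) auto
      finally show ?thesis by simp
    qed
    also have "\<dots> \<le> ennreal (6 * tdiam (C n) powr s)"
    proof (intro ennreal_leI mult_left_mono)
      have "tdiam (C n) powr 1 \<le> tdiam (C n) powr s"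
        using tdiam_nonneg[of "C n"] tdiam_le_1[of "C n"] s by (intro powr_mono') auto
      then show "tdiam (C n) \<le> tdiam (C n) powr s" using tdiam_nonneg[of "C n"] by simp
    qed simp
    finally show ?thesis by (simp add: ennreal_mult')
  qed (simp add: D_def)
  have Dm: "D n \<in> sets lborel" for n by (auto simp: D_def)
  have "ennreal (b - a) = emeasure lborel {a..<b}" using ab by simp
  also have "\<dots> \<le> emeasure lborel (\<Union>n. D n)"
  proof (rule emeasure_mono)
    have "(\<Union>n. C n) \<subseteq> (\<Union>n. D n)" using CD by (intro UN_mono) auto
    with ab(2) cov(1) show "{a..<b} \<subseteq> (\<Union>n. D n)" by (meson order_trans)
  qed (use Dm in auto)
  also have "\<dots> \<le> (\<Sum>n. emeasure lborel (D n))"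
    using Dm by (intro emeasure_subadditive_countably) auto
  also have "\<dots> \<le> (\<Sum>n. 6 * ennreal (tdiam (C n) powr s))"
    by (intro suminf_le meas) auto
  also have "\<dots> = 6 * (\<Sum>n. ennreal (tdiam (C n) powr s))" by (simp add: ennreal_suminf_cmult)
  also have "\<dots> < 6 * ennreal ((b - a) / 6)"
    using C(2) by (intro ennreal_mult_strict_left_mono) auto
  also have "\<dots> = ennreal (b - a)"
  proof -
    have "ennreal (6 * ((b - a) / 6)) = ennreal 6 * ennreal ((b - a) / 6)" by (rule ennreal_mult') simp
    moreover have "6 * ((b - a) / 6) = b - a" by simp
    ultimately show ?thesis by (simp only: ennreal_numeral)
  qed
  finally show False by simp
qed

lemma hdim_interval:
  assumes "a < b" "{a..<b} \<subseteq> A" "A \<subseteq> {0..<1}"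
  shows "hdim A = 1"
proof (rule antisym[OF hdim_le_1[OF assms(3)]])
  show "1 \<le> hdim A"
  proof (rule hdim_ge)
    show "A \<noteq> {}" using assms by force
    fix s :: real assume "s > 0" "hausdorff_torus s A = 0"
    then show "1 \<le> ereal s" using hausdorff_interval_nonzero[OF assms(1,2)] by (cases "s \<le> 1") auto
  qed
qed

text \<open>Isolation is an open condition: half the constant at \<open>x\<close> serves the points
  within \<open>d / 2\<close>. A limit set of zero length cannot be everything, so some isolated
  point exists, and an interval with it.\<close>

lemma hdim_isolated:
  assumes "hausdorff_torus 1 (limit_set S) = 0"
  shows "hdim {x \<in> {0..<1}. isolated_from S x} = 1"
proof -
  have "limit_set S \<noteq> {0..<1}" using assms hausdorff_interval_nonzero[of 0 1 "limit_set S" 1] by auto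
  then have "\<not> (\<forall>x\<in>{0..<1}. \<not> isolated_from S x)" by (auto simp: limit_set_def)
  then obtain x where x: "x \<in> {0..<1}" "isolated_from S x" by blast
  obtain d n where d: "d > 0" "\<And>u m. S u \<Longrightarrow> n \<le> length u \<Longrightarrow> d \<le> \<bar>x - xdot u - of_int m\<bar>"
    using x(2) unfolding isolated_from_def by blast
  show ?thesis
  proof (rule hdim_interval[of x "min 1 (x + d / 2)"])
    show "{x..<min 1 (x + d / 2)} \<subseteq> {x \<in> {0..<1}. isolated_from S x}"
    proof (intro subsetI CollectI conjI)
      fix z assume z: "z \<in> {x..<min 1 (x + d / 2)}"
      show "isolated_from S z" unfolding isolated_from_def
      proof (intro exI[of _ "d / 2"] exI[of _ n] conjI allI impI)
        fix u m assume "S u" "n \<le> length u"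
        from d(2)[OF this, of m] have "d \<le> \<bar>x - xdot u - of_int m\<bar>" .
        moreover have "\<bar>z - x\<bar> \<le> d / 2" using z by auto
        moreover have "\<bar>x - xdot u - of_int m\<bar> \<le> \<bar>z - xdot u - of_int m\<bar> + \<bar>z - x\<bar>" by linarith
        ultimately show "d / 2 \<le> \<bar>z - xdot u - of_int m\<bar>" by linarith
      qed (use d in simp)
    qed (use x in auto)
  qed (use x d in auto)
qed

section \<open>Energy of a finite tree\<close>

definition descendants :: "(bool list \<Rightarrow> bool) \<Rightarrow> nat \<Rightarrow> bool list \<Rightarrow> bool list set" where
  "descendants S n v = {u \<in> generation S n. take (length v) u = v}"

text \<open>A discrete \<open>s\<close>-energy of the counting measure on generation
  \<open>n\<close>, not normalised: a pair of words contributes \<open>2^(s i)\<close> for each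
  common prefix of length \<open>i \<ge> j\<close>.\<close>

definition tree_energy :: "real \<Rightarrow> nat \<Rightarrow> (bool list \<Rightarrow> bool) \<Rightarrow> nat \<Rightarrow> real" where
  "tree_energy s j S n = (\<Sum>i\<in>{j..n}. \<Sum>v\<in>{v. length v = i}. 2 powr (s * real i) * (real (card (descendants S n v)))\<^sup>2)"

lemma dyadic_powr: "(1 / 2 ^ k) powr s = 2 powr (- (s * real k))"
proof -
  have "(1 / 2 ^ k) powr s = 1 powr s / (2 ^ k) powr s" by (rule powr_divide)
  also have "(2 ^ k :: real) powr s = 2 powr (s * real k)"
    by (simp add: powr_realpow[symmetric] powr_powr mult.commute)
  finally show ?thesis by (simp add: powr_minus divide_inverse)
qed

text \<open>The scale is the last dyadic length above \<open>d\<close>, within a factor two of it. A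
  diameter zero has no such scale, which is why the error \<open>e\<close> is allowed. The bound on
  \<open>d\<close> gives \<open>g \<ge> j\<close>, where closure under prefixes is
  available.\<close>

lemma dyadic_scale:
  fixes d e s :: real
  assumes d: "0 \<le> d" "d \<le> 1 / 2 ^ Suc j" and e: "e > 0" and s: "0 < s"
  shows "\<exists>g\<ge>j. d < 1 / 2 ^ g \<and> (1 / 2 ^ g) powr s \<le> 2 powr s * d powr s + e"
proof (cases "d = 0")
  case True
  have "2 powr (- s) < (1::real)" using s by (simp add: powr_less_one)
  then have "(\<lambda>k. (2 powr (- s)) ^ k) \<longlonglongrightarrow> 0" by (intro LIMSEQ_realpow_zero) auto
  then obtain n1 where n1: "\<And>k. k \<ge> n1 \<Longrightarrow> norm ((2 powr (- s)) ^ k - 0) < e"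
    using LIMSEQ_D e by blast
  have "(1 / 2 ^ k) powr s = (2 powr (- s)) ^ k" for k
    unfolding dyadic_powr by (simp add: powr_realpow[symmetric] powr_powr)
  then have "(1 / 2 ^ max j n1) powr s \<le> e" using n1[of "max j n1"] by auto
  then show ?thesis using True by (intro exI[of _ "max j n1"]) auto
next
  case False
  then have d0: "d > 0" using d by simp
  obtain n0 where "(1/2 :: real) ^ n0 < d" using real_arch_pow_inv[of d "1/2"] d0 by auto
  then have ex: "1 / 2 ^ n0 \<le> d" by (simp add: power_divide)
  define n where "n = (LEAST n. 1 / 2 ^ n \<le> d)"
  have n: "1 / 2 ^ n \<le> d" unfolding n_def by (rule LeastI[of _ n0]) (rule ex)
  have jn: "j < n"
  proof (rule ccontr)
    assume "\<not> j < n"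
    then have "(2::real) ^ n \<le> 2 ^ j" by (intro power_increasing) auto
    then have "1 / (2::real) ^ j \<le> 1 / 2 ^ n" by (simp add: field_simps)
    with n d(2) have "1 / (2::real) ^ j \<le> 1 / 2 ^ Suc j" by linarith
    moreover have "1 / (2::real) ^ Suc j < 1 / 2 ^ j" by (intro divide_strict_left_mono) auto
    ultimately show False by linarith
  qed
  define g where "g = n - 1"
  have ng: "n = Suc g" "j \<le> g" using jn by (simp_all add: g_def)
  have "\<not> 1 / 2 ^ g \<le> d" using not_less_Least[of g "\<lambda>n. 1 / 2 ^ n \<le> d"] ng(1) unfolding n_def by simp
  moreover have "(1 / 2 ^ g) powr s \<le> 2 powr s * d powr s"
  proof -
    have "1 / 2 ^ g \<le> 2 * d" using n ng(1) by (simp add: field_simps)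
    then have "(1 / 2 ^ g) powr s \<le> (2 * d) powr s" using s by (intro powr_mono2) auto
    then show ?thesis using d0 by (simp add: powr_mult)
  qed
  ultimately show ?thesis using ng e by (intro exI[of _ g]) auto
qed

text \<open>Relative to one fixed point of \<open>A\<close>, every such word has a position within
  three units at scale \<open>g\<close>: two from its nearness to \<open>A\<close> and one from the
  diameter. The range from \<open>-3\<close> to \<open>3\<close> about an integer part has seven
  elements.\<close>

lemma card_words_near:
  assumes "tdiam A < 1 / 2 ^ g"
  shows "card {v. length v = g \<and> (\<exists>y\<in>A. \<exists>m. \<bar>y - xdot v - of_int m\<bar> \<le> 2 / 2 ^ g)} \<le> 7" (is "card ?V \<le> 7")
proof (cases "A = {}")
  case False
  then obtain y0 where y0: "y0 \<in> A" by blast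
  have "\<exists>m. \<bar>2 ^ g * y0 - wpos (v, m)\<bar> \<le> 3" if v: "v \<in> ?V" for v
  proof -
    obtain y m where y: "length v = g" "y \<in> A" "\<bar>y - xdot v - of_int m\<bar> \<le> 2 / 2 ^ g" using v by blast
    let ?k = "round (y0 - y)"
    have "\<bar>y0 - y - of_int ?k\<bar> < 1 / 2 ^ g"
      using tdist_le_tdiam[OF y0 y(2)] assms unfolding tdist_eq_round by linarith
    with y(3) have "\<bar>y0 - xdot v - of_int (m + ?k)\<bar> \<le> 2 / 2 ^ g + 1 / 2 ^ g" unfolding of_int_add by arith
    also have "\<dots> = 3 / 2 ^ g" by (simp add: add_divide_distrib[symmetric])
    finally have "2 ^ g * \<bar>y0 - xdot v - of_int (m + ?k)\<bar> \<le> 3" by (simp add: field_simps)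
    then have "\<bar>2 ^ length v * y0 - wpos (v, m + ?k)\<bar> \<le> 3"
      using arg_cong[OF wpos_distance[of v y0 "m + ?k"], of abs] unfolding abs_mult y(1) by simp
    then show ?thesis unfolding y(1) by blast
  qed
  then have "\<forall>v\<in>?V. \<exists>m. \<bar>2 ^ g * y0 - wpos (v, m)\<bar> \<le> 3" by blast
  from bchoice[OF this] obtain f where f: "\<forall>v\<in>?V. \<bar>2 ^ g * y0 - wpos (v, f v)\<bar> \<le> 3" by blast
  have "card ?V \<le> card {\<lfloor>2 ^ g * y0\<rfloor> - 3..\<lfloor>2 ^ g * y0\<rfloor> + 3}"
  proof (rule card_inj_on_le[of "\<lambda>v. wpos (v, f v)"])
    show "inj_on (\<lambda>v. wpos (v, f v)) ?V"
    proof (rule inj_onI)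
      fix v w assume "v \<in> ?V" "w \<in> ?V" "wpos (v, f v) = wpos (w, f w)"
      then show "v = w" using wpos_inj[of v w "f v" "f w"] by simp
    qed
    show "(\<lambda>v. wpos (v, f v)) ` ?V \<subseteq> {\<lfloor>2 ^ g * y0\<rfloor> - 3..\<lfloor>2 ^ g * y0\<rfloor> + 3}"
    proof (intro image_subsetI)
      fix v assume "v \<in> ?V"
      from bspec[OF f this] have "of_int (wpos (v, f v)) \<le> 2 ^ g * y0 + 3" "2 ^ g * y0 - 3 \<le> of_int (wpos (v, f v))" by linarith+
      then show "wpos (v, f v) \<in> {\<lfloor>2 ^ g * y0\<rfloor> - 3..\<lfloor>2 ^ g * y0\<rfloor> + 3}" by simp linarith
    qed
  qed simp
  then show ?thesis by simp
qed simp

lemma sum_UN_le: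
  fixes f :: "'a \<Rightarrow> real"
  assumes "finite I" "\<And>i. i \<in> I \<Longrightarrow> finite (A i)" "\<And>x. f x \<ge> 0"
  shows "sum f (\<Union>i\<in>I. A i) \<le> (\<Sum>i\<in>I. sum f (A i))"
  using assms(1,2)
proof (induction I)
  case (insert i I)
  have "sum f (A i \<union> (\<Union>i\<in>I. A i)) = sum f (A i) + sum f (\<Union>i\<in>I. A i) - sum f (A i \<inter> (\<Union>i\<in>I. A i))"
    using insert by (intro sum_Un) auto
  moreover have "0 \<le> sum f (A i \<inter> (\<Union>i\<in>I. A i))" using assms(3) by (rule sum_nonneg)
  ultimately show ?case using insert by simp
qed simp

text \<open>An energy (Frostman) estimate that avoids passing to a limit measure: by compactness (Koenig's
  lemma) a cover of the limit set catches every word of a sufficiently late generation, and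
  Cauchy-Schwarz compares the normalised counting measure of that generation with the cover.\<close>
lemma hausdorff_limit_set_nonzero:
  assumes cl: "closed_from j S" and s: "0 < s" "s \<le> 1" and c: "c > 0" and K: "K > 0"
    and m: "\<And>n. m n > 0"
    and freq: "\<And>n. \<exists>k\<ge>n. c * m k \<le> real (card (generation S k)) \<and> tree_energy s j S k \<le> K * (m k)\<^sup>2"
  shows "hausdorff_torus s (limit_set S) \<noteq> 0"
proof
  assume "hausdorff_torus s (limit_set S) = 0"
  \<comment> \<open>The estimate below ends with \<open>21 h K (m N)^2\<close>. The 22 makes this a
    proper fraction of \<open>(c m N)^2\<close>, which is the contradiction.\<close>
  define h where "h = c\<^sup>2 / (22 * K)"
  have h: "h > 0" using c K by (simp add: h_def)
  obtain C where C: "C \<in> torus_covers (1 / 2 ^ Suc j) (limit_set S)" "(\<Sum>n. ennreal (tdiam (C n) powr s)) < ennreal h"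
    by (rule hausdorff_torus_eq_0D[of s "limit_set S" "1 / 2 ^ Suc j" h]) (use h \<open>hausdorff_torus s (limit_set S) = 0\<close> in simp_all)
  have cov: "limit_set S \<subseteq> (\<Union>n. C n)" "\<And>n. tdiam (C n) \<le> 1 / 2 ^ Suc j"
    using C(1) by (auto simp: torus_covers_def)
  have "\<exists>g\<ge>j. tdiam (C n) < 1 / 2 ^ g \<and> (1 / 2 ^ g) powr s \<le> 2 powr s * tdiam (C n) powr s + h * (1/2) ^ Suc n" for n
    by (rule dyadic_scale) (use tdiam_nonneg cov h s in auto)
  then obtain g where g: "\<And>n. g n \<ge> j" "\<And>n. tdiam (C n) < 1 / 2 ^ g n"
    "\<And>n. (1 / 2 ^ g n) powr s \<le> 2 powr s * tdiam (C n) powr s + h * (1/2) ^ Suc n" by metis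
  define V where "V n = {v. length v = g n \<and> (\<exists>y\<in>C n. \<exists>m. \<bar>y - xdot v - of_int m\<bar> \<le> 2 / 2 ^ g n)}" for n
  have V7: "card (V n) \<le> 7" for n unfolding V_def by (rule card_words_near[OF g(2)])
  have finV: "finite (V n)" for n
    by (rule finite_subset[OF _ finite_bounded_words[of "g n"]]) (auto simp: V_def)
  \<comment> \<open>\<open>T\<close> keeps the words of \<open>S\<close> that avoid the cover. A
    limit point of \<open>T\<close> would be one of \<open>S\<close>, hence lie in some
    \<open>C i\<close>, hence be near a word of \<open>T\<close> of length \<open>g i\<close>, which
    would belong to \<open>V i\<close>. So \<open>T\<close> has no limit point and is
    finite.\<close>
  define T where "T u \<longleftrightarrow> S u \<and> (\<forall>i. g i \<le> length u \<longrightarrow> take (g i) u \<notin> V i)" for u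
  have "finite {u. T u}"
  proof (rule ccontr)
    assume "infinite {u. T u}"
    then obtain x where x: "x \<in> limit_set T" by (rule limit_set_nonempty)
    have clT: "closed_from j T" using cl unfolding closed_from_def T_def by (auto simp: min_absorb1)
    have "x \<in> limit_set S" using x unfolding limit_set_def isolated_from_def T_def by blast
    then obtain i where i: "x \<in> C i" using cov(1) by blast
    have "\<not> isolated_from T x" using x by (simp add: limit_set_def)
    then obtain v m where v: "T v" "length v = g i" "\<bar>x - xdot v - of_int m\<bar> \<le> 2 / 2 ^ g i"
      using not_isolated_near[OF clT _ g(1)[of i], of x] by blast
    then have "v \<in> V i" using i by (auto simp: V_def)
    moreover have "take (g i) v \<notin> V i" using v by (auto simp: T_def)
    ultimately show False using v(2) by simp
  qed
  then obtain n0 where n0: "\<And>u. T u \<Longrightarrow> length u < n0"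
    using finite_nat_set_iff_bounded[of "length ` {u. T u}"] by auto
  obtain N where N: "N \<ge> n0" "c * m N \<le> real (card (generation S N))" "tree_energy s j S N \<le> K * (m N)\<^sup>2"
    using freq[of n0] by blast
  define W where "W = {v. length v \<le> N \<and> (\<exists>i. v \<in> V i)}"
  have finW: "finite W" by (rule finite_subset[OF _ finite_bounded_words[of N]]) (auto simp: W_def)
  let ?Z = "\<lambda>v. real (card (descendants S N v))"
  have findesc: "finite (descendants S N v)" for v
    unfolding descendants_def using finite_generation by simp
  have "generation S N \<subseteq> (\<Union>v\<in>W. descendants S N v)"
  proof
    fix u assume u: "u \<in> generation S N"
    then have "\<not> T u" using n0[of u] N(1) by auto
    then obtain i where i: "g i \<le> length u" "take (g i) u \<in> V i" using u by (auto simp: T_def)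
    then have "take (g i) u \<in> W" "u \<in> descendants S N (take (g i) u)"
      using u by (auto simp: W_def descendants_def)
    then show "u \<in> (\<Union>v\<in>W. descendants S N v)" by blast
  qed
  then have "card (generation S N) \<le> card (\<Union>v\<in>W. descendants S N v)"
    using finW findesc by (intro card_mono) auto
  also have "\<dots> \<le> (\<Sum>v\<in>W. card (descendants S N v))" using finW by (rule card_UN_le)
  finally have "real (card (generation S N)) \<le> (\<Sum>v\<in>W. ?Z v)" by (simp only: of_nat_sum[symmetric] of_nat_le_iff)
  with N(2) have "c * m N \<le> (\<Sum>v\<in>W. ?Z v)" by linarith
  \<comment> \<open>The weights \<open>2^(-s |v| / 2)\<close> and \<open>2^(s |v| / 2)\<close>
    prepare Cauchy-Schwarz: one factor becomes the size of the cover, the other a part of the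
    energy.\<close>
  also have "\<dots> = (\<Sum>v\<in>W. 2 powr (- (s * real (length v)) / 2) * (2 powr (s * real (length v) / 2) * ?Z v))"
  proof (rule sum.cong[OF refl])
    fix v :: "bool list"
    have "2 powr (- (s * real (length v)) / 2) * 2 powr (s * real (length v) / 2) = 1" by (simp add: powr_add[symmetric])
    then show "?Z v = 2 powr (- (s * real (length v)) / 2) * (2 powr (s * real (length v) / 2) * ?Z v)"
      by (simp only: mult.assoc[symmetric] mult_1_left)
  qed
  finally have "(c * m N)\<^sup>2 \<le> (\<Sum>v\<in>W. 2 powr (- (s * real (length v)) / 2) * (2 powr (s * real (length v) / 2) * ?Z v))\<^sup>2"
    using c m[of N] by (intro power_mono) auto
  also have "\<dots> \<le> (\<Sum>v\<in>W. (2 powr (- (s * real (length v)) / 2))\<^sup>2) * (\<Sum>v\<in>W. (2 powr (s * real (length v) / 2) * ?Z v)\<^sup>2)"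
    by (rule Cauchy_Schwarz_ineq_sum)
  also have "(\<Sum>v\<in>W. (2 powr (- (s * real (length v)) / 2))\<^sup>2) = (\<Sum>v\<in>W. (1 / 2 ^ length v) powr s)"
  proof (rule sum.cong[OF refl])
    fix v :: "bool list"
    have "(2 powr (- (s * real (length v)) / 2))\<^sup>2 = 2 powr (- (s * real (length v)))"
      by (simp add: power2_eq_square powr_add[symmetric])
    also have "\<dots> = (1 / 2 ^ length v) powr s"
      by (simp only: dyadic_powr)
    finally show "(2 powr (- (s * real (length v)) / 2))\<^sup>2 = (1 / 2 ^ length v) powr s" .
  qed
  also have "(\<Sum>v\<in>W. (2 powr (s * real (length v) / 2) * ?Z v)\<^sup>2) = (\<Sum>v\<in>W. 2 powr (s * real (length v)) * (?Z v)\<^sup>2)"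
  proof (rule sum.cong[OF refl])
    fix v :: "bool list"
    have "(2 powr (s * real (length v) / 2))\<^sup>2 = 2 powr (s * real (length v))"
      by (simp add: power2_eq_square powr_add[symmetric])
    then show "(2 powr (s * real (length v) / 2) * ?Z v)\<^sup>2 = 2 powr (s * real (length v)) * (?Z v)\<^sup>2"
      by (simp only: power_mult_distrib)
  qed
  also have "(\<Sum>v\<in>W. (1 / 2 ^ length v) powr s) * (\<Sum>v\<in>W. 2 powr (s * real (length v)) * (?Z v)\<^sup>2)
    \<le> (21 * h) * (K * (m N)\<^sup>2)"
  proof (rule mult_mono)
    have "(\<Sum>v\<in>W. 2 powr (s * real (length v)) * (?Z v)\<^sup>2) \<le> (\<Sum>v\<in>(\<Union>i\<in>{j..N}. {v. length v = i}). 2 powr (s * real (length v)) * (?Z v)\<^sup>2)"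
    proof (rule sum_mono2)
      show "W \<subseteq> (\<Union>i\<in>{j..N}. {v. length v = i})" using g(1) by (auto simp: W_def V_def)
      show "finite (\<Union>i\<in>{j..N}. {v :: bool list. length v = i})"
        by (rule finite_subset[OF _ finite_bounded_words[of N]]) auto
    qed auto
    also have "\<dots> = tree_energy s j S N"
      unfolding tree_energy_def
      by (subst sum.UNION_disjoint) (auto intro!: sum.cong finite_subset[OF _ finite_bounded_words])
    finally show "(\<Sum>v\<in>W. 2 powr (s * real (length v)) * (?Z v)\<^sup>2) \<le> K * (m N)\<^sup>2" using N(3) by linarith
    have "\<forall>v\<in>W. \<exists>i. v \<in> V i" by (simp add: W_def)
    from bchoice[OF this] obtain q where q: "\<forall>v\<in>W. v \<in> V (q v)" by blast
    let ?I = "q ` W"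
    have "(\<Sum>v\<in>W. (1 / 2 ^ length v) powr s) \<le> (\<Sum>v\<in>(\<Union>i\<in>?I. V i). (1 / 2 ^ length v) powr s)"
      using q finW finV by (intro sum_mono2) auto
    also have "\<dots> \<le> (\<Sum>i\<in>?I. \<Sum>v\<in>V i. (1 / 2 ^ length v) powr s)"
      using finW finV by (intro sum_UN_le) auto
    also have "\<dots> = (\<Sum>i\<in>?I. real (card (V i)) * (1 / 2 ^ g i) powr s)"
      by (intro sum.cong) (auto simp: V_def)
    also have "\<dots> \<le> (\<Sum>i\<in>?I. 7 * (2 * tdiam (C i) powr s + h * (1/2) ^ Suc i))"
    proof (intro sum_mono mult_mono)
      fix i
      have "2 powr s \<le> 2 powr 1" using s by (intro powr_mono) auto
      then have "2 powr s * tdiam (C i) powr s \<le> 2 * tdiam (C i) powr s" by (intro mult_right_mono) auto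
      then show "(1 / 2 ^ g i) powr s \<le> 2 * tdiam (C i) powr s + h * (1/2) ^ Suc i" using g(3)[of i] by linarith
      show "real (card (V i)) \<le> 7" using V7[of i] by simp
    qed auto
    \<comment> \<open>There are at most seven words per set. The cover contributes 14 because
      \<open>2 powr s \<le> 2\<close>, and the errors \<open>h (1/2)^(i+1)\<close> of the dyadic
      scales contribute 7.\<close>
    also have "\<dots> = 14 * (\<Sum>i\<in>?I. tdiam (C i) powr s) + 7 * h * (\<Sum>i\<in>?I. (1/2) ^ Suc i)"
      by (simp add: sum.distrib sum_distrib_left distrib_left mult.assoc)
    also have "\<dots> \<le> 14 * h + 7 * h * 1"
    proof (intro add_mono mult_left_mono)
      have "ennreal (\<Sum>i\<in>?I. tdiam (C i) powr s) = (\<Sum>i\<in>?I. ennreal (tdiam (C i) powr s))"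
        by (rule sum_ennreal[symmetric]) auto
      also have "\<dots> \<le> (\<Sum>n. ennreal (tdiam (C n) powr s))" using finW by (intro sum_le_suminf) auto
      finally have "ennreal (\<Sum>i\<in>?I. tdiam (C i) powr s) \<le> ennreal h" using C(2) by simp
      then show "(\<Sum>i\<in>?I. tdiam (C i) powr s) \<le> h" using h by (simp add: ennreal_le_iff)
      have "(\<Sum>i\<in>?I. (1/2::real) ^ Suc i) \<le> (\<Sum>i. (1/2) ^ Suc i)"
        using finW power_half_series sums_summable by (intro sum_le_suminf) auto
      also have "\<dots> = 1" using power_half_series sums_unique by metis
      finally show "(\<Sum>i\<in>?I. (1/2::real) ^ Suc i) \<le> 1" .
    qed (use h in auto)
    finally show "(\<Sum>v\<in>W. (1 / 2 ^ length v) powr s) \<le> 21 * h" by simp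
  qed (use h in \<open>auto intro!: sum_nonneg\<close>)
  also have "\<dots> = 21 / 22 * (c * m N)\<^sup>2"
    using K by (simp add: h_def power_mult_distrib)
  finally have "(c * m N)\<^sup>2 \<le> 0" by simp
  then show False using c m[of N] by simp
qed

section \<open>The Markov tree\<close>

text \<open>Words shorter than \<open>j\<close> satisfy this vacuously, so generation
  \<open>j\<close> consists of all ones of that length, whatever their ancestors are.\<close>

definition branch :: "nat \<Rightarrow> (bool list \<Rightarrow> bool) \<Rightarrow> bool list \<Rightarrow> bool" where
  "branch j S u \<longleftrightarrow> (\<forall>i. j \<le> i \<longrightarrow> i \<le> length u \<longrightarrow> S (take i u))"

definition nuE :: "(bool \<Rightarrow> nat \<Rightarrow> (bool \<times> bool) pmf) \<Rightarrow> bool \<Rightarrow> nat \<Rightarrow> (bool \<times> bool \<Rightarrow> real) \<Rightarrow> real" where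
  "nuE nu b n g = (\<Sum>a\<in>UNIV. pmf (nu b n) a * g a)"

locale markov_bool_tree = prob_space M for M :: "'a measure" +
  fixes X :: "bool list \<Rightarrow> 'a \<Rightarrow> bool" and nu :: "bool \<Rightarrow> nat \<Rightarrow> (bool \<times> bool) pmf"
  assumes X_meas: "\<And>u. X u \<in> measurable M (count_space UNIV)"
    and markov: "markov_tree M X nu"
begin

text \<open>The labels up to generation \<open>n\<close>, coded as a set of words. It takes finitely
  many values, so every real function of it is measurable, bounded and integrable.\<close>

definition conf :: "nat \<Rightarrow> 'a \<Rightarrow> bool list set" where
  "conf n \<omega> = {v. length v \<le> n \<and> X v \<omega>}"

definition children :: "'a \<Rightarrow> bool list \<Rightarrow> bool \<times> bool" where
  "children \<omega> u = (X (u @ [False]) \<omega>, X (u @ [True]) \<omega>)"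

lemma conf_measurable_gen:
  assumes "\<And>v. length v \<le> n \<Longrightarrow> X v \<in> measurable N (count_space UNIV)"
  shows "conf n \<in> measurable N (count_space (Pow {v. length v \<le> n}))"
proof (subst measurable_count_space_eq2)
  show "finite (Pow {v :: bool list. length v \<le> n})" using finite_bounded_words by simp
  have "conf n -` {C} \<inter> space N \<in> sets N" if C: "C \<subseteq> {v. length v \<le> n}" for C
  proof -
    have "conf n \<omega> = C \<longleftrightarrow> (\<forall>v\<in>{v. length v \<le> n}. X v \<omega> = (v \<in> C))" for \<omega>
      using C unfolding conf_def set_eq_iff by blast
    then have "conf n -` {C} \<inter> space N = {\<omega> \<in> space N. \<forall>v\<in>{v. length v \<le> n}. X v \<omega> = (v \<in> C)}"
      by blast
    also have "\<dots> \<in> sets N"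
    proof (rule sets.sets_Collect_finite_All'[OF _ finite_bounded_words])
      fix v :: "bool list" assume "v \<in> {v. length v \<le> n}"
      then have "X v -` {v \<in> C} \<inter> space N \<in> sets N" using assms by (intro measurable_sets) auto
      then show "{\<omega> \<in> space N. X v \<omega> = (v \<in> C)} \<in> sets N" by (simp add: vimage_def Int_def conj_commute)
    qed (auto intro!: exI[of _ "[]"])
    finally show ?thesis .
  qed
  then show "conf n \<in> space N \<rightarrow> Pow {v. length v \<le> n} \<and> (\<forall>C\<in>Pow {v. length v \<le> n}. conf n -` {C} \<inter> space N \<in> sets N)"
    by (auto simp: conf_def)
qed

lemma conf_measurable: "conf n \<in> measurable M (count_space (Pow {v. length v \<le> n}))"
  by (rule conf_measurable_gen) (rule X_meas)

lemma conf_fun_measurable [measurable]: "(\<lambda>\<omega>. \<phi> (conf n \<omega>)) \<in> borel_measurable M" for \<phi> :: "bool list set \<Rightarrow> real"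
  by (rule measurable_compose[OF conf_measurable]) simp

lemma conf_pred: "{\<omega> \<in> space M. P (conf n \<omega>)} \<in> sets M"
proof -
  have "conf n -` {C \<in> Pow {v. length v \<le> n}. P C} \<inter> space M \<in> sets M"
    by (rule measurable_sets[OF conf_measurable]) auto
  moreover have "conf n -` {C \<in> Pow {v. length v \<le> n}. P C} \<inter> space M = {\<omega> \<in> space M. P (conf n \<omega>)}"
    by (auto simp: conf_def)
  ultimately show ?thesis by simp
qed

lemma conf_range: "conf n \<omega> \<in> Pow {v. length v \<le> n}"
  by (auto simp: conf_def)

lemma conf_fun_bounded:
  fixes \<phi> :: "bool list set \<Rightarrow> real"
  shows "\<exists>B. \<forall>\<omega>. \<bar>\<phi> (conf n \<omega>)\<bar> \<le> B"
proof -
  have fin: "finite (Pow {v :: bool list. length v \<le> n})" using finite_bounded_words by simp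
  have "\<bar>\<phi> (conf n \<omega>)\<bar> \<le> (\<Sum>C\<in>Pow {v. length v \<le> n}. \<bar>\<phi> C\<bar>)" for \<omega>
    by (rule member_le_sum[OF conf_range _ fin]) simp
  then show ?thesis by blast
qed

lemma conf_fun_integrable [simp]: "integrable M (\<lambda>\<omega>. \<phi> (conf n \<omega>))" for \<phi> :: "bool list set \<Rightarrow> real"
proof -
  obtain B where "\<forall>\<omega>. \<bar>\<phi> (conf n \<omega>)\<bar> \<le> B" using conf_fun_bounded[of \<phi> n] by blast
  then show ?thesis by (intro integrable_const_bound[of _ B]) auto
qed

lemma conf_restrict: "k \<le> n \<Longrightarrow> conf k \<omega> = {v \<in> conf n \<omega>. length v \<le> k}"
  by (auto simp: conf_def)

lemma X_conf: "length u \<le> n \<Longrightarrow> X u \<omega> \<longleftrightarrow> u \<in> conf n \<omega>"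
  by (simp add: conf_def)

lemma children_conf: "length u < n \<Longrightarrow> children \<omega> u = (u @ [False] \<in> conf n \<omega>, u @ [True] \<in> conf n \<omega>)"
  by (simp add: children_def X_conf)

lemma space_Gsig: "space (Gsig M X u) = space M"
  by (simp add: Gsig_def space_measure_of_conv)

lemma X_Gsig_measurable:
  assumes "\<not> (\<exists>w. w \<noteq> [] \<and> v = u @ w)"
  shows "X v \<in> measurable (Gsig M X u) (count_space UNIV)"
proof (subst measurable_count_space_eq2)
  let ?A = "{X v -` {b} \<inter> space M | v b. \<not> (\<exists>w. w \<noteq> [] \<and> v = u @ w)}"
  have "?A \<subseteq> Pow (space M)" by auto
  then have "sets (Gsig M X u) = sigma_sets (space M) ?A" by (simp add: Gsig_def)
  moreover have "X v -` {b} \<inter> space M \<in> ?A" for b using assms by blast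
  ultimately have "X v -` {b} \<inter> space M \<in> sets (Gsig M X u)" for b by (simp add: sigma_sets.Basic)
  then show "X v \<in> space (Gsig M X u) \<rightarrow> UNIV \<and> (\<forall>a\<in>UNIV. X v -` {a} \<inter> space (Gsig M X u) \<in> sets (Gsig M X u))"
    by (simp add: space_Gsig)
qed simp

lemma subalgebra_Gsig: "subalgebra M (Gsig M X u)"
proof -
  let ?A = "{X v -` {b} \<inter> space M | v b. \<not> (\<exists>w. w \<noteq> [] \<and> v = u @ w)}"
  have "?A \<subseteq> sets M" using X_meas by (auto intro!: measurable_sets)
  moreover have "?A \<subseteq> Pow (space M)" by auto
  ultimately have "sets (Gsig M X u) \<subseteq> sets M"
    by (simp add: Gsig_def sets.sigma_sets_subset)
  then show ?thesis by (simp add: subalgebra_def space_Gsig)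
qed

lemma X_meas' [measurable]: "X u \<in> measurable M (count_space UNIV)" by (rule X_meas)

lemma children_measurable [measurable]: "(\<lambda>\<omega>. children \<omega> u) \<in> measurable M (count_space UNIV)"
  unfolding children_def by measurable

text \<open>All factors other than the indicator are measurable with respect to
  \<open>Gsig M X u\<close>: neither a word of length at most \<open>n\<close> nor a child of
  another word of length \<open>n\<close> lies strictly below \<open>u\<close>. The Markov condition
  at \<open>u\<close> thus applies with the children of \<open>A\<close> already revealed, which
  yields the independence of families of the same generation.\<close>

lemma conditional_step_indicator:
  assumes u: "length u = n" and A: "A \<subseteq> {v. length v = n}" "finite A" "u \<notin> A"
  shows "expectation (\<lambda>\<omega>. (\<phi> (conf n \<omega>) * (\<Prod>v\<in>A. g v (children \<omega> v))) * indicator B (children \<omega> u))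
    = expectation (\<lambda>\<omega>. (\<phi> (conf n \<omega>) * (\<Prod>v\<in>A. g v (children \<omega> v))) * measure_pmf.prob (nu (X u \<omega>) n) B)"
    (is "expectation (\<lambda>\<omega>. ?Y \<omega> * ?I \<omega>) = expectation (\<lambda>\<omega>. ?Y \<omega> * ?P \<omega>)")
proof -
  let ?G = "Gsig M X u"
  interpret G: sigma_finite_subalgebra M ?G
  proof (rule finite_measure_subalgebra_is_sigma_finite)
    show "finite_measure_subalgebra M ?G"
      using subalgebra_Gsig by unfold_locales
  qed
  have notbelow: "\<not> (\<exists>w. w \<noteq> [] \<and> v = u @ w)" if "length v \<le> n" for v using that u by auto
  have below2: "\<not> (\<exists>w. w \<noteq> [] \<and> v @ [b] = u @ w)" if "v \<in> A" for v b
  proof (intro notI, elim exE conjE)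
    fix w assume w: "w \<noteq> []" "v @ [b] = u @ w"
    then have "length w = 1" using u A(1) that by (auto dest!: arg_cong[of _ _ length])
    then have "u = v" using w by (cases w) auto
    with A(3) that show False by simp
  qed
  have m1: "(\<lambda>\<omega>. \<phi> (conf n \<omega>)) \<in> borel_measurable ?G"
    by (rule measurable_compose[OF conf_measurable_gen]) (auto intro!: X_Gsig_measurable notbelow)
  have m2: "(\<lambda>\<omega>. g v (children \<omega> v)) \<in> borel_measurable ?G" if "v \<in> A" for v
  proof -
    have "(\<lambda>\<omega>. children \<omega> v) \<in> measurable ?G (count_space UNIV)"
      unfolding children_def using X_Gsig_measurable[OF below2[OF that, of False]] X_Gsig_measurable[OF below2[OF that, of True]]
      by measurable
    then show ?thesis by (rule measurable_compose) simp
  qed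
  have YG: "?Y \<in> borel_measurable ?G"
    by (intro borel_measurable_times[OF m1] borel_measurable_prod m2)
  have YM: "?Y \<in> borel_measurable M"
    using YG subalgebra_Gsig by (rule measurable_from_subalg[rotated])
  have IM: "?I \<in> borel_measurable M" by (rule measurable_compose[OF children_measurable]) simp
  define \<xi> where "\<xi> C = \<phi> {v \<in> C. length v \<le> n} * (\<Prod>v\<in>A. g v (v @ [False] \<in> C, v @ [True] \<in> C))" for C
  have Yeq: "?Y \<omega> = \<xi> (conf (Suc n) \<omega>)" for \<omega>
  proof -
    have "(\<Prod>v\<in>A. g v (children \<omega> v)) = (\<Prod>v\<in>A. g v (v @ [False] \<in> conf (Suc n) \<omega>, v @ [True] \<in> conf (Suc n) \<omega>))"
      using A(1) by (intro prod.cong refl) (auto simp: children_conf[of _ "Suc n"])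
    then show ?thesis by (simp add: \<xi>_def conf_restrict[of n "Suc n"])
  qed
  obtain B0 where B0: "\<forall>\<omega>. \<bar>\<xi> (conf (Suc n) \<omega>)\<bar> \<le> B0" using conf_fun_bounded[of \<xi> "Suc n"] by blast
  have YB: "\<bar>?Y \<omega>\<bar> \<le> B0" for \<omega> unfolding Yeq using B0 by blast
  have int: "integrable M (\<lambda>\<omega>. ?Y \<omega> * ?I \<omega>)"
  proof (rule integrable_const_bound[of _ B0])
    show "AE \<omega> in M. norm (?Y \<omega> * ?I \<omega>) \<le> B0"
    proof (rule AE_I2)
      fix \<omega>
      have "norm (?Y \<omega> * ?I \<omega>) \<le> \<bar>?Y \<omega>\<bar>" by (simp add: abs_mult split: split_indicator)
      with YB[of \<omega>] show "norm (?Y \<omega> * ?I \<omega>) \<le> B0" by linarith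
    qed
  qed (intro borel_measurable_times YM IM)
  have "expectation (\<lambda>\<omega>. ?Y \<omega> * ?I \<omega>) = expectation (\<lambda>\<omega>. ?Y \<omega> * real_cond_exp M ?G ?I \<omega>)"
    by (rule G.real_cond_exp_intg(2)[OF int YG IM, symmetric])
  also have "\<dots> = expectation (\<lambda>\<omega>. ?Y \<omega> * ?P \<omega>)"
  proof (rule integral_cong_AE)
    have "(\<lambda>\<omega>. measure_pmf.prob (nu (X u \<omega>) n) B) \<in> borel_measurable M"
      by (rule measurable_compose[OF X_meas]) simp
    then show "(\<lambda>\<omega>. ?Y \<omega> * ?P \<omega>) \<in> borel_measurable M" by (intro borel_measurable_times YM)
    show "(\<lambda>\<omega>. ?Y \<omega> * real_cond_exp M ?G ?I \<omega>) \<in> borel_measurable M"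
      by (intro borel_measurable_times YM borel_measurable_cond_exp2)
    have "AE \<omega> in M. real_cond_exp M ?G ?I \<omega> = ?P \<omega>"
      using markov u unfolding markov_tree_def children_def by blast
    then show "AE \<omega> in M. ?Y \<omega> * real_cond_exp M ?G ?I \<omega> = ?Y \<omega> * ?P \<omega>" by eventually_elim simp
  qed
  finally show ?thesis .
qed

lemma child_fun_integrable:
  assumes "A \<subseteq> {v. length v = n}"
  shows "integrable M (\<lambda>\<omega>. \<phi> (conf n \<omega>) * (\<Prod>v\<in>A. g v (children \<omega> v)) :: real)"
proof -
  define \<xi> where "\<xi> C = \<phi> {v \<in> C. length v \<le> n} * (\<Prod>v\<in>A. g v (v @ [False] \<in> C, v @ [True] \<in> C))" for C
  have "\<phi> (conf n \<omega>) * (\<Prod>v\<in>A. g v (children \<omega> v)) = \<xi> (conf (Suc n) \<omega>)" for \<omega>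
  proof -
    have "(\<Prod>v\<in>A. g v (children \<omega> v)) = (\<Prod>v\<in>A. g v (v @ [False] \<in> conf (Suc n) \<omega>, v @ [True] \<in> conf (Suc n) \<omega>))"
      using assms by (intro prod.cong refl) (auto simp: children_conf[of _ "Suc n"])
    then show ?thesis by (simp add: \<xi>_def conf_restrict[of n "Suc n"])
  qed
  then show ?thesis by (simp only: conf_fun_integrable)
qed

lemma conditional_step:
  assumes u: "length u = n" and A: "A \<subseteq> {v. length v = n}" "finite A" "u \<notin> A"
  shows "expectation (\<lambda>\<omega>. \<phi> (conf n \<omega>) * (\<Prod>v\<in>A. g v (children \<omega> v)) * f (children \<omega> u))
    = expectation (\<lambda>\<omega>. \<phi> (conf n \<omega>) * (\<Prod>v\<in>A. g v (children \<omega> v)) * nuE nu (X u \<omega>) n f)"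
proof -
  let ?Y = "\<lambda>\<omega>. \<phi> (conf n \<omega>) * (\<Prod>v\<in>A. g v (children \<omega> v))"
  have i1: "integrable M (\<lambda>\<omega>. ?Y \<omega> * h (children \<omega> u))" for h :: "bool \<times> bool \<Rightarrow> real"
  proof -
    have "(\<lambda>\<omega>. ?Y \<omega> * h (children \<omega> u)) = (\<lambda>\<omega>. \<phi> (conf n \<omega>) * (\<Prod>v\<in>insert u A. (g(u := h)) v (children \<omega> v)))"
    proof
      fix \<omega>
      have "(\<Prod>v\<in>A. (g(u := h)) v (children \<omega> v)) = (\<Prod>v\<in>A. g v (children \<omega> v))"
        using A(3) by (intro prod.cong) auto
      then show "?Y \<omega> * h (children \<omega> u) = \<phi> (conf n \<omega>) * (\<Prod>v\<in>insert u A. (g(u := h)) v (children \<omega> v))"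
        using A by simp
    qed
    moreover have "integrable M (\<lambda>\<omega>. \<phi> (conf n \<omega>) * (\<Prod>v\<in>insert u A. (g(u := h)) v (children \<omega> v)))"
      by (rule child_fun_integrable) (use u A in auto)
    ultimately show ?thesis by (simp only:)
  qed
  have i2: "integrable M (\<lambda>\<omega>. ?Y \<omega> * pmf (nu (X u \<omega>) n) a)" for a
  proof -
    have "(\<lambda>\<omega>. ?Y \<omega> * pmf (nu (X u \<omega>) n) a) = (\<lambda>\<omega>. (\<lambda>C. \<phi> C * pmf (nu (u \<in> C) n) a) (conf n \<omega>) * (\<Prod>v\<in>A. g v (children \<omega> v)))"
      using u by (simp add: X_conf[of u n] mult_ac)
    moreover have "integrable M (\<lambda>\<omega>. (\<lambda>C. \<phi> C * pmf (nu (u \<in> C) n) a) (conf n \<omega>) * (\<Prod>v\<in>A. g v (children \<omega> v)))"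
      by (rule child_fun_integrable[where \<phi> = "\<lambda>C. \<phi> C * pmf (nu (u \<in> C) n) a"]) (use A in auto)
    ultimately show ?thesis by (simp only:)
  qed
  have f: "f p = (\<Sum>a\<in>UNIV. f a * indicator {a} p)" for p
    by (subst sum.remove[of _ p]) (auto intro!: sum.neutral)
  have "expectation (\<lambda>\<omega>. ?Y \<omega> * f (children \<omega> u)) = expectation (\<lambda>\<omega>. \<Sum>a\<in>UNIV. f a * (?Y \<omega> * indicator {a} (children \<omega> u)))"
  proof (rule Bochner_Integration.integral_cong[OF refl])
    fix \<omega>
    have "?Y \<omega> * f (children \<omega> u) = ?Y \<omega> * (\<Sum>a\<in>UNIV. f a * indicator {a} (children \<omega> u))"
      by (rule arg_cong[OF f])
    also have "\<dots> = (\<Sum>a\<in>UNIV. f a * (?Y \<omega> * indicator {a} (children \<omega> u)))"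
      unfolding sum_distrib_left by (intro sum.cong refl) (simp only: mult_ac)
    finally show "?Y \<omega> * f (children \<omega> u) = (\<Sum>a\<in>UNIV. f a * (?Y \<omega> * indicator {a} (children \<omega> u)))" .
  qed
  also have "\<dots> = (\<Sum>a\<in>UNIV. f a * expectation (\<lambda>\<omega>. ?Y \<omega> * indicator {a} (children \<omega> u)))"
    by (subst Bochner_Integration.integral_sum) (use i1 in auto)
  also have "\<dots> = (\<Sum>a\<in>UNIV. f a * expectation (\<lambda>\<omega>. ?Y \<omega> * pmf (nu (X u \<omega>) n) a))"
    by (simp only: conditional_step_indicator[OF assms] measure_pmf_single)
  also have "\<dots> = expectation (\<lambda>\<omega>. \<Sum>a\<in>UNIV. f a * (?Y \<omega> * pmf (nu (X u \<omega>) n) a))"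
    by (subst Bochner_Integration.integral_sum) (use i2 in auto)
  also have "\<dots> = expectation (\<lambda>\<omega>. ?Y \<omega> * nuE nu (X u \<omega>) n f)"
    unfolding nuE_def by (simp add: sum_distrib_left mult_ac)
  finally show ?thesis .
qed

text \<open>The words of \<open>A\<close> are integrated out one at a time. Each new factor depends
  on the first \<open>n\<close> generations only and moves into \<open>\<phi>\<close>, which is
  therefore arbitrary in the induction.\<close>

lemma generation_step:
  assumes "A \<subseteq> {v. length v = n}" "finite A"
  shows "expectation (\<lambda>\<omega>. \<phi> (conf n \<omega>) * (\<Prod>v\<in>A. g v (children \<omega> v)))
    = expectation (\<lambda>\<omega>. \<phi> (conf n \<omega>) * (\<Prod>v\<in>A. nuE nu (X v \<omega>) n (g v)))"
  using assms(2,1)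
proof (induction A arbitrary: \<phi> rule: finite_induct)
  case (insert u A)
  have u: "length u = n" using insert.prems by simp
  have A: "A \<subseteq> {v. length v = n}" using insert.prems by simp
  have "expectation (\<lambda>\<omega>. \<phi> (conf n \<omega>) * (\<Prod>v\<in>insert u A. g v (children \<omega> v)))
    = expectation (\<lambda>\<omega>. \<phi> (conf n \<omega>) * (\<Prod>v\<in>A. g v (children \<omega> v)) * g u (children \<omega> u))"
    using insert.hyps by (simp add: mult_ac)
  also have "\<dots> = expectation (\<lambda>\<omega>. \<phi> (conf n \<omega>) * (\<Prod>v\<in>A. g v (children \<omega> v)) * nuE nu (X u \<omega>) n (g u))"
    by (rule conditional_step[OF u A insert(1,2)])
  also have "\<dots> = expectation (\<lambda>\<omega>. (\<lambda>C. \<phi> C * nuE nu (u \<in> C) n (g u)) (conf n \<omega>) * (\<Prod>v\<in>A. g v (children \<omega> v)))"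
    using u by (simp add: X_conf[of u n] mult_ac)
  also have "\<dots> = expectation (\<lambda>\<omega>. (\<lambda>C. \<phi> C * nuE nu (u \<in> C) n (g u)) (conf n \<omega>) * (\<Prod>v\<in>A. nuE nu (X v \<omega>) n (g v)))"
    by (rule insert.IH[OF A, of "\<lambda>C. \<phi> C * nuE nu (u \<in> C) n (g u)"])
  also have "\<dots> = expectation (\<lambda>\<omega>. \<phi> (conf n \<omega>) * (\<Prod>v\<in>insert u A. nuE nu (X v \<omega>) n (g v)))"
    using u insert.hyps by (simp add: X_conf[of u n] mult_ac)
  finally show ?case .
qed simp

end

section \<open>Moments of the generation sizes\<close>

definition kids :: "bool \<times> bool \<Rightarrow> nat" where
  "kids p = of_bool (fst p) + of_bool (snd p)"

definition mean_prod :: "(bool \<Rightarrow> nat \<Rightarrow> (bool \<times> bool) pmf) \<Rightarrow> nat \<Rightarrow> nat \<Rightarrow> real" where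
  "mean_prod nu n k = (\<Prod>l\<in>{n..<k}. gam nu l)"

definition split_prob :: "(bool \<Rightarrow> nat \<Rightarrow> (bool \<times> bool) pmf) \<Rightarrow> nat \<Rightarrow> real" where
  "split_prob nu n = pmf (nu True n) (True, True)"

text \<open>The partial sums of \<open>varsigma\<close>.\<close>
definition vs_sum :: "(bool \<Rightarrow> nat \<Rightarrow> (bool \<times> bool) pmf) \<Rightarrow> nat \<Rightarrow> nat \<Rightarrow> real" where
  "vs_sum nu n k = (\<Sum>l\<in>{n..<k}. 2 * split_prob nu l / (gam nu l * mean_prod nu n (Suc l)))"

lemma sum_bool_pairs: "(\<Sum>a\<in>UNIV. f a) = f (False, False) + f (False, True) + f (True, False) + f (True, True)"
  for f :: "bool \<times> bool \<Rightarrow> real"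
proof -
  have *: "(UNIV :: (bool \<times> bool) set) = {(False, False), (False, True), (True, False), (True, True)}" by auto
  show ?thesis by (subst *) (simp add: add.assoc)
qed

lemma pmf_bool_pairs: "pmf p (False, False) + pmf p (False, True) + pmf p (True, False) + pmf p (True, True) = 1"
  using sum_pmf_eq_1[of UNIV p] sum_bool_pairs[of "pmf p"] by simp

lemma gam_pmf: "gam nu n = 2 * pmf (nu True n) (True, True) + pmf (nu True n) (True, False) + pmf (nu True n) (False, True)"
proof -
  have "measure_pmf.prob (nu True n) {(True, False), (False, True)} = pmf (nu True n) (True, False) + pmf (nu True n) (False, True)"
    by (subst measure_measure_pmf_finite) auto
  then show ?thesis by (simp add: gam_def measure_pmf_single)
qed

lemma nuE_kids: "nuE nu True n (\<lambda>p. real (kids p)) = gam nu n"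
  unfolding nuE_def sum_bool_pairs gam_pmf by (simp add: kids_def)

lemma nuE_kids_factorial: "nuE nu True n (\<lambda>p. real (kids p) * (real (kids p) - 1)) = 2 * split_prob nu n"
  unfolding nuE_def sum_bool_pairs split_prob_def by (simp add: kids_def)

text \<open>The offspring generating function at \<open>1 - t\<close>. With \<open>t\<close> a
  survival probability it is the recursion for survival, quadratic since there are at most two
  children.\<close>

lemma nuE_kids_power: "nuE nu True n (\<lambda>p. (1 - t) ^ kids p) = 1 - (gam nu n * t - split_prob nu n * t\<^sup>2)"
proof -
  have "pmf (nu True n) (False, False) = 1 - pmf (nu True n) (False, True) - pmf (nu True n) (True, False) - pmf (nu True n) (True, True)"
    using pmf_bool_pairs[of "nu True n"] by linarith
  then show ?thesis
    unfolding nuE_def sum_bool_pairs split_prob_def gam_pmf by (simp add: kids_def power2_eq_square algebra_simps)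
qed

lemma split_prob_nonneg: "0 \<le> split_prob nu n" by (simp add: split_prob_def)

lemma two_split_prob_le: "2 * split_prob nu n \<le> gam nu n"
  by (simp add: split_prob_def gam_pmf)

lemma gam_nonneg: "0 \<le> gam nu n"
  by (simp add: gam_pmf)

lemma mean_prod_Suc: "n \<le> k \<Longrightarrow> mean_prod nu n (Suc k) = mean_prod nu n k * gam nu k"
  by (simp add: mean_prod_def)

lemma mean_prod_mult: "n \<le> k \<Longrightarrow> k \<le> l \<Longrightarrow> mean_prod nu n k * mean_prod nu k l = mean_prod nu n l"
  unfolding mean_prod_def by (rule prod.atLeastLessThan_concat)

lemma mean_prod_self [simp]: "mean_prod nu n n = 1"
  by (simp add: mean_prod_def)

lemma branch_cong:
  assumes "\<And>w. length w \<le> length u \<Longrightarrow> S w = S' w"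
  shows "branch j S u = branch j S' u"
  using assms unfolding branch_def by (metis length_take min.cobounded1)

lemma branch_snoc: "branch j S (u @ [b]) \<longleftrightarrow> branch j S u \<and> (j \<le> Suc (length u) \<longrightarrow> S (u @ [b]))"
proof -
  have "(\<forall>i. j \<le> i \<longrightarrow> i \<le> Suc (length u) \<longrightarrow> S (take i (u @ [b]))) \<longleftrightarrow>
    (\<forall>i. j \<le> i \<longrightarrow> i \<le> length u \<longrightarrow> S (take i (u @ [b]))) \<and> (j \<le> Suc (length u) \<longrightarrow> S (take (Suc (length u)) (u @ [b])))"
    using le_Suc_eq by auto
  then show ?thesis unfolding branch_def by simp
qed

lemma branch_self: "branch j S u \<Longrightarrow> j \<le> length u \<Longrightarrow> S u"
  unfolding branch_def by (metis order_refl take_all)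

lemma finite_descendants: "finite (descendants S n v)"
  unfolding descendants_def using finite_generation by simp

lemma descendants_Suc:
  assumes "j \<le> n" "length v \<le> n"
  shows "descendants (branch j S) (Suc n) v = (\<lambda>(u, b). u @ [b]) ` (SIGMA u:descendants (branch j S) n v. {b. S (u @ [b])})"
proof (intro equalityI subsetI)
  fix w assume w: "w \<in> descendants (branch j S) (Suc n) v"
  then obtain u b where ub: "w = u @ [b]" "length u = n"
    unfolding descendants_def by (auto simp: length_Suc_conv_rev)
  then have "u \<in> descendants (branch j S) n v" "S (u @ [b])"
    using w assms unfolding descendants_def by (auto simp: branch_snoc)
  then show "w \<in> (\<lambda>(u, b). u @ [b]) ` (SIGMA u:descendants (branch j S) n v. {b. S (u @ [b])})"
    using ub by (intro image_eqI[of _ _ "(u, b)"]) auto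
next
  fix w assume "w \<in> (\<lambda>(u, b). u @ [b]) ` (SIGMA u:descendants (branch j S) n v. {b. S (u @ [b])})"
  then obtain u b where "w = u @ [b]" "u \<in> descendants (branch j S) n v" "S (u @ [b])" by auto
  then show "w \<in> descendants (branch j S) (Suc n) v"
    using assms unfolding descendants_def by (auto simp: branch_snoc)
qed

context markov_bool_tree
begin

abbreviation desc :: "nat \<Rightarrow> bool list \<Rightarrow> nat \<Rightarrow> 'a \<Rightarrow> bool list set" where
  "desc j v n \<omega> \<equiv> descendants (branch j (\<lambda>u. X u \<omega>)) n v"

text \<open>The descendants read off from a configuration, so that results on functions of
  \<open>conf\<close> apply to them.\<close>

definition desc_conf :: "nat \<Rightarrow> bool list \<Rightarrow> nat \<Rightarrow> bool list set \<Rightarrow> bool list set" where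
  "desc_conf j v n C = descendants (branch j (\<lambda>u. u \<in> C)) n v"

definition Z :: "nat \<Rightarrow> bool list \<Rightarrow> nat \<Rightarrow> 'a \<Rightarrow> nat" where
  "Z j v n \<omega> = card (desc j v n \<omega>)"

lemma desc_eq_conf:
  assumes "n \<le> k"
  shows "desc j v n \<omega> = desc_conf j v n (conf k \<omega>)"
proof -
  have "branch j (\<lambda>u. X u \<omega>) u = branch j (\<lambda>u. u \<in> conf k \<omega>) u" if "length u = n" for u
    by (rule branch_cong) (use that assms in \<open>auto simp: conf_def\<close>)
  then show ?thesis unfolding desc_conf_def descendants_def by blast
qed

lemma Z_eq_conf: "n \<le> k \<Longrightarrow> Z j v n \<omega> = card (desc_conf j v n (conf k \<omega>))"
  unfolding Z_def using desc_eq_conf by simp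

lemma desc_X: "u \<in> desc j v n \<omega> \<Longrightarrow> j \<le> n \<Longrightarrow> X u \<omega>"
  unfolding descendants_def using branch_self[of j "\<lambda>u. X u \<omega>" u] by simp

lemma Z_Suc:
  assumes "j \<le> n" "length v \<le> n"
  shows "Z j v (Suc n) \<omega> = (\<Sum>u\<in>desc j v n \<omega>. kids (children \<omega> u))"
proof -
  have inj: "inj_on (\<lambda>(u, b). u @ [b]) A" for A :: "(bool list \<times> bool) set" by (rule inj_onI) auto
  have "card {b. X (u @ [b]) \<omega>} = kids (children \<omega> u)" for u
  proof -
    have "{b. X (u @ [b]) \<omega>} = (if X (u @ [False]) \<omega> then {False} else {}) \<union> (if X (u @ [True]) \<omega> then {True} else {})"
    proof (intro set_eqI)
      fix b show "b \<in> {b. X (u @ [b]) \<omega>} \<longleftrightarrow> b \<in> (if X (u @ [False]) \<omega> then {False} else {}) \<union> (if X (u @ [True]) \<omega> then {True} else {})"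
        by (cases b) auto
    qed
    then show ?thesis by (simp add: kids_def children_def)
  qed
  then show ?thesis
    unfolding Z_def descendants_Suc[OF assms] by (simp add: card_image[OF inj] card_SigmaI finite_descendants)
qed

text \<open>The random index set is replaced by all words of length \<open>n\<close>, with
  membership absorbed into \<open>\<phi>\<close>. As \<open>j \<le> n\<close>, a descendant carries
  a one, so the law of its children is \<open>nu True n\<close>.\<close>

lemma expectation_sum_desc:
  assumes "j \<le> n"
  shows "expectation (\<lambda>\<omega>. \<phi> (conf n \<omega>) * (\<Sum>u\<in>desc j v n \<omega>. h (children \<omega> u)))
    = nuE nu True n h * expectation (\<lambda>\<omega>. \<phi> (conf n \<omega>) * real (Z j v n \<omega>))"
proof -
  let ?W = "{u :: bool list. length u = n}"
  have finW: "finite ?W" by (rule finite_subset[OF _ finite_bounded_words[of n]]) auto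
  let ?\<phi> = "\<lambda>u C. \<phi> C * of_bool (u \<in> desc_conf j v n C)"
  have sub: "desc j v n \<omega> \<subseteq> ?W" for \<omega> unfolding descendants_def by auto
  have sum_eq: "(\<Sum>u\<in>desc j v n \<omega>. f u) = (\<Sum>u\<in>?W. of_bool (u \<in> desc_conf j v n (conf n \<omega>)) * f u)" for f :: "_ \<Rightarrow> real" and \<omega>
  proof -
    have "(\<Sum>u\<in>?W. of_bool (u \<in> desc_conf j v n (conf n \<omega>)) * f u) = (\<Sum>u\<in>desc j v n \<omega>. of_bool (u \<in> desc_conf j v n (conf n \<omega>)) * f u)"
      using sub finW by (intro sum.mono_neutral_right) (auto simp: desc_eq_conf[of n n])
    then show ?thesis by (simp add: desc_eq_conf[of n n])
  qed
  have i: "integrable M (\<lambda>\<omega>. ?\<phi> u (conf n \<omega>) * h (children \<omega> u))" if "u \<in> ?W" for u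
    using child_fun_integrable[of "{u}" n "?\<phi> u" "\<lambda>_. h"] that by simp
  have "expectation (\<lambda>\<omega>. \<phi> (conf n \<omega>) * (\<Sum>u\<in>desc j v n \<omega>. h (children \<omega> u)))
     = expectation (\<lambda>\<omega>. \<Sum>u\<in>?W. ?\<phi> u (conf n \<omega>) * h (children \<omega> u))"
    unfolding sum_eq by (simp only: sum_distrib_left mult.assoc)
  also have "\<dots> = (\<Sum>u\<in>?W. expectation (\<lambda>\<omega>. ?\<phi> u (conf n \<omega>) * h (children \<omega> u)))"
    by (rule Bochner_Integration.integral_sum) (rule i)
  also have "\<dots> = (\<Sum>u\<in>?W. expectation (\<lambda>\<omega>. ?\<phi> u (conf n \<omega>) * nuE nu True n h))"
  proof (rule sum.cong[OF refl])
    fix u assume u: "u \<in> ?W"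
    have "expectation (\<lambda>\<omega>. ?\<phi> u (conf n \<omega>) * h (children \<omega> u)) = expectation (\<lambda>\<omega>. ?\<phi> u (conf n \<omega>) * nuE nu (X u \<omega>) n h)"
      using generation_step[of "{u}" n "?\<phi> u" "\<lambda>_. h"] u by simp
    also have "\<dots> = expectation (\<lambda>\<omega>. ?\<phi> u (conf n \<omega>) * nuE nu True n h)"
    proof (rule Bochner_Integration.integral_cong[OF refl])
      fix \<omega>
      show "?\<phi> u (conf n \<omega>) * nuE nu (X u \<omega>) n h = ?\<phi> u (conf n \<omega>) * nuE nu True n h"
        using desc_X[where u = u and j = j and v = v and n = n and \<omega> = \<omega>] assms by (cases "u \<in> desc j v n \<omega>") (simp_all add: desc_eq_conf[of n n])
    qed
    finally show "expectation (\<lambda>\<omega>. ?\<phi> u (conf n \<omega>) * h (children \<omega> u)) = expectation (\<lambda>\<omega>. ?\<phi> u (conf n \<omega>) * nuE nu True n h)" .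
  qed
  also have "\<dots> = (\<Sum>u\<in>?W. nuE nu True n h * expectation (\<lambda>\<omega>. ?\<phi> u (conf n \<omega>)))"
    by (simp add: mult.commute)
  also have "\<dots> = nuE nu True n h * (\<Sum>u\<in>?W. expectation (\<lambda>\<omega>. ?\<phi> u (conf n \<omega>)))"
    by (simp only: sum_distrib_left)
  also have "(\<Sum>u\<in>?W. expectation (\<lambda>\<omega>. ?\<phi> u (conf n \<omega>))) = expectation (\<lambda>\<omega>. \<Sum>u\<in>?W. ?\<phi> u (conf n \<omega>))"
    by (rule Bochner_Integration.integral_sum[symmetric]) (rule conf_fun_integrable)
  also have "(\<lambda>\<omega>. \<Sum>u\<in>?W. ?\<phi> u (conf n \<omega>)) = (\<lambda>\<omega>. \<phi> (conf n \<omega>) * real (Z j v n \<omega>))"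
    unfolding Z_def using sum_eq[of "\<lambda>_. 1"] by (simp add: sum_distrib_left)
  finally show ?thesis .
qed

text \<open>Two different words of a generation have conditionally independent families. Leaving out
  the diagonal makes the factorial moment \<open>Z (Z - 1)\<close> the natural quantity.\<close>

lemma expectation_pairs_desc:
  assumes "j \<le> n"
  shows "expectation (\<lambda>\<omega>. \<phi> (conf n \<omega>) * (\<Sum>u\<in>desc j v n \<omega>. \<Sum>w\<in>desc j v n \<omega> - {u}. h (children \<omega> u) * h (children \<omega> w)))
    = (nuE nu True n h)\<^sup>2 * expectation (\<lambda>\<omega>. \<phi> (conf n \<omega>) * (real (Z j v n \<omega>) * (real (Z j v n \<omega>) - 1)))"
proof -
  let ?W = "{(u, w). length (u :: bool list) = n \<and> length (w :: bool list) = n \<and> u \<noteq> w}"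
  have finW: "finite ?W"
    by (rule finite_subset[OF _ finite_cartesian_product[OF finite_bounded_words[of n] finite_bounded_words[of n]]]) auto
  let ?b = "\<lambda>p C. of_bool (fst p \<in> desc_conf j v n C \<and> snd p \<in> desc_conf j v n C) :: real"
  let ?\<phi> = "\<lambda>p C. \<phi> C * ?b p C"
  have sum_eq: "(\<Sum>u\<in>desc j v n \<omega>. \<Sum>w\<in>desc j v n \<omega> - {u}. f u w) = (\<Sum>p\<in>?W. ?b p (conf n \<omega>) * f (fst p) (snd p))" for f :: "_ \<Rightarrow> _ \<Rightarrow> real" and \<omega>
  proof -
    let ?P = "SIGMA u:desc j v n \<omega>. desc j v n \<omega> - {u}"
    have "(\<Sum>u\<in>desc j v n \<omega>. \<Sum>w\<in>desc j v n \<omega> - {u}. f u w) = (\<Sum>p\<in>?P. f (fst p) (snd p))"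
      by (subst sum.Sigma) (auto simp: finite_descendants split_def)
    also have "\<dots> = (\<Sum>p\<in>?P. ?b p (conf n \<omega>) * f (fst p) (snd p))"
      by (intro sum.cong) (auto simp: desc_eq_conf[of n n])
    also have "\<dots> = (\<Sum>p\<in>?W. ?b p (conf n \<omega>) * f (fst p) (snd p))"
      using finW by (intro sum.mono_neutral_left) (auto simp: desc_eq_conf[of n n, symmetric] descendants_def)
    finally show ?thesis .
  qed
  have gen: "expectation (\<lambda>\<omega>. ?\<phi> p (conf n \<omega>) * (h (children \<omega> (fst p)) * h (children \<omega> (snd p)))) =
       expectation (\<lambda>\<omega>. ?\<phi> p (conf n \<omega>) * (nuE nu True n h)\<^sup>2)"
    and i: "integrable M (\<lambda>\<omega>. ?\<phi> p (conf n \<omega>) * (h (children \<omega> (fst p)) * h (children \<omega> (snd p))))" if p: "p \<in> ?W" for p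
  proof -
    have ne: "fst p \<noteq> snd p" and len: "length (fst p) = n" "length (snd p) = n" using p by auto
    have "expectation (\<lambda>\<omega>. ?\<phi> p (conf n \<omega>) * (h (children \<omega> (fst p)) * h (children \<omega> (snd p)))) = 
      expectation (\<lambda>\<omega>. ?\<phi> p (conf n \<omega>) * (nuE nu (X (fst p) \<omega>) n h * nuE nu (X (snd p) \<omega>) n h))"
      using generation_step[of "{fst p, snd p}" n "?\<phi> p" "\<lambda>_. h"] ne len by simp
    also have "\<dots> = expectation (\<lambda>\<omega>. ?\<phi> p (conf n \<omega>) * (nuE nu True n h)\<^sup>2)"
    proof (rule Bochner_Integration.integral_cong[OF refl])
      fix \<omega>
      show "?\<phi> p (conf n \<omega>) * (nuE nu (X (fst p) \<omega>) n h * nuE nu (X (snd p) \<omega>) n h) = ?\<phi> p (conf n \<omega>) * (nuE nu True n h)\<^sup>2"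
        using desc_X[where u = "fst p" and j = j and v = v and n = n and \<omega> = \<omega>] desc_X[where u = "snd p" and j = j and v = v and n = n and \<omega> = \<omega>] assms
        by (cases "fst p \<in> desc j v n \<omega> \<and> snd p \<in> desc j v n \<omega>") (auto simp: desc_eq_conf[of n n] power2_eq_square)
    qed
    finally show "expectation (\<lambda>\<omega>. ?\<phi> p (conf n \<omega>) * (h (children \<omega> (fst p)) * h (children \<omega> (snd p)))) =
       expectation (\<lambda>\<omega>. ?\<phi> p (conf n \<omega>) * (nuE nu True n h)\<^sup>2)" .
    show "integrable M (\<lambda>\<omega>. ?\<phi> p (conf n \<omega>) * (h (children \<omega> (fst p)) * h (children \<omega> (snd p))))"
      using child_fun_integrable[of "{fst p, snd p}" n "?\<phi> p" "\<lambda>_. h"] ne len by simp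
  qed
  have "expectation (\<lambda>\<omega>. \<phi> (conf n \<omega>) * (\<Sum>u\<in>desc j v n \<omega>. \<Sum>w\<in>desc j v n \<omega> - {u}. h (children \<omega> u) * h (children \<omega> w)))
    = expectation (\<lambda>\<omega>. \<Sum>p\<in>?W. ?\<phi> p (conf n \<omega>) * (h (children \<omega> (fst p)) * h (children \<omega> (snd p))))"
    unfolding sum_eq by (simp only: sum_distrib_left mult.assoc)
  also have "\<dots> = (\<Sum>p\<in>?W. expectation (\<lambda>\<omega>. ?\<phi> p (conf n \<omega>) * (h (children \<omega> (fst p)) * h (children \<omega> (snd p)))))"
    by (rule Bochner_Integration.integral_sum) (rule i)
  also have "\<dots> = (\<Sum>p\<in>?W. expectation (\<lambda>\<omega>. ?\<phi> p (conf n \<omega>) * (nuE nu True n h)\<^sup>2))"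
    by (rule sum.cong[OF refl]) (rule gen)
  also have "\<dots> = (\<Sum>p\<in>?W. (nuE nu True n h)\<^sup>2 * expectation (\<lambda>\<omega>. ?\<phi> p (conf n \<omega>)))"
    by (simp add: mult.commute)
  also have "\<dots> = (nuE nu True n h)\<^sup>2 * (\<Sum>p\<in>?W. expectation (\<lambda>\<omega>. ?\<phi> p (conf n \<omega>)))"
    by (simp only: sum_distrib_left)
  also have "(\<Sum>p\<in>?W. expectation (\<lambda>\<omega>. ?\<phi> p (conf n \<omega>))) = expectation (\<lambda>\<omega>. \<Sum>p\<in>?W. ?\<phi> p (conf n \<omega>))"
    by (rule Bochner_Integration.integral_sum[symmetric]) (rule conf_fun_integrable)
  also have "(\<lambda>\<omega>. \<Sum>p\<in>?W. ?\<phi> p (conf n \<omega>)) = (\<lambda>\<omega>. \<phi> (conf n \<omega>) * (real (Z j v n \<omega>) * (real (Z j v n \<omega>) - 1)))"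
  proof
    fix \<omega>
    have "(\<Sum>p\<in>?W. ?b p (conf n \<omega>)) = (\<Sum>u\<in>desc j v n \<omega>. \<Sum>w\<in>desc j v n \<omega> - {u}. 1)"
      using sum_eq[of "\<lambda>_ _. 1"] by simp
    also have "\<dots> = (\<Sum>u\<in>desc j v n \<omega>. real (Z j v n \<omega>) - 1)"
    proof (rule sum.cong[OF refl])
      fix u assume u: "u \<in> desc j v n \<omega>"
      then have "card (desc j v n \<omega>) \<ge> 1" using finite_descendants by (metis One_nat_def Suc_leI card_gt_0_iff empty_iff)
      then show "(\<Sum>w\<in>desc j v n \<omega> - {u}. 1) = real (Z j v n \<omega>) - 1"
        using u unfolding Z_def by (simp add: card_Diff_singleton finite_descendants of_nat_diff)
    qed
    also have "\<dots> = real (Z j v n \<omega>) * (real (Z j v n \<omega>) - 1)" by (simp add: Z_def)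
    finally show "(\<Sum>p\<in>?W. ?\<phi> p (conf n \<omega>)) = \<phi> (conf n \<omega>) * (real (Z j v n \<omega>) * (real (Z j v n \<omega>) - 1))"
      by (simp only: sum_distrib_left[symmetric])
  qed
  finally show ?thesis .
qed

text \<open>A product over a random set is not linear in membership, so the expectation is split
  according to the value of the whole set.\<close>

lemma expectation_prod_desc:
  assumes "j \<le> n"
  shows "expectation (\<lambda>\<omega>. \<phi> (conf n \<omega>) * (\<Prod>u\<in>desc j v n \<omega>. h (children \<omega> u)))
    = expectation (\<lambda>\<omega>. \<phi> (conf n \<omega>) * (nuE nu True n h) ^ Z j v n \<omega>)"
proof -
  let ?W = "Pow {u :: bool list. length u = n}"
  have finW: "finite ?W" by (rule finite_Pow_iff[THEN iffD2], rule finite_subset[OF _ finite_bounded_words[of n]]) auto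
  let ?\<phi> = "\<lambda>U C. \<phi> C * of_bool (desc_conf j v n C = U)"
  have mem: "desc j v n \<omega> \<in> ?W" for \<omega> unfolding descendants_def by auto
  have sum_eq: "\<phi> (conf n \<omega>) * f (desc j v n \<omega>) = (\<Sum>U\<in>?W. ?\<phi> U (conf n \<omega>) * f U)" for f :: "_ \<Rightarrow> real" and \<omega>
  proof -
    have "(\<Sum>U\<in>?W. ?\<phi> U (conf n \<omega>) * f U) = (\<Sum>U\<in>{desc j v n \<omega>}. ?\<phi> U (conf n \<omega>) * f U)"
      using finW mem[of \<omega>] by (intro sum.mono_neutral_right) (auto simp: desc_eq_conf[of n n])
    then show ?thesis by (simp add: desc_eq_conf[of n n])
  qed
  have finU: "finite U" if "U \<in> ?W" for U
    using that by (intro finite_subset[OF _ finite_bounded_words[of n]]) auto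
  have i1: "integrable M (\<lambda>\<omega>. ?\<phi> U (conf n \<omega>) * (\<Prod>u\<in>U. h (children \<omega> u)))" if "U \<in> ?W" for U
    using child_fun_integrable[of U n "?\<phi> U" "\<lambda>_. h"] that by simp
  have i2: "integrable M (\<lambda>\<omega>. ?\<phi> U (conf n \<omega>) * nuE nu True n h ^ card U)" for U
    using conf_fun_integrable[of "\<lambda>C. ?\<phi> U C * nuE nu True n h ^ card U"] .
  have "expectation (\<lambda>\<omega>. \<phi> (conf n \<omega>) * (\<Prod>u\<in>desc j v n \<omega>. h (children \<omega> u)))
    = expectation (\<lambda>\<omega>. \<Sum>U\<in>?W. ?\<phi> U (conf n \<omega>) * (\<Prod>u\<in>U. h (children \<omega> u)))"
    by (rule Bochner_Integration.integral_cong[OF refl], rule sum_eq)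
  also have "\<dots> = (\<Sum>U\<in>?W. expectation (\<lambda>\<omega>. ?\<phi> U (conf n \<omega>) * (\<Prod>u\<in>U. h (children \<omega> u))))"
    by (rule Bochner_Integration.integral_sum) (rule i1)
  also have "\<dots> = (\<Sum>U\<in>?W. expectation (\<lambda>\<omega>. ?\<phi> U (conf n \<omega>) * nuE nu True n h ^ card U))"
  proof (rule sum.cong[OF refl])
    fix U assume U: "U \<in> ?W"
    have "expectation (\<lambda>\<omega>. ?\<phi> U (conf n \<omega>) * (\<Prod>u\<in>U. h (children \<omega> u))) = expectation (\<lambda>\<omega>. ?\<phi> U (conf n \<omega>) * (\<Prod>u\<in>U. nuE nu (X u \<omega>) n h))"
      using generation_step[of U n "?\<phi> U" "\<lambda>_. h"] U finU[OF U] by simp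
    also have "\<dots> = expectation (\<lambda>\<omega>. ?\<phi> U (conf n \<omega>) * nuE nu True n h ^ card U)"
    proof (rule Bochner_Integration.integral_cong[OF refl])
      fix \<omega>
      show "?\<phi> U (conf n \<omega>) * (\<Prod>u\<in>U. nuE nu (X u \<omega>) n h) = ?\<phi> U (conf n \<omega>) * nuE nu True n h ^ card U"
      proof (cases "desc j v n \<omega> = U")
        case True
        have "(\<Prod>u\<in>U. nuE nu (X u \<omega>) n h) = (\<Prod>u\<in>U. nuE nu True n h)"
          using desc_X[where j = j and v = v and n = n and \<omega> = \<omega>] assms True by (intro prod.cong) auto
        then show ?thesis by simp
      qed (simp add: desc_eq_conf[of n n])
    qed
    finally show "expectation (\<lambda>\<omega>. ?\<phi> U (conf n \<omega>) * (\<Prod>u\<in>U. h (children \<omega> u))) = expectation (\<lambda>\<omega>. ?\<phi> U (conf n \<omega>) * nuE nu True n h ^ card U)" .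
  qed
  also have "\<dots> = expectation (\<lambda>\<omega>. \<Sum>U\<in>?W. ?\<phi> U (conf n \<omega>) * nuE nu True n h ^ card U)"
    by (rule Bochner_Integration.integral_sum[symmetric]) (rule i2)
  also have "\<dots> = expectation (\<lambda>\<omega>. \<phi> (conf n \<omega>) * (nuE nu True n h) ^ Z j v n \<omega>)"
    unfolding Z_def by (rule Bochner_Integration.integral_cong[OF refl], rule sum_eq[symmetric])
  finally show ?thesis .
qed

section \<open>Recursions for moments and survival probabilities\<close>

lemma mean_step:
  assumes "j \<le> n" "length v \<le> n"
  shows "expectation (\<lambda>\<omega>. \<phi> (conf n \<omega>) * real (Z j v (Suc n) \<omega>)) = gam nu n * expectation (\<lambda>\<omega>. \<phi> (conf n \<omega>) * real (Z j v n \<omega>))"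
  using expectation_sum_desc[OF assms(1), where \<phi> = \<phi> and v = v and h = "\<lambda>p. real (kids p)"] unfolding nuE_kids
  by (simp add: Z_Suc[OF assms])

lemma power_step:
  assumes "j \<le> n" "length v \<le> n"
  shows "expectation (\<lambda>\<omega>. \<phi> (conf n \<omega>) * (1 - t) ^ Z j v (Suc n) \<omega>)
    = expectation (\<lambda>\<omega>. \<phi> (conf n \<omega>) * (1 - (gam nu n * t - split_prob nu n * t\<^sup>2)) ^ Z j v n \<omega>)"
  using expectation_prod_desc[OF assms(1), where \<phi> = \<phi> and v = v and h = "\<lambda>p. (1 - t) ^ kids p"] unfolding nuE_kids_power
  by (simp add: Z_Suc[OF assms] power_sum)

lemma Z_fun_integrable:
  assumes "n \<le> k"
  shows "integrable M (\<lambda>\<omega>. \<phi> (conf k \<omega>) * f (Z j v n \<omega>) :: real)"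
  using conf_fun_integrable[of "\<lambda>C. \<phi> C * f (card (desc_conf j v n C))" k] by (simp add: Z_eq_conf[OF assms])

text \<open>The square of the total offspring is split into pairs of different parents and the
  diagonal. On the diagonal \<open>kids (kids - 1)\<close> is nonzero only for two children, whence
  \<open>split_prob\<close>.\<close>

lemma factorial_step:
  assumes "j \<le> n" "length v \<le> n"
  shows "expectation (\<lambda>\<omega>. \<phi> (conf n \<omega>) * (real (Z j v (Suc n) \<omega>) * (real (Z j v (Suc n) \<omega>) - 1)))
    = (gam nu n)\<^sup>2 * expectation (\<lambda>\<omega>. \<phi> (conf n \<omega>) * (real (Z j v n \<omega>) * (real (Z j v n \<omega>) - 1)))
      + 2 * split_prob nu n * expectation (\<lambda>\<omega>. \<phi> (conf n \<omega>) * real (Z j v n \<omega>))"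
proof -
  let ?k = "\<lambda>\<omega> u. real (kids (children \<omega> u))"
  let ?A = "\<lambda>\<omega>. \<Sum>u\<in>desc j v n \<omega>. \<Sum>w\<in>desc j v n \<omega> - {u}. ?k \<omega> u * ?k \<omega> w"
  let ?B = "\<lambda>\<omega>. \<Sum>u\<in>desc j v n \<omega>. ?k \<omega> u * (?k \<omega> u - 1)"
  have eq: "real (Z j v (Suc n) \<omega>) * (real (Z j v (Suc n) \<omega>) - 1) = ?A \<omega> + ?B \<omega>" for \<omega>
  proof -
    let ?D = "desc j v n \<omega>" and ?S = "\<Sum>u\<in>desc j v n \<omega>. ?k \<omega> u"
    have "?S * ?S = (\<Sum>u\<in>?D. ?k \<omega> u * ?S)" by (simp add: sum_distrib_right)
    also have "\<dots> = (\<Sum>u\<in>?D. (\<Sum>w\<in>?D - {u}. ?k \<omega> u * ?k \<omega> w) + ?k \<omega> u * ?k \<omega> u)"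
    proof (rule sum.cong[OF refl])
      fix u assume "u \<in> ?D"
      then have "?S = ?k \<omega> u + (\<Sum>w\<in>?D - {u}. ?k \<omega> w)" by (rule sum.remove[OF finite_descendants])
      then show "?k \<omega> u * ?S = (\<Sum>w\<in>?D - {u}. ?k \<omega> u * ?k \<omega> w) + ?k \<omega> u * ?k \<omega> u"
        by (simp add: distrib_left sum_distrib_left)
    qed
    finally have "?S * (?S - 1) = ?A \<omega> + ?B \<omega>"
      by (simp add: right_diff_distrib sum.distrib sum_subtractf)
    then show ?thesis by (simp add: Z_Suc[OF assms])
  qed
  have conf2: "?B \<omega> = (\<lambda>C. \<Sum>u\<in>desc_conf j v n {w \<in> C. length w \<le> n}. real (kids (u @ [False] \<in> C, u @ [True] \<in> C)) * (real (kids (u @ [False] \<in> C, u @ [True] \<in> C)) - 1)) (conf (Suc n) \<omega>)" for \<omega>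
    unfolding desc_eq_conf[of n n, OF order_refl] conf_restrict[of n "Suc n", simplified, symmetric]
    by (intro sum.cong) (auto simp: desc_conf_def descendants_def children_conf[of _ "Suc n"])
  have iB: "integrable M (\<lambda>\<omega>. \<phi> (conf n \<omega>) * ?B \<omega>)"
    unfolding conf2 conf_restrict[of n "Suc n", simplified] 
    by (rule conf_fun_integrable[of "\<lambda>C. \<phi> {w \<in> C. length w \<le> n} * (\<Sum>u\<in>desc_conf j v n {w \<in> C. length w \<le> n}. real (kids (u @ [False] \<in> C, u @ [True] \<in> C)) * (real (kids (u @ [False] \<in> C, u @ [True] \<in> C)) - 1))" "Suc n"])
  have iAB: "integrable M (\<lambda>\<omega>. \<phi> (conf n \<omega>) * (real (Z j v (Suc n) \<omega>) * (real (Z j v (Suc n) \<omega>) - 1)))"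
    using Z_fun_integrable[of "Suc n" "Suc n" "\<lambda>C. \<phi> {w \<in> C. length w \<le> n}" "\<lambda>z. real z * (real z - 1)" j v]
    by (simp add: conf_restrict[of n "Suc n"])
  have iA: "integrable M (\<lambda>\<omega>. \<phi> (conf n \<omega>) * ?A \<omega>)"
    using Bochner_Integration.integrable_diff[OF iAB iB] unfolding eq by (simp add: distrib_left)
  have "expectation (\<lambda>\<omega>. \<phi> (conf n \<omega>) * (real (Z j v (Suc n) \<omega>) * (real (Z j v (Suc n) \<omega>) - 1)))
    = expectation (\<lambda>\<omega>. \<phi> (conf n \<omega>) * ?A \<omega> + \<phi> (conf n \<omega>) * ?B \<omega>)"
    unfolding eq distrib_left ..
  also have "\<dots> = expectation (\<lambda>\<omega>. \<phi> (conf n \<omega>) * ?A \<omega>) + expectation (\<lambda>\<omega>. \<phi> (conf n \<omega>) * ?B \<omega>)"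
    by (rule Bochner_Integration.integral_add[OF iA iB])
  also have "expectation (\<lambda>\<omega>. \<phi> (conf n \<omega>) * ?A \<omega>) = (gam nu n)\<^sup>2 * expectation (\<lambda>\<omega>. \<phi> (conf n \<omega>) * (real (Z j v n \<omega>) * (real (Z j v n \<omega>) - 1)))"
    using expectation_pairs_desc[OF assms(1), where \<phi> = \<phi> and v = v and h = "\<lambda>p. real (kids p)"] unfolding nuE_kids .
  also have "expectation (\<lambda>\<omega>. \<phi> (conf n \<omega>) * ?B \<omega>) = 2 * split_prob nu n * expectation (\<lambda>\<omega>. \<phi> (conf n \<omega>) * real (Z j v n \<omega>))"
    using expectation_sum_desc[OF assms(1), where \<phi> = \<phi> and v = v and h = "\<lambda>p. real (kids p) * (real (kids p) - 1)"] unfolding nuE_kids_factorial .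
  finally show ?thesis .
qed

lemma mean_growth:
  assumes "n \<le> k" "j \<le> n" "length v \<le> n"
  shows "expectation (\<lambda>\<omega>. \<phi> (conf n \<omega>) * real (Z j v k \<omega>)) = mean_prod nu n k * expectation (\<lambda>\<omega>. \<phi> (conf n \<omega>) * real (Z j v n \<omega>))"
  using assms(1)
proof (induction k rule: dec_induct)
  case (step k)
  have "expectation (\<lambda>\<omega>. \<phi> (conf n \<omega>) * real (Z j v (Suc k) \<omega>)) = gam nu k * expectation (\<lambda>\<omega>. \<phi> (conf n \<omega>) * real (Z j v k \<omega>))"
    using mean_step[of j k v "\<lambda>C. \<phi> {w \<in> C. length w \<le> n}"] step.hyps assms by (simp add: conf_restrict[of n k])
  with step show ?case by (simp add: mean_prod_Suc mult_ac)
qed simp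

text \<open>Divided by the square of the mean, the one-step recursion becomes additive, and its
  increments are the terms of \<open>varsigma\<close>.\<close>

lemma factorial_growth:
  assumes "n \<le> k" "j \<le> n" "length v \<le> n" and pos: "\<And>l. n \<le> l \<Longrightarrow> gam nu l > 0"
  shows "expectation (\<lambda>\<omega>. \<phi> (conf n \<omega>) * (real (Z j v k \<omega>) * (real (Z j v k \<omega>) - 1)))
   = (mean_prod nu n k)\<^sup>2 * (expectation (\<lambda>\<omega>. \<phi> (conf n \<omega>) * (real (Z j v n \<omega>) * (real (Z j v n \<omega>) - 1)))
       + vs_sum nu n k * expectation (\<lambda>\<omega>. \<phi> (conf n \<omega>) * real (Z j v n \<omega>)))"
  using assms(1)
proof (induction k rule: dec_induct)
  case base
  show ?case by (simp add: vs_sum_def)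
next
  case (step k)
  let ?m = "mean_prod nu n k"
  have m: "?m > 0" unfolding mean_prod_def using pos by (intro prod_pos) auto
  have g: "gam nu k > 0" using pos step.hyps by simp
  have vs: "vs_sum nu n (Suc k) = vs_sum nu n k + 2 * split_prob nu k / (gam nu k * (?m * gam nu k))"
    using step.hyps by (simp add: vs_sum_def mean_prod_Suc)
  have "expectation (\<lambda>\<omega>. \<phi> (conf n \<omega>) * (real (Z j v (Suc k) \<omega>) * (real (Z j v (Suc k) \<omega>) - 1))) =
    (gam nu k)\<^sup>2 * expectation (\<lambda>\<omega>. \<phi> (conf n \<omega>) * (real (Z j v k \<omega>) * (real (Z j v k \<omega>) - 1)))
      + 2 * split_prob nu k * expectation (\<lambda>\<omega>. \<phi> (conf n \<omega>) * real (Z j v k \<omega>))"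
    using factorial_step[of j k v "\<lambda>C. \<phi> {w \<in> C. length w \<le> n}"] step.hyps assms by (simp add: conf_restrict[of n k])
  also note step.IH
  also note mean_growth[OF step.hyps(1) assms(2,3)]
  finally show ?case
    using m g step.hyps unfolding vs mean_prod_Suc[OF step.hyps(1)] by (simp add: field_simps power2_eq_square)
qed

text \<open>The probability that a one of level \<open>n\<close> has descendants \<open>k\<close>
  levels later, computed from its first offspring and the same quantity at level
  \<open>Suc n\<close>.\<close>

fun surv_prob :: "nat \<Rightarrow> nat \<Rightarrow> real" where
  "surv_prob n 0 = 1"
| "surv_prob n (Suc k) = gam nu n * surv_prob (Suc n) k - split_prob nu n * (surv_prob (Suc n) k)\<^sup>2"

text \<open>\<open>0 ^ Z\<close> is the indicator of extinction, because \<open>0 ^ 0 = 1\<close>.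
  The induction reaches level \<open>Suc n\<close> first, and one application of the generating
  function brings it back to \<open>n\<close>.\<close>

lemma extinction_generating_function:
  assumes "j \<le> n" "length v \<le> n"
  shows "expectation (\<lambda>\<omega>. \<phi> (conf n \<omega>) * 0 ^ Z j v (n + k) \<omega>) = expectation (\<lambda>\<omega>. \<phi> (conf n \<omega>) * (1 - surv_prob n k) ^ Z j v n \<omega>)"
  using assms
proof (induction k arbitrary: n \<phi>)
  case (Suc k)
  have "expectation (\<lambda>\<omega>. \<phi> (conf n \<omega>) * 0 ^ Z j v (n + Suc k) \<omega>) = expectation (\<lambda>\<omega>. \<phi> (conf n \<omega>) * (1 - surv_prob (Suc n) k) ^ Z j v (Suc n) \<omega>)"
    using Suc.IH[of "Suc n" "\<lambda>C. \<phi> {w \<in> C. length w \<le> n}"] Suc.prems by (simp add: conf_restrict[of n "Suc n"])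
  also have "\<dots> = expectation (\<lambda>\<omega>. \<phi> (conf n \<omega>) * (1 - surv_prob n (Suc k)) ^ Z j v n \<omega>)"
    using power_step[OF Suc.prems] by simp
  finally show ?case .
qed simp

text \<open>For an offspring law on \<open>{0, 1, 2}\<close> with mean \<open>\<gamma>\<close> and probability \<open>p\<close> of two children,
  \<open>1 / (\<gamma> t - p t^2) = 1 / (\<gamma> t) + (p / \<gamma>^2) / (1 - p t / \<gamma>)\<close> with \<open>p t / \<gamma> \<le> 1 / 2\<close>;
  iterating gives the inverse survival probability up to a factor two.\<close>
lemma surv_prob_bounds:
  assumes "\<And>l. n \<le> l \<Longrightarrow> gam nu l > 0"
  shows "0 < surv_prob n k \<and> surv_prob n k \<le> 1 \<and>
    1 / mean_prod nu n (n + k) + vs_sum nu n (n + k) / 2 \<le> 1 / surv_prob n k \<and>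
    1 / surv_prob n k \<le> 1 / mean_prod nu n (n + k) + vs_sum nu n (n + k)"
  using assms
proof (induction k arbitrary: n)
  case 0
  show ?case by (simp add: vs_sum_def)
next
  case (Suc k)
  let ?g = "gam nu n" and ?p = "split_prob nu n" and ?t = "surv_prob (Suc n) k"
  let ?m = "mean_prod nu (Suc n) (n + Suc k)" and ?v = "vs_sum nu (Suc n) (n + Suc k)"
  have IH: "0 < ?t" "?t \<le> 1" "1 / ?m + ?v / 2 \<le> 1 / ?t" "1 / ?t \<le> 1 / ?m + ?v"
    using Suc.IH[of "Suc n"] Suc.prems by simp_all
  have g: "?g > 0" using Suc.prems by simp
  have p: "0 \<le> ?p" "2 * ?p \<le> ?g" by (rule split_prob_nonneg, rule two_split_prob_le)
  have pt: "2 * (?p * ?t) \<le> ?g" "0 \<le> ?p * ?t"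
    using mult_left_mono[OF IH(2) p(1)] p IH(1) by auto
  have d: "?g - ?p * ?t > 0" using pt g by linarith
  have s: "surv_prob n (Suc k) = ?t * (?g - ?p * ?t)" by (simp add: power2_eq_square algebra_simps)
  have s0: "0 < surv_prob n (Suc k)" unfolding s using IH(1) d by simp
  have s1: "surv_prob n (Suc k) \<le> 1"
  proof -
    have "1 - surv_prob n (Suc k) = nuE nu True n (\<lambda>p. (1 - ?t) ^ kids p)" unfolding nuE_kids_power by simp
    also have "\<dots> \<ge> 0" unfolding nuE_def using IH(2) by (intro sum_nonneg mult_nonneg_nonneg) auto
    finally show ?thesis by simp
  qed
  have inv: "1 / surv_prob n (Suc k) = 1 / (?g * ?t) + ?p / (?g * (?g - ?p * ?t))"
    unfolding s using IH(1) g d by (simp add: field_simps)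
  have lo: "?p / ?g\<^sup>2 \<le> ?p / (?g * (?g - ?p * ?t))"
    using g d p pt by (intro divide_left_mono) (auto simp: power2_eq_square)
  have hi: "?p / (?g * (?g - ?p * ?t)) \<le> 2 * ?p / ?g\<^sup>2"
  proof -
    have "?g / 2 \<le> ?g - ?p * ?t" using pt(1) by simp
    then have "?p / (?g * (?g - ?p * ?t)) \<le> ?p / (?g * (?g / 2))"
      using p g d by (intro divide_left_mono mult_left_mono mult_pos_pos) auto
    then show ?thesis by (simp add: power2_eq_square mult.commute)
  qed
  have m: "mean_prod nu n (n + Suc k) = ?g * ?m"
    unfolding mean_prod_def by (rule prod.atLeast_Suc_lessThan) simp
  have v: "vs_sum nu n (n + Suc k) = 2 * ?p / ?g\<^sup>2 + ?v / ?g"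
  proof -
    have "vs_sum nu n (n + Suc k) = 2 * ?p / (?g * mean_prod nu n (Suc n)) + (\<Sum>l\<in>{Suc n..<n + Suc k}. 2 * split_prob nu l / (gam nu l * mean_prod nu n (Suc l)))"
      unfolding vs_sum_def by (rule sum.atLeast_Suc_lessThan) simp
    also have "(\<Sum>l\<in>{Suc n..<n + Suc k}. 2 * split_prob nu l / (gam nu l * mean_prod nu n (Suc l))) = ?v / ?g"
      unfolding vs_sum_def sum_divide_distrib
    proof (rule sum.cong[OF refl])
      fix l assume "l \<in> {Suc n..<n + Suc k}"
      then have "mean_prod nu n (Suc l) = ?g * mean_prod nu (Suc n) (Suc l)"
        unfolding mean_prod_def by (intro prod.atLeast_Suc_lessThan) auto
      then show "2 * split_prob nu l / (gam nu l * mean_prod nu n (Suc l)) = 2 * split_prob nu l / (gam nu l * mean_prod nu (Suc n) (Suc l)) / ?g"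
        by (simp add: mult_ac)
    qed
    finally show ?thesis by (simp add: mean_prod_def power2_eq_square)
  qed
  have "(1 / ?m + ?v / 2) / ?g \<le> (1 / ?t) / ?g" "(1 / ?t) / ?g \<le> (1 / ?m + ?v) / ?g"
    using IH(3,4) g by (intro divide_right_mono; simp)+
  then have "1 / (?g * ?m) + ?v / ?g / 2 \<le> 1 / (?g * ?t)" "1 / (?g * ?t) \<le> 1 / (?g * ?m) + ?v / ?g"
    by (simp_all add: add_divide_distrib mult_ac)
  then show ?case using s0 s1 lo hi unfolding inv m v by (simp add: add_divide_distrib)
qed

end

section \<open>Births and the event of finitely many ones\<close>

lemma prod_one_minus_ge:
  fixes a :: "'i \<Rightarrow> real"
  assumes "finite I" "\<And>i. i \<in> I \<Longrightarrow> 0 \<le> a i \<and> a i \<le> 1"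
  shows "1 - sum a I \<le> (\<Prod>i\<in>I. 1 - a i)"
  using assms
proof (induction I rule: finite_induct)
  case (insert i I)
  have a: "0 \<le> a i" "a i \<le> 1" "0 \<le> sum a I" "1 - sum a I \<le> (\<Prod>i\<in>I. 1 - a i)"
    using insert by (auto intro: sum_nonneg)
  have "1 - (a i + sum a I) \<le> (1 - a i) * (1 - sum a I)" using a by (simp add: algebra_simps)
  also have "\<dots> \<le> (1 - a i) * (\<Prod>i\<in>I. 1 - a i)" using a by (intro mult_left_mono) auto
  finally show ?case using insert.hyps by simp
qed simp

lemma eta_pmf: "eta nu n = 1 - pmf (nu False n) (False, False)"
  by (simp add: eta_def measure_pmf_single)

lemma eta_range: "0 \<le> eta nu n" "eta nu n \<le> 1"
  by (simp_all add: eta_pmf pmf_le_1)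

lemma nuE_no_child: "nuE nu b n (\<lambda>p. of_bool (p = (False, False))) = pmf (nu b n) (False, False)"
  unfolding nuE_def sum_bool_pairs by simp

lemma nuE_some_child: "nuE nu b n (\<lambda>p. of_bool (p \<noteq> (False, False))) = 1 - pmf (nu b n) (False, False)"
  using pmf_bool_pairs[of "nu b n"] unfolding nuE_def sum_bool_pairs by simp

lemma card_words_length: "card {v :: bool list. length v = n} = 2 ^ n"
  using card_generation_all[of n] by simp

lemma finite_words_length: "finite {v :: bool list. length v = n}"
  using finite_generation[of n "\<lambda>_. True"] by simp

context markov_bool_tree
begin

lemma prob_conf: "prob {\<omega> \<in> space M. P (conf n \<omega>)} = expectation (\<lambda>\<omega>. of_bool (P (conf n \<omega>)))"
proof -
  have "expectation (\<lambda>\<omega>. of_bool (P (conf n \<omega>))) = expectation (indicat_real {\<omega> \<in> space M. P (conf n \<omega>)})"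
    by (intro Bochner_Integration.integral_cong refl) (auto split: split_indicator)
  also have "\<dots> = prob {\<omega> \<in> space M. P (conf n \<omega>)}" using conf_pred[of P n] by simp
  finally show ?thesis ..
qed

definition empty_gen :: "nat \<Rightarrow> 'a \<Rightarrow> bool" where
  "empty_gen n \<omega> \<longleftrightarrow> (\<forall>u. length u = n \<longrightarrow> \<not> X u \<omega>)"

lemma empty_gen_conf: "n \<le> k \<Longrightarrow> empty_gen n \<omega> \<longleftrightarrow> (\<forall>u. length u = n \<longrightarrow> u \<notin> conf k \<omega>)"
  by (auto simp: empty_gen_def conf_def)

lemma empty_gen_measurable [measurable]: "{\<omega> \<in> space M. empty_gen n \<omega>} \<in> sets M"
  unfolding empty_gen_conf[OF order_refl] by (rule conf_pred[of "\<lambda>C. \<forall>u. length u = n \<longrightarrow> u \<notin> C" n])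

lemma Phi_0: "Phi M X a 0 = prob {\<omega> \<in> space M. empty_gen a \<omega>}"
proof -
  have "Phi M X a 0 = expectation (indicat_real {\<omega> \<in> space M. empty_gen a \<omega>})"
    unfolding Phi_def
  proof (rule Bochner_Integration.integral_cong[OF refl])
    fix \<omega> assume "\<omega> \<in> space M"
    have "card {u. length u = a \<and> X u \<omega>} = 0 \<longleftrightarrow> empty_gen a \<omega>"
      using finite_generation[of a "\<lambda>u. X u \<omega>"] by (auto simp: empty_gen_def)
    then show "0 ^ card {u. length u = a \<and> X u \<omega>} = indicat_real {\<omega> \<in> space M. empty_gen a \<omega>} \<omega>"
      using \<open>\<omega> \<in> space M\<close> by (cases "card {u. length u = a \<and> X u \<omega>}") (auto split: split_indicator)
  qed
  then show ?thesis by simp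
qed

text \<open>Above an empty generation \<open>n\<close> all \<open>2^n\<close> labels are zero, and
  independently each of these words has no one among its children with probability
  \<open>1 - eta nu n\<close>.\<close>

lemma empty_run_prob:
  assumes "a \<le> n"
  shows "prob {\<omega> \<in> space M. \<forall>i\<in>{a..n}. empty_gen i \<omega>} = Phi M X a 0 * (\<Prod>i\<in>{a..<n}. (1 - eta nu i) ^ (2 ^ i))"
  using assms
proof (induction n rule: dec_induct)
  case base
  show ?case by (simp add: Phi_0)
next
  case (step n)
  let ?W = "{v :: bool list. length v = n}"
  let ?P = "\<lambda>C. \<forall>i\<in>{a..n}. \<forall>u. length u = i \<longrightarrow> u \<notin> C"
  have P: "?P (conf n \<omega>) \<longleftrightarrow> (\<forall>i\<in>{a..n}. empty_gen i \<omega>)" for \<omega>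
    by (intro ball_cong refl) (rule empty_gen_conf[symmetric], simp)
  have eg: "(\<Prod>v\<in>?W. of_bool (children \<omega> v = (False, False))) = (of_bool (empty_gen (Suc n) \<omega>) :: real)" for \<omega>
  proof (cases "empty_gen (Suc n) \<omega>")
    case True
    then have "children \<omega> v = (False, False)" if "v \<in> ?W" for v
      using that by (auto simp: children_def empty_gen_def)
    then show ?thesis using True by (simp add: prod.neutral)
  next
    case False
    then obtain u where "length u = Suc n" "X u \<omega>" by (auto simp: empty_gen_def)
    then obtain v b where v: "length v = n" "X (v @ [b]) \<omega>" by (auto simp: length_Suc_conv_rev)
    have "children \<omega> v \<noteq> (False, False)" using v(2) by (cases b) (auto simp: children_def)
    then have "(\<Prod>v\<in>?W. of_bool (children \<omega> v = (False, False))) = (0 :: real)"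
      using v(1) finite_words_length by (intro prod_zero) auto
    then show ?thesis using False by simp
  qed
  have "prob {\<omega> \<in> space M. \<forall>i\<in>{a..Suc n}. empty_gen i \<omega>} = prob {\<omega> \<in> space M. (\<lambda>C. \<forall>i\<in>{a..Suc n}. \<forall>u. length u = i \<longrightarrow> u \<notin> C) (conf (Suc n) \<omega>)}"
    by (intro arg_cong[of _ _ prob]) (auto simp: empty_gen_conf[of _ "Suc n"])
  also have "\<dots> = expectation (\<lambda>\<omega>. of_bool (\<forall>i\<in>{a..Suc n}. \<forall>u. length u = i \<longrightarrow> u \<notin> conf (Suc n) \<omega>))"
    by (rule prob_conf)
  also have "\<dots> = expectation (\<lambda>\<omega>. of_bool (?P (conf n \<omega>)) * (\<Prod>v\<in>?W. of_bool (children \<omega> v = (False, False))))"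
  proof (rule Bochner_Integration.integral_cong[OF refl])
    fix \<omega>
    have "{a..Suc n} = insert (Suc n) {a..n}" using step.hyps by auto
    then have "(\<forall>i\<in>{a..Suc n}. \<forall>u. length u = i \<longrightarrow> u \<notin> conf (Suc n) \<omega>) \<longleftrightarrow> ?P (conf n \<omega>) \<and> empty_gen (Suc n) \<omega>"
      unfolding P by (auto simp: empty_gen_conf[of _ "Suc n"])
    then show "of_bool (\<forall>i\<in>{a..Suc n}. \<forall>u. length u = i \<longrightarrow> u \<notin> conf (Suc n) \<omega>) = (of_bool (?P (conf n \<omega>)) * (\<Prod>v\<in>?W. of_bool (children \<omega> v = (False, False))) :: real)"
      unfolding eg by simp
  qed
  also have "\<dots> = expectation (\<lambda>\<omega>. of_bool (?P (conf n \<omega>)) * (\<Prod>v\<in>?W. nuE nu (X v \<omega>) n (\<lambda>p. of_bool (p = (False, False)))))"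
    using generation_step[of ?W n "\<lambda>C. of_bool (?P C)" "\<lambda>_ p. of_bool (p = (False, False))"] finite_words_length by simp
  also have "\<dots> = expectation (\<lambda>\<omega>. of_bool (?P (conf n \<omega>)) * (1 - eta nu n) ^ (2 ^ n))"
  proof (rule Bochner_Integration.integral_cong[OF refl])
    fix \<omega>
    show "of_bool (?P (conf n \<omega>)) * (\<Prod>v\<in>?W. nuE nu (X v \<omega>) n (\<lambda>p. of_bool (p = (False, False)))) = of_bool (?P (conf n \<omega>)) * (1 - eta nu n) ^ (2 ^ n)"
    proof (cases "?P (conf n \<omega>)")
      case True
      then have "empty_gen n \<omega>" unfolding P using step.hyps by auto
      then have "(\<Prod>v\<in>?W. nuE nu (X v \<omega>) n (\<lambda>p. of_bool (p = (False, False)))) = (\<Prod>v\<in>?W. 1 - eta nu n)"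
        unfolding nuE_no_child by (intro prod.cong) (auto simp: empty_gen_def eta_pmf)
      then show ?thesis by (simp add: card_words_length)
    qed simp
  qed
  also have "\<dots> = expectation (\<lambda>\<omega>. of_bool (?P (conf n \<omega>))) * (1 - eta nu n) ^ (2 ^ n)"
    by simp
  also have "expectation (\<lambda>\<omega>. of_bool (?P (conf n \<omega>))) = prob {\<omega> \<in> space M. ?P (conf n \<omega>)}"
    by (rule prob_conf[symmetric])
  also have "{\<omega> \<in> space M. ?P (conf n \<omega>)} = {\<omega> \<in> space M. \<forall>i\<in>{a..n}. empty_gen i \<omega>}"
    unfolding P ..
  finally show ?case using step by (simp add: mult_ac)
qed

definition birth :: "bool list \<Rightarrow> 'a \<Rightarrow> bool" where
  "birth u \<omega> \<longleftrightarrow> \<not> X u \<omega> \<and> children \<omega> u \<noteq> (False, False)"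

lemma birth_conf: "birth u \<omega> \<longleftrightarrow> (\<lambda>C. u \<notin> C \<and> \<not> (u @ [False] \<notin> C \<and> u @ [True] \<notin> C)) (conf (Suc (length u)) \<omega>)"
  by (auto simp: birth_def children_def X_conf[symmetric])

lemma birth_measurable: "{\<omega> \<in> space M. birth u \<omega>} \<in> sets M"
  unfolding birth_conf by (rule conf_pred)

lemma prob_children:
  assumes "length u = n"
  shows "prob {\<omega> \<in> space M. X u \<omega> = b \<and> Q (children \<omega> u)} = prob {\<omega> \<in> space M. X u \<omega> = b} * nuE nu b n (\<lambda>p. of_bool (Q p))"
proof -
  have "prob {\<omega> \<in> space M. X u \<omega> = b \<and> Q (children \<omega> u)} = prob {\<omega> \<in> space M. (\<lambda>C. (u \<in> C) = b \<and> Q (u @ [False] \<in> C, u @ [True] \<in> C)) (conf (Suc n) \<omega>)}"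
    using assms by (intro arg_cong[of _ _ prob]) (auto simp: children_conf[of u "Suc n"] X_conf[of u "Suc n"])
  also have "\<dots> = expectation (\<lambda>\<omega>. of_bool ((u \<in> conf n \<omega>) = b) * (\<Prod>v\<in>{u}. of_bool (Q (children \<omega> v))))"
    unfolding prob_conf[of "\<lambda>C. (u \<in> C) = b \<and> Q (u @ [False] \<in> C, u @ [True] \<in> C)" "Suc n"] using assms
    by (intro Bochner_Integration.integral_cong refl) (auto simp: children_conf[of u "Suc n"] conf_def)
  also have "\<dots> = expectation (\<lambda>\<omega>. of_bool ((u \<in> conf n \<omega>) = b) * (\<Prod>v\<in>{u}. nuE nu (X v \<omega>) n (\<lambda>p. of_bool (Q p))))"
    by (rule generation_step[of "{u}" n "\<lambda>C. of_bool ((u \<in> C) = b)" "\<lambda>_ p. of_bool (Q p)"]) (use assms in auto)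
  also have "\<dots> = expectation (\<lambda>\<omega>. of_bool ((u \<in> conf n \<omega>) = b) * nuE nu b n (\<lambda>p. of_bool (Q p)))"
  proof (rule Bochner_Integration.integral_cong[OF refl])
    fix \<omega>
    have "X u \<omega> = (u \<in> conf n \<omega>)" using assms by (simp add: conf_def)
    then show "of_bool ((u \<in> conf n \<omega>) = b) * (\<Prod>v\<in>{u}. nuE nu (X v \<omega>) n (\<lambda>p. of_bool (Q p))) = of_bool ((u \<in> conf n \<omega>) = b) * nuE nu b n (\<lambda>p. of_bool (Q p))"
      by (cases "(u \<in> conf n \<omega>) = b") simp_all
  qed
  also have "\<dots> = expectation (\<lambda>\<omega>. of_bool ((u \<in> conf n \<omega>) = b)) * nuE nu b n (\<lambda>p. of_bool (Q p))"
    by simp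
  also have "expectation (\<lambda>\<omega>. of_bool ((u \<in> conf n \<omega>) = b)) = prob {\<omega> \<in> space M. (u \<in> conf n \<omega>) = b}"
    by (rule prob_conf[symmetric])
  finally show ?thesis using assms by (simp add: X_conf[of u n])
qed

text \<open>Borel-Cantelli over the generations. The union bound over the \<open>2^n\<close> words
  of length \<open>n\<close> is the source of the weight in the summability hypothesis.\<close>

lemma AE_eventually_no_birth:
  assumes "summable (\<lambda>j. 2 ^ j * eta nu j)"
  shows "AE \<omega> in M. \<exists>J. \<forall>u. J \<le> length u \<longrightarrow> \<not> birth u \<omega>"
proof -
  define A where "A n = (\<Union>u\<in>{u. length u = n}. {\<omega> \<in> space M. birth u \<omega>})" for n
  have A: "A n \<in> sets M" for n unfolding A_def using finite_words_length birth_measurable by auto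
  have "prob (A n) \<le> 2 ^ n * eta nu n" for n
  proof -
    have "prob (A n) \<le> (\<Sum>u\<in>{u. length u = n}. prob {\<omega> \<in> space M. birth u \<omega>})"
      unfolding A_def using finite_words_length birth_measurable by (intro finite_measure_subadditive_finite) auto
    also have "\<dots> \<le> (\<Sum>u\<in>{u :: bool list. length u = n}. eta nu n)"
    proof (rule sum_mono)
      fix u :: "bool list" assume "u \<in> {u. length u = n}"
      then have "prob {\<omega> \<in> space M. birth u \<omega>} = prob {\<omega> \<in> space M. X u \<omega> = False} * eta nu n"
        using prob_children[of u n False "\<lambda>p. p \<noteq> (False, False)"] unfolding nuE_some_child by (simp add: birth_def eta_pmf)
      also have "\<dots> \<le> 1 * eta nu n" using eta_range by (intro mult_right_mono) auto
      finally show "prob {\<omega> \<in> space M. birth u \<omega>} \<le> eta nu n" by simp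
    qed
    finally show ?thesis by (simp add: card_words_length)
  qed
  then have "summable (\<lambda>n. prob (A n))"
    by (intro summable_comparison_test'[OF assms, of 0]) auto
  then have "AE \<omega> in M. eventually (\<lambda>n. \<omega> \<in> space M - A n) sequentially"
    by (intro borel_cantelli_AE1[OF A]) (auto simp: less_top[symmetric])
  then show ?thesis
  proof eventually_elim
    case (elim \<omega>)
    then obtain J where "\<And>n. n \<ge> J \<Longrightarrow> \<omega> \<in> space M - A n" by (auto simp: eventually_sequentially)
    then show ?case unfolding A_def by (intro exI[of _ J]) auto
  qed
qed

definition finite_ones :: "'a \<Rightarrow> bool" where
  "finite_ones \<omega> \<longleftrightarrow> finite {u. X u \<omega>}"

lemma finite_ones_iff: "finite_ones \<omega> \<longleftrightarrow> (\<exists>n. \<forall>k\<ge>n. empty_gen k \<omega>)"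
proof
  assume "finite_ones \<omega>"
  then obtain n where "\<And>u. X u \<omega> \<Longrightarrow> length u < n"
    using finite_nat_set_iff_bounded[of "length ` {u. X u \<omega>}"] by (auto simp: finite_ones_def)
  then show "\<exists>n. \<forall>k\<ge>n. empty_gen k \<omega>" by (intro exI[of _ n]) (fastforce simp: empty_gen_def)
next
  assume "\<exists>n. \<forall>k\<ge>n. empty_gen k \<omega>"
  then obtain n where "\<And>k. k \<ge> n \<Longrightarrow> empty_gen k \<omega>" by blast
  then have "{u. X u \<omega>} \<subseteq> {u. length u \<le> n}" by (auto simp: empty_gen_def) (metis nat_le_linear)
  then show "finite_ones \<omega>" unfolding finite_ones_def using finite_bounded_words finite_subset by blast
qed

lemma finite_ones_measurable: "{\<omega> \<in> space M. finite_ones \<omega>} \<in> sets M"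
  unfolding finite_ones_iff by measurable

lemma empty_forever_prob:
  "(\<lambda>n. prob {\<omega> \<in> space M. \<forall>i\<in>{a..n}. empty_gen i \<omega>}) \<longlonglongrightarrow> prob {\<omega> \<in> space M. \<forall>i\<ge>a. empty_gen i \<omega>}"
proof -
  have "(\<lambda>n. prob {\<omega> \<in> space M. \<forall>i\<in>{a..n}. empty_gen i \<omega>}) \<longlonglongrightarrow> prob (\<Inter>n. {\<omega> \<in> space M. \<forall>i\<in>{a..n}. empty_gen i \<omega>})"
  proof (rule finite_Lim_measure_decseq)
    have "{\<omega> \<in> space M. \<forall>i\<in>{a..n}. empty_gen i \<omega>} \<in> sets M" for n
    proof -
      have "(\<forall>i\<in>{a..n}. empty_gen i \<omega>) \<longleftrightarrow> (\<forall>i\<in>{a..n}. \<forall>u. length u = i \<longrightarrow> u \<notin> conf n \<omega>)" for \<omega>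
        by (intro ball_cong refl) (rule empty_gen_conf, simp)
      then show ?thesis by (simp only: conf_pred[of "\<lambda>C. \<forall>i\<in>{a..n}. \<forall>u. length u = i \<longrightarrow> u \<notin> C" n])
    qed
    then show "range (\<lambda>n. {\<omega> \<in> space M. \<forall>i\<in>{a..n}. empty_gen i \<omega>}) \<subseteq> sets M" by blast
    show "decseq (\<lambda>n. {\<omega> \<in> space M. \<forall>i\<in>{a..n}. empty_gen i \<omega>})" by (rule decseq_SucI) auto
  qed
  also have "(\<Inter>n. {\<omega> \<in> space M. \<forall>i\<in>{a..n}. empty_gen i \<omega>}) = {\<omega> \<in> space M. \<forall>i\<ge>a. empty_gen i \<omega>}"
  proof -
    have "(\<forall>n. \<forall>i\<in>{a..n}. empty_gen i \<omega>) \<longleftrightarrow> (\<forall>i\<ge>a. empty_gen i \<omega>)" for \<omega>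
      by (meson atLeastAtMost_iff order_refl)
    then show ?thesis by blast
  qed
  finally show ?thesis .
qed

text \<open>From level \<open>a\<close> on, every one almost surely has a child carrying a one, so a
  nonempty generation is followed by nonempty generations only. Finitely many ones then means that
  all generations from \<open>a\<close> on are empty.\<close>

lemma finite_ones_prob_no_death:
  assumes "\<forall>j\<ge>a. measure_pmf.prob (nu True j) {(False, False)} = 0"
  shows "prob {\<omega> \<in> space M. finite_ones \<omega>} = Phi M X a 0 * lim (\<lambda>n. \<Prod>j=a..n. (1 - eta nu j) ^ (2 ^ j))"
proof -
  have "AE \<omega> in M. \<forall>u\<in>{u. a \<le> length u}. \<not> (X u \<omega> = True \<and> children \<omega> u = (False, False))"
  proof (subst AE_ball_countable, simp, intro ballI)
    fix u :: "bool list" assume u: "u \<in> {u. a \<le> length u}"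
    have "prob {\<omega> \<in> space M. X u \<omega> = True \<and> children \<omega> u = (False, False)} = 0"
      using prob_children[OF refl, of u True "\<lambda>p. p = (False, False)"] assms u unfolding nuE_no_child by (simp add: measure_pmf_single)
    moreover have "{\<omega> \<in> space M. X u \<omega> = True \<and> children \<omega> u = (False, False)} \<in> sets M" by measurable
    ultimately show "AE \<omega> in M. \<not> (X u \<omega> = True \<and> children \<omega> u = (False, False))"
      by (subst AE_iff_measurable[OF _ refl]) (auto simp: emeasure_eq_measure)
  qed
  then have "AE \<omega> in M. finite_ones \<omega> \<longleftrightarrow> (\<forall>i\<ge>a. empty_gen i \<omega>)"
  proof eventually_elim
    case (elim \<omega>)
    show ?case
    proof
      assume f: "finite_ones \<omega>"
      show "\<forall>i\<ge>a. empty_gen i \<omega>"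
      proof (rule ccontr)
        assume "\<not> (\<forall>i\<ge>a. empty_gen i \<omega>)"
        then obtain i where i: "i \<ge> a" "\<not> empty_gen i \<omega>" by blast
        have ne: "\<not> empty_gen k \<omega>" if "k \<ge> i" for k
          using that
        proof (induction k rule: dec_induct)
          case (step k)
          from step.IH obtain u where u: "length u = k" "X u \<omega>" unfolding empty_gen_def by blast
          have "a \<le> length u" using u(1) step.hyps(1) i(1) by linarith
          then have "children \<omega> u \<noteq> (False, False)" using bspec[OF elim, of u] u(2) by simp
          then obtain b where b: "X (u @ [b]) \<omega>" unfolding children_def by blast
          have "length (u @ [b]) = Suc k" using u(1) by simp
          then show ?case using b unfolding empty_gen_def by blast
        qed (rule i)
        obtain n where "\<forall>k\<ge>n. empty_gen k \<omega>" using f unfolding finite_ones_iff by blast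
        then show False using ne[of "max n i"] by auto
      qed
    qed (auto simp: finite_ones_iff)
  qed
  then have eq: "prob {\<omega> \<in> space M. finite_ones \<omega>} = prob {\<omega> \<in> space M. \<forall>i\<ge>a. empty_gen i \<omega>}"
    by (intro finite_measure_eq_AE) (use finite_ones_measurable in \<open>auto\<close>)
  \<comment> \<open>Empty generations up to \<open>Suc n\<close> involve the birth rates up to
    \<open>n\<close>; this is the shift between the two sequences.\<close>
  have lim1: "(\<lambda>n. Phi M X a 0 * (\<Prod>j=a..n. (1 - eta nu j) ^ (2 ^ j))) \<longlonglongrightarrow> prob {\<omega> \<in> space M. \<forall>i\<ge>a. empty_gen i \<omega>}"
  proof (rule Lim_transform_eventually)
    show "(\<lambda>n. prob {\<omega> \<in> space M. \<forall>i\<in>{a..Suc n}. empty_gen i \<omega>}) \<longlonglongrightarrow> prob {\<omega> \<in> space M. \<forall>i\<ge>a. empty_gen i \<omega>}"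
      using LIMSEQ_Suc[OF empty_forever_prob] .
    show "\<forall>\<^sub>F n in sequentially. prob {\<omega> \<in> space M. \<forall>i\<in>{a..Suc n}. empty_gen i \<omega>} = Phi M X a 0 * (\<Prod>j=a..n. (1 - eta nu j) ^ (2 ^ j))"
    proof (rule eventually_sequentiallyI[of a])
      fix n assume "a \<le> n"
      then have "{a..<Suc n} = {a..n}" by auto
      then show "prob {\<omega> \<in> space M. \<forall>i\<in>{a..Suc n}. empty_gen i \<omega>} = Phi M X a 0 * (\<Prod>j=a..n. (1 - eta nu j) ^ (2 ^ j))"
        using empty_run_prob[of a "Suc n"] \<open>a \<le> n\<close> by simp
    qed
  qed
  \<comment> \<open>\<open>lim\<close> denotes an actual limit here because the products decrease
    and stay in \<open>[0, 1]\<close>.\<close>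
  have lim2: "(\<lambda>n. Phi M X a 0 * (\<Prod>j=a..n. (1 - eta nu j) ^ (2 ^ j))) \<longlonglongrightarrow> Phi M X a 0 * lim (\<lambda>n. \<Prod>j=a..n. (1 - eta nu j) ^ (2 ^ j))"
  proof (intro tendsto_mult tendsto_const)
    have "decseq (\<lambda>n. \<Prod>j=a..n. (1 - eta nu j) ^ (2 ^ j))"
    proof (rule decseq_SucI)
      fix n
      have "(\<Prod>j=a..Suc n. (1 - eta nu j) ^ (2 ^ j)) \<le> (\<Prod>j=a..n. (1 - eta nu j) ^ (2 ^ j)) * 1"
      proof (cases "a \<le> Suc n")
        case True
        have "(\<Prod>j=a..Suc n. (1 - eta nu j) ^ (2 ^ j)) = (\<Prod>j=a..n. (1 - eta nu j) ^ (2 ^ j)) * (1 - eta nu (Suc n)) ^ (2 ^ Suc n)"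
          using prod.nat_ivl_Suc'[OF True, of "\<lambda>j. (1 - eta nu j) ^ (2 ^ j)"] by (simp add: mult.commute)
        also have "\<dots> \<le> (\<Prod>j=a..n. (1 - eta nu j) ^ (2 ^ j)) * 1"
          using eta_range[of nu] by (intro mult_left_mono prod_nonneg power_le_one) auto
        finally show ?thesis .
      qed simp
      then show "(\<Prod>j=a..Suc n. (1 - eta nu j) ^ (2 ^ j)) \<le> (\<Prod>j=a..n. (1 - eta nu j) ^ (2 ^ j))" by simp
    qed
    then have "convergent (\<lambda>n. \<Prod>j=a..n. (1 - eta nu j) ^ (2 ^ j))"
      using eta_range[of nu] by (intro Bseq_monoseq_convergent decseq_imp_monoseq BseqI'[of _ 1])
        (auto intro!: prod_le_1 power_le_one simp: abs_prod power_abs)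
    then show "(\<lambda>n. \<Prod>j=a..n. (1 - eta nu j) ^ (2 ^ j)) \<longlonglongrightarrow> lim (\<lambda>n. \<Prod>j=a..n. (1 - eta nu j) ^ (2 ^ j))"
      by (simp add: convergent_LIMSEQ_iff)
  qed
  show ?thesis unfolding eq by (rule LIMSEQ_unique[OF lim1 lim2])
qed

text \<open>Choose a level \<open>j\<close> where a one may die, so late that the tail of
  \<open>2^i eta\<close> is below \<open>1/2\<close>. With positive probability all words of level
  \<open>j\<close> have no child carrying a one, and given this no birth follows with probability at
  least \<open>1/2\<close>.\<close>

lemma finite_ones_prob_pos:
  assumes sm: "summable (\<lambda>j. 2 ^ j * eta nu j)"
    and death: "\<not> (\<exists>a. \<forall>j\<ge>a. measure_pmf.prob (nu True j) {(False, False)} = 0)"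
  shows "prob {\<omega> \<in> space M. finite_ones \<omega>} > 0"
proof -
  have c: "\<forall>e>0. \<exists>N. \<forall>m\<ge>N. \<forall>n. norm (\<Sum>i\<in>{m..<n}. 2 ^ i * eta nu i) < e"
    using sm unfolding summable_Cauchy .
  have "\<exists>N. \<forall>m\<ge>N. \<forall>n. norm (\<Sum>i\<in>{m..<n}. 2 ^ i * eta nu i) < 1/2"
    by (rule mp[OF spec[OF c, of "1/2"]]) simp
  then obtain J where J0: "\<forall>m\<ge>J. \<forall>n. norm (\<Sum>i\<in>{m..<n}. 2 ^ i * eta nu i) < 1/2"
    by blast
  have J: "(\<Sum>i\<in>{J..<n}. 2 ^ i * eta nu i) < 1/2" for n
    using spec[OF mp[OF spec[OF J0, of J] order_refl], of n] unfolding real_norm_def by linarith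
  obtain j where j: "j \<ge> J" "measure_pmf.prob (nu True j) {(False, False)} \<noteq> 0" using death by blast
  have eta1: "2 ^ i * eta nu i < 1/2" if "i \<ge> J" for i
  proof -
    have "2 ^ i * eta nu i \<le> (\<Sum>i\<in>{J..<Suc i}. 2 ^ i * eta nu i)"
      using that eta_range by (intro member_le_sum) auto
    then show ?thesis using J[of "Suc i"] by linarith
  qed
  let ?W = "{v :: bool list. length v = j}"
  \<comment> \<open>A lower bound for the chance of having no child that carries a one, valid for
    both labels, hence for every configuration of level \<open>j\<close>.\<close>
  define q where "q = min (pmf (nu True j) (False, False)) (1 - eta nu j)"
  have "eta nu j < 1"
  proof -
    have "1 * eta nu j \<le> 2 ^ j * eta nu j" using eta_range by (intro mult_right_mono) auto
    then show ?thesis using eta1[OF j(1)] by linarith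
  qed
  moreover have "pmf (nu True j) (False, False) > 0" using j(2) by (simp add: measure_pmf_single pmf_positive_iff pmf_eq_0_set_pmf)
  ultimately have q: "q > 0" by (simp add: q_def)
  have "Phi M X (Suc j) 0 \<ge> q ^ (2 ^ j)"
  proof -
    have "Phi M X (Suc j) 0 = expectation (\<lambda>\<omega>. 1 * (\<Prod>v\<in>?W. of_bool (children \<omega> v = (False, False))))"
    proof -
      have "Phi M X (Suc j) 0 = prob {\<omega> \<in> space M. (\<lambda>C. \<forall>v\<in>?W. v @ [False] \<notin> C \<and> v @ [True] \<notin> C) (conf (Suc j) \<omega>)}"
        unfolding Phi_0
      proof (intro arg_cong[of _ _ prob] Collect_cong conj_cong refl)
        fix \<omega>
        show "empty_gen (Suc j) \<omega> \<longleftrightarrow> (\<forall>v\<in>?W. v @ [False] \<notin> conf (Suc j) \<omega> \<and> v @ [True] \<notin> conf (Suc j) \<omega>)"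
        proof
          assume r: "\<forall>v\<in>?W. v @ [False] \<notin> conf (Suc j) \<omega> \<and> v @ [True] \<notin> conf (Suc j) \<omega>"
          show "empty_gen (Suc j) \<omega>" unfolding empty_gen_def
          proof (intro allI impI)
            fix u :: "bool list" assume "length u = Suc j"
            then obtain v b where v: "u = v @ [b]" "length v = j" by (auto simp: length_Suc_conv_rev)
            then show "\<not> X u \<omega>" using r by (cases b) (auto simp: conf_def)
          qed
        qed (auto simp: empty_gen_def conf_def)
      qed
      also have "\<dots> = expectation (\<lambda>\<omega>. 1 * (\<Prod>v\<in>?W. of_bool (children \<omega> v = (False, False))))"
        unfolding prob_conf[of "\<lambda>C. \<forall>v\<in>?W. v @ [False] \<notin> C \<and> v @ [True] \<notin> C" "Suc j"]
      proof (rule Bochner_Integration.integral_cong[OF refl])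
        fix \<omega>
        have "(\<Prod>v\<in>?W. of_bool (children \<omega> v = (False, False))) = (of_bool (\<forall>v\<in>?W. children \<omega> v = (False, False)) :: real)"
        proof (cases "\<forall>v\<in>?W. children \<omega> v = (False, False)")
          case False
          then have "(\<Prod>v\<in>?W. of_bool (children \<omega> v = (False, False))) = (0 :: real)"
            using finite_words_length by (intro prod_zero) auto
          then show ?thesis using False by (auto simp del: mem_Collect_eq)
        qed (simp add: prod.neutral)
        then show "of_bool (\<forall>v\<in>?W. v @ [False] \<notin> conf (Suc j) \<omega> \<and> v @ [True] \<notin> conf (Suc j) \<omega>) = (1 * (\<Prod>v\<in>?W. of_bool (children \<omega> v = (False, False))) :: real)"
          by (simp add: children_conf[of _ "Suc j"])
      qed
      finally show ?thesis .
    qed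
    also have "\<dots> = expectation (\<lambda>\<omega>. 1 * (\<Prod>v\<in>?W. nuE nu (X v \<omega>) j (\<lambda>p. of_bool (p = (False, False)))))"
      by (rule generation_step[of ?W j "\<lambda>_. 1" "\<lambda>_ p. of_bool (p = (False, False))"]) (use finite_words_length in auto)
    also have "\<dots> \<ge> expectation (\<lambda>\<omega>. q ^ (2 ^ j))"
    proof (rule integral_mono)
      show "integrable M (\<lambda>\<omega>. 1 * (\<Prod>v\<in>?W. nuE nu (X v \<omega>) j (\<lambda>p. of_bool (p = (False, False)))))"
        using conf_fun_integrable[of "\<lambda>C. 1 * (\<Prod>v\<in>?W. nuE nu (v \<in> C) j (\<lambda>p. of_bool (p = (False, False))))" j]
        by (simp add: X_conf[of _ j])
      fix \<omega>
      have "(\<Prod>v\<in>?W. q) \<le> (\<Prod>v\<in>?W. nuE nu (X v \<omega>) j (\<lambda>p. of_bool (p = (False, False))))"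
      proof (rule prod_mono)
        fix v :: "bool list"
        show "0 \<le> q \<and> q \<le> nuE nu (X v \<omega>) j (\<lambda>p. of_bool (p = (False, False)))"
          using q unfolding nuE_no_child by (cases "X v \<omega>") (auto simp: q_def eta_pmf)
      qed
      then show "q ^ (2 ^ j) \<le> 1 * (\<Prod>v\<in>?W. nuE nu (X v \<omega>) j (\<lambda>p. of_bool (p = (False, False))))"
        by (simp add: card_words_length)
    qed simp
    finally show ?thesis by (simp add: prob_space)
  qed
  moreover have "q ^ (2 ^ j) > 0" using q by simp
  ultimately have Phi: "Phi M X (Suc j) 0 > 0" by linarith
  have "Phi M X (Suc j) 0 / 2 \<le> prob {\<omega> \<in> space M. \<forall>i\<ge>Suc j. empty_gen i \<omega>}"
  proof (rule tendsto_lowerbound[OF empty_forever_prob])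
    show "\<forall>\<^sub>F n in sequentially. Phi M X (Suc j) 0 / 2 \<le> prob {\<omega> \<in> space M. \<forall>i\<in>{Suc j..n}. empty_gen i \<omega>}"
    proof (rule eventually_sequentiallyI[of "Suc j"])
      fix n assume n: "Suc j \<le> n"
      have "1/2 \<le> 1 - (\<Sum>i\<in>{Suc j..<n}. 2 ^ i * eta nu i)"
      proof -
        have "(\<Sum>i\<in>{Suc j..<n}. 2 ^ i * eta nu i) \<le> (\<Sum>i\<in>{J..<n}. 2 ^ i * eta nu i)"
          using j(1) eta_range by (intro sum_mono2) auto
        then show ?thesis using J[of n] by linarith
      qed
      also have "\<dots> \<le> (\<Prod>i\<in>{Suc j..<n}. 1 - 2 ^ i * eta nu i)"
      proof (rule prod_one_minus_ge)
        fix i assume "i \<in> {Suc j..<n}"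
        then have "2 ^ i * eta nu i < 1/2" using j(1) by (intro eta1) auto
        then show "0 \<le> 2 ^ i * eta nu i \<and> 2 ^ i * eta nu i \<le> 1" by (simp add: eta_range)
      qed simp
      also have "\<dots> \<le> (\<Prod>i\<in>{Suc j..<n}. (1 - eta nu i) ^ (2 ^ i))"
      proof (rule prod_mono)
        fix i assume i: "i \<in> {Suc j..<n}"
        have "1 + real (2 ^ i) * (- eta nu i) \<le> (1 + (- eta nu i)) ^ (2 ^ i)"
          using eta_range(2)[of nu i] by (intro Bernoulli_inequality) auto
        moreover have "2 ^ i * eta nu i < 1/2" using i j(1) by (intro eta1) auto
        ultimately show "0 \<le> 1 - 2 ^ i * eta nu i \<and> 1 - 2 ^ i * eta nu i \<le> (1 - eta nu i) ^ (2 ^ i)" by simp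
      qed
      finally have "Phi M X (Suc j) 0 * (1/2) \<le> Phi M X (Suc j) 0 * (\<Prod>i\<in>{Suc j..<n}. (1 - eta nu i) ^ (2 ^ i))"
        using Phi by (intro mult_left_mono) auto
      then show "Phi M X (Suc j) 0 / 2 \<le> prob {\<omega> \<in> space M. \<forall>i\<in>{Suc j..n}. empty_gen i \<omega>}"
        unfolding empty_run_prob[OF n] by simp
    qed
  qed simp
  also have "\<dots> \<le> prob {\<omega> \<in> space M. finite_ones \<omega>}"
    by (intro finite_measure_mono finite_ones_measurable) (auto simp: finite_ones_iff)
  finally show ?thesis using Phi by linarith
qed

end

section \<open>Survival\<close>

context prob_space
begin

text \<open>Complements keep the symmetric difference. For a countable union, finitely many pieces
  leave out less than \<open>e / 2\<close>, and approximating piece \<open>i\<close> within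
  \<open>e / 4\<close> times \<open>2^(-i-1)\<close> costs at most \<open>e / 4\<close> in
  total.\<close>

lemma sigma_sets_approx:
  assumes alg: "algebra (space M) A" and sub: "A \<subseteq> sets M" and D: "D \<in> sigma_sets (space M) A"
  shows "\<forall>e>0. \<exists>E\<in>A. prob ((D - E) \<union> (E - D)) < e"
  using D
proof (induction rule: sigma_sets.induct)
  interpret algebra "space M" A by (rule alg)
  have meas: "a \<in> sets M" if "a \<in> sigma_sets (space M) A" for a
    using that sub sets.sigma_sets_subset by blast
  {
    case (Basic a)
    then show ?case by (intro allI impI bexI[of _ a]) auto
  next
    case Empty
    then show ?case by (intro allI impI bexI[of _ "{}"]) auto
  next
    case (Compl a)
    show ?case
    proof (intro allI impI)
      fix e :: real assume "e > 0"
      then obtain E where E: "E \<in> A" "prob ((a - E) \<union> (E - a)) < e" using Compl.IH by blast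
      have "a \<subseteq> space M" using meas[OF Compl.hyps] sets.sets_into_space by blast
      moreover have "E \<subseteq> space M" using E(1) space_closed by blast
      ultimately have "(space M - a - (space M - E)) \<union> (space M - E - (space M - a)) = (a - E) \<union> (E - a)" by blast
      then show "\<exists>E\<in>A. prob ((space M - a - E) \<union> (E - (space M - a))) < e"
        using E by (intro bexI[of _ "space M - E"]) auto
    qed
  next
    case (Union a)
    show ?case
    proof (intro allI impI)
      fix e :: real assume e: "e > 0"
      have "\<forall>i. \<exists>E. E \<in> A \<and> prob ((a i - E) \<union> (E - a i)) < e / 4 * (1/2) ^ Suc i"
      proof
        fix i
        have "0 < e / 4 * (1/2) ^ Suc i" using e by simp
        then show "\<exists>E. E \<in> A \<and> prob ((a i - E) \<union> (E - a i)) < e / 4 * (1/2) ^ Suc i" using Union.IH[of i] by blast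
      qed
      from choice[OF this] obtain E where E: "\<And>i. E i \<in> A" "\<And>i. prob ((a i - E i) \<union> (E i - a i)) < e / 4 * (1/2) ^ Suc i" by blast
      have am: "a i \<in> sets M" for i using meas[OF Union.hyps] .
      have Em: "E i \<in> sets M" for i using E(1) sub by blast
      have "(\<lambda>n. prob (\<Union>i<n. a i)) \<longlonglongrightarrow> prob (\<Union>n. \<Union>i<n. a i)"
        by (rule finite_Lim_measure_incseq) (use am in \<open>auto intro!: incseq_SucI simp: lessThan_Suc\<close>)
      also have "(\<Union>n. \<Union>i<n. a i) = (\<Union>i. a i)" by auto
      finally have "\<exists>n. prob (\<Union>i. a i) - e / 2 < prob (\<Union>i<n. a i)"
        using e by (intro eventually_happens'[OF sequentially_bot] order_tendstoD(1)) auto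
      then obtain n where n: "prob (\<Union>i. a i) - e / 2 < prob (\<Union>i<n. a i)" by blast
      let ?F = "\<Union>i<n. E i"
      have FA: "?F \<in> A" using E(1) by auto
      have d1: "prob ((\<Union>i. a i) - (\<Union>i<n. a i)) < e / 2"
        using n am by (subst finite_measure_Diff) auto
      have "prob (((\<Union>i. a i) - ?F) \<union> (?F - (\<Union>i. a i))) \<le> prob (((\<Union>i. a i) - (\<Union>i<n. a i)) \<union> (\<Union>i<n. (a i - E i) \<union> (E i - a i)))"
        using am Em by (intro finite_measure_mono) (blast, auto)
      also have "\<dots> \<le> prob ((\<Union>i. a i) - (\<Union>i<n. a i)) + prob (\<Union>i<n. (a i - E i) \<union> (E i - a i))"
        using am Em by (intro measure_subadditive) (auto simp: emeasure_eq_measure)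
      also have "prob (\<Union>i<n. (a i - E i) \<union> (E i - a i)) \<le> (\<Sum>i<n. prob ((a i - E i) \<union> (E i - a i)))"
        using am Em by (intro finite_measure_subadditive_finite) auto
      also have "\<dots> \<le> (\<Sum>i<n. e / 4 * (1/2) ^ Suc i)" by (intro sum_mono less_imp_le E)
      also have "\<dots> = e / 4 * (\<Sum>i<n. (1/2) ^ Suc i)" by (simp only: sum_distrib_left)
      also have "\<dots> \<le> e / 4 * 1"
      proof (rule mult_left_mono)
        have "(\<Sum>i<n. (1/2::real) ^ Suc i) \<le> (\<Sum>i. (1/2) ^ Suc i)"
          using power_half_series sums_summable by (intro sum_le_suminf) auto
        also have "\<dots> = 1" using sums_unique[OF power_half_series] by simp
        finally show "(\<Sum>i<n. (1/2::real) ^ Suc i) \<le> 1" .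
      qed (use e in simp)
      finally show "\<exists>E\<in>A. prob (((\<Union>i. a i) - E) \<union> (E - (\<Union>i. a i))) < e"
        using d1 e FA by (intro bexI[of _ ?F]) auto
    qed
  }
qed

text \<open>Continuity from above: the tail unions decrease, and each contains its first
  event.\<close>

lemma prob_infinitely_often_ge:
  fixes B :: "nat \<Rightarrow> 'a set"
  assumes B: "\<And>k. B k \<in> sets M" and b: "\<And>k. k \<ge> k0 \<Longrightarrow> b \<le> prob (B k)"
  shows "b \<le> prob (\<Inter>n. \<Union>k\<in>{n..}. B k)"
proof (rule tendsto_lowerbound)
  show "(\<lambda>n. prob (\<Union>k\<in>{n..}. B k)) \<longlonglongrightarrow> prob (\<Inter>n. \<Union>k\<in>{n..}. B k)"
  proof (rule finite_Lim_measure_decseq)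
    show "decseq (\<lambda>n. \<Union>k\<in>{n..}. B k)" by (rule decseq_SucI) (auto intro: Suc_leD)
  qed (use B in auto)
  show "\<forall>\<^sub>F n in sequentially. b \<le> prob (\<Union>k\<in>{n..}. B k)"
  proof (rule eventually_sequentiallyI[of k0])
    fix n assume "k0 \<le> n"
    then have "b \<le> prob (B n)" by (rule b)
    also have "\<dots> \<le> prob (\<Union>k\<in>{n..}. B k)" using B by (intro finite_measure_mono) auto
    finally show "b \<le> prob (\<Union>k\<in>{n..}. B k)" .
  qed
qed simp

end

lemma geometric_tail_sum:
  fixes r :: real
  assumes "0 < r" "r < 1" "i \<le> k"
  shows "(\<Sum>l\<in>{i..<k}. r ^ Suc l) + r ^ k \<le> 2 * r ^ i / (1 - r)"
proof -
  have eq: "(\<Sum>l\<in>{i..<k}. r ^ Suc l) * (1 - r) = r ^ Suc i - r ^ Suc k"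
    using assms(3)
  proof (induction k rule: dec_induct)
    case (step n)
    have "(\<Sum>l\<in>{i..<Suc n}. r ^ Suc l) = (\<Sum>l\<in>{i..<n}. r ^ Suc l) + r ^ Suc n" using step.hyps by simp
    then have "(\<Sum>l\<in>{i..<Suc n}. r ^ Suc l) * (1 - r) = (r ^ Suc i - r ^ Suc n) + r ^ Suc n * (1 - r)"
      by (simp only: distrib_right step.IH)
    then show ?case by (simp add: algebra_simps)
  qed simp
  have p: "r ^ Suc i \<le> r ^ i" "r ^ k \<le> r ^ i" "0 \<le> r ^ Suc k"
    using assms by (auto intro!: power_decreasing)
  have "((\<Sum>l\<in>{i..<k}. r ^ Suc l) + r ^ k) * (1 - r) = r ^ Suc i - r ^ Suc k + (r ^ k - r ^ Suc k)"
    unfolding distrib_right eq by (simp add: algebra_simps)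
  also have "\<dots> \<le> 2 * r ^ i" using p by linarith
  finally show ?thesis using assms by (simp add: pos_le_divide_eq)
qed

context markov_bool_tree
begin

definition conf_events :: "'a set set" where
  "conf_events = {{\<omega> \<in> space M. P (conf n \<omega>)} | n P. True}"

text \<open>Events of finitely many generations approximate only the members of the sigma-algebra
  they generate, possibly smaller than that of \<open>M\<close>. Survival and richness are therefore
  shown to belong to it.\<close>

definition conf_sigma :: "'a measure" where
  "conf_sigma = sigma (space M) conf_events"

lemma conf_eventsI: "{\<omega> \<in> space M. P (conf n \<omega>)} \<in> conf_events"
  by (auto simp: conf_events_def)

lemma conf_events_sets: "conf_events \<subseteq> sets M"
  using conf_pred by (auto simp: conf_events_def)

lemma conf_events_algebra: "algebra (space M) conf_events"
  unfolding algebra_iff_Un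
proof (intro conjI ballI)
  show "conf_events \<subseteq> Pow (space M)" by (auto simp: conf_events_def)
  show "{} \<in> conf_events" using conf_eventsI[of "\<lambda>_. False" 0] by simp
next
  fix a assume "a \<in> conf_events"
  then obtain n P where "a = {\<omega> \<in> space M. P (conf n \<omega>)}" by (auto simp: conf_events_def)
  then have "space M - a = {\<omega> \<in> space M. \<not> P (conf n \<omega>)}" by auto
  then show "space M - a \<in> conf_events" using conf_eventsI[of "\<lambda>C. \<not> P C" n] by simp
next
  fix a b assume "a \<in> conf_events" "b \<in> conf_events"
  then obtain n P m Q where ab: "a = {\<omega> \<in> space M. P (conf n \<omega>)}" "b = {\<omega> \<in> space M. Q (conf m \<omega>)}" by (auto simp: conf_events_def)
  let ?N = "max n m"
  have "conf n \<omega> = {v \<in> conf ?N \<omega>. length v \<le> n}" "conf m \<omega> = {v \<in> conf ?N \<omega>. length v \<le> m}" for \<omega>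
    by (rule conf_restrict, simp)+
  then have "a \<union> b = {\<omega> \<in> space M. (\<lambda>C. P {v \<in> C. length v \<le> n} \<or> Q {v \<in> C. length v \<le> m}) (conf ?N \<omega>)}"
    unfolding ab by auto
  then show "a \<union> b \<in> conf_events" using conf_eventsI by simp
qed

lemma sets_conf_sigma: "sets conf_sigma = sigma_sets (space M) conf_events"
proof -
  have "conf_events \<subseteq> Pow (space M)" by (auto simp: conf_events_def)
  then show ?thesis by (simp add: conf_sigma_def)
qed

lemma space_conf_sigma: "space conf_sigma = space M"
  by (simp add: conf_sigma_def space_measure_of_conv)

lemma conf_sigma_subset: "sets conf_sigma \<subseteq> sets M"
  unfolding sets_conf_sigma by (rule sets.sigma_sets_subset[OF conf_events_sets])

lemma conf_pred_sigma: "{\<omega> \<in> space conf_sigma. P (conf n \<omega>)} \<in> sets conf_sigma"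
  unfolding sets_conf_sigma space_conf_sigma by (rule sigma_sets.Basic[OF conf_eventsI])

definition survives :: "nat \<Rightarrow> 'a \<Rightarrow> bool" where
  "survives j \<omega> \<longleftrightarrow> (\<forall>n. 1 \<le> Z j [] (j + n) \<omega>)"

lemma Z_pred_sigma: "{\<omega> \<in> space conf_sigma. P (Z j v n \<omega>)} \<in> sets conf_sigma"
  unfolding Z_eq_conf[OF order_refl] by (rule conf_pred_sigma[of "\<lambda>C. P (card (desc_conf j v n C))" n])

lemma Z_pred: "{\<omega> \<in> space M. P (Z j v n \<omega>)} \<in> sets M"
  using Z_pred_sigma conf_sigma_subset unfolding space_conf_sigma by blast

lemma survives_sigma: "{\<omega> \<in> space conf_sigma. survives j \<omega>} \<in> sets conf_sigma"
  unfolding survives_def by (rule sets.sets_Collect_countable_All) (rule Z_pred_sigma)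

lemma survives_sets: "{\<omega> \<in> space M. survives j \<omega>} \<in> sets M"
  using survives_sigma conf_sigma_subset unfolding space_conf_sigma by blast

lemma Z_mono_pos:
  assumes "j \<le> n" "n \<le> k" "1 \<le> Z j [] k \<omega>"
  shows "1 \<le> Z j [] n \<omega>"
  using assms(2,3)
proof (induction k rule: dec_induct)
  case (step k)
  have "Z j [] (Suc k) \<omega> = (\<Sum>u\<in>desc j [] k \<omega>. kids (children \<omega> u))"
    using step.hyps assms(1) by (intro Z_Suc) auto
  then have "desc j [] k \<omega> \<noteq> {}" using step.prems by auto
  then have "1 \<le> Z j [] k \<omega>" unfolding Z_def using finite_descendants by (simp add: card_gt_0_iff Suc_le_eq)
  then show ?case by (rule step.IH)
qed

lemma survivesD: "survives j \<omega> \<Longrightarrow> j \<le> n \<Longrightarrow> 1 \<le> Z j [] n \<omega>"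
  unfolding survives_def by (metis le_add_diff_inverse)

lemma Z_root_le: "Z j [] n \<omega> \<le> 2 ^ n"
proof -
  have "card (desc j [] n \<omega>) \<le> card {v :: bool list. length v = n}"
    by (intro card_mono finite_words_length) (auto simp: descendants_def)
  then show ?thesis by (simp add: Z_def card_words_length)
qed

lemma Z_integrable: "integrable M (\<lambda>\<omega>. f (Z j v n \<omega>) :: real)"
  using Z_fun_integrable[of n n "\<lambda>_. 1" f j v] by simp

lemma Z_mean_le: "expectation (\<lambda>\<omega>. real (Z j [] n \<omega>)) \<le> 2 ^ n"
proof -
  have "expectation (\<lambda>\<omega>. real (Z j [] n \<omega>)) \<le> expectation (\<lambda>\<omega>. 2 ^ n)"
  proof (rule integral_mono)
    fix \<omega>
    have "real (Z j [] n \<omega>) \<le> real (2 ^ n)" using Z_root_le by (simp only: of_nat_le_iff)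
    then show "real (Z j [] n \<omega>) \<le> 2 ^ n" by simp
  qed (auto intro: Z_integrable)
  then show ?thesis by (simp add: prob_space)
qed

lemma mean_growth_root:
  assumes "j \<le> n"
  shows "expectation (\<lambda>\<omega>. real (Z j [] n \<omega>)) \<le> mean_prod nu j n * 2 ^ j"
proof -
  have "expectation (\<lambda>\<omega>. real (Z j [] n \<omega>)) = mean_prod nu j n * expectation (\<lambda>\<omega>. real (Z j [] j \<omega>))"
    using mean_growth[of j n j "[]" "\<lambda>_. 1"] assms by simp
  also have "\<dots> \<le> mean_prod nu j n * 2 ^ j"
    using gam_nonneg by (intro mult_left_mono Z_mean_le) (auto simp: mean_prod_def intro: prod_nonneg)
  finally show ?thesis .
qed

section \<open>Criteria for survival and for extinction\<close>

lemma markov_Z: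
  assumes "a > 0"
  shows "prob {\<omega> \<in> space M. a \<le> real (Z j [] n \<omega>)} \<le> expectation (\<lambda>\<omega>. real (Z j [] n \<omega>)) / a"
  by (rule integral_Markov_inequality_measure[of _ _ "{}"]) (use assms Z_integrable in auto)

lemma survives_null_of_mean:
  assumes "\<And>e. e > 0 \<Longrightarrow> \<exists>n\<ge>j. mean_prod nu j n < e"
  shows "AE \<omega> in M. \<not> survives j \<omega>"
proof -
  have "prob {\<omega> \<in> space M. survives j \<omega>} \<le> 0"
  proof (rule field_le_epsilon)
    fix e :: real assume "e > 0"
    then obtain n where n: "j \<le> n" "mean_prod nu j n < e / 2 ^ j" using assms[of "e / 2 ^ j"] by auto
    have "prob {\<omega> \<in> space M. survives j \<omega>} \<le> prob {\<omega> \<in> space M. 1 \<le> real (Z j [] n \<omega>)}"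
      using survivesD[OF _ n(1)] by (intro finite_measure_mono Z_pred[of "\<lambda>z. 1 \<le> real z"]) auto
    also have "\<dots> \<le> expectation (\<lambda>\<omega>. real (Z j [] n \<omega>))" using markov_Z[of 1 j n] by simp
    also have "\<dots> \<le> mean_prod nu j n * 2 ^ j" by (rule mean_growth_root[OF n(1)])
    also have "\<dots> \<le> e" using n(2) by (simp add: field_simps)
    finally show "prob {\<omega> \<in> space M. survives j \<omega>} \<le> 0 + e" by simp
  qed
  then show ?thesis
    using survives_sets by (subst AE_iff_measurable[OF _ refl]) (auto simp: emeasure_eq_measure measure_le_0_iff)
qed

lemma survival_at_prob:
  assumes "j \<le> n"
  shows "prob {\<omega> \<in> space M. P (conf n \<omega>) \<and> 1 \<le> Z j [] (n + k) \<omega>} = expectation (\<lambda>\<omega>. of_bool (P (conf n \<omega>)) * (1 - (1 - surv_prob n k) ^ Z j [] n \<omega>))"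
proof -
  let ?N = "n + k"
  have "prob {\<omega> \<in> space M. P (conf n \<omega>) \<and> 1 \<le> Z j [] ?N \<omega>} = prob {\<omega> \<in> space M. (\<lambda>C. P {v \<in> C. length v \<le> n} \<and> 1 \<le> card (desc_conf j [] ?N C)) (conf ?N \<omega>)}"
    by (simp add: conf_restrict[of n ?N] Z_eq_conf[of ?N ?N])
  also have "\<dots> = expectation (\<lambda>\<omega>. of_bool ((\<lambda>C. P {v \<in> C. length v \<le> n} \<and> 1 \<le> card (desc_conf j [] ?N C)) (conf ?N \<omega>)))"
    by (rule prob_conf)
  also have "\<dots> = expectation (\<lambda>\<omega>. of_bool (P (conf n \<omega>)) - of_bool (P (conf n \<omega>)) * 0 ^ Z j [] ?N \<omega>)"
  proof (rule Bochner_Integration.integral_cong[OF refl])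
    fix \<omega>
    have "of_bool (P (conf n \<omega>) \<and> 1 \<le> Z j [] ?N \<omega>) = (of_bool (P (conf n \<omega>)) - of_bool (P (conf n \<omega>)) * 0 ^ Z j [] ?N \<omega> :: real)"
      by (cases "Z j [] ?N \<omega>") auto
    then show "of_bool (P {v \<in> conf ?N \<omega>. length v \<le> n} \<and> 1 \<le> card (desc_conf j [] ?N (conf ?N \<omega>))) = (of_bool (P (conf n \<omega>)) - of_bool (P (conf n \<omega>)) * 0 ^ Z j [] ?N \<omega> :: real)"
      by (simp add: conf_restrict[of n ?N] Z_eq_conf[of ?N ?N])
  qed
  also have "\<dots> = expectation (\<lambda>\<omega>. of_bool (P (conf n \<omega>))) - expectation (\<lambda>\<omega>. of_bool (P (conf n \<omega>)) * 0 ^ Z j [] ?N \<omega>)"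
  proof (rule Bochner_Integration.integral_diff)
    show "integrable M (\<lambda>\<omega>. of_bool (P (conf n \<omega>)) :: real)" by (rule conf_fun_integrable[of "\<lambda>C. of_bool (P C)" n])
    show "integrable M (\<lambda>\<omega>. of_bool (P (conf n \<omega>)) * 0 ^ Z j [] ?N \<omega> :: real)"
      using Z_fun_integrable[of ?N ?N "\<lambda>C. of_bool (P {v \<in> C. length v \<le> n})" "\<lambda>z. 0 ^ z" j "[]"] by (simp add: conf_restrict[of n ?N])
  qed
  also have "expectation (\<lambda>\<omega>. of_bool (P (conf n \<omega>)) * 0 ^ Z j [] ?N \<omega>) = expectation (\<lambda>\<omega>. of_bool (P (conf n \<omega>)) * (1 - surv_prob n k) ^ Z j [] n \<omega>)"
    by (rule extinction_generating_function[of j n "[]" "\<lambda>C. of_bool (P C)"]) (use assms in auto)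
  also have "expectation (\<lambda>\<omega>. of_bool (P (conf n \<omega>))) - \<dots> = expectation (\<lambda>\<omega>. of_bool (P (conf n \<omega>)) - of_bool (P (conf n \<omega>)) * (1 - surv_prob n k) ^ Z j [] n \<omega>)"
  proof (rule Bochner_Integration.integral_diff[symmetric])
    show "integrable M (\<lambda>\<omega>. of_bool (P (conf n \<omega>)) :: real)" by (rule conf_fun_integrable[of "\<lambda>C. of_bool (P C)" n])
    show "integrable M (\<lambda>\<omega>. of_bool (P (conf n \<omega>)) * (1 - surv_prob n k) ^ Z j [] n \<omega> :: real)"
      by (rule Z_fun_integrable[of n n "\<lambda>C. of_bool (P C)" "\<lambda>z. (1 - surv_prob n k) ^ z" j "[]"]) simp
  qed
  finally show ?thesis by (simp add: right_diff_distrib)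
qed

lemma one_minus_power_le:
  assumes "0 \<le> (s::real)" "s \<le> 1"
  shows "1 - (1 - s) ^ z \<le> real z * s"
  using Bernoulli_inequality[of "- s" z] assms by simp

text \<open>The survival probability of a single one is at most \<open>2 / vs_sum\<close> by the
  lower bound on its inverse, and generation \<open>j\<close> has at most \<open>2^j\<close>
  ones.\<close>

lemma survives_null_of_varsigma:
  assumes pos: "\<And>l. j \<le> l \<Longrightarrow> gam nu l > 0" and unb: "\<And>B. \<exists>n\<ge>j. B < vs_sum nu j n"
  shows "AE \<omega> in M. \<not> survives j \<omega>"
proof -
  have "prob {\<omega> \<in> space M. survives j \<omega>} \<le> 0"
  proof (rule field_le_epsilon)
    fix e :: real assume e: "e > 0"
    obtain n where n: "j \<le> n" "2 * 2 ^ j / e < vs_sum nu j n" using unb by blast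
    define k where "k = n - j"
    have k: "n = j + k" using n(1) by (simp add: k_def)
    have b: "0 < surv_prob j k" "surv_prob j k \<le> 1" "1 / mean_prod nu j n + vs_sum nu j n / 2 \<le> 1 / surv_prob j k"
      using surv_prob_bounds[of j k, OF pos] k by auto
    have m: "mean_prod nu j n > 0" unfolding mean_prod_def using pos by (intro prod_pos) auto
    have "2 ^ j / e < 1 / surv_prob j k"
    proof -
      have "2 ^ j / e = (2 * 2 ^ j / e) / 2" by simp
      also have "\<dots> < vs_sum nu j n / 2" using n(2) by (intro divide_strict_right_mono) auto
      also have "\<dots> \<le> 1 / surv_prob j k" using b(3) m by (smt (verit) zero_less_divide_1_iff)
      finally show ?thesis .
    qed
    then have se: "2 ^ j * surv_prob j k < e" using e b(1) by (simp add: field_simps)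
    have "prob {\<omega> \<in> space M. survives j \<omega>} \<le> prob {\<omega> \<in> space M. True \<and> 1 \<le> Z j [] (j + k) \<omega>}"
      using survivesD[of j _ "j + k"] Z_pred[of "\<lambda>z. 1 \<le> z"] by (intro finite_measure_mono) auto
    also have "\<dots> = expectation (\<lambda>\<omega>. 1 - (1 - surv_prob j k) ^ Z j [] j \<omega>)"
      using survival_at_prob[of j j "\<lambda>_. True" k] by simp
    also have "\<dots> \<le> expectation (\<lambda>\<omega>. real (Z j [] j \<omega>) * surv_prob j k)"
      using b by (intro integral_mono Z_integrable[where f = "\<lambda>z. 1 - (1 - surv_prob j k) ^ z"] Z_integrable[where f = "\<lambda>z. real z * surv_prob j k"] one_minus_power_le) auto
    also have "\<dots> = expectation (\<lambda>\<omega>. real (Z j [] j \<omega>)) * surv_prob j k" by simp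
    also have "\<dots> \<le> 2 ^ j * surv_prob j k" using b by (intro mult_right_mono Z_mean_le) auto
    finally show "prob {\<omega> \<in> space M. survives j \<omega>} \<le> 0 + e" using se by simp
  qed
  then show ?thesis
    using survives_sets by (subst AE_iff_measurable[OF _ refl]) (auto simp: emeasure_eq_measure measure_le_0_iff)
qed

text \<open>The bound \<open>C\<close> on the inverse survival probability is uniform in the
  horizon. A single one at level \<open>j\<close> thus reaches every later level with probability at
  least \<open>1 / C\<close>, and these events decrease to survival.\<close>

lemma survives_prob_pos:
  assumes pos: "\<And>l. j \<le> l \<Longrightarrow> gam nu l > 0"
    and bd: "\<And>n. j \<le> n \<Longrightarrow> 1 / mean_prod nu j n + vs_sum nu j n \<le> C"
    and start: "prob {\<omega> \<in> space M. 1 \<le> Z j [] j \<omega>} > 0"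
  shows "prob {\<omega> \<in> space M. survives j \<omega>} > 0"
proof -
  let ?q = "prob {\<omega> \<in> space M. 1 \<le> Z j [] j \<omega>}"
  have C: "C > 0" using bd[of j] by (simp add: vs_sum_def)
  have low: "?q / C \<le> prob {\<omega> \<in> space M. 1 \<le> Z j [] (j + k) \<omega>}" for k
  proof -
    have b: "0 < surv_prob j k" "surv_prob j k \<le> 1" "1 / surv_prob j k \<le> C"
      using surv_prob_bounds[of j k, OF pos] bd[of "j + k"] by force+
    then have sC: "1 / C \<le> surv_prob j k" using C by (simp add: field_simps)
    have "?q / C = expectation (\<lambda>\<omega>. of_bool (1 \<le> Z j [] j \<omega>)) / C"
      using prob_conf[of "\<lambda>C. 1 \<le> card (desc_conf j [] j C)" j] by (simp add: Z_eq_conf[of j j])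
    also have "\<dots> = expectation (\<lambda>\<omega>. of_bool (1 \<le> Z j [] j \<omega>) / C)" by simp
    also have "\<dots> \<le> expectation (\<lambda>\<omega>. 1 - (1 - surv_prob j k) ^ Z j [] j \<omega>)"
    proof (intro integral_mono Z_integrable[where f = "\<lambda>z. 1 - (1 - surv_prob j k) ^ z"] Z_integrable[where f = "\<lambda>z. of_bool (1 \<le> z) / C"])
      fix \<omega>
      show "of_bool (1 \<le> Z j [] j \<omega>) / C \<le> 1 - (1 - surv_prob j k) ^ Z j [] j \<omega>"
      proof (cases "1 \<le> Z j [] j \<omega>")
        case True
        then have "(1 - surv_prob j k) ^ Z j [] j \<omega> \<le> (1 - surv_prob j k) ^ 1"
          using b by (intro power_decreasing) auto
        then show ?thesis using True sC by simp
      next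
        case False
        then have "Z j [] j \<omega> = 0" by simp
        then show ?thesis by simp
      qed
    qed
    also have "\<dots> = prob {\<omega> \<in> space M. 1 \<le> Z j [] (j + k) \<omega>}"
      using survival_at_prob[of j j "\<lambda>_. True" k] by simp
    finally show ?thesis .
  qed
  have lim: "(\<lambda>k. prob {\<omega> \<in> space M. 1 \<le> Z j [] (j + k) \<omega>}) \<longlonglongrightarrow> prob (\<Inter>k. {\<omega> \<in> space M. 1 \<le> Z j [] (j + k) \<omega>})"
  proof (rule finite_Lim_measure_decseq)
    show "range (\<lambda>k. {\<omega> \<in> space M. 1 \<le> Z j [] (j + k) \<omega>}) \<subseteq> sets M" using Z_pred[of "\<lambda>z. 1 \<le> z"] by blast
    show "decseq (\<lambda>k. {\<omega> \<in> space M. 1 \<le> Z j [] (j + k) \<omega>})"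
    proof (rule decseq_SucI, rule subsetI)
      fix k \<omega> assume "\<omega> \<in> {\<omega> \<in> space M. 1 \<le> Z j [] (j + Suc k) \<omega>}"
      then show "\<omega> \<in> {\<omega> \<in> space M. 1 \<le> Z j [] (j + k) \<omega>}"
        using Z_mono_pos[of j "j + k" "j + Suc k" \<omega>] by simp
    qed
  qed
  have "(\<Inter>k. {\<omega> \<in> space M. 1 \<le> Z j [] (j + k) \<omega>}) = {\<omega> \<in> space M. survives j \<omega>}"
    by (auto simp: survives_def)
  with lim have "(\<lambda>k. prob {\<omega> \<in> space M. 1 \<le> Z j [] (j + k) \<omega>}) \<longlonglongrightarrow> prob {\<omega> \<in> space M. survives j \<omega>}" by simp
  then have "?q / C \<le> prob {\<omega> \<in> space M. survives j \<omega>}"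
    by (rule tendsto_lowerbound) (use low in auto)
  moreover have "?q / C > 0" using start C by simp
  ultimately show ?thesis by linarith
qed

end

section \<open>Energy bounds\<close>

context markov_bool_tree
begin

abbreviation energy :: "real \<Rightarrow> nat \<Rightarrow> nat \<Rightarrow> 'a \<Rightarrow> real" where
  "energy s j k \<omega> \<equiv> tree_energy s j (branch j (\<lambda>u. X u \<omega>)) k"

lemma energy_Z: "energy s j k \<omega> = (\<Sum>i\<in>{j..k}. \<Sum>v\<in>{v. length v = i}. 2 powr (s * real i) * (real (Z j v k \<omega>))\<^sup>2)"
  unfolding tree_energy_def Z_def ..

lemma energy_conf: "energy s j k \<omega> = (\<lambda>C. \<Sum>i\<in>{j..k}. \<Sum>v\<in>{v. length v = i}. 2 powr (s * real i) * (real (card (desc_conf j v k C)))\<^sup>2) (conf k \<omega>)"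
  unfolding energy_Z Z_eq_conf[OF order_refl] ..

lemma energy_integrable: "integrable M (energy s j k)"
  unfolding energy_conf by (rule conf_fun_integrable[of "\<lambda>C. \<Sum>i\<in>{j..k}. \<Sum>v\<in>{v. length v = i}. 2 powr (s * real i) * (real (card (desc_conf j v k C)))\<^sup>2" k])

lemma energy_nonneg: "0 \<le> energy s j k \<omega>"
  unfolding tree_energy_def by (intro sum_nonneg) auto

lemma Z_own_generation:
  assumes "length v = i"
  shows "Z j v i \<omega> = of_bool (v \<in> desc j [] i \<omega>)"
proof -
  have "desc j v i \<omega> = (if v \<in> desc j [] i \<omega> then {v} else {})"
    using assms unfolding descendants_def by auto
  then show ?thesis by (simp add: Z_def)
qed

lemma sum_Z_own_generation: "(\<Sum>v\<in>{v. length v = i}. real (Z j v i \<omega>)) = real (Z j [] i \<omega>)"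
proof -
  have "(\<Sum>v\<in>{v. length v = i}. real (Z j v i \<omega>)) = (\<Sum>v\<in>{v. length v = i}. of_bool (v \<in> desc j [] i \<omega>))"
    by (intro sum.cong) (auto simp: Z_own_generation)
  also have "\<dots> = (\<Sum>v\<in>desc j [] i \<omega>. of_bool (v \<in> desc j [] i \<omega>))"
    using finite_words_length by (intro sum.mono_neutral_right) (auto simp: descendants_def)
  finally show ?thesis by (simp add: Z_def)
qed

text \<open>A word has at most one descendant in its own generation, so the factorial moment starts
  from zero; only the contribution of splittings and the mean remain.\<close>

lemma second_moment:
  assumes "length v = i" "j \<le> i" "i \<le> k" and pos: "\<And>l. i \<le> l \<Longrightarrow> gam nu l > 0"
  shows "expectation (\<lambda>\<omega>. (real (Z j v k \<omega>))\<^sup>2) = ((mean_prod nu i k)\<^sup>2 * vs_sum nu i k + mean_prod nu i k) * expectation (\<lambda>\<omega>. real (Z j v i \<omega>))"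
proof -
  have e: "expectation (\<lambda>\<omega>. real (Z j v i \<omega>) * (real (Z j v i \<omega>) - 1)) = 0"
  proof -
    have "real (Z j v i \<omega>) * (real (Z j v i \<omega>) - 1) = 0" for \<omega>
      by (cases "v \<in> desc j [] i \<omega>") (simp_all add: Z_own_generation[OF assms(1)])
    then show ?thesis by (simp only: Bochner_Integration.integral_zero)
  qed
  have "expectation (\<lambda>\<omega>. (real (Z j v k \<omega>))\<^sup>2) = expectation (\<lambda>\<omega>. real (Z j v k \<omega>) * (real (Z j v k \<omega>) - 1) + real (Z j v k \<omega>))"
    by (simp add: power2_eq_square algebra_simps)
  also have "\<dots> = expectation (\<lambda>\<omega>. real (Z j v k \<omega>) * (real (Z j v k \<omega>) - 1)) + expectation (\<lambda>\<omega>. real (Z j v k \<omega>))"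
    by (rule Bochner_Integration.integral_add[OF Z_integrable[where f = "\<lambda>z. real z * (real z - 1)"] Z_integrable[where f = real]])
  also have "expectation (\<lambda>\<omega>. real (Z j v k \<omega>) * (real (Z j v k \<omega>) - 1)) = (mean_prod nu i k)\<^sup>2 * (vs_sum nu i k * expectation (\<lambda>\<omega>. real (Z j v i \<omega>)))"
    using factorial_growth[of i k j v "\<lambda>_. 1", OF assms(3,2) _ pos] assms(1) e by simp
  also have "expectation (\<lambda>\<omega>. real (Z j v k \<omega>)) = mean_prod nu i k * expectation (\<lambda>\<omega>. real (Z j v i \<omega>))"
    using mean_growth[of i k j v "\<lambda>_. 1", OF assms(3,2)] assms(1) by simp
  finally show ?thesis by (simp add: algebra_simps)
qed

lemma mean_prod_pos:
  assumes "\<And>l. j \<le> l \<Longrightarrow> gam nu l > 0" "j \<le> i"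
  shows "mean_prod nu i k > 0"
  unfolding mean_prod_def using assms by (intro prod_pos) auto

text \<open>By \<open>2 * split_prob \<le> gam\<close> a term is at most an inverse mean. Division
  by \<open>mean_prod nu j i\<close> moves the base of the products from \<open>i\<close> to
  \<open>j\<close>, where growth is assumed.\<close>

lemma vs_sum_tail:
  assumes pos: "\<And>l. j \<le> l \<Longrightarrow> gam nu l > 0" and "j \<le> i"
  shows "vs_sum nu i k / mean_prod nu j i \<le> (\<Sum>l\<in>{i..<k}. 1 / mean_prod nu j (Suc l))"
  unfolding vs_sum_def sum_divide_distrib
proof (rule sum_mono)
  fix l assume l: "l \<in> {i..<k}"
  have g: "gam nu l > 0" using pos l assms(2) by simp
  have m: "mean_prod nu j (Suc l) > 0" using mean_prod_pos[OF pos order_refl] .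
  have "mean_prod nu j i * mean_prod nu i (Suc l) = mean_prod nu j (Suc l)"
    using l assms(2) by (intro mean_prod_mult) auto
  then have "2 * split_prob nu l / (gam nu l * mean_prod nu i (Suc l)) / mean_prod nu j i = 2 * split_prob nu l / gam nu l * (1 / mean_prod nu j (Suc l))"
    by (simp add: mult_ac)
  also have "\<dots> \<le> 1 * (1 / mean_prod nu j (Suc l))"
    using two_split_prob_le[of nu l] g m by (intro mult_right_mono) auto
  finally show "2 * split_prob nu l / (gam nu l * mean_prod nu i (Suc l)) / mean_prod nu j i \<le> 1 / mean_prod nu j (Suc l)" by simp
qed

text \<open>After division by the squared mean, level \<open>i\<close> contributes at most
  \<open>2^j 2^(s i)\<close> times
  \<open>vs_sum nu i k / mean_prod nu j i + 1 / mean_prod nu j k\<close>. Growth of the means like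
  \<open>2^(s' n)\<close> at all levels makes this decay with ratio \<open>2^(s - s')\<close>, so
  the sum is bounded in \<open>k\<close>.\<close>

lemma energy_bound:
  assumes pos: "\<And>l. j \<le> l \<Longrightarrow> gam nu l > 0" and s: "s < s'" "0 < s'" and c0: "c0 > 0"
    and grow: "\<And>n. j \<le> n \<Longrightarrow> c0 * 2 powr (s' * real n) \<le> mean_prod nu j n"
  shows "\<exists>K>0. \<forall>k\<ge>j. expectation (energy s j k) \<le> K * (mean_prod nu j k)\<^sup>2"
proof -
  define r where "r = 2 powr (- s')"
  define \<rho> where "\<rho> = 2 powr (s - s')"
  have r: "0 < r" "r < 1" unfolding r_def using s by (auto simp: powr_less_one)
  have \<rho>: "0 < \<rho>" "\<rho> < 1" unfolding \<rho>_def using s by (auto simp: powr_less_one)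
  have inv: "1 / mean_prod nu j n \<le> r ^ n / c0" if "j \<le> n" for n
  proof -
    have rn: "r ^ n = 1 / 2 powr (s' * real n)"
    proof -
      have "r ^ n = 2 powr (- (s' * real n))" by (simp add: r_def powr_realpow[symmetric] powr_powr)
      then show ?thesis by (simp add: powr_minus divide_inverse)
    qed
    have "1 / mean_prod nu j n \<le> 1 / (c0 * 2 powr (s' * real n))"
      using grow[OF that] c0 mean_prod_pos[OF pos order_refl] by (intro divide_left_mono) auto
    then show ?thesis by (simp add: rn mult.commute)
  qed
  define D where "D = 2 / (c0 * (1 - r))"
  have D: "D > 0" using c0 r by (simp add: D_def)
  have level: "vs_sum nu i k / mean_prod nu j i + 1 / mean_prod nu j k \<le> D * r ^ i" if ik: "j \<le> i" "i \<le> k" for i k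
  proof -
    have "vs_sum nu i k / mean_prod nu j i + 1 / mean_prod nu j k \<le> (\<Sum>l\<in>{i..<k}. 1 / mean_prod nu j (Suc l)) + 1 / mean_prod nu j k"
      using vs_sum_tail[OF pos ik(1)] by simp
    also have "\<dots> \<le> (\<Sum>l\<in>{i..<k}. r ^ Suc l / c0) + r ^ k / c0"
      using ik by (intro add_mono sum_mono inv) auto
    also have "\<dots> = ((\<Sum>l\<in>{i..<k}. r ^ Suc l) + r ^ k) / c0" by (simp add: sum_divide_distrib add_divide_distrib)
    also have "\<dots> \<le> (2 * r ^ i / (1 - r)) / c0"
      using c0 by (intro divide_right_mono geometric_tail_sum r ik) auto
    finally show ?thesis by (simp add: D_def mult_ac)
  qed
  let ?W = "\<lambda>i. {v :: bool list. length v = i}"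
  have "expectation (energy s j k) \<le> (2 ^ j * D / (1 - \<rho>)) * (mean_prod nu j k)\<^sup>2" if k: "j \<le> k" for k
  proof -
    let ?m = "mean_prod nu j k"
    have iv: "integrable M (\<lambda>\<omega>. 2 powr (s * real i) * (real (Z j v k \<omega>))\<^sup>2)" for i v
      by (rule Z_integrable[where f = "\<lambda>z. 2 powr (s * real i) * (real z)\<^sup>2"])
    have "expectation (energy s j k) = (\<Sum>i\<in>{j..k}. \<Sum>v\<in>?W i. expectation (\<lambda>\<omega>. 2 powr (s * real i) * (real (Z j v k \<omega>))\<^sup>2))"
      unfolding energy_Z
      by (subst Bochner_Integration.integral_sum, intro Bochner_Integration.integrable_sum iv,
          rule sum.cong[OF refl], subst Bochner_Integration.integral_sum) (rule iv, rule refl)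
    also have "\<dots> = (\<Sum>i\<in>{j..k}. \<Sum>v\<in>?W i. 2 powr (s * real i) * (((mean_prod nu i k)\<^sup>2 * vs_sum nu i k + mean_prod nu i k) * expectation (\<lambda>\<omega>. real (Z j v i \<omega>))))"
    proof (intro sum.cong refl)
      fix i v assume "i \<in> {j..k}" "v \<in> ?W i"
      then have "expectation (\<lambda>\<omega>. (real (Z j v k \<omega>))\<^sup>2) = ((mean_prod nu i k)\<^sup>2 * vs_sum nu i k + mean_prod nu i k) * expectation (\<lambda>\<omega>. real (Z j v i \<omega>))"
        using pos by (intro second_moment) auto
      then show "expectation (\<lambda>\<omega>. 2 powr (s * real i) * (real (Z j v k \<omega>))\<^sup>2) = 2 powr (s * real i) * (((mean_prod nu i k)\<^sup>2 * vs_sum nu i k + mean_prod nu i k) * expectation (\<lambda>\<omega>. real (Z j v i \<omega>)))"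
        by simp
    qed
    also have "\<dots> = (\<Sum>i\<in>{j..k}. 2 powr (s * real i) * ((mean_prod nu i k)\<^sup>2 * vs_sum nu i k + mean_prod nu i k) * expectation (\<lambda>\<omega>. real (Z j [] i \<omega>)))"
    proof (rule sum.cong[OF refl])
      fix i assume "i \<in> {j..k}"
      have "(\<Sum>v\<in>?W i. expectation (\<lambda>\<omega>. real (Z j v i \<omega>))) = expectation (\<lambda>\<omega>. \<Sum>v\<in>?W i. real (Z j v i \<omega>))"
        by (rule Bochner_Integration.integral_sum[symmetric]) (rule Z_integrable)
      then show "(\<Sum>v\<in>?W i. 2 powr (s * real i) * (((mean_prod nu i k)\<^sup>2 * vs_sum nu i k + mean_prod nu i k) * expectation (\<lambda>\<omega>. real (Z j v i \<omega>)))) =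
        2 powr (s * real i) * ((mean_prod nu i k)\<^sup>2 * vs_sum nu i k + mean_prod nu i k) * expectation (\<lambda>\<omega>. real (Z j [] i \<omega>))"
        unfolding sum_Z_own_generation by (simp only: sum_distrib_left[symmetric] mult.assoc[symmetric])
    qed
    also have "\<dots> \<le> (\<Sum>i\<in>{j..k}. (2 ^ j * D * ?m\<^sup>2) * \<rho> ^ i)"
    proof (rule sum_mono)
      fix i assume i: "i \<in> {j..k}"
      let ?a = "mean_prod nu j i" and ?b = "mean_prod nu i k"
      have a: "?a > 0" and b: "?b > 0" and m: "?m > 0" using mean_prod_pos[OF pos] i by auto
      have ab: "?m = ?a * ?b" using i by (simp add: mean_prod_mult)
      have v0: "vs_sum nu i k \<ge> 0"
        unfolding vs_sum_def using split_prob_nonneg gam_nonneg mean_prod_pos[OF pos] i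
        by (intro sum_nonneg divide_nonneg_nonneg mult_nonneg_nonneg) (auto intro: less_imp_le)
      have "2 powr (s * real i) * (?b\<^sup>2 * vs_sum nu i k + ?b) * expectation (\<lambda>\<omega>. real (Z j [] i \<omega>)) \<le> 2 powr (s * real i) * (?b\<^sup>2 * vs_sum nu i k + ?b) * (?a * 2 ^ j)"
        using i b v0 by (intro mult_left_mono mean_growth_root) auto
      also have "\<dots> = 2 ^ j * 2 powr (s * real i) * ?m\<^sup>2 * (vs_sum nu i k / ?a + 1 / ?m)"
        unfolding ab using a b by (simp add: field_simps power2_eq_square)
      also have "\<dots> \<le> 2 ^ j * 2 powr (s * real i) * ?m\<^sup>2 * (D * r ^ i)"
        using i by (intro mult_left_mono level) auto
      also have "\<dots> = (2 ^ j * D * ?m\<^sup>2) * (2 powr (s * real i) * r ^ i)" by simp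
      also have "2 powr (s * real i) * r ^ i = \<rho> ^ i"
      proof -
        have "\<rho> = 2 powr s * r" by (simp add: r_def \<rho>_def powr_add[symmetric])
        moreover have "2 powr (s * real i) = (2 powr s) ^ i" by (simp add: powr_realpow[symmetric] powr_powr)
        ultimately show ?thesis by (simp add: power_mult_distrib)
      qed
      finally show "2 powr (s * real i) * (?b\<^sup>2 * vs_sum nu i k + ?b) * expectation (\<lambda>\<omega>. real (Z j [] i \<omega>)) \<le> (2 ^ j * D * ?m\<^sup>2) * \<rho> ^ i" .
    qed
    also have "\<dots> = (2 ^ j * D * ?m\<^sup>2) * (\<Sum>i\<in>{j..k}. \<rho> ^ i)" by (simp only: sum_distrib_left)
    also have "\<dots> \<le> (2 ^ j * D * ?m\<^sup>2) * (1 / (1 - \<rho>))"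
    proof (rule mult_left_mono)
      have "(\<Sum>i\<in>{j..k}. \<rho> ^ i) \<le> (\<Sum>i. \<rho> ^ i)" using \<rho> by (intro sum_le_suminf summable_geometric) auto
      also have "\<dots> = 1 / (1 - \<rho>)" using \<rho> by (intro suminf_geometric) auto
      finally show "(\<Sum>i\<in>{j..k}. \<rho> ^ i) \<le> 1 / (1 - \<rho>)" .
    qed (use D in auto)
    finally show ?thesis by (simp add: mult_ac)
  qed
  moreover have "2 ^ j * D / (1 - \<rho>) > 0" using D \<rho> by simp
  ultimately show ?thesis by blast
qed

text \<open>Paley-Zygmund for generation \<open>k\<close>, given an event of generation \<open>n\<close> on which generation \<open>n\<close> has
  size \<open>z\<close>; the lower bound is comparable with the survival probability.\<close>
lemma large_generation_prob:
  assumes j: "j \<le> n" and pos: "\<And>l. j \<le> l \<Longrightarrow> gam nu l > 0" and z: "1 \<le> z"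
    and k: "n \<le> k" and m1: "1 \<le> mean_prod nu n k"
  shows "prob {\<omega> \<in> space M. (P (conf n \<omega>) \<and> Z j [] n \<omega> = z) \<and> survives j \<omega>} / 16
    \<le> prob {\<omega> \<in> space M. (P (conf n \<omega>) \<and> Z j [] n \<omega> = z) \<and> mean_prod nu n k * real z / 2 \<le> real (Z j [] k \<omega>)}"
proof -
  let ?Q = "\<lambda>C. P C \<and> card (desc_conf j [] n C) = z"
  have Q: "P (conf n \<omega>) \<and> Z j [] n \<omega> = z \<longleftrightarrow> ?Q (conf n \<omega>)" for \<omega>
    by (simp add: Z_eq_conf[of n n])
  let ?f = "\<lambda>\<omega>. of_bool (?Q (conf n \<omega>)) :: real"
  let ?W = "\<lambda>\<omega>. real (Z j [] k \<omega>)"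
  let ?m = "mean_prod nu n k" and ?v = "vs_sum nu n k"
  have posn: "gam nu l > 0" if "n \<le> l" for l using pos that j by simp
  have v0: "?v \<ge> 0"
    unfolding vs_sum_def using split_prob_nonneg gam_nonneg mean_prod_pos[OF pos j]
    by (intro sum_nonneg divide_nonneg_nonneg mult_nonneg_nonneg) (auto intro: less_imp_le)
  define p where "p = expectation ?f"
  have p0: "p \<ge> 0" unfolding p_def by (rule integral_nonneg_AE) auto
  have fZ: "?f \<omega> * g (Z j [] n \<omega>) = ?f \<omega> * g z" for \<omega> and g :: "nat \<Rightarrow> real"
    by (simp add: Z_eq_conf[of n n])
  have EZ: "expectation (\<lambda>\<omega>. ?f \<omega> * ?W \<omega>) = ?m * (p * z)"
    using mean_growth[OF k j, of "[]" "\<lambda>C. of_bool (?Q C)"] fZ[of _ real] by (simp add: p_def)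
  have EZZ: "expectation (\<lambda>\<omega>. ?f \<omega> * (?W \<omega> * (?W \<omega> - 1))) = ?m\<^sup>2 * (p * (real z * (real z - 1)) + ?v * (p * z))"
    using factorial_growth[OF k j _ posn, of "[]" "\<lambda>C. of_bool (?Q C)"] fZ[of _ real] fZ[of _ "\<lambda>z. real z * (real z - 1)"]
    by (simp add: p_def)
  have i0: "integrable M (\<lambda>\<omega>. ?f \<omega> * g (Z j [] k \<omega>))" for g :: "nat \<Rightarrow> real"
    using Z_fun_integrable[of k k "\<lambda>C. of_bool (?Q {v \<in> C. length v \<le> n})" g j "[]"] by (simp add: conf_restrict[OF k])
  have E2: "expectation (\<lambda>\<omega>. ?f \<omega> * (?W \<omega>)\<^sup>2) \<le> p * ?m\<^sup>2 * (z * (z + ?v))"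
  proof -
    have "expectation (\<lambda>\<omega>. ?f \<omega> * (?W \<omega>)\<^sup>2) = expectation (\<lambda>\<omega>. ?f \<omega> * (?W \<omega> * (?W \<omega> - 1)) + ?f \<omega> * ?W \<omega>)"
      by (simp add: power2_eq_square algebra_simps)
    also have "\<dots> = ?m\<^sup>2 * (p * (real z * (real z - 1)) + ?v * (p * z)) + ?m * (p * z)"
      unfolding EZ[symmetric] EZZ[symmetric]
      by (rule Bochner_Integration.integral_add[OF i0[of "\<lambda>z. real z * (real z - 1)"] i0[of real]])
    \<comment> \<open>The linear term is absorbed into the quadratic one since the mean is at least
      one.\<close>
    also have "\<dots> \<le> ?m\<^sup>2 * (p * (real z * (real z - 1)) + ?v * (p * z)) + ?m\<^sup>2 * (p * z)"
      using m1 p0 by (intro add_left_mono mult_right_mono) (auto simp: power2_eq_square)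
    also have "\<dots> = p * ?m\<^sup>2 * (z * (z + ?v))" using z by (simp add: algebra_simps of_nat_diff)
    finally show ?thesis .
  qed
  define A where "A = {\<omega> \<in> space M. ?Q (conf n \<omega>) \<and> ?m * real z / 2 \<le> ?W \<omega>}"
  have Ac: "A = {\<omega> \<in> space M. (\<lambda>C. ?Q {v \<in> C. length v \<le> n} \<and> ?m * real z / 2 \<le> real (card (desc_conf j [] k C))) (conf k \<omega>)}"
    unfolding A_def by (simp add: conf_restrict[OF k] Z_eq_conf[of k k])
  have Am: "A \<in> sets M" unfolding Ac by (rule conf_pred)
  \<comment> \<open>On \<open>A\<close> the size \<open>W\<close> is at most
    \<open>W^2 / (2 \<Lambda>) + \<Lambda> / 2\<close>; off \<open>A\<close> it is below half the
    conditional mean. This \<open>\<Lambda>\<close> makes the quadratic term a quarter of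
    \<open>m p z\<close>, so a quarter is left for \<open>A\<close>.\<close>
  define \<Lambda> where "\<Lambda> = 2 * ?m * (z + ?v)"
  have \<Lambda>: "\<Lambda> > 0" unfolding \<Lambda>_def using m1 z v0 by (intro mult_pos_pos) auto
  have i1: "integrable M (\<lambda>\<omega>. ?f \<omega> * (?m * z / 2))" by (rule i0[of "\<lambda>_. ?m * z / 2"])
  have i2: "integrable M (\<lambda>\<omega>. ?f \<omega> * ((?W \<omega>)\<^sup>2 / (2 * \<Lambda>)))" by (rule i0[of "\<lambda>x. (real x)\<^sup>2 / (2 * \<Lambda>)"])
  have i3: "integrable M (\<lambda>\<omega>. \<Lambda> / 2 * indicat_real A \<omega>)"
  proof (rule integrable_mult_right)
    show "integrable M (indicat_real A)" using Am by (simp add: emeasure_eq_measure)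
  qed
  have "?m * (p * z) \<le> expectation (\<lambda>\<omega>. ?f \<omega> * (?m * z / 2) + ?f \<omega> * ((?W \<omega>)\<^sup>2 / (2 * \<Lambda>)) + \<Lambda> / 2 * indicat_real A \<omega>)"
    unfolding EZ[symmetric]
  proof (rule integral_mono)
    show "integrable M (\<lambda>\<omega>. ?f \<omega> * (?m * z / 2) + ?f \<omega> * ((?W \<omega>)\<^sup>2 / (2 * \<Lambda>)) + \<Lambda> / 2 * indicat_real A \<omega>)"
      by (rule Bochner_Integration.integrable_add[OF Bochner_Integration.integrable_add[OF i1 i2] i3])
    fix \<omega> assume w: "\<omega> \<in> space M"
    have young: "?W \<omega> \<le> (?W \<omega>)\<^sup>2 / (2 * \<Lambda>) + \<Lambda> / 2"
    proof -
      have "0 \<le> (?W \<omega> - \<Lambda>)\<^sup>2" by simp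
      then have "2 * \<Lambda> * ?W \<omega> \<le> (?W \<omega>)\<^sup>2 + \<Lambda> * \<Lambda>" by (simp add: power2_eq_square algebra_simps)
      then have "?W \<omega> \<le> ((?W \<omega>)\<^sup>2 + \<Lambda> * \<Lambda>) / (2 * \<Lambda>)" using \<Lambda> by (simp add: pos_le_divide_eq mult.commute)
      then show ?thesis using \<Lambda> by (simp add: add_divide_distrib)
    qed
    have nn: "0 \<le> ?m * z / 2" "0 \<le> (?W \<omega>)\<^sup>2 / (2 * \<Lambda>)" using m1 \<Lambda> by auto
    show "?f \<omega> * ?W \<omega> \<le> ?f \<omega> * (?m * z / 2) + ?f \<omega> * ((?W \<omega>)\<^sup>2 / (2 * \<Lambda>)) + \<Lambda> / 2 * indicat_real A \<omega>"
    proof (cases "?Q (conf n \<omega>)")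
      case True
      show ?thesis
      proof (cases "\<omega> \<in> A")
        case True
        then show ?thesis using young nn \<open>?Q (conf n \<omega>)\<close> by simp
      next
        case False
        then have "?W \<omega> < ?m * real z / 2" using w True unfolding A_def by auto
        then show ?thesis using nn False True by simp
      qed
    next
      case False
      then have f0: "?f \<omega> = 0" by simp
      have "0 \<le> \<Lambda> / 2 * indicat_real A \<omega>" using \<Lambda> by (intro mult_nonneg_nonneg) auto
      then show ?thesis unfolding f0 by simp
    qed
  next
    show "integrable M (\<lambda>\<omega>. ?f \<omega> * ?W \<omega>)" by (rule i0[of real])
  qed
  also have "\<dots> = p * (?m * z / 2) + expectation (\<lambda>\<omega>. ?f \<omega> * (?W \<omega>)\<^sup>2) / (2 * \<Lambda>) + \<Lambda> / 2 * prob A"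
  proof -
    show ?thesis
      using Am unfolding Bochner_Integration.integral_add[OF Bochner_Integration.integrable_add[OF i1 i2] i3] Bochner_Integration.integral_add[OF i1 i2]
      by (simp add: p_def)
  qed
  also have "\<dots> \<le> p * (?m * z / 2) + p * ?m\<^sup>2 * (z * (z + ?v)) / (2 * \<Lambda>) + \<Lambda> / 2 * prob A"
    using E2 \<Lambda> by (intro add_mono divide_right_mono) auto
  also have "p * ?m\<^sup>2 * (z * (z + ?v)) / (2 * \<Lambda>) = p * ?m * z / 4"
  proof -
    have gen: "p * a\<^sup>2 * (x * q) / (2 * (2 * a * q)) = p * a * x / 4" if "a > 0" "q > 0" for a q x :: real
      using that by (simp add: power2_eq_square)
    have "?m > 0" "z + ?v > 0" using m1 z v0 by auto
    then show ?thesis unfolding \<Lambda>_def by (rule gen)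
  qed
  finally have "?m * (p * z) \<le> p * (?m * z / 2) + p * ?m * z / 4 + \<Lambda> / 2 * prob A" .
  moreover have "?m * (p * z) = 4 * (?m * (p * z / 4))" "p * (?m * z / 2) = 2 * (?m * (p * z / 4))" "p * ?m * z / 4 = ?m * (p * z / 4)"
    "\<Lambda> / 2 * prob A = ?m * ((z + ?v) * prob A)"
    by (simp_all add: \<Lambda>_def)
  ultimately have "?m * (p * z / 4) \<le> ?m * ((z + ?v) * prob A)" by linarith
  then have key: "p * z / 4 \<le> (z + ?v) * prob A" using m1 by simp
  have surv: "prob {\<omega> \<in> space M. ?Q (conf n \<omega>) \<and> survives j \<omega>} \<le> 16 * prob A"
  proof -
    define t where "t = surv_prob n (k - n)"
    have nk: "n + (k - n) = k" using k by simp
    have b: "0 < t" "t \<le> 1" "1 / ?m + ?v / 2 \<le> 1 / t"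
      using surv_prob_bounds[of n "k - n", OF posn] unfolding nk t_def by auto
    have sd: "1 \<le> Z j [] (n + (k - n)) \<omega>" if "survives j \<omega>" for \<omega>
      by (rule survivesD[OF that]) (use j in simp)
    have "prob {\<omega> \<in> space M. ?Q (conf n \<omega>) \<and> survives j \<omega>} \<le> prob {\<omega> \<in> space M. ?Q (conf n \<omega>) \<and> 1 \<le> Z j [] (n + (k - n)) \<omega>}"
    proof (rule finite_measure_mono)
      show "{\<omega> \<in> space M. ?Q (conf n \<omega>) \<and> 1 \<le> Z j [] (n + (k - n)) \<omega>} \<in> sets M"
        using conf_pred[of "\<lambda>C. ?Q {v \<in> C. length v \<le> n} \<and> 1 \<le> card (desc_conf j [] k C)" k] unfolding nk
        by (simp add: conf_restrict[OF k] Z_eq_conf[of k k])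
    qed (use sd in blast)
    also have "\<dots> = expectation (\<lambda>\<omega>. ?f \<omega> * (1 - (1 - t) ^ Z j [] n \<omega>))"
      unfolding t_def by (rule survival_at_prob[OF j, of ?Q])
    also have "\<dots> = p * (1 - (1 - t) ^ z)"
      unfolding fZ[of _ "\<lambda>x. 1 - (1 - t) ^ x"] by (simp add: p_def)
    finally have s: "prob {\<omega> \<in> space M. ?Q (conf n \<omega>) \<and> survives j \<omega>} \<le> p * (1 - (1 - t) ^ z)" .
    show ?thesis
    \<comment> \<open>For small \<open>v\<close> survival is bounded by one. For
      \<open>v > z\<close> it is at most \<open>z t\<close> with \<open>t \<le> 2 / v\<close>. In
      both cases \<open>z + v\<close> is at most twice the larger number, which keeps the constant
      within 16.\<close>
    proof (cases "?v \<le> z")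
      case True
      have "p * (1 - (1 - t) ^ z) \<le> p * 1" using p0 b by (intro mult_left_mono) auto
      moreover have "p * z / 4 \<le> (2 * z) * prob A"
        using key mult_right_mono[of "z + ?v" "2 * z" "prob A"] True by simp
      then have "z * (p / 4) \<le> z * (2 * prob A)" by (simp add: mult_ac)
      then have "p / 4 \<le> 2 * prob A" using z by (subst (asm) mult_le_cancel_left_pos) auto
      ultimately show ?thesis using s measure_nonneg[of M A] by linarith
    next
      case False
      have "?m > 0" using m1 by linarith
      then have "?v / 2 \<le> 1 / t" using b(3) by (smt (verit) zero_less_divide_1_iff)
      then have tv: "t * ?v \<le> 2" using b(1) by (simp add: field_simps)
      have "1 - (1 - t) ^ z \<le> z * t" by (rule one_minus_power_le) (use b in auto)
      then have "p * (1 - (1 - t) ^ z) * ?v \<le> p * (z * t) * ?v"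
        using p0 v0 by (intro mult_left_mono mult_right_mono) auto
      also have "\<dots> = (p * z) * (t * ?v)" by simp
      also have "\<dots> \<le> (p * z) * 2" using p0 tv by (intro mult_left_mono) auto
      also have "\<dots> = 8 * (p * z / 4)" by simp
      also have "\<dots> \<le> 8 * ((z + ?v) * prob A)" by (intro mult_left_mono key) auto
      also have "\<dots> \<le> 8 * ((2 * ?v) * prob A)" using False by (intro mult_left_mono mult_right_mono) auto
      finally have "?v * (p * (1 - (1 - t) ^ z)) \<le> ?v * (16 * prob A)" by (simp add: mult_ac)
      then have "p * (1 - (1 - t) ^ z) \<le> 16 * prob A"
        using False z by (subst (asm) mult_le_cancel_left_pos) auto
      then show ?thesis using s by linarith
    qed
  qed
  then show ?thesis unfolding Q A_def[symmetric] by simp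
qed

text \<open>The constants are natural numbers, so that the event is a countable combination of
  events of finitely many generations. They may depend on the outcome; only arbitrarily late good
  generations are demanded, since no single generation is good almost surely on survival.\<close>

definition rich :: "nat \<Rightarrow> real \<Rightarrow> 'a \<Rightarrow> bool" where
  "rich j s \<omega> \<longleftrightarrow> (\<exists>c K :: nat. \<forall>n. \<exists>k. n \<le> k \<and> mean_prod nu j k \<le> real (Suc c) * real (Z j [] k \<omega>)
      \<and> energy s j k \<omega> \<le> real K * (mean_prod nu j k)\<^sup>2)"

lemma rich_sigma: "{\<omega> \<in> space conf_sigma. rich j s \<omega>} \<in> sets conf_sigma"
  unfolding rich_def
proof (intro sets.sets_Collect_countable_Ex sets.sets_Collect_countable_All)
  fix c K n k :: nat
  show "{\<omega> \<in> space conf_sigma. n \<le> k \<and> mean_prod nu j k \<le> real (Suc c) * real (Z j [] k \<omega>) \<and> energy s j k \<omega> \<le> real K * (mean_prod nu j k)\<^sup>2} \<in> sets conf_sigma"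
    unfolding energy_conf Z_eq_conf[OF order_refl]
    by (rule conf_pred_sigma[of "\<lambda>C. n \<le> k \<and> mean_prod nu j k \<le> real (Suc c) * real (card (desc_conf j [] k C)) \<and> (\<Sum>i\<in>{j..k}. \<Sum>v\<in>{v. length v = i}. 2 powr (s * real i) * (real (card (desc_conf j v k C)))\<^sup>2) \<le> real K * (mean_prod nu j k)\<^sup>2" k])
qed

lemma rich_sets: "{\<omega> \<in> space M. rich j s \<omega>} \<in> sets M"
  using rich_sigma conf_sigma_subset unfolding space_conf_sigma by blast

end

section \<open>Dimension of surviving trees\<close>

lemma closed_from_branch: "closed_from j (branch j S)"
  unfolding closed_from_def branch_def by (auto simp: min_def)

context markov_bool_tree
begin

text \<open>A late generation is large with at least \<open>1/16\<close> of the survival probability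
  \<open>\<beta>\<close>. \<open>K\<close> is chosen so that by Markov's inequality a large energy
  has probability at most \<open>\<beta> / 32\<close>. What remains holds at every late level, hence
  for infinitely many levels together. That \<open>K\<close> depends on \<open>\<beta>\<close> does
  no harm, as richness quantifies over it.\<close>

lemma rich_dominates_fixed_size:
  assumes j: "j \<le> n" and pos: "\<And>l. j \<le> l \<Longrightarrow> gam nu l > 0" and z: "1 \<le> z"
    and s: "s < s'" "0 < s'" and c0: "c0 > 0"
    and grow: "\<And>n. j \<le> n \<Longrightarrow> c0 * 2 powr (s' * real n) \<le> mean_prod nu j n"
  shows "prob {\<omega> \<in> space M. (P (conf n \<omega>) \<and> Z j [] n \<omega> = z) \<and> survives j \<omega>} / 32
    \<le> prob {\<omega> \<in> space M. (P (conf n \<omega>) \<and> Z j [] n \<omega> = z) \<and> rich j s \<omega>}" (is "?\<beta> / 32 \<le> ?R")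
proof (cases "?\<beta> = 0")
  case True
  then show ?thesis by simp
next
  case False
  then have \<beta>: "?\<beta> > 0" using measure_nonneg[of M] by (simp add: less_le)
  let ?Q = "\<lambda>C. P C \<and> card (desc_conf j [] n C) = z"
  have Q: "P (conf n \<omega>) \<and> Z j [] n \<omega> = z \<longleftrightarrow> ?Q (conf n \<omega>)" for \<omega>
    by (simp add: Z_eq_conf[of n n])
  obtain K0 where K0: "K0 > 0" "\<forall>k\<ge>j. expectation (energy s j k) \<le> K0 * (mean_prod nu j k)\<^sup>2"
    using energy_bound[OF pos s c0 grow] by blast
  obtain K :: nat where K: "32 * K0 / ?\<beta> < real K" using reals_Archimedean2 by blast
  have K1: "real K > 0" using K K0 \<beta> by (smt (verit) divide_pos_pos)
  have KK: "K0 / real K \<le> ?\<beta> / 32" using K K1 \<beta> by (simp add: field_simps)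
  let ?mn = "mean_prod nu j n"
  have mn: "?mn > 0" by (rule mean_prod_pos[OF pos order_refl])
  \<comment> \<open>\<open>c\<close> absorbs the fixed mean between \<open>j\<close> and
    \<open>n\<close> and the factor \<open>1/2\<close> in the largeness of the generation.\<close>
  obtain c :: nat where c: "2 * ?mn < real c" using reals_Archimedean2 by blast
  \<comment> \<open>Beyond this level the mean from \<open>n\<close> on is at least one, as the
    second moment argument requires.\<close>
  obtain k1 :: nat where k1: "log 2 (?mn / c0) / s' < real k1" using reals_Archimedean2 by blast
  define k0 where "k0 = max n k1"
  have m1: "1 \<le> mean_prod nu n k" if k: "k0 \<le> k" for k
  proof -
    have "log 2 (?mn / c0) < s' * real k1" using k1 s by (simp add: field_simps)
    also have "\<dots> \<le> s' * real k" using k s by (intro mult_left_mono) (auto simp: k0_def)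
    finally have "?mn / c0 < 2 powr (s' * real k)"
      using mn c0 by (subst (asm) log_less_iff) auto
    then have "?mn < c0 * 2 powr (s' * real k)" using c0 by (simp add: field_simps)
    also have "\<dots> \<le> mean_prod nu j k" using k j by (intro grow) (auto simp: k0_def)
    also have "\<dots> = ?mn * mean_prod nu n k" using k j by (intro mean_prod_mult[symmetric]) (auto simp: k0_def)
    finally show ?thesis using mn by simp
  qed
  define B where "B k = {\<omega> \<in> space M. ?Q (conf n \<omega>) \<and> mean_prod nu j k \<le> real (Suc c) * real (Z j [] k \<omega>) \<and> energy s j k \<omega> \<le> real K * (mean_prod nu j k)\<^sup>2}" for k
  have Qm: "{\<omega> \<in> space M. ?Q (conf n \<omega>)} \<in> sets M" by (rule conf_pred)
  have em[measurable]: "energy s j k \<in> borel_measurable M" for k using energy_integrable by (rule borel_measurable_integrable)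
  have Bm: "B k \<in> sets M" for k
  proof -
    have "B k = {\<omega> \<in> space M. ?Q (conf n \<omega>)} \<inter> {\<omega> \<in> space M. mean_prod nu j k \<le> real (Suc c) * real (Z j [] k \<omega>)} \<inter> {\<omega> \<in> space M. energy s j k \<omega> \<le> real K * (mean_prod nu j k)\<^sup>2}"
      unfolding B_def by blast
    moreover have "{\<omega> \<in> space M. energy s j k \<omega> \<le> real K * (mean_prod nu j k)\<^sup>2} \<in> sets M" by measurable
    ultimately show ?thesis using Qm Z_pred[of "\<lambda>z. mean_prod nu j k \<le> real (Suc c) * real z" j "[]" k] by (simp only: sets.Int)
  qed
  have "?\<beta> / 32 \<le> prob (B k)" if k: "k0 \<le> k" for k
  proof -
    let ?mp = "mean_prod nu j k"
    have nk: "n \<le> k" using k by (simp add: k0_def)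
    have mp: "?mp > 0" by (rule mean_prod_pos[OF pos order_refl])
    let ?A = "{\<omega> \<in> space M. (P (conf n \<omega>) \<and> Z j [] n \<omega> = z) \<and> mean_prod nu n k * real z / 2 \<le> real (Z j [] k \<omega>)}"
    let ?N = "{\<omega> \<in> space M. real K * ?mp\<^sup>2 \<le> energy s j k \<omega>}"
    have Nm: "?N \<in> sets M" by measurable
    have "?\<beta> / 16 \<le> prob ?A" by (rule large_generation_prob[OF j pos z nk m1[OF k]])
    also have "\<dots> \<le> prob (B k \<union> ?N)"
    proof (rule finite_measure_mono)
      show "?A \<subseteq> B k \<union> ?N"
      proof
        fix \<omega> assume a: "\<omega> \<in> ?A"
        then have z2: "mean_prod nu n k * real z / 2 \<le> real (Z j [] k \<omega>)" by simp
        have "?mp = ?mn * mean_prod nu n k" using nk j by (intro mean_prod_mult[symmetric]) auto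
        also have "\<dots> \<le> ?mn * (mean_prod nu n k * real z)" using mn z m1[OF k] by (intro mult_left_mono) auto
        also have "\<dots> \<le> ?mn * (2 * real (Z j [] k \<omega>))" using mn z2 by (intro mult_left_mono) auto
        also have "\<dots> = (2 * ?mn) * real (Z j [] k \<omega>)" by simp
        also have "\<dots> \<le> real (Suc c) * real (Z j [] k \<omega>)" using c by (intro mult_right_mono) auto
        finally show "\<omega> \<in> B k \<union> ?N" using a unfolding B_def Q by auto
      qed
      show "B k \<union> ?N \<in> sets M" using Bm Nm by (rule sets.Un)
    qed
    also have "\<dots> \<le> prob (B k) + prob ?N"
      using Bm Nm by (intro measure_subadditive) (auto simp: emeasure_eq_measure)
    also have "prob ?N \<le> expectation (energy s j k) / (real K * ?mp\<^sup>2)"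
      by (rule integral_Markov_inequality_measure[of _ _ "{}"]) (use energy_integrable energy_nonneg K1 mp in auto)
    also have "\<dots> \<le> K0 * ?mp\<^sup>2 / (real K * ?mp\<^sup>2)"
      using K0(2) nk j K1 by (intro divide_right_mono) auto
    also have "\<dots> = K0 / real K" using mp by simp
    finally show ?thesis using KK by linarith
  qed
  then have "?\<beta> / 32 \<le> prob (\<Inter>n. \<Union>k\<in>{n..}. B k)"
    using Bm by (intro prob_infinitely_often_ge) auto
  also have "\<dots> \<le> ?R"
  proof (rule finite_measure_mono)
    show "(\<Inter>n. \<Union>k\<in>{n..}. B k) \<subseteq> {\<omega> \<in> space M. (P (conf n \<omega>) \<and> Z j [] n \<omega> = z) \<and> rich j s \<omega>}"
    proof
      fix \<omega> assume w: "\<omega> \<in> (\<Inter>n. \<Union>k\<in>{n..}. B k)"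
      then have io: "\<exists>k. N \<le> k \<and> \<omega> \<in> B k" for N by (auto dest: spec[of _ N])
      then obtain k where "\<omega> \<in> B k" by blast
      then have "\<omega> \<in> space M" "?Q (conf n \<omega>)" by (auto simp: B_def)
      moreover have "rich j s \<omega>"
        unfolding rich_def using io by (intro exI[of _ c] exI[of _ K]) (auto simp: B_def)
      ultimately show "\<omega> \<in> {\<omega> \<in> space M. (P (conf n \<omega>) \<and> Z j [] n \<omega> = z) \<and> rich j s \<omega>}" unfolding Q by simp
    qed
    have "{\<omega> \<in> space M. (P (conf n \<omega>) \<and> Z j [] n \<omega> = z) \<and> rich j s \<omega>} = {\<omega> \<in> space M. ?Q (conf n \<omega>)} \<inter> {\<omega> \<in> space M. rich j s \<omega>}"
      unfolding Q by blast
    then show "{\<omega> \<in> space M. (P (conf n \<omega>) \<and> Z j [] n \<omega> = z) \<and> rich j s \<omega>} \<in> sets M"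
      using Qm rich_sets by (simp only: sets.Int)
  qed
  finally show ?thesis .
qed

text \<open>Sum over the finitely many values of \<open>Z\<close> at level \<open>n\<close>.
  Survival excludes the value zero, and the constant does not depend on the value.\<close>

lemma rich_dominates:
  assumes j: "j \<le> n" and pos: "\<And>l. j \<le> l \<Longrightarrow> gam nu l > 0"
    and s: "s < s'" "0 < s'" and c0: "c0 > 0"
    and grow: "\<And>n. j \<le> n \<Longrightarrow> c0 * 2 powr (s' * real n) \<le> mean_prod nu j n"
  shows "prob {\<omega> \<in> space M. P (conf n \<omega>) \<and> survives j \<omega>} / 32 \<le> prob {\<omega> \<in> space M. P (conf n \<omega>) \<and> rich j s \<omega>}"
proof -
  let ?I = "{1..2 ^ n} :: nat set"
  let ?S = "\<lambda>z. {\<omega> \<in> space M. (P (conf n \<omega>) \<and> Z j [] n \<omega> = z) \<and> survives j \<omega>}"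
  let ?R = "\<lambda>z. {\<omega> \<in> space M. (P (conf n \<omega>) \<and> Z j [] n \<omega> = z) \<and> rich j s \<omega>}"
  have Pm: "{\<omega> \<in> space M. P (conf n \<omega>)} \<in> sets M" by (rule conf_pred)
  have Sm: "?S z \<in> sets M" for z
  proof -
    have "?S z = {\<omega> \<in> space M. P (conf n \<omega>)} \<inter> {\<omega> \<in> space M. Z j [] n \<omega> = z} \<inter> {\<omega> \<in> space M. survives j \<omega>}" by blast
    then show ?thesis using Pm Z_pred[of "\<lambda>x. x = z" j "[]" n] survives_sets[of j] by (simp only: sets.Int)
  qed
  have Rm: "?R z \<in> sets M" for z
  proof -
    have "?R z = {\<omega> \<in> space M. P (conf n \<omega>)} \<inter> {\<omega> \<in> space M. Z j [] n \<omega> = z} \<inter> {\<omega> \<in> space M. rich j s \<omega>}" by blast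
    then show ?thesis using Pm Z_pred[of "\<lambda>x. x = z" j "[]" n] rich_sets[of j s] by (simp only: sets.Int)
  qed
  have "prob {\<omega> \<in> space M. P (conf n \<omega>) \<and> survives j \<omega>} \<le> prob (\<Union>z\<in>?I. ?S z)"
    using Sm Z_root_le survivesD[OF _ j] by (intro finite_measure_mono) (auto simp: Suc_le_eq)
  also have "\<dots> \<le> (\<Sum>z\<in>?I. prob (?S z))"
    using Sm by (intro finite_measure_subadditive_finite) auto
  also have "\<dots> \<le> (\<Sum>z\<in>?I. 32 * prob (?R z))"
  proof (rule sum_mono)
    fix z assume "z \<in> ?I"
    then show "prob (?S z) \<le> 32 * prob (?R z)"
      using rich_dominates_fixed_size[OF j pos _ s c0 grow, of z P] by simp
  qed
  also have "\<dots> = 32 * (\<Sum>z\<in>?I. prob (?R z))" by (simp only: sum_distrib_left)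
  also have "(\<Sum>z\<in>?I. prob (?R z)) = prob (\<Union>z\<in>?I. ?R z)"
    using Rm by (intro finite_measure_finite_Union[symmetric]) (auto simp: disjoint_family_on_def)
  also have "\<dots> \<le> prob {\<omega> \<in> space M. P (conf n \<omega>) \<and> rich j s \<omega>}"
  proof (rule finite_measure_mono)
    have "{\<omega> \<in> space M. P (conf n \<omega>) \<and> rich j s \<omega>} = {\<omega> \<in> space M. P (conf n \<omega>)} \<inter> {\<omega> \<in> space M. rich j s \<omega>}" by blast
    then show "{\<omega> \<in> space M. P (conf n \<omega>) \<and> rich j s \<omega>} \<in> sets M" using Pm rich_sets[of j s] by (simp only: sets.Int)
  qed auto
  finally show ?thesis by simp
qed

text \<open>A conditional zero-one law: \<open>rich_dominates\<close> extends from cylinder events to the event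
  of surviving without being rich, which must then be null.\<close>
lemma survives_rich:
  assumes pos: "\<And>l. j \<le> l \<Longrightarrow> gam nu l > 0"
    and s: "s < s'" "0 < s'" and c0: "c0 > 0"
    and grow: "\<And>n. j \<le> n \<Longrightarrow> c0 * 2 powr (s' * real n) \<le> mean_prod nu j n"
  shows "AE \<omega> in M. survives j \<omega> \<longrightarrow> rich j s \<omega>"
proof -
  define D where "D = {\<omega> \<in> space M. survives j \<omega>} - {\<omega> \<in> space M. rich j s \<omega>}"
  have Ds: "D \<in> sigma_sets (space M) conf_events"
    unfolding D_def sets_conf_sigma[symmetric] using survives_sigma[of j] rich_sigma[of j s]
    unfolding space_conf_sigma by (rule sets.Diff)
  have Dm: "D \<in> sets M" unfolding D_def using survives_sets rich_sets by (rule sets.Diff)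
  have "prob D \<le> 0"
  proof (rule field_le_epsilon)
    fix e :: real assume "e > 0"
    \<comment> \<open>\<open>33 = 32 + 1\<close>: the approximation error enters once directly and
      32 times through the domination.\<close>
    then obtain E where E: "E \<in> conf_events" "prob ((D - E) \<union> (E - D)) < e / 33"
      using sigma_sets_approx[OF conf_events_algebra conf_events_sets Ds] by (meson divide_pos_pos zero_less_numeral)
    obtain n P where EP: "E = {\<omega> \<in> space M. P (conf n \<omega>)}" using E(1) by (auto simp: conf_events_def)
    have Em: "E \<in> sets M" using E(1) conf_events_sets by blast
    let ?P = "\<lambda>C. P {v \<in> C. length v \<le> n}" and ?N = "max n j"
    have EP2: "E = {\<omega> \<in> space M. ?P (conf ?N \<omega>)}"
      unfolding EP by (simp add: conf_restrict[of n ?N])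
    have "prob (E \<inter> {\<omega> \<in> space M. survives j \<omega>}) / 32 \<le> prob (E \<inter> {\<omega> \<in> space M. rich j s \<omega>})"
    proof -
      have "E \<inter> {\<omega> \<in> space M. survives j \<omega>} = {\<omega> \<in> space M. ?P (conf ?N \<omega>) \<and> survives j \<omega>}"
        "E \<inter> {\<omega> \<in> space M. rich j s \<omega>} = {\<omega> \<in> space M. ?P (conf ?N \<omega>) \<and> rich j s \<omega>}"
        unfolding EP2 by blast+
      then show ?thesis using rich_dominates[of j ?N s s' c0 ?P, OF max.cobounded2 pos s c0 grow] by simp
    qed
    \<comment> \<open>Outcomes in \<open>D\<close> are not rich, so the rich part of
      \<open>E\<close> lies in \<open>E - D\<close>.\<close>
    also have "\<dots> \<le> prob ((D - E) \<union> (E - D))"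
      using Dm Em by (intro finite_measure_mono) (auto simp: D_def)
    finally have 1: "prob (E \<inter> {\<omega> \<in> space M. survives j \<omega>}) < 32 * (e / 33)" using E(2) by linarith
    have "prob D \<le> prob ((E \<inter> {\<omega> \<in> space M. survives j \<omega>}) \<union> ((D - E) \<union> (E - D)))"
      using Dm Em survives_sets[of j] by (intro finite_measure_mono) (auto simp: D_def)
    also have "\<dots> \<le> prob (E \<inter> {\<omega> \<in> space M. survives j \<omega>}) + prob ((D - E) \<union> (E - D))"
      using Dm Em survives_sets[of j] by (intro measure_subadditive) (auto simp: emeasure_eq_measure)
    finally show "prob D \<le> 0 + e" using 1 E(2) by linarith
  qed
  then have "prob D = 0" by (simp add: measure_le_0_iff)
  moreover have "{\<omega> \<in> space M. \<not> (survives j \<omega> \<longrightarrow> rich j s \<omega>)} = D" by (auto simp: D_def)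
  ultimately show ?thesis using Dm by (subst AE_iff_measurable[of D]) (auto simp: emeasure_eq_measure)
qed

lemma rich_hausdorff:
  assumes "rich j s \<omega>" "0 < s" "s \<le> 1" and pos: "\<And>l. j \<le> l \<Longrightarrow> gam nu l > 0"
  shows "hausdorff_torus s (limit_set (branch j (\<lambda>u. X u \<omega>))) \<noteq> 0"
proof -
  obtain c K :: nat where cK: "\<And>n. \<exists>k. n \<le> k \<and> mean_prod nu j k \<le> real (Suc c) * real (Z j [] k \<omega>)
      \<and> energy s j k \<omega> \<le> real K * (mean_prod nu j k)\<^sup>2"
    using assms(1) unfolding rich_def by blast
  show ?thesis
  proof (rule hausdorff_limit_set_nonzero[OF closed_from_branch assms(2,3), where c = "1 / real (Suc c)" and K = "real (Suc K)" and m = "mean_prod nu j"])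
    show "mean_prod nu j n > 0" for n by (rule mean_prod_pos[OF pos order_refl])
    fix n
    obtain k where k: "n \<le> k" "mean_prod nu j k \<le> real (Suc c) * real (Z j [] k \<omega>)" "energy s j k \<omega> \<le> real K * (mean_prod nu j k)\<^sup>2"
      using cK by blast
    have "real (card (generation (branch j (\<lambda>u. X u \<omega>)) k)) = real (Z j [] k \<omega>)"
      by (simp add: Z_def descendants_def)
    moreover have "1 / real (Suc c) * mean_prod nu j k \<le> real (Z j [] k \<omega>)" using k(2) by (simp add: field_simps)
    moreover have "energy s j k \<omega> \<le> real (Suc K) * (mean_prod nu j k)\<^sup>2"
      using k(3) by (rule order_trans) (intro mult_right_mono, auto)
    ultimately show "\<exists>k\<ge>n. 1 / real (Suc c) * mean_prod nu j k \<le> real (card (generation (branch j (\<lambda>u. X u \<omega>)) k)) \<and> energy s j k \<omega> \<le> real (Suc K) * (mean_prod nu j k)\<^sup>2"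
      using k(1) by auto
  qed auto
qed

text \<open>Markov's inequality along generations of small mean.\<close>
lemma small_generations:
  assumes "\<And>e m. e > 0 \<Longrightarrow> \<exists>n\<ge>m. j \<le> n \<and> mean_prod nu j n * 2 powr (- s * real n) < e"
  shows "AE \<omega> in M. \<forall>e>0. \<forall>m. \<exists>n\<ge>m. real (Z j [] n \<omega>) * 2 powr (- s * real n) \<le> e"
proof -
  have one: "AE \<omega> in M. \<exists>n\<ge>m. real (Z j [] n \<omega>) * 2 powr (- s * real n) \<le> e" if e: "e > 0" for e :: real and m
  proof -
    let ?A = "{\<omega> \<in> space M. \<forall>n. \<not> (m \<le> n \<and> real (Z j [] n \<omega>) * 2 powr (- s * real n) \<le> e)}"
    have Am: "?A \<in> sets M"
      by (rule sets.sets_Collect_countable_All) (rule Z_pred[of "\<lambda>z. \<not> (m \<le> n \<and> real z * 2 powr (- s * real n) \<le> e)" j "[]" n for n])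
    have "prob ?A \<le> 0"
    proof (rule field_le_epsilon)
      fix d :: real assume d: "d > 0"
      obtain n where n: "m \<le> n" "j \<le> n" "mean_prod nu j n * 2 powr (- s * real n) < d * e / 2 ^ j"
        using assms[of "d * e / 2 ^ j" m] d e by auto
      let ?t = "e / 2 powr (- s * real n)"
      have "prob ?A \<le> prob {\<omega> \<in> space M. ?t \<le> real (Z j [] n \<omega>)}"
      proof (rule finite_measure_mono)
        show "?A \<subseteq> {\<omega> \<in> space M. ?t \<le> real (Z j [] n \<omega>)}"
        proof
          fix \<omega> assume "\<omega> \<in> ?A"
          then have "\<omega> \<in> space M" "\<not> (m \<le> n \<and> real (Z j [] n \<omega>) * 2 powr (- s * real n) \<le> e)" by blast+
          then have "\<omega> \<in> space M" "e < real (Z j [] n \<omega>) * 2 powr (- s * real n)" using n(1) by simp_all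
          then show "\<omega> \<in> {\<omega> \<in> space M. ?t \<le> real (Z j [] n \<omega>)}" by (simp add: pos_divide_le_eq)
        qed
      qed (rule Z_pred[of "\<lambda>z. ?t \<le> real z"])
      also have "\<dots> \<le> expectation (\<lambda>\<omega>. real (Z j [] n \<omega>)) / ?t" by (rule markov_Z) (use e in simp)
      also have "\<dots> \<le> mean_prod nu j n * 2 ^ j / ?t"
        using e by (intro divide_right_mono mean_growth_root n(2)) auto
      also have "\<dots> = 2 ^ j / e * (mean_prod nu j n * 2 powr (- s * real n))" by simp
      also have "\<dots> \<le> 2 ^ j / e * (d * e / 2 ^ j)" using n(3) e by (intro mult_left_mono) auto
      also have "\<dots> = d" using e by simp
      finally show "prob ?A \<le> 0 + d" by simp
    qed
    then have "prob ?A = 0" by (simp only: measure_le_0_iff)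
    then have "emeasure M ?A = 0" by (simp only: emeasure_eq_measure ennreal_0)
    then have "?A \<in> null_sets M" using Am by (rule null_setsI)
    then have "AE \<omega> in M. \<omega> \<notin> ?A" by (rule AE_not_in)
    with AE_space show ?thesis by eventually_elim blast
  qed
  have "AE \<omega> in M. \<forall>i m. \<exists>n\<ge>m. real (Z j [] n \<omega>) * 2 powr (- s * real n) \<le> 1 / real (Suc i)"
    by (subst AE_all_countable, intro allI, subst AE_all_countable, intro allI, rule one) simp
  then show ?thesis
  proof eventually_elim
    case (elim \<omega>)
    show ?case
    proof (intro allI impI)
      fix e :: real and m assume "e > 0"
      then obtain i where i: "1 / real (Suc i) < e" using reals_Archimedean[of e] by (auto simp: inverse_eq_divide)
      from elim obtain n where "n \<ge> m" "real (Z j [] n \<omega>) * 2 powr (- s * real n) \<le> 1 / real (Suc i)" by blast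
      with i show "\<exists>n\<ge>m. real (Z j [] n \<omega>) * 2 powr (- s * real n) \<le> e" by (intro exI[of _ n]) auto
    qed
  qed
qed

end

section \<open>The parameters of the tree\<close>

lemma jlow_enatD:
  assumes "jlow nu = enat j0" "j0 \<le> l"
  shows "gam nu l > 0"
proof -
  have ex: "\<exists>j0. \<forall>j\<ge>j0. gam nu j > 0" using assms(1) by (auto simp: jlow_def split: if_splits)
  then have "j0 = (LEAST j0. \<forall>j\<ge>j0. gam nu j > 0)" using assms(1) by (simp add: jlow_def)
  with LeastI_ex[OF ex] assms(2) show ?thesis by blast
qed

lemma jlow_infinityD:
  assumes "jlow nu = \<infinity>"
  shows "\<exists>l\<ge>j. gam nu l = 0"
proof -
  have "\<not> (\<exists>j0. \<forall>j\<ge>j0. gam nu j > 0)" using assms by (auto simp: jlow_def split: if_splits)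
  then obtain l where "l \<ge> j" "\<not> gam nu l > 0" by blast
  then show ?thesis using gam_nonneg[of nu l] by (intro exI[of _ l]) auto
qed

lemma mean_prod_atLeastAtMost: "(\<Prod>l=j..n. gam nu l) = mean_prod nu j (Suc n)"
  unfolding mean_prod_def by (rule prod.cong) auto

lemma mean_prod_gt_0:
  assumes "\<And>l. j \<le> l \<Longrightarrow> gam nu l > 0"
  shows "mean_prod nu j n > 0"
  unfolding mean_prod_def using assms by (intro prod_pos) auto

lemma sum_ln_gam:
  assumes "\<And>l. j \<le> l \<Longrightarrow> gam nu l > 0"
  shows "(\<Sum>l=j..n. ln (gam nu l)) = ln (mean_prod nu j (Suc n))"
  unfolding mean_prod_atLeastAtMost[symmetric] using assms by (intro ln_prod[symmetric]) force+

lemma theta_jlow: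
  assumes "jlow nu = enat j0"
  shows "theta nu = liminf (\<lambda>j. ereal (ln (mean_prod nu j0 (Suc j)) / (real j * ln 2)))"
  unfolding theta_def assms using sum_ln_gam[of j0 nu] jlow_enatD[OF assms] by simp

text \<open>A lower limit below \<open>s1 < s\<close> gives arbitrarily large \<open>i\<close> with
  mean below \<open>2^(s1 i)\<close>. The gap \<open>s - s1\<close> absorbs both the change of base
  from \<open>j0\<close> to \<open>j\<close> and the shift from \<open>i\<close> to
  \<open>Suc i\<close>.\<close>

lemma theta_upper:
  assumes jl: "jlow nu = enat j0" and th: "theta nu < ereal s" and j: "j0 \<le> j" and e: "e > 0"
  shows "\<exists>n\<ge>m. j \<le> n \<and> mean_prod nu j n * 2 powr (- s * real n) < e"
proof -
  have pos: "gam nu l > 0" if "j0 \<le> l" for l by (rule jlow_enatD[OF jl that])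
  have mp: "mean_prod nu j0 n > 0" for n by (rule mean_prod_gt_0[OF pos])
  obtain s1 where s1: "theta nu < ereal s1" "s1 < s"
    using ereal_dense2[OF th] by auto
  define a where "a = mean_prod nu j0 j"
  have a: "a > 0" unfolding a_def by (rule mp)
  have "(\<lambda>n. 2 powr (- (s - s1) * real n)) \<longlonglongrightarrow> 0"
    by (rule summable_LIMSEQ_zero[OF summable_two_powr]) (use s1 in simp)
  moreover have "0 < e * a * 2 powr s" using e a by simp
  ultimately have "\<forall>\<^sub>F n in sequentially. 2 powr (- (s - s1) * real n) < e * a * 2 powr s"
    by (rule order_tendstoD(2))
  then obtain N where N: "\<And>n. n \<ge> N \<Longrightarrow> 2 powr (- (s - s1) * real n) < e * a * 2 powr s"
    by (auto simp: eventually_sequentially)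
  \<comment> \<open>The 1 among the bounds makes \<open>i\<close> positive, so that the quotient by
    \<open>i\<close> can be cleared.\<close>
  define N1 where "N1 = max (max N m) (max j 1)"
  have "\<exists>i\<ge>N1. ereal (ln (mean_prod nu j0 (Suc i)) / (real i * ln 2)) < ereal s1"
  proof (rule ccontr)
    assume "\<not> ?thesis"
    then have "\<forall>\<^sub>F i in sequentially. ereal s1 \<le> ereal (ln (mean_prod nu j0 (Suc i)) / (real i * ln 2))"
      by (intro eventually_sequentiallyI[of N1]) (auto simp: not_less)
    then have "ereal s1 \<le> theta nu" unfolding theta_jlow[OF jl] by (rule Liminf_bounded)
    with s1 show False by simp
  qed
  then obtain i where i: "N1 \<le> i" "ln (mean_prod nu j0 (Suc i)) / (real i * ln 2) < s1" by auto
  have i1: "i \<ge> 1" "j \<le> i" "m \<le> i" "N \<le> i" using i(1) by (auto simp: N1_def)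
  have "ln (mean_prod nu j0 (Suc i)) < s1 * (real i * ln 2)"
    using i(2) i1 by (simp add: pos_divide_less_eq)
  also have "\<dots> = ln (2 powr (s1 * real i))" by (simp add: ln_powr)
  finally have "mean_prod nu j0 (Suc i) < 2 powr (s1 * real i)" using mp by (subst (asm) ln_less_cancel_iff) auto
  moreover have "mean_prod nu j0 (Suc i) = a * mean_prod nu j (Suc i)"
    unfolding a_def using j i1 by (intro mean_prod_mult[symmetric]) auto
  ultimately have lt: "a * mean_prod nu j (Suc i) < 2 powr (s1 * real i)" by simp
  have "a * (mean_prod nu j (Suc i) * 2 powr (- s * real (Suc i))) = (a * mean_prod nu j (Suc i)) * 2 powr (- s * real (Suc i))" by simp
  also have "\<dots> < 2 powr (s1 * real i) * 2 powr (- s * real (Suc i))" using lt by (intro mult_strict_right_mono) auto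
  also have "\<dots> = 2 powr (- (s - s1) * real i) * 2 powr (- s)" by (simp add: powr_add[symmetric] algebra_simps)
  also have "\<dots> < (e * a * 2 powr s) * 2 powr (- s)" using N[OF i1(4)] by (intro mult_strict_right_mono) auto
  also have "\<dots> = a * e" by (simp add: powr_minus)
  finally have "mean_prod nu j (Suc i) * 2 powr (- s * real (Suc i)) < e" using a by simp
  then show ?thesis using i1 by (intro exI[of _ "Suc i"]) auto
qed

lemma eventually_lower_bound:
  fixes f :: "nat \<Rightarrow> real"
  assumes "\<And>n. f n > 0" "b > 0" "\<And>n. N \<le> n \<Longrightarrow> b \<le> f n"
  shows "\<exists>c>0. \<forall>n. c \<le> f n"
proof -
  define c where "c = Min (insert b (f ` {..N}))"
  have "c > 0" unfolding c_def using assms by (subst Min_gr_iff) auto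
  moreover have "c \<le> f n" for n
  proof (cases "n \<le> N")
    case True
    then show ?thesis unfolding c_def by (intro Min_le) auto
  next
    case False
    have "c \<le> b" unfolding c_def by (intro Min_le) auto
    then show ?thesis using assms(3)[of n] False by simp
  qed
  ultimately show ?thesis by blast
qed

text \<open>A lower limit above \<open>s\<close> controls all but finitely many levels; the
  remaining means are positive and only diminish the constant.\<close>

lemma theta_lower:
  assumes jl: "jlow nu = enat j0" and th: "ereal s < theta nu" and j: "j0 \<le> j"
  shows "\<exists>c>0. \<forall>n\<ge>j. c * 2 powr (s * real n) \<le> mean_prod nu j n"
proof -
  have pos: "gam nu l > 0" if "j0 \<le> l" for l by (rule jlow_enatD[OF jl that])
  have mp: "mean_prod nu i n > 0" if "j0 \<le> i" for i n using pos that by (intro mean_prod_gt_0) auto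
  have "\<forall>\<^sub>F i in sequentially. ereal s < ereal (ln (mean_prod nu j0 (Suc i)) / (real i * ln 2))"
    using th unfolding theta_jlow[OF jl] by (rule less_LiminfD)
  then obtain N where N: "\<And>i. i \<ge> N \<Longrightarrow> s < ln (mean_prod nu j0 (Suc i)) / (real i * ln 2)"
    by (auto simp: eventually_sequentially)
  define a where "a = mean_prod nu j0 j"
  have a: "a > 0" unfolding a_def by (rule mp) simp
  have "\<exists>c>0. \<forall>n. c \<le> mean_prod nu j n * 2 powr (- s * real n)"
  proof (rule eventually_lower_bound[where b = "2 powr (- s) / a" and N = "Suc (max N (max j 1))"])
    show "0 < mean_prod nu j n * 2 powr (- s * real n)" for n using mp[OF j] by simp
    show "2 powr (- s) / a > 0" using a by simp
    fix n assume n: "Suc (max N (max j 1)) \<le> n"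
    define i where "i = n - 1"
    have ni: "n = Suc i" and i: "N \<le> i" "j \<le> i" "1 \<le> i" using n by (auto simp: i_def)
    have "ln (2 powr (s * real i)) = s * (real i * ln 2)" by (simp add: ln_powr)
    also have "\<dots> < ln (mean_prod nu j0 (Suc i))" using N[OF i(1)] i by (simp add: pos_less_divide_eq)
    finally have "2 powr (s * real i) < mean_prod nu j0 (Suc i)" using mp by (subst (asm) ln_less_cancel_iff) auto
    also have "\<dots> = a * mean_prod nu j n"
      unfolding a_def ni using j i by (intro mean_prod_mult[symmetric]) auto
    finally have l: "2 powr (s * real i) * 2 powr (- s * real n) \<le> a * mean_prod nu j n * 2 powr (- s * real n)"
      by (intro mult_right_mono) auto
    have e: "2 powr (s * real i) * 2 powr (- s * real n) = 2 powr (- s)"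
      by (simp add: ni powr_add[symmetric] algebra_simps)
    have "2 powr (- s) \<le> a * (mean_prod nu j n * 2 powr (- s * real n))" using l unfolding e mult.assoc .
    then show "2 powr (- s) / a \<le> mean_prod nu j n * 2 powr (- s * real n)"
      using a by (simp add: pos_divide_le_eq mult.commute)
  qed
  then obtain c where c: "c > 0" "\<And>n. c \<le> mean_prod nu j n * 2 powr (- s * real n)" by blast
  have "c * 2 powr (s * real n) \<le> mean_prod nu j n" for n
  proof -
    have "c * 2 powr (s * real n) \<le> mean_prod nu j n * 2 powr (- s * real n) * 2 powr (s * real n)"
      using c(2) by (intro mult_right_mono) auto
    also have "\<dots> = mean_prod nu j n" by (simp add: mult.assoc powr_add[symmetric])
    finally show ?thesis .
  qed
  with c(1) show ?thesis by blast
qed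

text \<open>\<open>jlow = \<infinity>\<close> is covered as well: then a generation mean vanishes infinitely often.\<close>
lemma theta_negative_mean:
  assumes "theta nu < 0"
  shows "\<exists>j0. \<forall>j\<ge>j0. \<forall>e>0. \<exists>n\<ge>j. mean_prod nu j n < e"
proof (cases "jlow nu")
  case (enat j0)
  have "\<exists>n\<ge>j. mean_prod nu j n < e" if "j0 \<le> j" "e > 0" for j e
    using theta_upper[OF enat, of 0 j e 0] assms that by (auto simp: zero_ereal_def)
  then show ?thesis by blast
next
  case infinity
  have "\<exists>n\<ge>j. mean_prod nu j n < e" if "e > 0" for j e
  proof -
    obtain l where l: "l \<ge> j" "gam nu l = 0" using jlow_infinityD[OF infinity] by blast
    then have "mean_prod nu j (Suc l) = 0" by (simp add: mean_prod_Suc)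
    then show ?thesis using l that by (intro exI[of _ "Suc l"]) auto
  qed
  then show ?thesis by blast
qed

lemma vs_sum_eq: "j \<le> k \<Longrightarrow> vs_sum nu j k = 2 * (\<Sum>n<k. if j \<le> n then measure_pmf.prob (nu True n) {(True, True)} / (gam nu n * (\<Prod>l=j..n. gam nu l)) else 0)"
proof -
  assume "j \<le> k"
  have "(\<Sum>n<k. if j \<le> n then measure_pmf.prob (nu True n) {(True, True)} / (gam nu n * (\<Prod>l=j..n. gam nu l)) else 0)
    = (\<Sum>n\<in>{j..<k}. if j \<le> n then measure_pmf.prob (nu True n) {(True, True)} / (gam nu n * (\<Prod>l=j..n. gam nu l)) else 0)"
    by (rule sum.mono_neutral_right) auto
  also have "\<dots> = (\<Sum>n\<in>{j..<k}. split_prob nu n / (gam nu n * mean_prod nu j (Suc n)))"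
    by (rule sum.cong) (auto simp: mean_prod_atLeastAtMost split_prob_def measure_pmf_single)
  finally show ?thesis by (simp add: vs_sum_def sum_distrib_left)
qed

text \<open>Translates divergence of the extended nonnegative series into unbounded real partial
  sums, the form in which the survival bounds use it.\<close>

lemma varsigma_infinite_iff: "varsigma nu j = \<infinity> \<longleftrightarrow> (\<forall>B. \<exists>n\<ge>j. B < vs_sum nu j n)"
proof -
  define f where "f n = (if j \<le> n then measure_pmf.prob (nu True n) {(True, True)} / (gam nu n * (\<Prod>l=j..n. gam nu l)) else 0)" for n
  have f0: "f n \<ge> 0" for n unfolding f_def using gam_nonneg by (auto intro!: divide_nonneg_nonneg mult_nonneg_nonneg prod_nonneg)
  have vs: "vs_sum nu j k = 2 * sum f {..<k}" if "j \<le> k" for k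
    unfolding f_def by (rule vs_sum_eq[OF that])
  have v: "varsigma nu j = 2 * (\<Sum>n. ennreal (f n))" unfolding varsigma_def f_def ..
  show ?thesis
  proof
    assume inf: "varsigma nu j = \<infinity>"
    show "\<forall>B. \<exists>n\<ge>j. B < vs_sum nu j n"
    proof (rule ccontr)
      assume "\<not> ?thesis"
      then obtain B where B: "\<And>n. j \<le> n \<Longrightarrow> vs_sum nu j n \<le> B" by (auto simp: not_less)
      have "sum f {..<n} \<le> B / 2" for n
      proof -
        have "sum f {..<n} \<le> sum f {..<max j n}" using f0 by (intro sum_mono2) auto
        then show ?thesis using B[of "max j n"] vs[of "max j n"] by simp
      qed
      then have "(\<Sum>n. ennreal (f n)) \<le> ennreal (B / 2)"
        unfolding suminf_eq_SUP using f0 by (intro SUP_least) (auto simp: sum_ennreal intro: ennreal_leI)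
      then have "(\<Sum>n. ennreal (f n)) \<noteq> \<infinity>" by (auto simp: top_unique)
      then show False using inf unfolding v by (simp add: ennreal_mult_eq_top_iff)
    qed
  next
    assume unb: "\<forall>B. \<exists>n\<ge>j. B < vs_sum nu j n"
    show "varsigma nu j = \<infinity>"
    proof (rule ccontr)
      assume "varsigma nu j \<noteq> \<infinity>"
      then have "(\<Sum>n. ennreal (f n)) \<noteq> \<infinity>" unfolding v by (auto simp: ennreal_mult_eq_top_iff)
      then have sm: "summable f" using f0 by (intro summable_suminf_not_top) auto
      obtain n where n: "j \<le> n" "2 * suminf f < vs_sum nu j n" using unb by blast
      have "sum f {..<n} \<le> suminf f" using f0 sm by (intro sum_le_suminf) auto
      then show False using n vs[OF n(1)] by simp
    qed
  qed
qed

lemma liminf_prod_zeroD: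
  assumes "liminf (\<lambda>n. ereal (\<Prod>l=j..n. gam nu l)) = 0" "e > 0"
  shows "\<exists>n\<ge>j. mean_prod nu j n < e"
proof (rule ccontr)
  assume no: "\<not> ?thesis"
  have "\<forall>\<^sub>F n in sequentially. ereal e \<le> ereal (\<Prod>l=j..n. gam nu l)"
  proof (rule eventually_sequentiallyI[of j])
    fix n assume "j \<le> n"
    then show "ereal e \<le> ereal (\<Prod>l=j..n. gam nu l)" using no unfolding mean_prod_atLeastAtMost by (auto simp: not_less)
  qed
  then have "ereal e \<le> liminf (\<lambda>n. ereal (\<Prod>l=j..n. gam nu l))" by (rule Liminf_bounded)
  with assms show False by simp
qed

lemma liminf_prod_nonzeroD:
  assumes "liminf (\<lambda>n. ereal (\<Prod>l=j..n. gam nu l)) \<noteq> 0" and pos: "\<And>l. j \<le> l \<Longrightarrow> gam nu l > 0"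
  shows "\<exists>c>0. \<forall>n. c \<le> mean_prod nu j n"
proof -
  have "0 \<le> liminf (\<lambda>n. ereal (\<Prod>l=j..n. gam nu l))"
    using gam_nonneg by (intro Liminf_bounded always_eventually) (auto intro: prod_nonneg)
  then have "0 < liminf (\<lambda>n. ereal (\<Prod>l=j..n. gam nu l))" using assms(1) by (simp add: less_le)
  then obtain b where b: "0 < ereal b" "ereal b < liminf (\<lambda>n. ereal (\<Prod>l=j..n. gam nu l))"
    using ereal_dense2 by blast
  have "\<forall>\<^sub>F n in sequentially. ereal b < ereal (\<Prod>l=j..n. gam nu l)" using b(2) by (rule less_LiminfD)
  then obtain N where N: "\<And>n. n \<ge> N \<Longrightarrow> b < (\<Prod>l=j..n. gam nu l)" by (auto simp: eventually_sequentially)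
  show ?thesis
  proof (rule eventually_lower_bound[where b = b and N = "Suc N"])
    show "mean_prod nu j n > 0" for n by (rule mean_prod_gt_0[OF pos])
    show "b > 0" using b by simp
    fix n assume "Suc N \<le> n"
    then have "N \<le> n - 1" "Suc (n - 1) = n" by auto
    then show "b \<le> mean_prod nu j n" using N[of "n - 1"] unfolding mean_prod_atLeastAtMost by simp
  qed
qed

section \<open>The theorem\<close>

lemma isolated_from_cong:
  assumes "\<And>u. j \<le> length u \<Longrightarrow> S u = S' u"
  shows "isolated_from S x \<longleftrightarrow> isolated_from S' x"
proof -
  have "isolated_from S2 x" if iso1: "isolated_from S1 x" and eq: "\<And>u. j \<le> length u \<Longrightarrow> S1 u = S2 u" for S1 S2
  proof -
    obtain d n where d: "d > 0" "\<forall>u m. S1 u \<longrightarrow> n \<le> length u \<longrightarrow> d \<le> \<bar>x - xdot u - of_int m\<bar>"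
      using iso1 unfolding isolated_from_def by blast
    show ?thesis unfolding isolated_from_def
      by (intro exI[of _ d] conjI exI[of _ "max n j"]) (use d eq in auto)
  qed
  then show ?thesis using assms by blast
qed

lemma closed_from_no_birth:
  assumes "\<And>u b. j \<le> length u \<Longrightarrow> S (u @ [b]) \<Longrightarrow> S u"
  shows "closed_from j S"
proof -
  have "S u \<Longrightarrow> j \<le> i \<Longrightarrow> i \<le> length u \<Longrightarrow> S (take i u)" for u i
  proof (induction u rule: rev_induct)
    case (snoc b u)
    show ?case
    proof (cases "i = length (u @ [b])")
      case False
      then have i: "i \<le> length u" using snoc.prems(3) by simp
      then have "S u" using assms[of u b] snoc.prems by simp
      then show ?thesis using snoc.IH snoc.prems(2) i by simp
    qed (use snoc.prems in simp)
  qed simp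
  then show ?thesis unfolding closed_from_def by blast
qed

lemma hausdorff_torus_eq_0_mono:
  assumes "hausdorff_torus s A = 0" "s \<le> t"
  shows "hausdorff_torus t A = 0"
proof (rule hausdorff_torus_eq_0I)
  fix d e :: real assume "d > 0" "e > 0"
  obtain C where C: "C \<in> torus_covers d A" "(\<Sum>n. ennreal (tdiam (C n) powr s)) < ennreal e"
    by (rule hausdorff_torus_eq_0D[OF assms(1) \<open>d > 0\<close> \<open>e > 0\<close>])
  have "(\<Sum>n. ennreal (tdiam (C n) powr t)) \<le> (\<Sum>n. ennreal (tdiam (C n) powr s))"
    using tdiam_nonneg tdiam_le_1 assms(2) by (intro suminf_le ennreal_leI powr_mono') auto
  also have "\<dots> \<le> ennreal e" using C(2) by simp
  finally show "\<exists>C\<in>torus_covers d A. (\<Sum>n. ennreal (tdiam (C n) powr t)) \<le> ennreal e"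
    using C(1) by blast
qed

text \<open>Change of base level: passing from \<open>i\<close> to \<open>j\<close> adds a constant
  and divides by the positive mean between them, so divergence of \<open>varsigma\<close> is the
  same at all bases from \<open>jlow\<close> on.\<close>

lemma vs_sum_split:
  assumes "i \<le> j" "j \<le> n" and pos: "\<And>l. i \<le> l \<Longrightarrow> gam nu l > 0"
  shows "vs_sum nu i n = vs_sum nu i j + vs_sum nu j n / mean_prod nu i j"
proof -
  have "vs_sum nu i n = vs_sum nu i j + (\<Sum>l\<in>{j..<n}. 2 * split_prob nu l / (gam nu l * mean_prod nu i (Suc l)))"
    unfolding vs_sum_def using assms(1,2) by (rule sum.atLeastLessThan_concat[symmetric])
  also have "(\<Sum>l\<in>{j..<n}. 2 * split_prob nu l / (gam nu l * mean_prod nu i (Suc l))) = vs_sum nu j n / mean_prod nu i j"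
    unfolding vs_sum_def sum_divide_distrib
  proof (rule sum.cong[OF refl])
    fix l assume "l \<in> {j..<n}"
    then have "mean_prod nu i (Suc l) = mean_prod nu i j * mean_prod nu j (Suc l)"
      using assms(1) by (intro mean_prod_mult[symmetric]) auto
    then show "2 * split_prob nu l / (gam nu l * mean_prod nu i (Suc l)) = 2 * split_prob nu l / (gam nu l * mean_prod nu j (Suc l)) / mean_prod nu i j"
      by (simp add: mult_ac)
  qed
  finally show ?thesis .
qed

section \<open>Transfer from branches to the set of ones\<close>

context markov_bool_tree
begin

definition no_birth_from :: "nat \<Rightarrow> 'a \<Rightarrow> bool" where
  "no_birth_from j \<omega> \<longleftrightarrow> (\<forall>u. j \<le> length u \<longrightarrow> \<not> birth u \<omega>)"

lemma no_birth_from_mono: "no_birth_from i \<omega> \<Longrightarrow> i \<le> j \<Longrightarrow> no_birth_from j \<omega>"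
  unfolding no_birth_from_def by (meson order_trans)

lemma no_birth_closed:
  assumes "no_birth_from j \<omega>"
  shows "closed_from j (\<lambda>u. X u \<omega>)"
proof (rule closed_from_no_birth)
  fix u b assume "j \<le> length u" "X (u @ [b]) \<omega>"
  then have "\<not> birth u \<omega>" "children \<omega> u \<noteq> (False, False)"
    using assms by (auto simp: no_birth_from_def children_def) (cases b; auto)
  then show "X u \<omega>" by (simp add: birth_def)
qed

lemma no_birth_branch:
  assumes "no_birth_from j \<omega>" "j \<le> length u"
  shows "branch j (\<lambda>u. X u \<omega>) u \<longleftrightarrow> X u \<omega>"
proof
  assume "X u \<omega>"
  then show "branch j (\<lambda>u. X u \<omega>) u" using no_birth_closed[OF assms(1)] unfolding closed_from_def branch_def by blast
qed (use branch_self[of j "\<lambda>u. X u \<omega>"] assms in auto)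

lemma no_birth_limit_set:
  assumes "no_birth_from j \<omega>"
  shows "limit_set (branch j (\<lambda>u. X u \<omega>)) = limit_set (\<lambda>u. X u \<omega>)"
proof -
  have "isolated_from (branch j (\<lambda>u. X u \<omega>)) x \<longleftrightarrow> isolated_from (\<lambda>u. X u \<omega>) x" for x
    by (rule isolated_from_cong[of j]) (rule no_birth_branch[OF assms])
  then show ?thesis by (simp add: limit_set_def)
qed

lemma no_birth_card_generation:
  assumes "no_birth_from j \<omega>" "j \<le> n"
  shows "card (generation (\<lambda>u. X u \<omega>) n) = Z j [] n \<omega>"
proof -
  have "generation (\<lambda>u. X u \<omega>) n = desc j [] n \<omega>"
    unfolding descendants_def using no_birth_branch[OF assms(1)] assms(2) by auto
  then show ?thesis by (simp add: Z_def)
qed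

lemma survives_not_finite:
  assumes "survives j \<omega>"
  shows "\<not> finite_ones \<omega>"
proof
  assume "finite_ones \<omega>"
  then obtain n where n: "\<And>k. k \<ge> n \<Longrightarrow> empty_gen k \<omega>" unfolding finite_ones_iff by blast
  have "1 \<le> Z j [] (max j n) \<omega>" using survivesD[OF assms max.cobounded1] .
  then obtain u where "u \<in> desc j [] (max j n) \<omega>" unfolding Z_def by (metis card.empty equals0I not_one_le_zero)
  then have "X u \<omega>" "length u = max j n" using desc_X[where u = u and j = j and v = "[]" and n = "max j n" and \<omega> = \<omega>] by (auto simp: descendants_def intro: branch_self)
  then show False using n[of "max j n"] by (auto simp: empty_gen_def)
qed

text \<open>Without births from \<open>j\<close> on, the ones beyond level \<open>j\<close> are
  exactly the branches, and an empty generation of branches has only empty successors. The converse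
  implication holds for every \<open>j\<close>.\<close>

lemma not_survives_finite:
  assumes nb: "no_birth_from j \<omega>" and "\<not> survives j \<omega>"
  shows "finite_ones \<omega>"
proof -
  obtain n where n: "Z j [] (j + n) \<omega> = 0" using assms(2) unfolding survives_def by (auto simp: not_le)
  have "empty_gen k \<omega>" if k: "j + n \<le> k" for k
  proof -
    have "\<not> 1 \<le> Z j [] k \<omega>" using Z_mono_pos[of j "j + n" k \<omega>] k n by auto
    then have "card (generation (\<lambda>u. X u \<omega>) k) = 0" using no_birth_card_generation[OF nb, of k] k by simp
    then have "generation (\<lambda>u. X u \<omega>) k = {}" using finite_generation by simp
    then show ?thesis by (auto simp: empty_gen_def)
  qed
  then show ?thesis unfolding finite_ones_iff by blast
qed

lemma AE_no_birth:
  assumes "summable (\<lambda>j. 2 ^ j * eta nu j)"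
  shows "AE \<omega> in M. \<exists>j. no_birth_from j \<omega>"
  using AE_eventually_no_birth[OF assms] unfolding no_birth_from_def .

lemma AE_finite_ones:
  assumes sm: "summable (\<lambda>j. 2 ^ j * eta nu j)" and ns: "\<And>j. j0 \<le> j \<Longrightarrow> AE \<omega> in M. \<not> survives j \<omega>"
  shows "AE \<omega> in M. finite_ones \<omega>"
proof -
  have "AE \<omega> in M. \<forall>j. j0 \<le> j \<longrightarrow> \<not> survives j \<omega>"
    unfolding AE_all_countable using ns by auto
  with AE_no_birth[OF sm] show ?thesis
  proof eventually_elim
    case (elim \<omega>)
    then obtain j where j: "no_birth_from j \<omega>" by blast
    show ?case
      by (rule not_survives_finite[OF no_birth_from_mono[OF j max.cobounded1, of j0]]) (use elim in auto)
  qed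
qed

lemma prob_ge_1_Z: "prob {\<omega> \<in> space M. 1 \<le> Z j [] j \<omega>} = 1 - Phi M X j 0"
proof -
  have "1 \<le> Z j [] j \<omega> \<longleftrightarrow> \<not> empty_gen j \<omega>" for \<omega>
  proof -
    have "desc j [] j \<omega> = {u. length u = j \<and> X u \<omega>}"
      unfolding descendants_def branch_def by (auto dest: spec[of _ j])
    then have "1 \<le> Z j [] j \<omega> \<longleftrightarrow> {u. length u = j \<and> X u \<omega>} \<noteq> {}"
      unfolding Z_def using finite_generation[of j "\<lambda>u. X u \<omega>"] by (simp add: Suc_le_eq card_gt_0_iff)
    then show ?thesis by (auto simp: empty_gen_def)
  qed
  then have "{\<omega> \<in> space M. 1 \<le> Z j [] j \<omega>} = space M - {\<omega> \<in> space M. empty_gen j \<omega>}" by auto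
  then show ?thesis using prob_compl[OF empty_gen_measurable[of j]] by (simp add: Phi_0)
qed

text \<open>The first two conditions do not depend on the base level and extinguish the branches
  from every \<open>j \<ge> j0\<close>; the third excludes ones from \<open>j0\<close> on
  altogether. If all fail, inverse means and \<open>vs_sum\<close> are bounded, so a one present
  with positive probability survives with positive probability. The failure of the third condition
  supplies it, in generation \<open>j0\<close> or through a later birth.\<close>

lemma finite_ones_almost_surely_iff:
  assumes sm: "summable (\<lambda>j. 2 ^ j * eta nu j)" and jl: "jlow nu = enat j0"
  shows "prob {\<omega> \<in> space M. finite_ones \<omega>} = 1 \<longleftrightarrow>
    varsigma nu j0 = \<infinity> \<or> liminf (\<lambda>j. ereal (\<Prod>l=j0..j. gam nu l)) = 0 \<or> (Phi M X j0 0 = 1 \<and> (\<forall>j\<ge>j0. eta nu j = 0))"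
    (is "_ \<longleftrightarrow> ?V \<or> ?L \<or> ?E")
proof
  have pos: "gam nu l > 0" if "j0 \<le> l" for l by (rule jlow_enatD[OF jl that])
  have mp: "mean_prod nu i n > 0" if "j0 \<le> i" for i n using pos that by (intro mean_prod_gt_0) auto
  have m0: "0 \<le> mean_prod nu j0 n" for n using mp[of j0 n] by simp
  {
    assume h: "?V \<or> ?L \<or> ?E"
    have "AE \<omega> in M. finite_ones \<omega>"
      using h
    proof (elim disjE)
      assume V: ?V
      show ?thesis
      proof (rule AE_finite_ones[OF sm, of j0], rule survives_null_of_varsigma)
        fix j B assume j: "j0 \<le> j"
        show "gam nu l > 0" if "j \<le> l" for l using pos j that by simp
        \<comment> \<open>The first entry of the maximum forces \<open>j \<le> n\<close> by
          monotonicity; the second is the bound \<open>B\<close> carried over to base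
          \<open>j\<close>.\<close>
        obtain n where n: "n \<ge> j0" "max (vs_sum nu j0 j) (vs_sum nu j0 j + B / mean_prod nu j0 j) < vs_sum nu j0 n"
          using V unfolding varsigma_infinite_iff by blast
        have "j \<le> n"
        proof (rule ccontr)
          assume "\<not> j \<le> n"
          then have "vs_sum nu j0 n \<le> vs_sum nu j0 j"
            unfolding vs_sum_def by (intro sum_mono2) (auto intro!: divide_nonneg_nonneg mult_nonneg_nonneg simp: split_prob_nonneg gam_nonneg m0)
          then show False using n(2) by simp
        qed
        then have "B / mean_prod nu j0 j < vs_sum nu j n / mean_prod nu j0 j"
          using n(2) vs_sum_split[OF j _ pos, of n] by simp
        then have "B < vs_sum nu j n" using mp[of j0 j] by (simp add: divide_less_cancel)
        then show "\<exists>n\<ge>j. B < vs_sum nu j n" using \<open>j \<le> n\<close> by blast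
      qed
    next
      assume L: ?L
      show ?thesis
      proof (rule AE_finite_ones[OF sm, of j0], rule survives_null_of_mean, rule ccontr)
        fix j and e :: real assume j: "j0 \<le> j" and e: "e > 0" and no: "\<not> (\<exists>n\<ge>j. mean_prod nu j n < e)"
        have "\<exists>c>0. \<forall>n. c \<le> mean_prod nu j0 n"
        proof (rule eventually_lower_bound[where b = "e * mean_prod nu j0 j" and N = j])
          fix n assume n: "j \<le> n"
          have "e * mean_prod nu j0 j \<le> mean_prod nu j n * mean_prod nu j0 j"
            using no n mp[of j0 j] by (intro mult_right_mono) (auto simp: not_less)
          also have "\<dots> = mean_prod nu j0 n" using mean_prod_mult[OF j n, of nu] by (simp add: mult.commute)
          finally show "e * mean_prod nu j0 j \<le> mean_prod nu j0 n" .
        qed (use mp[of j0] e in auto)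
        then obtain c where c: "c > 0" "\<And>n. c \<le> mean_prod nu j0 n" by blast
        then show False using liminf_prod_zeroD[OF L c(1)] by (meson not_less)
      qed
    next
      assume E: ?E
      have "prob {\<omega> \<in> space M. \<forall>i\<in>{j0..n}. empty_gen i \<omega>} = 1" if "j0 \<le> n" for n
        unfolding empty_run_prob[OF that] using E by (auto intro!: prod.neutral)
      then have "(\<lambda>n. prob {\<omega> \<in> space M. \<forall>i\<in>{j0..n}. empty_gen i \<omega>}) \<longlonglongrightarrow> 1"
        by (intro tendsto_eventually eventually_sequentiallyI[of j0])
      then have p1: "prob {\<omega> \<in> space M. \<forall>i\<ge>j0. empty_gen i \<omega>} = 1"
        using LIMSEQ_unique[OF empty_forever_prob] by blast
      have m: "{\<omega> \<in> space M. \<forall>i\<ge>j0. empty_gen i \<omega>} \<in> sets M" by measurable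
      have "AE \<omega> in M. \<omega> \<in> {\<omega> \<in> space M. \<forall>i\<ge>j0. empty_gen i \<omega>}"
        using prob_eq_1[OF m] p1 by simp
      then show ?thesis by eventually_elim (auto simp: finite_ones_iff)
    qed
    then have "AE \<omega> in M. \<omega> \<in> {\<omega> \<in> space M. finite_ones \<omega>}" using AE_space by eventually_elim auto
    then show "prob {\<omega> \<in> space M. finite_ones \<omega>} = 1" using prob_eq_1[OF finite_ones_measurable] by simp
  }
  assume p1: "prob {\<omega> \<in> space M. finite_ones \<omega>} = 1"
  show "?V \<or> ?L \<or> ?E"
  proof (rule ccontr)
    assume "\<not> (?V \<or> ?L \<or> ?E)"
    then have nV: "\<not> ?V" and nL: "\<not> ?L" and nE: "\<not> ?E" by blast+
    obtain B where B: "\<And>n. j0 \<le> n \<Longrightarrow> vs_sum nu j0 n \<le> B" using nV unfolding varsigma_infinite_iff by (auto simp: not_less)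
    obtain c where c: "c > 0" "\<And>n. c \<le> mean_prod nu j0 n" using liminf_prod_nonzeroD[OF nL pos] by blast
    have start: "\<exists>j\<ge>j0. prob {\<omega> \<in> space M. 1 \<le> Z j [] j \<omega>} > 0"
    proof (cases "Phi M X j0 0 = 1")
      case False
      have "prob {\<omega> \<in> space M. 1 \<le> Z j0 [] j0 \<omega>} \<noteq> 0" using False unfolding prob_ge_1_Z by simp
      then show ?thesis by (intro exI[of _ j0]) (simp add: less_le measure_nonneg)
    next
      case True
      then obtain j where j: "j \<ge> j0" "eta nu j \<noteq> 0" using nE by blast
      \<comment> \<open>Any word of length \<open>j\<close> would do. If it is almost surely zero,
        it has a child carrying a one with probability \<open>eta nu j > 0\<close>.\<close>
      define u where "u = replicate j False"
      have u: "length u = j" by (simp add: u_def)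
      have Xm: "{\<omega> \<in> space M. X u \<omega>} \<in> sets M" by measurable
      have sub1: "prob {\<omega> \<in> space M. X u \<omega>} \<le> prob {\<omega> \<in> space M. 1 \<le> Z j [] j \<omega>}"
      proof (rule finite_measure_mono)
        show "{\<omega> \<in> space M. X u \<omega>} \<subseteq> {\<omega> \<in> space M. 1 \<le> Z j [] j \<omega>}"
        proof (intro subsetI CollectI conjI)
          fix \<omega> assume w: "\<omega> \<in> {\<omega> \<in> space M. X u \<omega>}"
          then have "u \<in> desc j [] j \<omega>" using u unfolding descendants_def branch_def by auto
          then show "1 \<le> Z j [] j \<omega>" unfolding Z_def using finite_descendants by (metis One_nat_def Suc_leI card_gt_0_iff empty_iff)
        qed simp
      qed (rule Z_pred[of "\<lambda>z. 1 \<le> z"])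
      show ?thesis
      proof (cases "prob {\<omega> \<in> space M. X u \<omega>} = 0")
        case False
        then have "prob {\<omega> \<in> space M. X u \<omega>} > 0" by (simp add: less_le measure_nonneg)
        then show ?thesis using sub1 j(1) by (intro exI[of _ j]) linarith
      next
        case True
        have "{\<omega> \<in> space M. X u \<omega> = False} = space M - {\<omega> \<in> space M. X u \<omega>}" by auto
        then have "prob {\<omega> \<in> space M. X u \<omega> = False} = 1" using prob_compl[OF Xm] True by simp
        then have "prob {\<omega> \<in> space M. X u \<omega> = False \<and> children \<omega> u \<noteq> (False, False)} = eta nu j"
          using prob_children[OF u, of False "\<lambda>p. p \<noteq> (False, False)"] unfolding nuE_some_child by (simp add: eta_pmf)
        also have "\<dots> > 0" using j(2) eta_range(1)[of nu j] by simp
        finally have "prob {\<omega> \<in> space M. X u \<omega> = False \<and> children \<omega> u \<noteq> (False, False)} > 0" .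
        also have "prob {\<omega> \<in> space M. X u \<omega> = False \<and> children \<omega> u \<noteq> (False, False)} \<le> prob {\<omega> \<in> space M. 1 \<le> Z (Suc j) [] (Suc j) \<omega>}"
        proof (rule finite_measure_mono)
          show "{\<omega> \<in> space M. X u \<omega> = False \<and> children \<omega> u \<noteq> (False, False)} \<subseteq> {\<omega> \<in> space M. 1 \<le> Z (Suc j) [] (Suc j) \<omega>}"
          proof (intro subsetI CollectI conjI)
            fix \<omega> assume w: "\<omega> \<in> {\<omega> \<in> space M. X u \<omega> = False \<and> children \<omega> u \<noteq> (False, False)}"
            then obtain b where "X (u @ [b]) \<omega>" unfolding children_def by blast
            then have "u @ [b] \<in> desc (Suc j) [] (Suc j) \<omega>" using u unfolding descendants_def branch_def by auto
            then show "1 \<le> Z (Suc j) [] (Suc j) \<omega>" unfolding Z_def using finite_descendants by (metis One_nat_def Suc_leI card_gt_0_iff empty_iff)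
          qed simp
        qed (rule Z_pred[of "\<lambda>z. 1 \<le> z"])
        finally show ?thesis using j(1) by (intro exI[of _ "Suc j"]) auto
      qed
    qed
    then obtain j where j: "j \<ge> j0" "prob {\<omega> \<in> space M. 1 \<le> Z j [] j \<omega>} > 0" by blast
    let ?a = "mean_prod nu j0 j"
    have "prob {\<omega> \<in> space M. survives j \<omega>} > 0"
    \<comment> \<open>The bounds \<open>c\<close> and \<open>B\<close> at base \<open>j0\<close>,
      converted to base \<open>j\<close> by the mean between the two levels.\<close>
    proof (rule survives_prob_pos[where C = "?a / c + ?a * (B - vs_sum nu j0 j)"])
      show "gam nu l > 0" if "j \<le> l" for l using pos j that by simp
      show "prob {\<omega> \<in> space M. 1 \<le> Z j [] j \<omega>} > 0" by (rule j(2))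
      fix n assume n: "j \<le> n"
      have a: "?a > 0" by (rule mp) simp
      have "1 / mean_prod nu j n = ?a / mean_prod nu j0 n"
        using mean_prod_mult[OF j(1) n, of nu] mp[OF j(1), of n] mp[of j0 n] a by (simp add: frac_eq_eq mult.commute)
      also have "\<dots> \<le> ?a / c" using c a mp[of j0 n] by (intro divide_left_mono) auto
      finally have 1: "1 / mean_prod nu j n \<le> ?a / c" .
      have "vs_sum nu j n / ?a \<le> B - vs_sum nu j0 j"
        using vs_sum_split[OF j(1) n pos] B[of n] n j(1) by simp
      then have "vs_sum nu j n \<le> ?a * (B - vs_sum nu j0 j)" using a by (simp add: pos_divide_le_eq mult.commute)
      with 1 show "1 / mean_prod nu j n + vs_sum nu j n \<le> ?a / c + ?a * (B - vs_sum nu j0 j)" by linarith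
    qed
    moreover have "prob {\<omega> \<in> space M. survives j \<omega>} \<le> prob (space M - {\<omega> \<in> space M. finite_ones \<omega>})"
      using survives_not_finite finite_ones_measurable by (intro finite_measure_mono) auto
    ultimately show False using p1 prob_compl[OF finite_ones_measurable] by simp
  qed
qed

text \<open>One exceptional null set must serve all exponents and all base levels. So exponents from
  above run through \<open>t + (1 - t) / (i + 1)\<close> and from below through the rationals. The
  case \<open>i = 0\<close> is exponent one and shows that the limit set has zero length.\<close>

lemma AE_dimension_limit_set:
  assumes sm: "summable (\<lambda>j. 2 ^ j * eta nu j)" and jl: "jlow nu = enat j0"
    and th: "theta nu = ereal t" "0 \<le> t" "t < 1"
  shows "AE \<omega> in M. (limit_set (\<lambda>u. X u \<omega>) \<noteq> {} \<longrightarrow> hdim (limit_set (\<lambda>u. X u \<omega>)) = ereal t)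
      \<and> hausdorff_torus 1 (limit_set (\<lambda>u. X u \<omega>)) = 0"
proof -
  have pos: "gam nu l > 0" if "j0 \<le> l" for l by (rule jlow_enatD[OF jl that])
  have up: "AE \<omega> in M. \<forall>e>0. \<forall>m. \<exists>n\<ge>m. real (Z j [] n \<omega>) * 2 powr (- s * real n) \<le> e"
    if "j0 \<le> j" "t < s" for j s
    by (rule small_generations, rule theta_upper[OF jl]) (use th that in auto)
  have "AE \<omega> in M. \<forall>j i. j0 \<le> j \<longrightarrow> (\<forall>e>0. \<forall>m. \<exists>n\<ge>m. real (Z j [] n \<omega>) * 2 powr (- (t + (1 - t) / real (Suc i)) * real n) \<le> e)"
    unfolding AE_all_countable
  proof (intro allI)
    fix j i
    show "AE \<omega> in M. j0 \<le> j \<longrightarrow> (\<forall>e>0. \<forall>m. \<exists>n\<ge>m. real (Z j [] n \<omega>) * 2 powr (- (t + (1 - t) / real (Suc i)) * real n) \<le> e)"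
      using up[of j "t + (1 - t) / real (Suc i)"] th by (cases "j0 \<le> j") auto
  qed
  moreover have "AE \<omega> in M. \<forall>j (q :: rat). j0 \<le> j \<longrightarrow> 0 < q \<longrightarrow> of_rat q < t \<longrightarrow> survives j \<omega> \<longrightarrow> rich j (of_rat q) \<omega>"
    unfolding AE_all_countable
  proof (intro allI)
    fix j and q :: rat
    show "AE \<omega> in M. j0 \<le> j \<longrightarrow> 0 < q \<longrightarrow> of_rat q < t \<longrightarrow> survives j \<omega> \<longrightarrow> rich j (of_rat q) \<omega>"
    proof (cases "j0 \<le> j \<and> 0 < q \<and> of_rat q < t")
      case True
      define s' where "s' = (of_rat q + t) / 2"
      have "0 < (of_rat q :: real)" using True by (simp add: zero_less_of_rat_iff)
      then have s': "of_rat q < s'" "0 < s'" "s' < t" using True th(2) unfolding s'_def by (simp_all add: add_pos_nonneg)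
      obtain c where c: "c > 0" "\<forall>n\<ge>j. c * 2 powr (s' * real n) \<le> mean_prod nu j n"
        using theta_lower[OF jl, of s' j] s' th True by auto
      have "AE \<omega> in M. survives j \<omega> \<longrightarrow> rich j (of_rat q) \<omega>"
        by (rule survives_rich[OF _ s'(1,2) c(1)]) (use pos True c(2) in auto)
      then show ?thesis by eventually_elim simp
    qed auto
  qed
  moreover note AE_no_birth[OF sm]
  ultimately show ?thesis
  proof eventually_elim
    case (elim \<omega>)
    let ?S = "\<lambda>u. X u \<omega>"
    obtain J where J: "no_birth_from J \<omega>" using elim(3) by blast
    define j where "j = max J j0"
    have j: "no_birth_from j \<omega>" "j0 \<le> j" using no_birth_from_mono[OF J, of j] by (simp_all add: j_def)
    have zero: "hausdorff_torus (t + (1 - t) / real (Suc i)) (limit_set ?S) = 0" for i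
    proof (rule hausdorff_limit_set_eq_0[OF no_birth_closed[OF j(1)]])
      show "0 < t + (1 - t) / real (Suc i)" using th by (intro add_nonneg_pos) auto
      fix e :: real and n assume e: "e > 0"
      obtain k where k: "max n j \<le> k" "real (Z j [] k \<omega>) * 2 powr (- (t + (1 - t) / real (Suc i)) * real k) \<le> e"
        using elim(1) j(2) e by blast
      then show "\<exists>k\<ge>n. real (card (generation ?S k)) * 2 powr (- (t + (1 - t) / real (Suc i)) * real k) \<le> e"
        using no_birth_card_generation[OF j(1), of k] by (intro exI[of _ k]) auto
    qed
    have one: "hausdorff_torus 1 (limit_set ?S) = 0" using zero[of 0] by simp
    have "hdim (limit_set ?S) = ereal t" if ne: "limit_set ?S \<noteq> {}"
    proof (rule antisym)
      show "hdim (limit_set ?S) \<le> ereal t"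
      proof (rule dense_ge)
        fix z assume z: "ereal t < z"
        show "hdim (limit_set ?S) \<le> z"
        proof (cases z)
          case (real r)
          then have r: "t < r" using z by simp
          obtain i where i: "inverse (real (Suc i)) < r - t" using reals_Archimedean[of "r - t"] r by auto
          have "(1 - t) / real (Suc i) \<le> 1 / real (Suc i)" using th by (intro divide_right_mono) auto
          then have "t + (1 - t) / real (Suc i) \<le> r" using i by (simp add: inverse_eq_divide)
          moreover have "hdim (limit_set ?S) \<le> ereal (t + (1 - t) / real (Suc i))"
          proof (rule hdim_le[OF _ zero])
            show "0 < t + (1 - t) / real (Suc i)" using th by (intro add_nonneg_pos) auto
          qed
          ultimately show ?thesis using real by (meson ereal_less_eq(3) order_trans)
        qed (use z in auto)
      qed
      show "ereal t \<le> hdim (limit_set ?S)"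
      proof (rule hdim_ge[OF ne])
        fix s :: real assume s: "s > 0" "hausdorff_torus s (limit_set ?S) = 0"
        show "ereal t \<le> ereal s"
        proof (rule ccontr)
          assume "\<not> ereal t \<le> ereal s"
          \<comment> \<open>A rational strictly between \<open>s\<close> and \<open>t\<close> is
            needed because richness is available off a null set only for rational exponents below
            \<open>t\<close>.\<close>
          then obtain q :: rat where q: "s < of_rat q" "of_rat q < t" using of_rat_dense[of s t] by auto
          have q1: "(of_rat q :: real) \<le> 1" by (rule order_trans[OF less_imp_le[OF q(2)] less_imp_le[OF th(3)]])
          have q0: "0 < q" using q(1) s(1) by (metis less_trans zero_less_of_rat_iff)
          have "survives j \<omega>"
          proof (rule ccontr)
            assume "\<not> survives j \<omega>"
            then have "finite {u. X u \<omega>}" using not_survives_finite[OF j(1)] by (simp add: finite_ones_def)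
            then show False using ne isolated_from_finite by (auto simp: limit_set_def)
          qed
          then have "rich j (of_rat q) \<omega>" using elim(2) j(2) q0 q(2) by blast
          then have "hausdorff_torus (of_rat q) (limit_set ?S) \<noteq> 0"
            using rich_hausdorff[of j "of_rat q" \<omega>] q1 q0 pos j(2) no_birth_limit_set[OF j(1)] by auto
          then show False using hausdorff_torus_eq_0_mono[OF s(2)] q(1) by simp
        qed
      qed
    qed
    with one show ?case by blast
  qed
qed

section \<open>The spectrum of the random series\<close>

context
  fixes psi :: "real \<Rightarrow> real" and hl :: real and hu :: ereal
  assumes sch: "schwartz psi" and onb: "wavelet_onb psi" and hl: "0 < hl" and hu: "ereal hl < hu"
begin

lemma Rser_wseries: "Rser psi hl hu X \<omega> = wseries psi (\<lambda>u. wcoef hl hu (X u \<omega>) (length u))"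
  by (rule ext) (rule Rser_eq_wseries[OF sch hl abs_wcoef_le[OF hl hu]])

lemma holder_Rser:
  assumes "no_birth_from j \<omega>"
  shows "holder_exp (Rser psi hl hu X \<omega>) x = (if isolated_from (\<lambda>u. X u \<omega>) x then hu else ereal hl)"
  unfolding Rser_wseries
  using holder_isolated[OF sch onb hl hu, of "\<lambda>u. X u \<omega>" x] holder_not_isolated[OF sch onb hl hu no_birth_closed[OF assms], of x]
  by simp

lemma Eset_eq:
  assumes "no_birth_from j \<omega>"
  shows "Eset psi hl hu X \<omega> h = (if h = ereal hl then limit_set (\<lambda>u. X u \<omega>) else if h = hu then {x \<in> {0..<1}. isolated_from (\<lambda>u. X u \<omega>) x} else {})"
  unfolding Eset_def holder_Rser[OF assms] using hu by (auto simp: limit_set_def)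

text \<open>Dimension \<open>-\<infinity>\<close> means an empty limit set, and by compactness this
  happens only for finitely many ones.\<close>

lemma dR_minus_infinity_iff:
  assumes "no_birth_from j \<omega>"
  shows "dR psi hl hu X \<omega> (ereal hl) = -\<infinity> \<longleftrightarrow> finite_ones \<omega>"
proof -
  have "limit_set (\<lambda>u. X u \<omega>) = {} \<longleftrightarrow> finite_ones \<omega>"
    using limit_set_nonempty[of "\<lambda>u. X u \<omega>"] isolated_from_finite[of "\<lambda>u. X u \<omega>"]
    unfolding finite_ones_def limit_set_def by blast
  then show ?thesis unfolding dR_def Eset_eq[OF assms] by (simp add: hdim_empty_iff)
qed

lemma AE_dR_minus_infinity:
  assumes "summable (\<lambda>j. 2 ^ j * eta nu j)"
  shows "AE \<omega> in M. (\<omega> \<in> {\<omega> \<in> space M. finite_ones \<omega>}) = (dR psi hl hu X \<omega> (ereal hl) = -\<infinity>)"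
  using AE_no_birth[OF assms] AE_space by eventually_elim (auto simp: dR_minus_infinity_iff)

end

end

theorem mainTheorem1:
  fixes M :: "'a measure" and X :: "bool list \<Rightarrow> 'a \<Rightarrow> bool"
    and nu :: "bool \<Rightarrow> nat \<Rightarrow> (bool \<times> bool) pmf"
    and psi :: "real \<Rightarrow> real" and hl :: real and hu :: ereal
  assumes "prob_space M"
    and "schwartz psi" and "wavelet_onb psi"
    and "0 < hl" and "ereal hl < hu"
    and "\<forall>u. X u \<in> measurable M (count_space UNIV)"
    and "markov_tree M X nu"
    and "summable (\<lambda>j. 2 ^ j * eta nu j)"
    and "theta nu < 1"
  shows
   "(theta nu < 0 \<longrightarrow>
       (AE \<omega> in M. \<forall>x\<in>{0..<1}. holder_exp (Rser psi hl hu X \<omega>) x = hu) \<and>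
       (AE \<omega> in M. \<forall>h::ereal. h \<ge> 0 \<longrightarrow>
          dR psi hl hu X \<omega> h = (if h = hu then 1 else -\<infinity>))) \<and>
    (theta nu \<ge> 0 \<longrightarrow>
       (AE \<omega> in M. \<forall>h::ereal. h \<ge> 0 \<longrightarrow>
          (h = ereal hl \<longrightarrow> dR psi hl hu X \<omega> h \<in> {-\<infinity>, theta nu}) \<and>
          (h = hu \<longrightarrow> dR psi hl hu X \<omega> h = 1) \<and>
          (h \<noteq> ereal hl \<and> h \<noteq> hu \<longrightarrow> dR psi hl hu X \<omega> h = -\<infinity>)) \<and>
       (\<forall>js::nat. (\<forall>j\<ge>js. measure_pmf.prob (nu True j) {(False, False)} = 0) \<longrightarrow>
          ae_event_prob M (\<lambda>\<omega>. dR psi hl hu X \<omega> (ereal hl) = -\<infinity>)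
            (Phi M X js 0 * lim (\<lambda>n. \<Prod>j=js..n. (1 - eta nu j) ^ (2 ^ j)))) \<and>
       (\<not> (\<exists>js::nat. \<forall>j\<ge>js. measure_pmf.prob (nu True j) {(False, False)} = 0) \<longrightarrow>
          (\<exists>A\<in>sets M. (AE \<omega> in M. (\<omega> \<in> A) = (dR psi hl hu X \<omega> (ereal hl) = -\<infinity>)) \<and>
             measure M A > 0 \<and>
             (measure M A = 1 \<longleftrightarrow>
                (varsigma nu (the_enat (jlow nu)) = \<infinity> \<or>
                 liminf (\<lambda>j. ereal (\<Prod>l=the_enat (jlow nu)..j. gam nu l)) = 0 \<or>
                 (Phi M X (the_enat (jlow nu)) 0 = 1 \<and> (\<forall>j\<ge>the_enat (jlow nu). eta nu j = 0)))))))"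
proof -
  interpret prob_space M by fact
  interpret markov_bool_tree M X nu using assms(6,7) by unfold_locales auto
  note wav = assms(2-5)
  note sm = assms(8)
  \<comment> \<open>A measurable event that agrees almost surely with \<open>dR\<close> being
    \<open>-\<infinity>\<close> at \<open>hl\<close>; it is the witness in both probability
    statements.\<close>
  let ?F = "{\<omega> \<in> space M. finite_ones \<omega>}"
  have hd: "hdim {0..<1} = 1" by (rule hdim_interval[of 0 1]) auto
  have neg: "AE \<omega> in M. \<exists>j. no_birth_from j \<omega> \<and> finite_ones \<omega>" if th: "theta nu < 0"
  proof -
    obtain j0 where j0: "\<forall>j\<ge>j0. \<forall>e>0. \<exists>n\<ge>j. mean_prod nu j n < e" using theta_negative_mean[OF th] by blast
    have "AE \<omega> in M. finite_ones \<omega>"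
      by (rule AE_finite_ones[OF sm, of j0], rule survives_null_of_mean) (use j0 in blast)
    with AE_no_birth[OF sm] show ?thesis by eventually_elim blast
  qed
  have iso: "isolated_from (\<lambda>u. X u \<omega>) x" if "finite_ones \<omega>" for \<omega> x
    using that isolated_from_finite unfolding finite_ones_def by blast
  have a1: "AE \<omega> in M. \<forall>x\<in>{0..<1}. holder_exp (Rser psi hl hu X \<omega>) x = hu" if "theta nu < 0"
    using neg[OF that]
  proof eventually_elim
    case (elim \<omega>)
    then obtain j where "no_birth_from j \<omega>" "finite_ones \<omega>" by blast
    then show ?case using iso by (simp add: holder_Rser[OF wav])
  qed
  have a2: "AE \<omega> in M. \<forall>h::ereal. h \<ge> 0 \<longrightarrow> dR psi hl hu X \<omega> h = (if h = hu then 1 else -\<infinity>)" if "theta nu < 0"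
    using neg[OF that]
  proof eventually_elim
    case (elim \<omega>)
    then obtain j where j: "no_birth_from j \<omega>" and f: "finite_ones \<omega>" by blast
    have "limit_set (\<lambda>u. X u \<omega>) = {}" "{x \<in> {0..<1}. isolated_from (\<lambda>u. X u \<omega>) x} = {0..<1}"
      using iso[OF f] by (auto simp: limit_set_def)
    then show ?case using assms(5) unfolding dR_def Eset_eq[OF wav j] by (auto simp: hd hdim_empty_iff)
  qed
  have b: "(AE \<omega> in M. \<forall>h::ereal. h \<ge> 0 \<longrightarrow>
          (h = ereal hl \<longrightarrow> dR psi hl hu X \<omega> h \<in> {-\<infinity>, theta nu}) \<and>
          (h = hu \<longrightarrow> dR psi hl hu X \<omega> h = 1) \<and>
          (h \<noteq> ereal hl \<and> h \<noteq> hu \<longrightarrow> dR psi hl hu X \<omega> h = -\<infinity>))"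
    and jl: "jlow nu = enat (the_enat (jlow nu))" if th0: "theta nu \<ge> 0"
  proof -
    \<comment> \<open>With \<open>jlow nu = \<infinity>\<close> the value of \<open>theta nu\<close>
      would be \<open>-\<infinity>\<close>, so here \<open>the_enat\<close> never returns its
      default value.\<close>
    show jl: "jlow nu = enat (the_enat (jlow nu))"
    proof (cases "jlow nu")
      case infinity
      then have "theta nu = -\<infinity>" by (simp add: theta_def)
      then show ?thesis using th0 by simp
    qed simp
    obtain t where t: "theta nu = ereal t" "0 \<le> t" "t < 1"
      using th0 assms(9) by (cases "theta nu") auto
    show "AE \<omega> in M. \<forall>h::ereal. h \<ge> 0 \<longrightarrow>
          (h = ereal hl \<longrightarrow> dR psi hl hu X \<omega> h \<in> {-\<infinity>, theta nu}) \<and>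
          (h = hu \<longrightarrow> dR psi hl hu X \<omega> h = 1) \<and>
          (h \<noteq> ereal hl \<and> h \<noteq> hu \<longrightarrow> dR psi hl hu X \<omega> h = -\<infinity>)"
      using AE_dimension_limit_set[OF sm jl t] AE_no_birth[OF sm]
    proof eventually_elim
      case (elim \<omega>)
      then obtain j where j: "no_birth_from j \<omega>" by blast
      have hd1: "hdim {x \<in> {0..<1}. isolated_from (\<lambda>u. X u \<omega>) x} = 1"
        using elim(1) by (intro hdim_isolated) blast
      have hd2: "hdim (limit_set (\<lambda>u. X u \<omega>)) \<in> {-\<infinity>, theta nu}"
        using elim(1) t(1) hdim_empty_iff by (cases "limit_set (\<lambda>u. X u \<omega>) = {}") auto
      have hd3: "hdim {} = -\<infinity>" by (simp add: hdim_empty_iff)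
      show ?case unfolding dR_def Eset_eq[OF wav j] using hd1 hd2 hd3 assms(5) by auto
    qed
  qed
  have c: "ae_event_prob M (\<lambda>\<omega>. dR psi hl hu X \<omega> (ereal hl) = -\<infinity>)
            (Phi M X js 0 * lim (\<lambda>n. \<Prod>j=js..n. (1 - eta nu j) ^ (2 ^ j)))"
    if "\<forall>j\<ge>js. measure_pmf.prob (nu True j) {(False, False)} = 0" for js
    unfolding ae_event_prob_def
    using finite_ones_measurable AE_dR_minus_infinity[OF wav sm] finite_ones_prob_no_death[OF that] by blast
  have d: "\<exists>A\<in>sets M. (AE \<omega> in M. (\<omega> \<in> A) = (dR psi hl hu X \<omega> (ereal hl) = -\<infinity>)) \<and>
             measure M A > 0 \<and>
             (measure M A = 1 \<longleftrightarrow>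
                (varsigma nu (the_enat (jlow nu)) = \<infinity> \<or>
                 liminf (\<lambda>j. ereal (\<Prod>l=the_enat (jlow nu)..j. gam nu l)) = 0 \<or>
                 (Phi M X (the_enat (jlow nu)) 0 = 1 \<and> (\<forall>j\<ge>the_enat (jlow nu). eta nu j = 0))))"
    if "theta nu \<ge> 0" "\<not> (\<exists>js::nat. \<forall>j\<ge>js. measure_pmf.prob (nu True j) {(False, False)} = 0)"
    by (rule bexI[of _ ?F], intro conjI)
       (rule AE_dR_minus_infinity[OF wav sm], rule finite_ones_prob_pos[OF sm that(2)],
        rule finite_ones_almost_surely_iff[OF sm jl[OF that(1)]], rule finite_ones_measurable)
  show ?thesis using a1 a2 b c d by blast
qed

end
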